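(* Let $R:\overline{\mathbb C}\to\overline{\mathbb C}$ be a parabolic rational map with $\deg(R)\ge2$, with Julia set $J$, and let $\phi:J\to\mathbb R$ be a continuous function. Then for every $\alpha\in F$ we have $b(\alpha)=\delta$.
   Context: $\overline{\mathbb C}$ is the Riemann sphere with spherical metric $d_{\overline{\mathbb C}}$, $J$ is the Julia set of $R$, and $|R'|_s$ is the norm of the spherical derivative. $R$ is expansive if there is $v>0$ with $\sup_{n\ge0}d_{\overline{\mathbb C}}(R^n(x),R^n(y))>v$ for all distinct $x,y\in J$; it is expanding if there is $n\ge1$ with $|(R^n)'|_s>1$ on $J$; it is parabolic if it is expansive but not expanding. $\Omega(R)$ is the set of rationally indifferent periodic points of $R$ (multiplier a root of unity); it is finite and non-empty for parabolic $R$. $\dim_H$ is Hausdorff dimension with respect to $d_{\overline{\mathbb C}}$; $\delta=\dim_H(J)$; $B(\alpha)=\{x\in J:\lim_{n\to\infty}\frac1n\sum_{k=0}^{n-1}\phi(R^k(x))=\alpha\}$ and $b(\alpha)=\dim_H(B(\alpha))$. Let $m_\delta$ be the unique nonatomic $\delta$-conformal measure for $R$ (a Borel probability measure on $J$ with $m_\delta(R(A))=\int_A|R'|_s^\delta\,dm_\delta$ for every Borel $A\subset J$ with $R|_A$ injective), and $\mu_\delta$ the unique (up to a constant) ergodic $R$-invariant Borel measure on $J$ equivalent to $m_\delta$; if $\mu_\delta$ is finite it is normalized to be a probability measure. Let $\underline\alpha_\Omega$ and $\overline\alpha_\Omega$ be the minimum and the maximum of $\frac1\ell\sum_{k=0}^{\ell-1}\phi(R^k(\omega))$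 over $\omega\in\Omega(R)$, where $R^\ell(\omega)=\omega$. Then $F=[\underline\alpha_\Omega,\overline\alpha_\Omega]$ if $\mu_\delta$ is infinite, and $F=[\min\{\int\phi\,d\mu_\delta,\underline\alpha_\Omega\},\ \max\{\int\phi\,d\mu_\delta,\overline\alpha_\Omega\}]$ if $\mu_\delta$ is finite. *)

theory Defs
  imports "HOL-Probability.Probability" "HOL-Computational_Algebra.Polynomial"
begin

section \<open>The Riemann sphere with the spherical metric\<close>

datatype rsphere = Fin complex | Infty

text \<open>Inverse stereographic projection onto the unit sphere of \<open>complex \<times> real\<close>.\<close>

fun stereo :: "rsphere \<Rightarrow> complex \<times> real" where
  "stereo (Fin z) = (complex_of_real (2 / (1 + (cmod z)\<^sup>2)) * z, ((cmod z)\<^sup>2 - 1) / ((cmod z)\<^sup>2 + 1))"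
| "stereo Infty = (0, 1)"

lemma norm_stereo: "norm (stereo x) = 1"
proof (cases x)
  case (Fin z)
  define t where "t = (cmod z)\<^sup>2"
  have t: "t + 1 \<noteq> 0" "1 + t = t + 1" using zero_le_power2[of "cmod z"] unfolding t_def by linarith+
  have "(norm (complex_of_real (2 / (1 + t)) * z))\<^sup>2 = (2 / (1 + t))\<^sup>2 * t"
    by (simp only: norm_mult norm_of_real power_mult_distrib power2_abs t_def)
  then have "(norm (stereo x))\<^sup>2 = (2 / (1 + t))\<^sup>2 * t + ((t - 1) / (t + 1))\<^sup>2"
    unfolding Fin stereo.simps norm_prod_def fst_conv snd_conv t_def
    by (simp only: real_norm_def power2_abs)
      (intro real_sqrt_pow2 add_nonneg_nonneg mult_nonneg_nonneg zero_le_power2)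
  also have "\<dots> = (4 * t + (t - 1)\<^sup>2) / (t + 1)\<^sup>2"
    unfolding t(2) by (simp only: power_divide times_divide_eq_left add_divide_distrib) simp
  also have "4 * t + (t - 1)\<^sup>2 = (t + 1)\<^sup>2"
    by (simp add: power2_eq_square algebra_simps)
  also have "(t + 1)\<^sup>2 / (t + 1)\<^sup>2 = 1" using t by simp
  finally have "norm (stereo x) = 1 \<or> norm (stereo x) = - 1" by (simp only: power2_eq_1_iff)
  then show ?thesis using norm_ge_zero[of "stereo x"] by linarith
next
  case Infty
  then show ?thesis by (simp add: norm_prod_def)
qed

lemma stereo_inject: "stereo x = stereo y \<longleftrightarrow> x = y"
proof
  have pos: "(cmod z)\<^sup>2 + 1 \<noteq> 0" "1 + (cmod z)\<^sup>2 \<noteq> 0" for z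
    using zero_le_power2[of "cmod z"] by linarith+
  have less1: "((cmod z)\<^sup>2 - 1) / ((cmod z)\<^sup>2 + 1) \<noteq> 1" for z
    using pos(1)[of z] by (simp only: divide_eq_1_iff) linarith
  assume eq: "stereo x = stereo y"
  show "x = y"
  proof (cases x; cases y)
    fix z w
    assume xy: "x = Fin z" "y = Fin w"
    have "((cmod z)\<^sup>2 - 1) / ((cmod z)\<^sup>2 + 1) = ((cmod w)\<^sup>2 - 1) / ((cmod w)\<^sup>2 + 1)"
      using eq unfolding xy stereo.simps prod.inject by blast
    then have "((cmod z)\<^sup>2 - 1) * ((cmod w)\<^sup>2 + 1) = ((cmod w)\<^sup>2 - 1) * ((cmod z)\<^sup>2 + 1)"
      by (simp only: frac_eq_eq[OF pos(1) pos(1)])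
    then have tu: "(cmod z)\<^sup>2 = (cmod w)\<^sup>2" by (simp only: algebra_simps)
    have "complex_of_real (2 / (1 + (cmod w)\<^sup>2)) * z = complex_of_real (2 / (1 + (cmod w)\<^sup>2)) * w"
      using eq unfolding xy stereo.simps prod.inject tu by blast
    moreover have "complex_of_real (2 / (1 + (cmod w)\<^sup>2)) \<noteq> 0"
      unfolding of_real_eq_0_iff divide_eq_0_iff using pos(2)[of w] by linarith
    ultimately show "x = y" unfolding xy by (metis mult_left_cancel)
  next
    fix z assume "x = Fin z" "y = Infty"
    then show "x = y" using eq less1[of z] unfolding \<open>x = Fin z\<close> \<open>y = Infty\<close> stereo.simps prod.inject by blast
  next
    fix w assume "x = Infty" "y = Fin w"
    then show "x = y" using eq less1[of w] unfolding \<open>x = Infty\<close> \<open>y = Fin w\<close> stereo.simps prod.inject by metis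
  qed simp
qed simp

lemma inner_unit_bounds:
  fixes u v :: "'a::real_inner"
  assumes "norm u = 1" "norm v = 1"
  shows "-1 \<le> u \<bullet> v" "u \<bullet> v \<le> 1"
  using Cauchy_Schwarz_ineq2[of u v] assms by auto

lemma arccos_inner_triangle:
  fixes u v w :: "'a::real_inner"
  assumes u: "norm u = 1" and v: "norm v = 1" and w: "norm w = 1"
  shows "arccos (u \<bullet> w) \<le> arccos (u \<bullet> v) + arccos (v \<bullet> w)"
proof (cases "arccos (u \<bullet> v) + arccos (v \<bullet> w) \<le> pi")
  case False
  then show ?thesis
    using arccos_ubound[OF inner_unit_bounds[OF u w]] by linarith
next
  case True
  define a b where "a = u \<bullet> v" and "b = v \<bullet> w"
  have a: "-1 \<le> a" "a \<le> 1" and b: "-1 \<le> b" "b \<le> 1"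
    using inner_unit_bounds[OF u v] inner_unit_bounds[OF v w] by (auto simp: a_def b_def)
  have uu: "u \<bullet> u = 1" and vv: "v \<bullet> v = 1" and ww: "w \<bullet> w = 1"
    using u v w by (simp_all add: dot_square_norm)
  define p q where "p = u - a *\<^sub>R v" and "q = w - b *\<^sub>R v"
  have pq: "p \<bullet> q = u \<bullet> w - a * b"
    by (simp add: p_def q_def inner_diff_left inner_diff_right vv a_def b_def
        inner_commute algebra_simps)
  have "p \<bullet> p = 1 - a\<^sup>2"
    by (simp add: p_def inner_diff_left inner_diff_right uu vv a_def inner_commute
        power2_eq_square algebra_simps)
  then have np: "norm p = sqrt (1 - a\<^sup>2)" by (simp add: norm_eq_sqrt_inner)
  have "q \<bullet> q = 1 - b\<^sup>2"
    by (simp add: q_def inner_diff_left inner_diff_right ww vv b_def inner_commute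
        power2_eq_square algebra_simps)
  then have nq: "norm q = sqrt (1 - b\<^sup>2)" by (simp add: norm_eq_sqrt_inner)
  have "cos (arccos a + arccos b) = a * b - sqrt (1 - a\<^sup>2) * sqrt (1 - b\<^sup>2)"
    using a b by (simp add: cos_add sin_arccos)
  also have "\<dots> \<le> a * b + p \<bullet> q"
    using Cauchy_Schwarz_ineq2[of p q] np nq by auto
  also have "\<dots> = u \<bullet> w" by (simp add: pq)
  finally have "arccos (u \<bullet> w) \<le> arccos (cos (arccos a + arccos b))"
    using inner_unit_bounds[OF u w] by (intro arccos_le_arccos) auto
  also have "\<dots> = arccos a + arccos b"
    using True a b by (intro arccos_cos) (auto simp: a_def b_def arccos_lbound)
  finally show ?thesis by (simp add: a_def b_def)
qed

instantiation rsphere :: metric_space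
begin

text \<open>Great-circle distance on the unit sphere, i.e. the length metric of \<open>2 |dz| / (1 + |z|\<^sup>2)\<close>.\<close>

definition dist_rsphere :: "rsphere \<Rightarrow> rsphere \<Rightarrow> real" where
  "dist_rsphere x y = arccos (stereo x \<bullet> stereo y)"

definition uniformity_rsphere :: "(rsphere \<times> rsphere) filter" where
  "uniformity_rsphere = (INF e\<in>{0<..}. principal {(x, y). dist x y < e})"

definition open_rsphere :: "rsphere set \<Rightarrow> bool" where
  "open_rsphere U = (\<forall>x\<in>U. \<forall>\<^sub>F (x', y) in uniformity. x' = x \<longrightarrow> y \<in> U)"

instance
proof
  fix x y z :: rsphere
  show "dist x y = 0 \<longleftrightarrow> x = y"
  proof
    assume "dist x y = 0"
    then have "cos (arccos (stereo x \<bullet> stereo y)) = 1" by (simp add: dist_rsphere_def)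
    then have 1: "stereo x \<bullet> stereo y = 1"
      using inner_unit_bounds[OF norm_stereo norm_stereo, of x y] by simp
    have n: "stereo z \<bullet> stereo z = 1" for z by (simp add: dot_square_norm norm_stereo)
    have "(stereo x - stereo y) \<bullet> (stereo x - stereo y) = 0"
      unfolding inner_diff_left inner_diff_right n 1 inner_commute[of "stereo y" "stereo x"] by simp
    then have "stereo x = stereo y" by (simp only: inner_eq_zero_iff right_minus_eq)
    then show "x = y" by (simp only: stereo_inject)
  qed (simp add: dist_rsphere_def dot_square_norm norm_stereo)
  show "dist x y \<le> dist x z + dist y z"
    using arccos_inner_triangle[OF norm_stereo[of x] norm_stereo[of z] norm_stereo[of y]]
    by (simp only: dist_rsphere_def inner_commute[of "stereo z"])
qed (simp_all only: uniformity_rsphere_def open_rsphere_def)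

end

section \<open>Rational maps and their derivatives\<close>

text \<open>For coprime \<open>p\<close>, \<open>q\<close> and \<open>n\<close> the maximum of their degrees, the value at infinity is the
  value at \<open>0\<close> of the quotient of the reversed polynomials \<open>c\<^sup>n p(1/c)\<close> and \<open>c\<^sup>n q(1/c)\<close>, whose
  constant terms are the coefficients of degree \<open>n\<close>.\<close>

fun quotient_map :: "complex poly \<Rightarrow> complex poly \<Rightarrow> rsphere \<Rightarrow> rsphere" where
  "quotient_map p q (Fin z) = (if poly q z = 0 then Infty else Fin (poly p z / poly q z))"
| "quotient_map p q Infty =
    (let n = max (degree p) (degree q)
     in if coeff q n = 0 then Infty else Fin (coeff p n / coeff q n))"

definition rational_map :: "nat \<Rightarrow> (rsphere \<Rightarrow> rsphere) \<Rightarrow> bool" where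
  "rational_map d R \<longleftrightarrow>
    (\<exists>p q. q \<noteq> 0 \<and> coprime p q \<and> d = max (degree p) (degree q) \<and> R = quotient_map p q)"

text \<open>\<open>chart a\<close> is a local coordinate near \<open>a\<close>: \<open>z\<close> if \<open>a\<close> is finite and \<open>1/z\<close> if \<open>a\<close> is
  infinity, with local inverse \<open>chart_inv a\<close>. The one point outside the domain of \<open>chart a\<close> is sent
  to \<open>0\<close>; this does not affect any derivative at \<open>a\<close>.\<close>

fun chart :: "rsphere \<Rightarrow> rsphere \<Rightarrow> complex" where
  "chart (Fin _) (Fin z) = z"
| "chart (Fin _) Infty = 0"
| "chart Infty (Fin z) = 1 / z"
| "chart Infty Infty = 0"

fun chart_inv :: "rsphere \<Rightarrow> complex \<Rightarrow> rsphere" where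
  "chart_inv (Fin _) c = Fin c"
| "chart_inv Infty c = (if c = 0 then Infty else Fin (1 / c))"

definition chart_deriv :: "(rsphere \<Rightarrow> rsphere) \<Rightarrow> rsphere \<Rightarrow> complex" where
  "chart_deriv f a = deriv (\<lambda>c. chart (f a) (f (chart_inv a c))) (chart a a)"

text \<open>The inversion \<open>1/z\<close> is an isometry, so in each of the two charts the metric is
  \<open>2 |dc| / (1 + |c|\<^sup>2)\<close>.\<close>

definition sph_deriv :: "(rsphere \<Rightarrow> rsphere) \<Rightarrow> rsphere \<Rightarrow> real" where
  "sph_deriv f a =
    cmod (chart_deriv f a) * (1 + (cmod (chart a a))\<^sup>2) / (1 + (cmod (chart (f a) (f a)))\<^sup>2)"

section \<open>Julia set, parabolic maps, rationally indifferent periodic points\<close>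

definition normal_family_on :: "rsphere set \<Rightarrow> (rsphere \<Rightarrow> rsphere) set \<Rightarrow> bool" where
  "normal_family_on U \<F> \<longleftrightarrow>
    (\<forall>f :: nat \<Rightarrow> rsphere \<Rightarrow> rsphere. range f \<subseteq> \<F> \<longrightarrow>
      (\<exists>r g. strict_mono r \<and>
        (\<forall>K. compact K \<and> K \<subseteq> U \<longrightarrow> uniform_limit K (f \<circ> r) g sequentially)))"

definition fatou :: "(rsphere \<Rightarrow> rsphere) \<Rightarrow> rsphere set" where
  "fatou R = {x. \<exists>U. open U \<and> x \<in> U \<and> normal_family_on U (range (\<lambda>n. R ^^ n))}"

definition julia :: "(rsphere \<Rightarrow> rsphere) \<Rightarrow> rsphere set" where
  "julia R = - fatou R"

definition expansive :: "(rsphere \<Rightarrow> rsphere) \<Rightarrow> bool" where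
  "expansive R \<longleftrightarrow>
    (\<exists>v>0. \<forall>x\<in>julia R. \<forall>y\<in>julia R. x \<noteq> y \<longrightarrow> (SUP n. dist ((R ^^ n) x) ((R ^^ n) y)) > v)"

definition expanding :: "(rsphere \<Rightarrow> rsphere) \<Rightarrow> bool" where
  "expanding R \<longleftrightarrow> (\<exists>n\<ge>1. \<forall>x\<in>julia R. sph_deriv (R ^^ n) x > 1)"

definition parabolic :: "(rsphere \<Rightarrow> rsphere) \<Rightarrow> bool" where
  "parabolic R \<longleftrightarrow> expansive R \<and> \<not> expanding R"

definition periodic_point :: "(rsphere \<Rightarrow> rsphere) \<Rightarrow> rsphere \<Rightarrow> bool" where
  "periodic_point R x \<longleftrightarrow> (\<exists>l\<ge>1. (R ^^ l) x = x)"

definition period :: "(rsphere \<Rightarrow> rsphere) \<Rightarrow> rsphere \<Rightarrow> nat" where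
  "period R x = (LEAST l. l \<ge> 1 \<and> (R ^^ l) x = x)"

definition multiplier :: "(rsphere \<Rightarrow> rsphere) \<Rightarrow> rsphere \<Rightarrow> complex" where
  "multiplier R x = chart_deriv (R ^^ period R x) x"

definition rationally_indifferent :: "(rsphere \<Rightarrow> rsphere) \<Rightarrow> rsphere set" where
  "rationally_indifferent R = {x. periodic_point R x \<and> (\<exists>k\<ge>1. multiplier R x ^ k = 1)}"

section \<open>Hausdorff dimension\<close>

text \<open>Used for \<open>s > 0\<close> only, where \<open>0 powr s = 0\<close> is the contribution of points and of the
  empty set.\<close>

definition hausdorff_pre :: "real \<Rightarrow> real \<Rightarrow> 'a::metric_space set \<Rightarrow> ennreal" where
  "hausdorff_pre s e A =
    (INF U\<in>{U :: nat \<Rightarrow> 'a set. A \<subseteq> (\<Union>i. U i) \<and> (\<forall>i. bounded (U i) \<and> diameter (U i) \<le> e)}.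
      \<Sum>i. ennreal (diameter (U i) powr s))"

definition hausdorff_outer :: "real \<Rightarrow> 'a::metric_space set \<Rightarrow> ennreal" where
  "hausdorff_outer s A = (SUP e\<in>{0<..}. hausdorff_pre s e A)"

definition hausdorff_dim :: "'a::metric_space set \<Rightarrow> ennreal" where
  "hausdorff_dim A = (INF s\<in>{s. s > 0 \<and> hausdorff_outer s A = 0}. ennreal s)"

section \<open>Birkhoff averages\<close>

definition birkhoff_avg :: "(rsphere \<Rightarrow> rsphere) \<Rightarrow> (rsphere \<Rightarrow> real) \<Rightarrow> nat \<Rightarrow> rsphere \<Rightarrow> real" where
  "birkhoff_avg R \<phi> n x = (1 / real n) * (\<Sum>k<n. \<phi> ((R ^^ k) x))"

definition birkhoff_level :: "(rsphere \<Rightarrow> rsphere) \<Rightarrow> (rsphere \<Rightarrow> real) \<Rightarrow> real \<Rightarrow> rsphere set" where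
  "birkhoff_level R \<phi> \<alpha> = {x \<in> julia R. (\<lambda>n. birkhoff_avg R \<phi> n x) \<longlonglongrightarrow> \<alpha>}"

definition alpha_min :: "(rsphere \<Rightarrow> rsphere) \<Rightarrow> (rsphere \<Rightarrow> real) \<Rightarrow> real" where
  "alpha_min R \<phi> = Min ((\<lambda>x. birkhoff_avg R \<phi> (period R x) x) ` rationally_indifferent R)"

definition alpha_max :: "(rsphere \<Rightarrow> rsphere) \<Rightarrow> (rsphere \<Rightarrow> real) \<Rightarrow> real" where
  "alpha_max R \<phi> = Max ((\<lambda>x. birkhoff_avg R \<phi> (period R x) x) ` rationally_indifferent R)"

section \<open>Conformal and invariant measures on the Julia set\<close>

definition borel_measure_on :: "'a::topological_space set \<Rightarrow> 'a measure \<Rightarrow> bool" where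
  "borel_measure_on S M \<longleftrightarrow> sets M = sets (restrict_space borel S)"

definition conformal_measure :: "(rsphere \<Rightarrow> rsphere) \<Rightarrow> real \<Rightarrow> rsphere measure \<Rightarrow> bool" where
  "conformal_measure R s m \<longleftrightarrow>
    borel_measure_on (julia R) m \<and> prob_space m \<and>
    (\<forall>A\<in>sets m. inj_on R A \<longrightarrow>
      emeasure m (R ` A) = (\<integral>\<^sup>+x\<in>A. ennreal (sph_deriv R x powr s) \<partial>m))"

definition nonatomic :: "'a measure \<Rightarrow> bool" where
  "nonatomic M \<longleftrightarrow>
    (\<forall>A\<in>sets M. emeasure M A > 0 \<longrightarrow>
      (\<exists>B\<in>sets M. B \<subseteq> A \<and> 0 < emeasure M B \<and> emeasure M B < emeasure M A))"

definition invariant_measure :: "('a \<Rightarrow> 'a) \<Rightarrow> 'a measure \<Rightarrow> bool" where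
  "invariant_measure T M \<longleftrightarrow>
    T \<in> measurable M M \<and> (\<forall>A\<in>sets M. emeasure M (T -` A \<inter> space M) = emeasure M A)"

definition ergodic_measure :: "('a \<Rightarrow> 'a) \<Rightarrow> 'a measure \<Rightarrow> bool" where
  "ergodic_measure T M \<longleftrightarrow>
    (\<forall>A\<in>sets M. T -` A \<inter> space M = A \<longrightarrow>
      emeasure M A = 0 \<or> emeasure M (space M - A) = 0)"

definition equivalent_measures :: "'a measure \<Rightarrow> 'a measure \<Rightarrow> bool" where
  "equivalent_measures M N \<longleftrightarrow> absolutely_continuous M N \<and> absolutely_continuous N M"

text \<open>Sigma-finiteness is what makes such a measure unique up to a constant: without it,
  \<open>\<infinity> \<cdot> m\<close> would always be another one.\<close>

definition ergodic_conformal_class_measure ::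
    "(rsphere \<Rightarrow> rsphere) \<Rightarrow> rsphere measure \<Rightarrow> rsphere measure \<Rightarrow> bool" where
  "ergodic_conformal_class_measure R m \<mu> \<longleftrightarrow>
    borel_measure_on (julia R) \<mu> \<and> sigma_finite_measure \<mu> \<and>
    invariant_measure R \<mu> \<and> ergodic_measure R \<mu> \<and> equivalent_measures \<mu> m \<and>
    (finite_measure \<mu> \<longrightarrow> prob_space \<mu>)"

definition frequency_interval ::
    "(rsphere \<Rightarrow> rsphere) \<Rightarrow> (rsphere \<Rightarrow> real) \<Rightarrow> rsphere measure \<Rightarrow> real set" where
  "frequency_interval R \<phi> \<mu> =
    (if finite_measure \<mu>
     then {min (\<integral>x. \<phi> x \<partial>\<mu>) (alpha_min R \<phi>) .. max (\<integral>x. \<phi> x \<partial>\<mu>) (alpha_max R \<phi>)}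
     else {alpha_min R \<phi> .. alpha_max R \<phi>})"

end

theory Submission
 imports Defs "HOL-Complex_Analysis.Complex_Analysis" "HOL-Computational_Algebra.Fundamental_Theorem_Algebra"
begin

text \<open>On a disc that no forward orbit of a critical point enters, all inverse branches of the iterates of \<open>R\<close> exist,
 contract by expansivity and have bounded distortion by Koebe's theorem. Those that map a smaller disc into itself
 are the letters of iterated function systems. A sequence of finite families of letters with disjoint images and
 \<open>(\<Sum>g. \<bar>g'\<bar> powr s)\<close> large generates a Cantor set in \<open>J\<close> of positive \<open>s\<close>-dimensional measure, by the mass distribution
 principle; if the Birkhoff averages over the letters tend to \<open>\<alpha>\<close>, it lies in \<open>B(\<alpha>)\<close>. For \<open>s < \<delta>\<close>, Vitali's covering lemma
 and the conformal measure provide such families along typical orbits, with averages near \<open>\<integral>\<phi> d\<mu>\<close> if \<open>\<mu>\<close> is finite and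
 with bounded averages otherwise. A long stay near a rationally indifferent cycle costs only a subexponential factor,
 so letters can be lengthened by such stays, which moves the averages towards, or all the way to, that of the cycle.
 All this rests on the structure of the closure of the critical orbits, which meets \<open>J\<close> in a finite set of neutral
 periodic points; expansivity yields it, critical orbits being trapped by components of the Fatou set near \<open>J\<close>.\<close>

text \<open>The gap \<open>\<delta> - s\<close> drives the construction. Conformality and covering
  only bound \<open>(\<Sum>g. aa g powr \<delta>)\<close> from below by some positive constant.
  Since the derivatives \<open>aa g\<close> can be taken arbitrarily small, the smaller exponent
  makes the sum exceed any bound, and this pays for the Koebe constant lost at every composition and
  for the separation of the images. If \<open>\<mu>\<close> is infinite, there is no average to
  start from; families with merely bounded averages are then lengthened by stays whose share of the
  time tends to one, so that the tolerance shrinks to zero. Being parabolic is defined as expansive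
  and not expanding, so even the existence of a rationally indifferent point has to be extracted.
  The device is shadowing: an orbit that stays near \<open>J\<close> is followed by exactly one
  orbit in \<open>J\<close>, and the latter is the same for all points of a connected set of such
  orbits in the Fatou set. One global coordinate, which sends a critical point to infinity, turns
  branches into functions on plane discs: this point lies in the Fatou set, so \<open>J\<close> is
  bounded in the coordinate, and the branches avoid it.\<close>

abbreviation (input) eventually_seq :: "(nat => bool) => bool" (binder "EVS " 10)
 where "eventually_seq P \<equiv> eventually P sequentially"
abbreviation (input) filter_limit (infixr "--->" 55) where "f ---> l \<equiv> tendsto f l"
abbreviation (input) seq_limit (infix "---->" 60) where "f ----> l \<equiv> (f ---> l) sequentially"

section \<open>Spherical geometry\<close>

lemma inverse_Suc_subseq: "strict_mono r ==> (%k. 1/real (Suc (r k))) ----> 0"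
 using LIMSEQ_subseq_LIMSEQ[OF LIMSEQ_Suc[OF lim_1_over_n], of r] by (simp add: o_def)

text \<open>Homogeneous coordinates \<open>[a : b]\<close>: infinity becomes a point like any other,
  and a rational map becomes a pair of polynomials. The pair \<open>(0, 0)\<close> has a junk value,
  whence the side conditions \<open>a ~= 0 | b ~= 0\<close> throughout.\<close>

definition hpt :: "complex => complex => rsphere" where
 "hpt a b = (if b = 0 then Infty else Fin (a/b))"

definition hsq :: "complex => complex => real" where
 "hsq a b = (cmod a)^2 + (cmod b)^2"

lemma hsq_pos: "a ~= 0 | b ~= 0 ==> hsq a b > 0"
 by (auto simp: hsq_def add_pos_nonneg add_nonneg_pos)

lemma hsq_nonneg [simp]: "0 <= hsq a b" by (simp add: hsq_def)

lemma hpt_Fin [simp]: "hpt z 1 = Fin z" and hpt_Infty [simp]: "b = 0 ==> hpt a b = Infty"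
 by (auto simp: hpt_def)

lemma stereo_hpt:
 assumes "a ~= 0 | b ~= 0"
 shows "stereo (hpt a b) = (complex_of_real (2/hsq a b)*(a*cnj b), ((cmod a)^2 - (cmod b)^2)/hsq a b)"
proof (cases "b = 0")
 case True
 thus ?thesis using assms by (simp add: hpt_def hsq_def)
next
 case False
 have N: "hsq a b > 0" using hsq_pos assms by blast
 have B: "(cmod b)^2 > 0" using False by simp
 have e: "1 + (cmod (a/b))^2 = hsq a b/(cmod b)^2"
  using False by (simp add: hsq_def norm_divide power_divide field_simps)
 have e2: "(cmod (a/b))^2 + 1 = hsq a b/(cmod b)^2" using e by simp
 have e3: "(cmod (a/b))^2 - 1 = ((cmod a)^2 - (cmod b)^2)/(cmod b)^2"
  using False by (simp add: norm_divide power_divide field_simps)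
 have c: "complex_of_real ((cmod b)^2) = b*cnj b"
  by (simp add: complex_norm_square[symmetric])
 have "complex_of_real (2/(hsq a b/(cmod b)^2))*(a/b) = complex_of_real (2/hsq a b)*(complex_of_real ((cmod b)^2)*(a/b))"
  using N B by simp
 also have "complex_of_real ((cmod b)^2)*(a/b) = a*cnj b"
  unfolding c using False by simp
 finally have 1: "complex_of_real (2/(hsq a b/(cmod b)^2))*(a/b) = complex_of_real (2/hsq a b)*(a*cnj b)" .
 show ?thesis using False
  unfolding hpt_def stereo.simps if_not_P[OF False] e e2 e3 1 using N B by simp
qed

text \<open>This is Lagrange's identity: the determinant of two vectors measures how far the lines
  they span are from coinciding. All metric estimates below are read off this determinant.\<close>

lemma inner_stereo_hpt:
 assumes ab: "a ~= 0 | b ~= 0" and cd: "c ~= 0 | d ~= 0"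
 shows "stereo (hpt a b) \<bullet> stereo (hpt c d) = 1 - 2*(cmod (a*d - c*b))^2/(hsq a b*hsq c d)"
proof -
 have N: "hsq a b > 0" "hsq c d > 0" using hsq_pos assms by blast+
 have *: "4*((a*cnj b) \<bullet> (c*cnj d)) + ((cmod a)^2 - (cmod b)^2)*((cmod c)^2 - (cmod d)^2)
   = hsq a b*hsq c d - 2*(cmod (a*d - c*b))^2"
  unfolding hsq_def cmod_power2 inner_complex_def by (simp add: algebra_simps power2_eq_square)
 have "stereo (hpt a b) \<bullet> stereo (hpt c d) =
   (4*((a*cnj b) \<bullet> (c*cnj d)) + ((cmod a)^2 - (cmod b)^2)*((cmod c)^2 - (cmod d)^2))/(hsq a b*hsq c d)"
  unfolding stereo_hpt[OF ab] stereo_hpt[OF cd] inner_prod_def fst_conv snd_conv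
  using N by (simp add: inner_complex_def field_simps)
 also have "... = 1 - 2*(cmod (a*d - c*b))^2/(hsq a b*hsq c d)"
  unfolding*using N by (simp add: field_simps)
 finally show ?thesis .
qed

text \<open>The chord is algebraic in homogeneous coordinates, while \<open>dist\<close> is an
  \<open>arccos\<close>. Estimates are made for the chord and transferred to
  \<open>dist\<close>.\<close>

definition chord :: "rsphere => rsphere => real" where
 "chord x y = norm (stereo x - stereo y)"

lemma chord_inner: "(chord x y)^2 = 2 - 2*(stereo x \<bullet> stereo y)"
proof -
 have n: "stereo z \<bullet> stereo z = 1" for z by (simp add: dot_square_norm norm_stereo)
 show ?thesis
  unfolding chord_def power2_norm_eq_inner
  by (simp only: inner_diff_left inner_diff_right n inner_commute[of "stereo y" "stereo x"])
qed

lemma chord_hpt: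
 assumes ab: "a ~= 0 | b ~= 0" and cd: "c ~= 0 | d ~= 0"
 shows "chord (hpt a b) (hpt c d) = 2*cmod (a*d - c*b)/(sqrt (hsq a b) * sqrt (hsq c d))"
proof -
 have N: "hsq a b > 0" "hsq c d > 0" using hsq_pos assms by blast+
 have "(chord (hpt a b) (hpt c d))^2 = (2*cmod (a*d - c*b)/(sqrt (hsq a b) * sqrt (hsq c d)))^2"
  unfolding chord_inner inner_stereo_hpt[OF ab cd] using N
  by (simp add: power_divide power_mult_distrib)
 moreover have "chord (hpt a b) (hpt c d) >= 0" by (simp add: chord_def)
 ultimately show ?thesis using N by (simp add: power2_eq_iff_nonneg)
qed

lemma dist_rsphere_bounds: "0 <= dist x y" "dist (x::rsphere) y <= pi"
 using arccos_lbound arccos_ubound inner_unit_bounds[OF norm_stereo norm_stereo, of x y]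
 by (auto simp: dist_rsphere_def)

lemma cos_dist_rsphere: "cos (dist x y) = stereo x \<bullet> stereo y"
 using inner_unit_bounds[OF norm_stereo norm_stereo, of x y] by (simp add: dist_rsphere_def cos_arccos)

lemma chord_sin: "chord x y = 2 * sin (dist x y/2)"
proof -
 have "(chord x y)^2 = (2 * sin (dist x y/2))^2"
  unfolding chord_inner cos_dist_rsphere[symmetric]
  using cos_double_sin[of "dist x y/2"] by (simp add: power_mult_distrib)
 moreover have "sin (dist x y/2) >= 0"
  using dist_rsphere_bounds[of x y] pi_gt_zero by (intro sin_ge_zero) linarith+
 ultimately show ?thesis by (intro power2_eq_imp_eq[of "chord x y"]) (simp_all add: chord_def)
qed

lemma chord_le_dist: "chord x y <= dist x y"
 unfolding chord_sin using sin_x_le_x[of "dist x y/2"] by simp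

lemma dist_le_chord: "dist x y <= pi/2*chord x y"
proof -
 define t where "t = dist x y/2"
 have t: "0 <= t" "t <= pi/2" using dist_rsphere_bounds[of x y] by (auto simp: t_def)
 have "concave_on {0..pi} sin"
  by (rule f''_le0_imp_concave[where f' = cos and f'' = "%x. - sin x"])
    (auto intro!: derivative_eq_intros sin_ge_zero)
 hence "sin ((1 - 2*t/pi) *\<^sub>R 0 + (2*t/pi) *\<^sub>R (pi/2)) >= (1 - 2*t/pi) * sin 0 + (2*t/pi) * sin (pi/2)"
  using t by (intro concave_onD) (auto simp: field_simps)
 hence "2*t/pi <= sin t" by simp
 hence "t <= pi/2 * sin t" by (simp add: field_simps)
 thus ?thesis unfolding chord_sin t_def by simp
qed

text \<open>Here the ratio of chord and arc tends to one for close points, unlike in the bound with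
  \<open>pi/2\<close>; this is what identifies their infinitesimal versions. It rests on
  \<open>t*cos t <= sin t\<close>.\<close>

lemma dist_le_chord_cos:
 assumes "dist x y < pi"
 shows "dist x y*cos (dist x y/2) <= chord x y"
proof -
 define t where "t = dist x y/2"
 have t: "0 <= t" "t < pi/2" using dist_rsphere_bounds[of x y] assms by (auto simp: t_def)
 have "sin 0 - 0*cos 0 <= sin t - t*cos t"
 proof (rule DERIV_nonneg_imp_nondecreasing[OF t(1)])
  fix x assume x: "0 <= x" "x <= t"
  hence "x * sin x >= 0" using t by (intro mult_nonneg_nonneg sin_ge_zero) auto
  thus "EX y. ((%x. sin x - x*cos x) has_real_derivative y) (at x) & 0 <= y"
   by (intro exI[of _ "x * sin x"]) (auto intro!: derivative_eq_intros)
 qed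
 hence "t*cos t <= sin t" by simp
 thus ?thesis unfolding chord_sin t_def by simp
qed

lemma chord_nonneg [simp]: "0 <= chord x y" by (simp add: chord_def)

lemma rsphere_hpt: obtains a b where "x = hpt a b" "a ~= 0 | b ~= 0"
proof (cases x)
 case (Fin z) thus ?thesis using that[of z 1] by simp
next
 case Infty thus ?thesis using that[of 1 0] by simp
qed

lemma range_stereo: "range stereo = sphere 0 1"
proof
 show "range stereo <= sphere 0 1" by (auto simp: norm_stereo)
 show "sphere 0 1 <= range stereo"
 proof
  fix u :: "complex \<times> real" assume "u : sphere 0 1"
  then obtain w t where u: "u = (w, t)" and n: "(cmod w)^2 + t^2 = 1"
   by (cases u) (auto simp: norm_prod_def)
  show "u : range stereo"
  proof (cases "t = 1")
   case True
   hence "u = stereo Infty" using n by (simp add: u)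
   thus ?thesis by blast
  next
   case False
   have "t^2 <= 1" using n zero_le_power2[of "cmod w"] by linarith
   hence "\<bar>t\<bar> <= 1" by (simp add: abs_square_le_1)
   hence t1: "1 - t > 0" using False by linarith
   define z where "z = w/complex_of_real (1 - t)"
   have nz: "(cmod z)^2 = (1 - t^2)/(1 - t)^2"
    using n t1 by (simp add: z_def norm_divide power_divide del: of_real_diff)
   also have "... = ((1 + t)*(1 - t))/((1 - t)*(1 - t))" by (simp add: power2_eq_square algebra_simps)
   also have "... = (1 + t)/(1 - t)" using t1 by simp
   finally have nz: "(cmod z)^2 = (1 + t)/(1 - t)" .
   have a: "1 + (cmod z)^2 = 2/(1 - t)" "(cmod z)^2 + 1 = 2/(1 - t)" "(cmod z)^2 - 1 = 2*t/(1 - t)"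
    unfolding nz using t1 by (auto simp: field_simps)
   have "stereo (Fin z) = u"
    unfolding stereo.simps a u using t1
    by (simp add: z_def del: of_real_diff) (simp add: complex_eq_iff field_simps)
   thus ?thesis by blast
  qed
 qed
qed

lemma inj_stereo: "inj stereo" by (simp add: inj_def stereo_inject)

lemma continuous_inv_stereo: "continuous_on (sphere 0 1) (inv stereo)"
 unfolding continuous_on_iff
proof safe
 fix u :: "complex \<times> real" and e :: real assume u: "u : sphere 0 1" and e: "e > 0"
 have "dist (inv stereo u') (inv stereo u) < e" if "u' : sphere 0 1" "dist u' u < e/(pi/2)" for u' :: "complex \<times> real"
 proof -
  have "stereo (inv stereo u') = u'" "stereo (inv stereo u) = u"
   using that(1) u range_stereo by (metis f_inv_into_f)+
  hence "chord (inv stereo u') (inv stereo u) = dist u' u"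
   unfolding chord_def dist_norm by simp
  thus ?thesis using dist_le_chord[of "inv stereo u'" "inv stereo u"] that(2)
   by (simp add: field_simps)
 qed
 thus "EX d>0. ALL x':sphere 0 1. dist x' u < d --> dist (inv stereo x') (inv stereo u) < e"
  using e by (intro exI[of _ "e/(pi/2)"]) auto
qed

lemma rsphere_UNIV: "(UNIV :: rsphere set) = inv stereo ` sphere 0 1"
proof -
 have "x : inv stereo ` sphere 0 1" for x
 proof -
  have "x = inv stereo (stereo x)" by (simp add: inj_stereo)
  moreover have "stereo x : sphere 0 1" by (simp add: norm_stereo)
  ultimately show ?thesis by blast
 qed
 thus ?thesis by blast
qed

lemma compact_rsphere: "compact (UNIV :: rsphere set)"
 using compact_continuous_image[OF continuous_inv_stereo compact_sphere] rsphere_UNIV by (simp only:)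

lemma connected_rsphere: "connected (UNIV :: rsphere set)"
proof -
 have "connected (inv stereo ` sphere 0 1)"
  by (intro connected_continuous_image continuous_inv_stereo connected_sphere) simp
 thus ?thesis using rsphere_UNIV by (simp only:)
qed

lemma closed_imp_compact_rsphere: "closed (S :: rsphere set) ==> compact S"
 using compact_Int_closed[OF compact_rsphere, of S] by simp

lemma dist_hpt_le:
 assumes ab: "a ~= 0 | b ~= 0" and cd: "c ~= 0 | d ~= 0"
 shows "dist (hpt a b) (hpt c d) <= pi*cmod (a*d - c*b)/(sqrt (hsq a b) * sqrt (hsq c d))"
 using dist_le_chord[of "hpt a b" "hpt c d"] unfolding chord_hpt[OF assms] by simp

lemma dist_hpt_ge:
 assumes ab: "a ~= 0 | b ~= 0" and cd: "c ~= 0 | d ~= 0"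
 shows "2*cmod (a*d - c*b)/(sqrt (hsq a b) * sqrt (hsq c d)) <= dist (hpt a b) (hpt c d)"
 using chord_le_dist[of "hpt a b" "hpt c d"] unfolding chord_hpt[OF assms] by simp

lemma hpt_eq_iff:
 assumes ab: "a ~= 0 | b ~= 0" and cd: "c ~= 0 | d ~= 0"
 shows "hpt a b = hpt c d \<longleftrightarrow> a*d = c*b"
 using assms by (auto simp: hpt_def field_simps)

lemma tendsto_hpt:
 assumes P: "(P ---> a) F" and Q: "(Q ---> b) F" and ab: "a ~= 0 | b ~= 0"
 shows "((%z. hpt (P z) (Q z)) ---> hpt a b) F"
proof -
 have h: "((%z. hsq (P z) (Q z)) ---> hsq a b) F"
  unfolding hsq_def by (intro tendsto_intros P Q)
 have pos: "hsq a b > 0" by (rule hsq_pos[OF ab])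
 have "eventually (%z. hsq (P z) (Q z) > 0) F"
  using order_tendstoD(1)[OF h pos] .
 hence ne: "eventually (%z. P z ~= 0 | Q z ~= 0) F"
  by eventually_elim (auto simp: hsq_def)
 have "((%z. pi*cmod (P z*b - a*Q z)/(sqrt (hsq (P z) (Q z)) * sqrt (hsq a b)))
   ---> pi*cmod (a*b - a*b)/(sqrt (hsq a b) * sqrt (hsq a b))) F"
  by (intro tendsto_intros P Q h) (use pos in auto)
 hence "((%z. pi*cmod (P z*b - a*Q z)/(sqrt (hsq (P z) (Q z)) * sqrt (hsq a b))) ---> 0) F"
  by simp
 hence "((%z. dist (hpt (P z) (Q z)) (hpt a b)) ---> 0) F"
 proof (rule tendsto_0_le[where K = 1])
  show "eventually (%z. norm (dist (hpt (P z) (Q z)) (hpt a b))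
   <= norm (pi*cmod (P z*b - a*Q z)/(sqrt (hsq (P z) (Q z)) * sqrt (hsq a b)))*1) F"
   using ne by eventually_elim (use dist_hpt_le[OF _ ab] in "simp add: abs_mult")
 qed
 thus ?thesis by (rule iffD2[OF tendsto_dist_iff])
qed

lemma continuous_on_hpt:
 assumes "continuous_on S P" "continuous_on S Q" "!!z. z : S ==> P z ~= 0 | Q z ~= 0"
 shows "continuous_on S (%z. hpt (P z) (Q z))"
 using assms unfolding continuous_on_def by (auto intro!: tendsto_hpt)

text \<open>The determinant of \<open>(P w, Q w)\<close> and \<open>(P z, Q z)\<close>, divided by
  \<open>w - z\<close>, tends to the Wronskian. The arc is squeezed between the chord and the chord
  divided by a cosine tending to one.\<close>

lemma hpt_metric_deriv:
 assumes P: "(P has_field_derivative P') (at z)" and Q: "(Q has_field_derivative Q') (at z)"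
  and ne: "P z ~= 0 | Q z ~= 0"
 shows "((%w. dist (hpt (P w) (Q w)) (hpt (P z) (Q z))/dist w z) --->
   2*cmod (P'*Q z - P z*Q')/hsq (P z) (Q z)) (at z)"
proof -
 define f where "f w = hpt (P w) (Q w)" for w
 have cP: "(P ---> P z) (at z)" and cQ: "(Q ---> Q z) (at z)"
  using P Q DERIV_isCont isContD by blast+
 have h: "((%z. hsq (P z) (Q z)) ---> hsq (P z) (Q z)) (at z)"
  unfolding hsq_def by (intro tendsto_intros cP cQ)
 have pos: "hsq (P z) (Q z) > 0" by (rule hsq_pos[OF ne])
 have "eventually (%z. hsq (P z) (Q z) > 0) (at z)"
  using order_tendstoD(1)[OF h pos] .
 hence nev: "eventually (%z. P z ~= 0 | Q z ~= 0) (at z)"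
  by eventually_elim (auto simp: hsq_def)
 have "((%w. P w*Q z - P z*Q w) has_field_derivative (P'*Q z - P z*Q')) (at z)"
  by (auto intro!: derivative_eq_intros P Q)
 hence "((%w. (P w*Q z - P z*Q w)/(w - z)) ---> P'*Q z - P z*Q') (at z)"
  by (simp add: has_field_derivative_iff mult.commute)
 hence n: "((%w. cmod ((P w*Q z - P z*Q w)/(w - z))) ---> cmod (P'*Q z - P z*Q')) (at z)"
  by (rule tendsto_norm)
 have "((%w. 2*cmod ((P w*Q z - P z*Q w)/(w - z))/(sqrt (hsq (P w) (Q w)) * sqrt (hsq (P z) (Q z))))
   ---> 2*cmod (P'*Q z - P z*Q')/(sqrt (hsq (P z) (Q z)) * sqrt (hsq (P z) (Q z)))) (at z)"
  by (intro tendsto_divide tendsto_mult tendsto_const tendsto_real_sqrt n h) (use pos in auto)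
 hence c: "((%w. 2*cmod ((P w*Q z - P z*Q w)/(w - z))/(sqrt (hsq (P w) (Q w)) * sqrt (hsq (P z) (Q z))))
   ---> 2*cmod (P'*Q z - P z*Q')/hsq (P z) (Q z)) (at z)"
  using pos by simp
 have e: "eventually (%w. 2*cmod ((P w*Q z - P z*Q w)/(w - z))/(sqrt (hsq (P w) (Q w)) * sqrt (hsq (P z) (Q z)))
   = chord (f w) (f z)/dist w z) (at z)"
  using nev
 proof eventually_elim
  case (elim w)
  show ?case unfolding f_def chord_hpt[OF elim ne] norm_divide dist_norm by simp
 qed
 have c1: "((%w. chord (f w) (f z)/dist w z) ---> 2*cmod (P'*Q z - P z*Q')/hsq (P z) (Q z)) (at z)"
  by (rule Lim_transform_eventually[OF c e])
 have "(f ---> f z) (at z)" unfolding f_def by (rule tendsto_hpt[OF cP cQ ne])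
 hence d0: "((%w. dist (f w) (f z)) ---> 0) (at z)" by (rule iffD1[OF tendsto_dist_iff])
 have lt: "eventually (%w. dist (f w) (f z) < pi) (at z)"
  using order_tendstoD(2)[OF d0 pi_gt_zero] .
 have cosl: "((%w. cos (dist (f w) (f z)/2)) ---> cos (0/2)) (at z)"
  by (intro tendsto_intros d0) auto
 have c2: "((%w. chord (f w) (f z)/dist w z/cos (dist (f w) (f z)/2)) --->
   2*cmod (P'*Q z - P z*Q')/hsq (P z) (Q z)/cos (0/2)) (at z)"
  by (intro tendsto_divide c1 cosl) simp
 have up: "eventually (%w. dist (f w) (f z)/dist w z <= chord (f w) (f z)/dist w z/cos (dist (f w) (f z)/2)) (at z)"
  using lt
 proof eventually_elim
  case (elim w)
  have cp: "cos (dist (f w) (f z)/2) > 0"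
   using elim zero_le_dist[of "f w" "f z"] by (intro cos_gt_zero_pi) linarith+
  have "dist (f w) (f z) <= chord (f w) (f z)/cos (dist (f w) (f z)/2)"
   using dist_le_chord_cos[OF elim] cp by (simp add: field_simps)
  from divide_right_mono[OF this, of "dist w z"] show ?case by (simp add: mult.commute)
 qed
 have "((%w. dist (f w) (f z)/dist w z) ---> 2*cmod (P'*Q z - P z*Q')/hsq (P z) (Q z)) (at z)"
 proof (rule tendsto_sandwich[OF _ up c1])
  show "eventually (%w. chord (f w) (f z)/dist w z <= dist (f w) (f z)/dist w z) (at z)"
   by (intro always_eventually allI divide_right_mono chord_le_dist) simp
  show "((%w. chord (f w) (f z)/dist w z/cos (dist (f w) (f z)/2)) --->
   2*cmod (P'*Q z - P z*Q')/hsq (P z) (Q z)) (at z)" using c2 by simp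
 qed
 thus ?thesis by (simp add: f_def)
qed

text \<open>The coordinate \<open>1 / (z - c)\<close>, with the junk value \<open>0\<close> at the point \<open>c\<close> it sends to infinity.\<close>

fun kap :: "complex => rsphere => complex" where
 "kap c (Fin z) = 1/(z - c)"
| "kap c Infty = 0"

text \<open>The inverse coordinate \<open>c + 1/u\<close>, written homogeneously so that
  \<open>u = 0\<close> gives \<open>Infty\<close>. It parametrizes the sphere minus one point by the
  whole plane, so a chart has no domain to keep track of.\<close>

definition kinv :: "complex => complex => rsphere" where
 "kinv c u = hpt (1 + c*u) u"

lemma kinv_ne: "1 + c*u ~= 0 | (u::complex) ~= 0" by auto

lemma kap_hpt: "a ~= c*b ==> kap c (hpt a b) = b/(a - c*b)"
 by (auto simp: hpt_def field_simps)

lemma kap_kinv [simp]: "kap c (kinv c u) = u"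
 unfolding kinv_def by (subst kap_hpt) auto

lemma kinv_kap [simp]: "x ~= Fin c ==> kinv c (kap c x) = x"
 by (cases x) (auto simp: kinv_def hpt_def field_simps)

lemma kinv_neq [simp]: "kinv c u ~= Fin c"
 by (auto simp: kinv_def hpt_def field_simps)

lemma kinv_neq' [simp]: "Fin c ~= kinv c u" using kinv_neq[of c u] by metis

lemma range_kinv: "range (kinv c) = - {Fin c}"
proof -
 have "x : range (kinv c)" if "x ~= Fin c" for x
  using kinv_kap[OF that] by (metis rangeI)
 thus ?thesis by auto
qed

lemma inj_kinv: "inj (kinv c)" by (metis injI kap_kinv)

lemma continuous_on_kinv: "continuous_on S (kinv c)"
 unfolding kinv_def by (intro continuous_on_hpt continuous_intros kinv_ne)

lemma continuous_on_Fin: "continuous_on S Fin"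
proof -
 have "continuous_on S (%z. hpt z 1)" by (intro continuous_on_hpt continuous_intros) auto
 thus ?thesis by simp
qed

lemma dist_kinv_le: "dist (kinv c u) (kinv c w) <= pi*cmod (u - w)*(1 + cmod c)^2"
proof -
 have ge: "sqrt (hsq (1 + c*u) u) >= 1/(1 + cmod c)" for u
 proof -
  have "1 = cmod ((1 + c*u) - c*u)" by simp
  also have "... <= cmod (1 + c*u) + cmod c*cmod u"
   by (metis norm_mult norm_triangle_ineq4)
  also have "... <= sqrt (hsq (1 + c*u) u) + cmod c * sqrt (hsq (1 + c*u) u)"
   unfolding hsq_def by (intro add_mono mult_left_mono real_le_rsqrt) auto
  also have "... = sqrt (hsq (1 + c*u) u)*(1 + cmod c)" by (simp add: algebra_simps)
  finally show ?thesis using norm_ge_zero[of c] by (simp add: divide_le_eq add_pos_nonneg)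
 qed
 have "1/(1 + cmod c)*(1/(1 + cmod c)) <= sqrt (hsq (1 + c*u) u) * sqrt (hsq (1 + c*w) w)"
  by (intro mult_mono ge) (auto simp: hsq_def)
 moreover have "1/(1 + cmod c)*(1/(1 + cmod c)) > 0"
  using norm_ge_zero[of c] by (intro mult_pos_pos divide_pos_pos) linarith+
 moreover have "sqrt (hsq (1 + c*u) u) * sqrt (hsq (1 + c*w) w) > 0"
  using hsq_pos[OF kinv_ne, of c u] hsq_pos[OF kinv_ne, of c w] by simp
 ultimately have "pi*cmod (u - w)/(sqrt (hsq (1 + c*u) u) * sqrt (hsq (1 + c*w) w)) <=
   pi*cmod (u - w)/(1/(1 + cmod c)*(1/(1 + cmod c)))"
  by (intro divide_left_mono mult_pos_pos[of _ "1/(1 + cmod c)*(1/(1 + cmod c))"]) auto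
 moreover have "(1 + c*u)*w - (1 + c*w)*u = w - u" by (simp add: algebra_simps)
 hence "dist (kinv c u) (kinv c w) <= pi*cmod (u - w)/(sqrt (hsq (1 + c*u) u) * sqrt (hsq (1 + c*w) w))"
  unfolding kinv_def using dist_hpt_le[OF kinv_ne[of c u] kinv_ne[of c w]] by (simp add: norm_minus_commute)
 ultimately show ?thesis by (simp add: power2_eq_square)
qed

lemma dist_kinv_ge:
 assumes "cmod u <= B" "cmod w <= B"
 shows "cmod (u - w) <= (1 + (1 + cmod c)*B)^2*dist (kinv c u) (kinv c w)"
proof -
 have B: "B >= 0" using assms(1) norm_ge_zero[of u] by linarith
 have ge: "sqrt (hsq (1 + c*u) u) <= 1 + (1 + cmod c)*B" if "cmod u <= B" for u
 proof -
  have "sqrt (hsq (1 + c*u) u) <= cmod (1 + c*u) + cmod u"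
   unfolding hsq_def by (rule sqrt_sum_squares_le_sum) auto
  also have "... <= 1 + cmod c*cmod u + cmod u"
   using norm_triangle_ineq[of 1 "c*u"] by (simp add: norm_mult)
  also have "... <= 1 + cmod c*B + B"
   using that by (intro add_mono mult_left_mono) auto
  finally show ?thesis by (simp add: algebra_simps)
 qed
 have "sqrt (hsq (1 + c*u) u) * sqrt (hsq (1 + c*w) w) <= (1 + (1 + cmod c)*B)^2"
  unfolding power2_eq_square using B by (intro mult_mono ge assms) (auto simp: hsq_def)
 moreover have p: "sqrt (hsq (1 + c*u) u) * sqrt (hsq (1 + c*w) w) > 0"
  using hsq_pos[OF kinv_ne, of c u] hsq_pos[OF kinv_ne, of c w] by simp
 ultimately have "2*cmod (u - w)/(1 + (1 + cmod c)*B)^2 <= 2*cmod (u - w)/(sqrt (hsq (1 + c*u) u) * sqrt (hsq (1 + c*w) w))"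
  using B by (intro divide_left_mono) (auto intro!: mult_pos_pos add_pos_nonneg)
 also have "... <= dist (kinv c u) (kinv c w)"
 proof -
  have "(1 + c*u)*w - (1 + c*w)*u = w - u" by (simp add: algebra_simps)
  thus ?thesis
   unfolding kinv_def using dist_hpt_ge[OF kinv_ne[of c u] kinv_ne[of c w]] by (simp add: norm_minus_commute)
 qed
 finally have "2*cmod (u - w) <= (1 + (1 + cmod c)*B)^2*dist (kinv c u) (kinv c w)"
 proof -
  assume a: "2*cmod (u - w)/(1 + (1 + cmod c)*B)^2 <= dist (kinv c u) (kinv c w)"
  have "(1 + (1 + cmod c)*B)^2 > 0" using B by (intro zero_less_power) (auto intro!: add_pos_nonneg)
  thus ?thesis using a by (simp add: divide_le_eq mult.commute)
 qed
 thus ?thesis using norm_ge_zero[of "u - w"] by linarith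
qed

lemma continuous_on_kap: "continuous_on (- {Fin c}) (kap c)"
proof -
 have "((kap c) ---> kap c x) (at x within - {Fin c})" if x: "x ~= Fin c" for x
 proof -
  define r where "r = dist x (Fin c)/2"
  have r: "r > 0" using x by (simp add: r_def)
  have "compact (cball x r)" by (simp add: closed_imp_compact_rsphere)
  text \<open>Near \<open>c\<close> the coordinate is large, so away from \<open>c\<close> it is bounded.\<close>
  have bd: "cmod (kap c y) <= pi/(2*r)*(sqrt 2*(1 + cmod c))*2" if y: "dist y x < r" for y
  proof (cases y)
   case (Fin z)
   have zc: "z ~= c" using y Fin x r unfolding r_def by (auto simp: dist_commute)
   have "r <= dist y (Fin c)"
    using dist_triangle[of x "Fin c" y] y unfolding r_def by (simp add: dist_commute)
   also have "... = dist (hpt z 1) (hpt c 1)" by (simp add: Fin)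
   also have "... <= pi*cmod (z - c)/(sqrt (hsq z 1) * sqrt (hsq c 1))"
    using dist_hpt_le[of z 1 c 1] by simp
   also have "... <= pi*cmod (z - c)/(1*1)"
    by (intro divide_left_mono mult_mono) (auto simp: hsq_def add_nonneg_pos intro!: mult_pos_pos)
   finally have "r <= pi*cmod (z - c)" by simp
   hence "1/cmod (z - c) <= pi/r" using r zc by (simp add: field_simps)
   also have "... = pi/(2*r)*1*2" by simp
   also have "... <= pi/(2*r)*(sqrt 2*(1 + cmod c))*2"
   proof (intro mult_right_mono mult_left_mono)
    have "1*1 <= sqrt 2*(1 + cmod c)" by (intro mult_mono) auto
    thus "1 <= sqrt 2*(1 + cmod c)" by simp
   qed (use r in auto)
   finally show ?thesis by (simp add: Fin norm_divide)
  next
   case Infty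
   thus ?thesis using r by simp
  qed
  define B where "B = pi/(2*r)*(sqrt 2*(1 + cmod c))*2"
  define K where "K = (1 + (1 + cmod c)*B)^2"
  have le: "dist (kap c y) (kap c x) <= K*dist y x" if y: "dist y x < r" for y
  proof -
   have yc: "y ~= Fin c" using y x r unfolding r_def by (auto simp: dist_commute)
   show ?thesis using dist_kinv_ge[OF bd[OF y] bd[of x], of c] yc x r
    by (simp add: dist_norm K_def B_def)
  qed
  have "((%y. K*dist y x) ---> K*0) (at x within - {Fin c})"
   by (intro tendsto_intros tendsto_dist_iff[THEN iffD1] tendsto_ident_at)
  hence "((%y. K*dist y x) ---> 0) (at x within - {Fin c})" by simp
  hence "((%y. dist (kap c y) (kap c x)) ---> 0) (at x within - {Fin c})"
  proof (rule tendsto_0_le[where K = 1])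
   have "eventually (%y. dist y x < r) (at x within - {Fin c})"
    using r by (auto simp: eventually_at)
   thus "\<forall>\<^sub>F y in at x within - {Fin c}. norm (dist (kap c y) (kap c x)) <= norm (K*dist y x)*1"
    by eventually_elim (use le in "auto simp: K_def abs_mult")
  qed
  thus ?thesis by (rule iffD2[OF tendsto_dist_iff])
 qed
 thus ?thesis unfolding continuous_on_def by auto
qed

section \<open>Holomorphic maps into and between spheres\<close>

text \<open>A pair of holomorphic functions without common zeros instead of a meromorphic function:
  poles are then no exception. A single pair on all of \<open>S\<close> is demanded, and for
  iterates of a rational map in a coordinate \<open>kinv c\<close> the homogenized polynomials
  provide it.\<close>

definition sphol :: "(complex => rsphere) => complex set => bool" where
 "sphol f S \<longleftrightarrow> (EX P Q. P holomorphic_on S & Q holomorphic_on S &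
   (ALL z:S. (P z ~= 0 | Q z ~= 0) & f z = hpt (P z) (Q z)))"

lemma spholI:
 assumes "P holomorphic_on S" "Q holomorphic_on S"
  "!!z. z : S ==> P z ~= 0 | Q z ~= 0" "!!z. z : S ==> f z = hpt (P z) (Q z)"
 shows "sphol f S"
 using assms unfolding sphol_def by blast

lemma spholE:
 assumes "sphol f S"
 obtains P Q where "P holomorphic_on S" "Q holomorphic_on S"
  "!!z. z : S ==> P z ~= 0 | Q z ~= 0" "!!z. z : S ==> f z = hpt (P z) (Q z)"
 using assms unfolding sphol_def by blast

lemma sphol_subset: "sphol f S ==> T <= S ==> sphol f T"
 unfolding sphol_def by (meson holomorphic_on_subset subsetD)

lemma sphol_continuous: "sphol f S ==> continuous_on S f"
proof (elim spholE)
 fix P Q assume a: "P holomorphic_on S" "Q holomorphic_on S"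
  "!!z. z : S ==> P z ~= 0 | Q z ~= 0" "!!z. z : S ==> f z = hpt (P z) (Q z)"
 have "continuous_on S (%z. hpt (P z) (Q z))"
  using a by (intro continuous_on_hpt holomorphic_on_imp_continuous_on)
 thus ?thesis using a(4) by (simp cong: continuous_on_cong)
qed

lemma sphol_kinv: "sphol (kinv c) S"
 by (rule spholI[of "%u. 1 + c*u" _ "%u. u"])
   (auto simp: kinv_def intro!: holomorphic_intros)

lemma sphol_compose:
 assumes "sphol f T" "h holomorphic_on S" "h ` S <= T"
 shows "sphol (%z. f (h z)) S"
proof -
 obtain P Q where a: "P holomorphic_on T" "Q holomorphic_on T"
  "!!z. z : T ==> P z ~= 0 | Q z ~= 0" "!!z. z : T ==> f z = hpt (P z) (Q z)"
  using assms(1) unfolding sphol_def by blast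
 show ?thesis
  using assms(3)
  by (intro spholI[of "%z. P (h z)" _ "%z. Q (h z)"] a
    holomorphic_on_compose_gen[OF assms(2), unfolded o_def, where t=T]) auto
qed

lemma sphol_kap_holomorphic:
 assumes "sphol f S" "!!z. z : S ==> f z ~= Fin c"
 shows "(%z. kap c (f z)) holomorphic_on S"
proof -
 obtain P Q where a: "P holomorphic_on S" "Q holomorphic_on S"
  "!!z. z : S ==> P z ~= 0 | Q z ~= 0" "!!z. z : S ==> f z = hpt (P z) (Q z)"
  using assms(1) unfolding sphol_def by blast
 have ne: "P z ~= c*Q z" if "z : S" for z
  using assms(2)[OF that] a(3)[OF that] a(4)[OF that] by (auto simp: hpt_def)
 have "(%z. Q z/(P z - c*Q z)) holomorphic_on S"
  using ne by (intro holomorphic_intros a) auto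
 thus ?thesis
  by (rule holomorphic_transform) (use a(4) ne kap_hpt in auto)
qed

definition rmap :: "(rsphere => rsphere) => bool" where
 "rmap f \<longleftrightarrow> (ALL c. sphol (%u. f (kinv c u)) UNIV)"

lemma rmap_sphol: "rmap f ==> sphol (%u. f (kinv c u)) S"
 unfolding rmap_def using sphol_subset by blast

lemma ex_chart: "EX c. x ~= Fin c"
 proof (cases x)
 case (Fin z)
 thus ?thesis by (intro exI[of _ "z + 1"]) simp
qed simp

lemma open_minus_Fin [simp]: "open (- {x :: rsphere})" by (simp add: open_Compl)

lemma isCont_kap: "x ~= Fin c ==> isCont (kap c) x"
 using continuous_on_kap[of c] by (simp add: continuous_on_eq_continuous_at)

lemma isCont_kinv: "isCont (kinv c) u"
 using continuous_on_kinv[of UNIV c] by (simp add: continuous_on_eq_continuous_at)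

lemma filterlim_kap_at:
 assumes "x ~= Fin c"
 shows "filterlim (kap c) (at (kap c x)) (at x)"
proof (rule filterlim_atI)
 show "((kap c) ---> kap c x) (at x)" using isCont_kap[OF assms] by (simp add: isCont_def)
 have "eventually (%y. y : - {Fin c}) (at x)"
  using assms by (intro eventually_at_in_open') auto
 thus "eventually (%y. kap c y ~= kap c x) (at x)"
  using eventually_neq_at_within[of x x UNIV]
 proof eventually_elim
  case (elim y)
  thus ?case using kinv_kap[of y c] kinv_kap[OF assms] by (metis ComplD singletonI)
 qed
qed

lemma filterlim_kinv_at: "filterlim (kinv c) (at (kinv c u)) (at u)"
proof (rule filterlim_atI)
 show "((kinv c) ---> kinv c u) (at u)" using isCont_kinv by (simp add: isCont_def)
 show "eventually (%y. kinv c y ~= kinv c u) (at u)"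
  using eventually_neq_at_within[of u u UNIV] by eventually_elim (metis kap_kinv)
qed

lemma at_rsphere_ne_bot [simp]: "at (x :: rsphere) ~= bot"
proof
 assume a: "at x = bot"
 obtain c where c: "x ~= Fin c" using ex_chart by blast
 have "filterlim (kinv c) (at (kinv c (kap c x))) (at (kap c x))" by (rule filterlim_kinv_at)
 hence "filterlim (kinv c) bot (at (kap c x))" using a c by simp
 hence "filtermap (kinv c) (at (kap c x)) = bot" by (simp add: filterlim_def le_bot)
 thus False by (simp add: filtermap_bot_iff)
qed

lemma tendsto_chart:
 assumes "x ~= Fin c"
 shows "(g ---> l) (at x) \<longleftrightarrow> ((%u. g (kinv c u)) ---> l) (at (kap c x))"
proof
 assume "(g ---> l) (at x)"
 thus "((%u. g (kinv c u)) ---> l) (at (kap c x))"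
  using filterlim_compose[OF _ filterlim_kinv_at[of c "kap c x"], of g "nhds l"] assms by simp
next
 assume "((%u. g (kinv c u)) ---> l) (at (kap c x))"
 hence l: "((%y. g (kinv c (kap c y))) ---> l) (at x)"
  using filterlim_compose[OF _ filterlim_kap_at[OF assms], of "%u. g (kinv c u)" "nhds l"] by simp
 have "eventually (%y. y : - {Fin c}) (at x)"
  using assms by (intro eventually_at_in_open') auto
 hence "eventually (%y. g (kinv c (kap c y)) = g y) (at x)"
  by eventually_elim simp
 with l show "(g ---> l) (at x)" by (rule Lim_transform_eventually)
qed

lemma rmap_continuous: "rmap f ==> continuous_on S f"
proof (rule continuous_on_subset)
 assume f: "rmap f"
 show "continuous_on UNIV f"
  unfolding continuous_on_eq_continuous_at[OF open_UNIV]
 proof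
  fix x
  obtain c where c: "x ~= Fin c" using ex_chart by blast
  have "continuous_on UNIV (%u. f (kinv c u))" by (intro sphol_continuous rmap_sphol f)
  hence "((%u. f (kinv c u)) ---> f (kinv c (kap c x))) (at (kap c x))"
   by (simp add: continuous_on_eq_continuous_at isCont_def)
  thus "isCont f x" using c by (simp add: isCont_def tendsto_chart[OF c])
 qed
qed simp

text \<open>The density of the spherical metric in the coordinate \<open>kinv c\<close>: its length
  element is \<open>hw c u\<close> times \<open>|du|\<close>.\<close>

definition hw :: "complex => complex => real" where
 "hw c u = 2/hsq (1 + c*u) u"

lemma hw_pos: "hw c u > 0" using hsq_pos[OF kinv_ne, of c u] by (simp add: hw_def)

lemma continuous_hw: "continuous_on S (hw c)"
 unfolding hw_def hsq_def
 by (intro continuous_intros) (use hsq_pos[OF kinv_ne, of c] in "auto simp: hsq_def less_le")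

lemma kinv_metric_deriv: "((%w. dist (kinv c w) (kinv c u)/dist w u) ---> hw c u) (at u)"
proof -
 have "((%w. dist (hpt (1 + c*w) w) (hpt (1 + c*u) u)/dist w u) --->
  2*cmod (c*u - (1 + c*u)*1)/hsq (1 + c*u) u) (at u)"
  by (rule hpt_metric_deriv) (auto intro!: derivative_eq_intros kinv_ne)
 thus ?thesis by (simp add: kinv_def hw_def)
qed

lemma metric_deriv_chart:
 assumes P: "(P has_field_derivative P') (at u)" and Q: "(Q has_field_derivative Q') (at u)"
  and ne: "P u ~= 0 | Q u ~= 0" and f: "\<forall>\<^sub>F w in nhds u. f (kinv c w) = hpt (P w) (Q w)"
 shows "((%y. dist (f y) (f (kinv c u))/dist y (kinv c u)) --->
   2*cmod (P'*Q u - P u*Q')/hsq (P u) (Q u)/hw c u) (at (kinv c u))"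
proof -
 have f1: "f (kinv c u) = hpt (P u) (Q u)" using f by (rule eventually_nhds_x_imp_x)
 have f2: "\<forall>\<^sub>F w in at u. f (kinv c w) = hpt (P w) (Q w)"
  using f by (simp add: eventually_nhds_conv_at)
 have "((%w. (dist (hpt (P w) (Q w)) (hpt (P u) (Q u))/dist w u)/(dist (kinv c w) (kinv c u)/dist w u))
  ---> 2*cmod (P'*Q u - P u*Q')/hsq (P u) (Q u)/hw c u) (at u)"
  using hw_pos[of c u] by (intro tendsto_divide hpt_metric_deriv[OF P Q ne] kinv_metric_deriv) auto
 moreover have "\<forall>\<^sub>F w in at u. (dist (hpt (P w) (Q w)) (hpt (P u) (Q u))/dist w u)/(dist (kinv c w) (kinv c u)/dist w u)
   = dist (f (kinv c w)) (f (kinv c u))/dist (kinv c w) (kinv c u)"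
  using f2 eventually_neq_at_within[of u u UNIV]
  by eventually_elim (simp add: f1)
 ultimately have "((%w. dist (f (kinv c w)) (f (kinv c u))/dist (kinv c w) (kinv c u))
  ---> 2*cmod (P'*Q u - P u*Q')/hsq (P u) (Q u)/hw c u) (at u)"
  by (rule Lim_transform_eventually)
 thus ?thesis using tendsto_chart[of "kinv c u" c, OF kinv_neq] unfolding kap_kinv by blast
qed

lemma metric_deriv_Fin:
 assumes P: "(P has_field_derivative P') (at z)" and Q: "(Q has_field_derivative Q') (at z)"
  and ne: "P z ~= 0 | Q z ~= 0" and f: "\<forall>\<^sub>F w in nhds z. f (Fin w) = hpt (P w) (Q w)"
 shows "((%y. dist (f y) (f (Fin z))/dist y (Fin z)) --->
   cmod (P'*Q z - P z*Q')*(1 + (cmod z)^2)/hsq (P z) (Q z)) (at (Fin z))"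
proof -
 define c where "c = z - 1"
 have k: "kinv c 1 = Fin z" by (simp add: kinv_def c_def hpt_def)
 have zc: "c + 1/1 = z" by (simp add: c_def)
 have I: "isCont (%u. c + 1/u) 1" by (intro continuous_intros) auto
 have "((%u. P (c + 1/u)) has_field_derivative P'*(- 1)) (at 1)"
  by (rule DERIV_chain2[where g = "%u. c + 1/u"])
    (use P zc in "auto intro!: derivative_eq_intros")
 moreover have "((%u. Q (c + 1/u)) has_field_derivative Q'*(- 1)) (at 1)"
  by (rule DERIV_chain2[where g = "%u. c + 1/u"])
    (use Q zc in "auto intro!: derivative_eq_intros")
 moreover have "\<forall>\<^sub>F u in nhds 1. f (kinv c u) = hpt (P (c + 1/u)) (Q (c + 1/u))"
 proof -
  have "((%u. c + 1/u) ---> z) (nhds 1)"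
   using I zc by (simp add: isCont_def continuous_at tendsto_nhds_iff)
  hence "\<forall>\<^sub>F u in nhds 1. f (Fin (c + 1/u)) = hpt (P (c + 1/u)) (Q (c + 1/u))"
   using eventually_compose_filterlim[OF f] by blast
  moreover have "\<forall>\<^sub>F u in nhds (1::complex). u ~= 0"
   using t1_space_nhds[of 1 "0::complex"] by simp
  ultimately show ?thesis
   by eventually_elim (simp add: kinv_def hpt_def field_simps)
 qed
 ultimately have "((%y. dist (f y) (f (kinv c 1))/dist y (kinv c 1)) --->
   2*cmod ((P'*(- 1))*Q (c + 1/1) - P (c + 1/1)*(Q'*(- 1)))/hsq (P (c + 1/1)) (Q (c + 1/1))/hw c 1) (at (kinv c 1))"
  by (intro metric_deriv_chart) (use ne zc in auto)
 moreover have "hw c 1 = 2/(1 + (cmod z)^2)"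
  by (simp add: hw_def hsq_def c_def add.commute)
 moreover have "(P'*(- 1))*Q z - P z*(Q'*(- 1)) = - (P'*Q z - P z*Q')" by simp
 ultimately show ?thesis unfolding zc k by (simp only: norm_minus_cancel) simp
qed

lemma isCont_nhds: "isCont f a ==> (f ---> f a) (nhds a)"
 by (simp add: isCont_def tendsto_at_iff_tendsto_nhds)

lemma isCont_eventually_ne: "isCont f a ==> f a ~= (b :: _ :: t1_space) ==> \<forall>\<^sub>F w in nhds a. f w ~= b"
 using tendsto_imp_eventually_ne isCont_nhds by blast

lemma sph_deriv_coordinates:
 assumes P': "(P has_field_derivative P') (at z)" and Q': "(Q has_field_derivative Q') (at z)"
  and ne: "P z ~= 0 | Q z ~= 0" and z: "chart a a = z"
  and evf: "\<forall>\<^sub>F w in nhds z. f (chart_inv a w) = hpt (P w) (Q w)"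
 shows "sph_deriv f a = cmod (P'*Q z - P z*Q')*(1 + (cmod z)^2)/hsq (P z) (Q z)"
proof -
 have "chart_inv a z = a" using z by (cases a) auto
 hence fz: "f a = hpt (P z) (Q z)" using eventually_nhds_x_imp_x[OF evf] by simp
 show ?thesis
 proof (cases "Q z = 0")
  case False
  have fa: "f a = Fin (P z/Q z)" using fz False by (simp add: hpt_def)
  have "\<forall>\<^sub>F w in nhds z. Q w ~= 0" by (rule isCont_eventually_ne[OF DERIV_isCont[OF Q'] False])
  hence "\<forall>\<^sub>F w in nhds z. chart (f a) (f (chart_inv a w)) = P w/Q w"
   using evf by eventually_elim (simp add: fa hpt_def)
  moreover have "((%w. P w/Q w) has_field_derivative (P'*Q z - P z*Q')/(Q z*Q z)) (at z)"
   using False by (auto intro!: derivative_eq_intros P' Q')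
  ultimately have "((%w. chart (f a) (f (chart_inv a w))) has_field_derivative (P'*Q z - P z*Q')/(Q z*Q z)) (at z)"
   by (subst DERIV_cong_ev[OF refl _ refl])
  hence "chart_deriv f a = (P'*Q z - P z*Q')/(Q z*Q z)"
   unfolding chart_deriv_def z by (rule DERIV_imp_deriv)
  hence "sph_deriv f a = cmod (P'*Q z - P z*Q')/(cmod (Q z))^2*(1 + (cmod z)^2)/(1 + (cmod (P z/Q z))^2)"
   unfolding sph_deriv_def z by (simp add: fa norm_divide norm_mult power2_eq_square)
  also have "1 + (cmod (P z/Q z))^2 = hsq (P z) (Q z)/(cmod (Q z))^2"
   using False by (simp add: hsq_def norm_divide power_divide field_simps)
  finally show ?thesis using False by simp
 next
  case True
  have fa: "f a = Infty" using fz True by (simp add: hpt_def)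
  have P0: "P z ~= 0" using ne True by simp
  have "\<forall>\<^sub>F w in nhds z. P w ~= 0" by (rule isCont_eventually_ne[OF DERIV_isCont[OF P'] P0])
  hence "\<forall>\<^sub>F w in nhds z. chart (f a) (f (chart_inv a w)) = Q w/P w"
   using evf by eventually_elim (simp add: fa hpt_def)
  moreover have "((%w. Q w/P w) has_field_derivative (Q'*P z - Q z*P')/(P z*P z)) (at z)"
   using P0 by (auto intro!: derivative_eq_intros P' Q')
  ultimately have "((%w. chart (f a) (f (chart_inv a w))) has_field_derivative (Q'*P z - Q z*P')/(P z*P z)) (at z)"
   by (subst DERIV_cong_ev[OF refl _ refl])
  hence "chart_deriv f a = (Q'*P z - Q z*P')/(P z*P z)"
   unfolding chart_deriv_def z by (rule DERIV_imp_deriv)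
  hence "sph_deriv f a = cmod (Q'*P z)/(cmod (P z))^2*(1 + (cmod z)^2)"
   unfolding sph_deriv_def z by (simp add: fa norm_divide norm_mult power2_eq_square True)
  thus ?thesis by (simp add: True hsq_def norm_mult mult_ac)
 qed
qed

text \<open>The bridge from the defined derivative, which is tied to two particular charts, to a
  limit that mentions no chart. By uniqueness of limits it can then be evaluated in whatever
  coordinate is convenient.\<close>

lemma sph_deriv_tendsto:
 assumes f: "rmap f"
 shows "((%y. dist (f y) (f a)/dist y a) ---> sph_deriv f a) (at a)"
proof (cases a)
 case a: (Fin z)
 define c where "c = z - 1"
 have "sphol (%u. f (kinv c u)) UNIV" using f by (simp add: rmap_def)
 hence "sphol (%w. f (kinv c (1/(w - c)))) (- {c})"
  by (rule sphol_compose) (auto intro!: holomorphic_intros)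
 then obtain P Q where PQ: "P holomorphic_on - {c}" "Q holomorphic_on - {c}"
  "!!w. w : - {c} ==> P w ~= 0 | Q w ~= 0" "!!w. w : - {c} ==> f (kinv c (1/(w - c))) = hpt (P w) (Q w)"
  unfolding sphol_def by blast
 have z: "z : - {c}" by (simp add: c_def)
 have kw: "kinv c (1/(w - c)) = Fin w" if "w ~= c" for w
  using kinv_kap[of "Fin w" c] that by simp
 have "\<forall>\<^sub>F w in nhds z. w : - {c}" using z by (intro eventually_nhds_in_open) auto
 hence evf: "\<forall>\<^sub>F w in nhds z. f (Fin w) = hpt (P w) (Q w)"
  by eventually_elim (use PQ(4) kw in simp)
 obtain P' Q' where P': "(P has_field_derivative P') (at z)" and Q': "(Q has_field_derivative Q') (at z)"
  using PQ(1,2) z holomorphic_derivI[of _ "- {c}" z] open_Compl[OF closed_singleton] by blast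
 have ne: "P z ~= 0 | Q z ~= 0" using PQ(3) z by blast
 show ?thesis
  using metric_deriv_Fin[OF P' Q' ne evf] sph_deriv_coordinates[OF P' Q' ne, of a f] evf by (simp add: a)
next
 case a: Infty
 have ci: "chart_inv a u = kinv 0 u" for u by (simp add: a kinv_def hpt_def)
 obtain P Q where PQ: "P holomorphic_on UNIV" "Q holomorphic_on UNIV"
  "!!w. P w ~= 0 | Q w ~= 0" "!!w. f (kinv 0 w) = hpt (P w) (Q w)"
  using f unfolding rmap_def sphol_def by (metis UNIV_I)
 obtain P' Q' where P': "(P has_field_derivative P') (at 0)" and Q': "(Q has_field_derivative Q') (at 0)"
  using PQ(1,2) holomorphic_derivI[of _ UNIV 0] open_UNIV by blast
 have evf: "\<forall>\<^sub>F w in nhds 0. f (chart_inv a w) = hpt (P w) (Q w)" by (simp add: ci PQ(4))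
 have k0: "kinv 0 0 = Infty" by (simp add: kinv_def)
 have hw00: "hw 0 0 = 2" by (simp add: hw_def hsq_def)
 show ?thesis
  using metric_deriv_chart[OF P' Q' PQ(3), of f 0] sph_deriv_coordinates[OF P' Q' PQ(3) _ evf] PQ(4)
  by (simp add: a k0 hw00)
qed

lemma sph_deriv_unique:
 assumes "rmap f" "((%y. dist (f y) (f a)/dist y a) ---> l) (at a)"
 shows "sph_deriv f a = l"
 using tendsto_unique[OF at_rsphere_ne_bot sph_deriv_tendsto[OF assms(1)] assms(2)] .

lemma sph_deriv_nonneg: "rmap f ==> 0 <= sph_deriv f a"
 by (rule tendsto_lowerbound[OF sph_deriv_tendsto]) auto

lemma sph_deriv_hpt:
 assumes f: "rmap f" and P: "(P has_field_derivative P') (at u)" and Q: "(Q has_field_derivative Q') (at u)"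
  and ne: "P u ~= 0 | Q u ~= 0" and e: "\<forall>\<^sub>F w in nhds u. f (kinv c w) = hpt (P w) (Q w)"
 shows "sph_deriv f (kinv c u) = 2*cmod (P'*Q u - P u*Q')/hsq (P u) (Q u)/hw c u"
 by (rule sph_deriv_unique[OF f metric_deriv_chart[OF P Q ne e]])

lemma sph_deriv_chart:
 assumes f: "rmap f" and ne: "f (kinv c u) ~= Fin c'"
  and h: "((%w. kap c' (f (kinv c w))) has_field_derivative h') (at u)"
 shows "sph_deriv f (kinv c u) = cmod h'*hw c' (kap c' (f (kinv c u)))/hw c u"
proof -
 define h where "h w = kap c' (f (kinv c w))" for w
 have hd: "(h has_field_derivative h') (at u)" using h unfolding h_def .
 have "isCont (%w. f (kinv c w)) u"
  using sphol_continuous[OF rmap_sphol[OF f, of c UNIV]] by (simp add: continuous_on_eq_continuous_at)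
 hence "\<forall>\<^sub>F w in nhds u. f (kinv c w) ~= Fin c'"
  by (rule isCont_eventually_ne) (rule ne)
 hence e: "\<forall>\<^sub>F w in nhds u. f (kinv c w) = hpt (1 + c'*h w) (h w)"
  by eventually_elim (use kinv_kap in "simp add: h_def kinv_def")
 have "sph_deriv f (kinv c u) = 2*cmod (c'*h'*h u - (1 + c'*h u)*h')/hsq (1 + c'*h u) (h u)/hw c u"
  by (rule sph_deriv_hpt[OF f _ hd kinv_ne e]) (auto intro!: derivative_eq_intros hd)
 also have "c'*h'*h u - (1 + c'*h u)*h' = - h'" by (simp add: algebra_simps)
 finally show ?thesis by (simp add: hw_def h_def)
qed

text \<open>If the derivative of \<open>f\<close> at \<open>a\<close> is nonzero, then
  \<open>f y ~= f a\<close> for \<open>y\<close> near \<open>a\<close> and the difference quotients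
  can be multiplied. If it is zero, this may fail, but a bound \<open>D\<close> on the quotients of
  \<open>g\<close> is enough.\<close>

lemma sph_deriv_compose:
 assumes f: "rmap f" and g: "rmap g" and fg: "rmap (%x. g (f x))"
 shows "sph_deriv (%x. g (f x)) a = sph_deriv g (f a) * sph_deriv f a"
proof (cases "sph_deriv f a = 0")
 case False
 have fa: "((%y. dist (f y) (f a)/dist y a) ---> sph_deriv f a) (at a)" by (rule sph_deriv_tendsto[OF f])
 hence "\<forall>\<^sub>F y in at a. dist (f y) (f a)/dist y a ~= 0"
  using False tendsto_imp_eventually_ne by blast
 hence ne: "\<forall>\<^sub>F y in at a. f y ~= f a" by eventually_elim auto
 have "(f ---> f a) (at a)" using rmap_continuous[OF f, of UNIV] by (simp add: continuous_on_def)
 hence fl: "filterlim f (at (f a)) (at a)" using ne by (rule filterlim_atI)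
 have "((%y. dist (g (f y)) (g (f a))/dist (f y) (f a)) ---> sph_deriv g (f a)) (at a)"
  using filterlim_compose[OF sph_deriv_tendsto[OF g] fl] .
 from tendsto_mult[OF this fa]
 have "((%y. dist (g (f y)) (g (f a))/dist (f y) (f a)*(dist (f y) (f a)/dist y a)) ---> sph_deriv g (f a) * sph_deriv f a) (at a)" .
 moreover have "\<forall>\<^sub>F y in at a. dist (g (f y)) (g (f a))/dist (f y) (f a)*(dist (f y) (f a)/dist y a) = dist (g (f y)) (g (f a))/dist y a"
  using ne by eventually_elim simp
 ultimately have "((%y. dist (g (f y)) (g (f a))/dist y a) ---> sph_deriv g (f a) * sph_deriv f a) (at a)"
  by (rule Lim_transform_eventually)
 thus ?thesis by (rule sph_deriv_unique[OF fg])
next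
 case True
 define D where "D = sph_deriv g (f a) + 1"
 have D: "D > 0" using sph_deriv_nonneg[OF g, of "f a"] by (simp add: D_def)
 have "\<forall>\<^sub>F y in at (f a). dist (g y) (g (f a))/dist y (f a) < D"
  using order_tendstoD(2)[OF sph_deriv_tendsto[OF g]] by (simp add: D_def)
 hence "\<forall>\<^sub>F y in at (f a). dist (g y) (g (f a)) <= D*dist y (f a)"
  using eventually_neq_at_within[of "f a" "f a" UNIV] by eventually_elim (simp add: field_simps)
 hence n: "\<forall>\<^sub>F y in nhds (f a). dist (g y) (g (f a)) <= D*dist y (f a)"
  by (simp add: eventually_nhds_conv_at)
 have "(f ---> f a) (at a)" using rmap_continuous[OF f, of UNIV] by (simp add: continuous_on_def)
 from eventually_compose_filterlim[OF n this]
 have le: "\<forall>\<^sub>F y in at a. dist (g (f y)) (g (f a)) <= D*dist (f y) (f a)" .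
 have "((%y. dist (f y) (f a)/dist y a) ---> 0) (at a)" using sph_deriv_tendsto[OF f, of a] True by simp
 hence "((%y. dist (g (f y)) (g (f a))/dist y a) ---> 0) (at a)"
 proof (rule tendsto_0_le[where K = D])
  show "\<forall>\<^sub>F y in at a. norm (dist (g (f y)) (g (f a))/dist y a) <= norm (dist (f y) (f a)/dist y a)*D"
   using le by eventually_elim (simp add: divide_right_mono mult.commute)
 qed
 thus ?thesis using True by (simp add: sph_deriv_unique[OF fg])
qed

lemma continuous_sph_deriv:
 assumes f: "rmap f"
 shows "continuous_on S (sph_deriv f)"
proof (rule continuous_on_subset)
 show "continuous_on UNIV (sph_deriv f)"
  unfolding continuous_on_eq_continuous_at[OF open_UNIV]
 proof
  fix x
  obtain c where c: "x ~= Fin c" using ex_chart by blast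
  obtain P Q where PQ: "P holomorphic_on UNIV" "Q holomorphic_on UNIV"
   "!!w. P w ~= 0 | Q w ~= 0" "!!w. f (kinv c w) = hpt (P w) (Q w)"
   using f unfolding rmap_def sphol_def by (metis UNIV_I)
  have dP: "(P has_field_derivative deriv P u) (at u)" "(Q has_field_derivative deriv Q u) (at u)" for u
   using PQ(1,2) by (auto intro: holomorphic_derivI)
  have e: "sph_deriv f (kinv c u) = 2*cmod (deriv P u*Q u - P u*deriv Q u)/hsq (P u) (Q u)/hw c u" for u
   by (rule sph_deriv_hpt[OF f dP]) (use PQ in auto)
  have "continuous_on UNIV (%u. 2*cmod (deriv P u*Q u - P u*deriv Q u)/hsq (P u) (Q u)/hw c u)"
  proof (intro continuous_intros continuous_hw)
   show "continuous_on UNIV P" "continuous_on UNIV Q" "continuous_on UNIV (deriv P)" "continuous_on UNIV (deriv Q)"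
    using PQ(1,2) holomorphic_deriv by (auto intro!: holomorphic_on_imp_continuous_on)
   thus "continuous_on UNIV (%u. hsq (P u) (Q u))" unfolding hsq_def by (intro continuous_intros)
   show "ALL u:UNIV. hsq (P u) (Q u) ~= 0" using PQ(3) hsq_pos by (metis less_irrefl)
   show "ALL u:UNIV. hw c u ~= 0" using hw_pos by (metis less_irrefl)
  qed
  hence "((%u. sph_deriv f (kinv c u)) ---> sph_deriv f (kinv c (kap c x))) (at (kap c x))"
   unfolding e by (simp add: continuous_on_eq_continuous_at isCont_def)
  thus "isCont (sph_deriv f) x" using c by (simp add: isCont_def tendsto_chart[OF c])
 qed
qed simp

section \<open>Rational maps\<close>

text \<open>The homogenization of \<open>p\<close> to degree \<open>n\<close>. With the common
  degree \<open>d\<close> in place of \<open>n\<close>, the pair made from \<open>p\<close> and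
  \<open>q\<close> is the action of \<open>R\<close> in homogeneous coordinates.\<close>

definition hom :: "complex poly => nat => complex => complex => complex" where
 "hom p n a b = (\<Sum>i\<le>n. coeff p i*a^i*b^(n - i))"

lemma hom_nz: "b ~= 0 ==> degree p <= n ==> hom p n a b = b^n*poly p (a/b)"
proof -
 assume b: "b ~= 0" and n: "degree p <= n"
 have "poly p (a/b) = (\<Sum>i\<le>n. coeff p i*(a/b)^i)"
  unfolding poly_altdef using n
  by (intro sum.mono_neutral_left) (auto simp: coeff_eq_0)
 hence "b^n*poly p (a/b) = (\<Sum>i\<le>n. b^n*(coeff p i*(a/b)^i))"
  by (simp add: sum_distrib_left)
 also have "... = hom p n a b"
  unfolding hom_def
 proof (rule sum.cong[OF refl])
  fix i assume "i : {..n}"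
  hence "b^n = b^(n - i)*b^i" by (simp flip: power_add)
  thus "b^n*(coeff p i*(a/b)^i) = coeff p i*a^i*b^(n - i)"
   using b by (simp add: power_divide)
 qed
 finally show ?thesis by simp
qed

lemma hom_0: "hom p n a 0 = coeff p n*a^n"
proof -
 have "hom p n a 0 = (\<Sum>i\<in>{n}. coeff p i*a^i*0^(n - i))"
  unfolding hom_def by (rule sum.mono_neutral_right) auto
 thus ?thesis by simp
qed

locale rational =
 fixes p q :: "complex poly" and d :: nat and R :: "rsphere => rsphere"
 assumes q0: "q ~= 0" and cop: "coprime p q" and deg: "d = max (degree p) (degree q)"
  and Rq: "R = quotient_map p q" and d2: "d >= 2"
begin

lemma dp: "degree p <= d" and dq: "degree q <= d" using deg by auto

lemma no_common_root: "~ (poly p z = 0 & poly q z = 0)"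
proof
 assume "poly p z = 0 & poly q z = 0"
 hence "[:-z, 1:] dvd p" "[:-z, 1:] dvd q" by (auto simp: poly_eq_0_iff_dvd)
 hence "[:-z, 1:] dvd 1" using cop coprime_common_divisor by blast
 thus False by (simp add: is_unit_iff_degree)
qed

lemma hom_ne: "a ~= 0 | b ~= 0 ==> hom p d a b ~= 0 | hom q d a b ~= 0"
proof (cases "b = 0")
 case True
 assume "a ~= 0 | b ~= 0"
 hence a: "a ~= 0" using True by simp
 have "coeff p d ~= 0 | coeff q d ~= 0"
 proof (cases "degree q = d")
  case True
  thus ?thesis using q0 leading_coeff_0_iff by blast
 next
  case False
  hence "degree p = d" using deg by (auto simp: max_def split: if_splits)
  moreover have "p ~= 0" using calculation d2 by auto
  ultimately show ?thesis using leading_coeff_0_iff by blast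
 qed
 thus ?thesis using a True by (simp add: hom_0)
next
 case False
 thus ?thesis using no_common_root[of "a/b"] by (simp add: hom_nz dp dq)
qed

lemma R_hpt: "a ~= 0 | b ~= 0 ==> R (hpt a b) = hpt (hom p d a b) (hom q d a b)"
proof (cases "b = 0")
 case True
 assume "a ~= 0 | b ~= 0"
 hence a: "a ~= 0" using True by simp
 show ?thesis using a True by (simp add: Rq hom_0 hpt_def Let_def deg[symmetric])
next
 case False
 thus ?thesis by (simp add: Rq hpt_def hom_nz dp dq)
qed

lemma sphol_R:
 assumes "sphol f S"
 shows "sphol (%z. R (f z)) S"
proof -
 obtain P Q where a: "P holomorphic_on S" "Q holomorphic_on S"
  "!!z. z : S ==> P z ~= 0 | Q z ~= 0" "!!z. z : S ==> f z = hpt (P z) (Q z)"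
  using assms(1) unfolding sphol_def by blast
 show ?thesis
  by (rule spholI[of "%z. hom p d (P z) (Q z)" _ "%z. hom q d (P z) (Q z)"])
    (use a hom_ne R_hpt in "auto simp: hom_def[abs_def] intro!: holomorphic_intros")
qed

lemma sphol_Rn: "sphol f S ==> sphol (%z. (R^^n) (f z)) S"
 by (induction n) (auto intro: sphol_R)

lemma rmap_R: "rmap R" unfolding rmap_def by (intro allI sphol_R sphol_kinv)

lemma rmap_Rn: "rmap (R^^n)" unfolding rmap_def by (intro allI sphol_Rn sphol_kinv)

lemma cont_Rn: "continuous_on S (R^^n)" by (rule rmap_continuous[OF rmap_Rn])

lemma cont_R: "continuous_on S R" by (rule rmap_continuous[OF rmap_R])

lemma sph_deriv_add: "sph_deriv (R^^(m + n)) x = sph_deriv (R^^m) ((R^^n) x) * sph_deriv (R^^n) x"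
proof -
 have e: "(%x. (R^^m) ((R^^n) x)) = R^^(m + n)" by (simp add: funpow_add fun_eq_iff)
 show ?thesis using sph_deriv_compose[OF rmap_Rn rmap_Rn, of m n x] by (simp add: e rmap_Rn)
qed

lemma sph_deriv_0: "sph_deriv (R^^0) x = 1"
proof (rule sph_deriv_unique[OF rmap_Rn])
 have "((%y. 1) ---> 1) (at x)" by simp
 moreover have "\<forall>\<^sub>F y in at x. 1 = dist ((R^^0) y) ((R^^0) x)/dist y x"
  using eventually_neq_at_within[of x x UNIV] by eventually_elim simp
 ultimately show "((%y. dist ((R^^0) y) ((R^^0) x)/dist y x) ---> 1) (at x)"
  by (rule Lim_transform_eventually)
qed

lemma sph_deriv_prod: "sph_deriv (R^^n) x = (\<Prod>i<n. sph_deriv R ((R^^i) x))"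
proof (induction n)
 case 0
 show ?case using sph_deriv_0[of x] by (simp add: id_def)
next
 case (Suc n)
 show ?case using sph_deriv_add[of 1 n x] Suc by (simp add: mult.commute o_def)
qed

definition crit :: "rsphere set" where "crit = {x. sph_deriv R x = 0}"

definition wr :: "complex poly" where "wr = pderiv p*q - p*pderiv q"

lemma crit_Fin: "Fin z : crit \<longleftrightarrow> poly wr z = 0"
proof -
 have "((%y. dist (R y) (R (Fin z))/dist y (Fin z)) --->
   cmod (poly (pderiv p) z*poly q z - poly p z*poly (pderiv q) z)*(1 + (cmod z)^2)/hsq (poly p z) (poly q z)) (at (Fin z))"
  by (rule metric_deriv_Fin) (use no_common_root in "auto simp: Rq hpt_def intro!: poly_DERIV")
 hence "sph_deriv R (Fin z) = cmod (poly wr z)*(1 + (cmod z)^2)/hsq (poly p z) (poly q z)"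
  by (simp add: sph_deriv_unique[OF rmap_R] wr_def)
 moreover have "hsq (poly p z) (poly q z) > 0" using no_common_root[of z] by (intro hsq_pos) auto
 moreover have "1 + (cmod z)^2 > 0" by (simp add: add_pos_nonneg)
 ultimately show ?thesis by (simp add: crit_def)
qed

text \<open>Subtracting a multiple of one entry from the other does not change the Wronskian, so its
 degree can be computed from entries of different degrees.\<close>

lemma wronskian_degree:
 fixes f g :: "complex poly"
 assumes "f ~= 0" "g ~= 0" "degree f ~= degree g" "degree f + degree g >= 2"
 shows "pderiv f*g - f*pderiv g ~= 0 & degree (pderiv f*g - f*pderiv g) >= 1"
proof -
 let ?n = "degree f" and ?m = "degree g" and ?w = "pderiv f*g - f*pderiv g"
 let ?k = "?n + ?m - 1"
 have c1: "coeff (pderiv f*g) ?k = of_nat ?n*(lead_coeff f*lead_coeff g)"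
 proof (cases "?n = 0")
  case True
  hence "pderiv f = 0" by (simp add: pderiv_eq_0_iff)
  thus ?thesis using True by simp
 next
  case False
  have "coeff (pderiv f*g) (degree (pderiv f) + degree g) = lead_coeff (pderiv f)*lead_coeff g"
   by (rule coeff_mult_degree_sum)
  moreover have "degree (pderiv f) + degree g = ?k" using False by (simp add: degree_pderiv)
  moreover have "lead_coeff (pderiv f) = of_nat ?n*lead_coeff f"
   using False by (simp add: degree_pderiv coeff_pderiv)
  ultimately show ?thesis by simp
 qed
 have c2: "coeff (f*pderiv g) ?k = of_nat ?m*(lead_coeff f*lead_coeff g)"
 proof (cases "?m = 0")
  case True
  hence "pderiv g = 0" by (simp add: pderiv_eq_0_iff)
  thus ?thesis using True by simp
 next
  case False
  have "coeff (f*pderiv g) (degree f + degree (pderiv g)) = lead_coeff f*lead_coeff (pderiv g)"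
   by (rule coeff_mult_degree_sum)
  moreover have "degree f + degree (pderiv g) = ?k" using False by (simp add: degree_pderiv)
  moreover have "lead_coeff (pderiv g) = of_nat ?m*lead_coeff g"
   using False by (simp add: degree_pderiv coeff_pderiv)
  ultimately show ?thesis by simp
 qed
 have "coeff ?w ?k = (of_nat ?n - of_nat ?m)*(lead_coeff f*lead_coeff g)"
  unfolding coeff_diff c1 c2 by (simp add: algebra_simps)
 moreover have "(of_nat ?n - of_nat ?m :: complex) ~= 0" using assms(3) by simp
 ultimately have nz: "coeff ?w ?k ~= 0" using assms(1,2) by simp
 hence "degree ?w >= ?k" by (rule le_degree)
 thus ?thesis using nz assms(4) by auto
qed

lemma wr_props: "wr ~= 0 & degree wr >= 1"
proof (cases "degree p = degree q")
 case False
 have "p ~= 0" using cop False deg d2 q0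
 proof -
  have "p = 0 ==> is_unit q" using cop by simp
  thus ?thesis using False deg d2 by (auto simp: is_unit_iff_degree q0)
 qed
 thus ?thesis unfolding wr_def
  using False d2 deg q0 by (intro wronskian_degree) auto
next
 case True
 hence dd: "degree p = d" "degree q = d" using deg by auto
 define c where "c = lead_coeff p/lead_coeff q"
 define p' where "p' = p - smult c q"
 have w: "wr = pderiv p'*q - p'*pderiv q"
  by (simp add: wr_def p'_def pderiv_diff pderiv_smult algebra_simps)
 have lq: "lead_coeff q ~= 0" using q0 by simp
 have "coeff p' d = 0" using lq unfolding p'_def c_def dd by simp
 moreover have "degree p' <= d" unfolding p'_def
  using dd degree_diff_le[of p d "smult c q"] degree_smult_le[of c q] by simp
 ultimately have lt: "degree p' < d | p' = 0"
  by (metis leading_coeff_0_iff le_neq_implies_less)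
 have nz: "p' ~= 0"
 proof
  assume "p' = 0"
  hence "q dvd p" by (simp add: p'_def) (metis dvd_smult dvd_refl)
  hence "is_unit q" using cop by (metis coprime_common_divisor dvd_refl)
  thus False using dd d2 by (simp add: is_unit_iff_degree q0)
 qed
 hence "degree p' < d" using lt by simp
 thus ?thesis unfolding w using nz q0 dd d2 by (intro wronskian_degree) auto
qed

lemma finite_crit: "finite crit"
proof -
 have "crit <= insert Infty (Fin ` {z. poly wr z = 0})"
 proof
  fix x assume "x : crit"
  thus "x : insert Infty (Fin ` {z. poly wr z = 0})"
   by (cases x) (auto simp: crit_Fin)
 qed
 thus ?thesis using wr_props poly_roots_finite finite_subset by blast
qed

lemma ex_crit: "EX c. Fin c : crit"
proof -
 have "~ constant (poly wr)" using wr_props by (simp add: constant_degree)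
 thus ?thesis using fundamental_theorem_of_algebra crit_Fin by blast
qed

lemma fiber_Fin: "R (Fin z) = hpt a b \<longleftrightarrow> poly (smult b p - smult a q) z = 0" if "a ~= 0 | b ~= 0"
proof -
 have "R (Fin z) = hpt (poly p z) (poly q z)" by (simp add: Rq hpt_def)
 thus ?thesis using hpt_eq_iff[of "poly p z" "poly q z" a b] no_common_root[of z] that
  by (auto simp: algebra_simps)
qed

lemma fiber_poly_nz: "smult b p - smult a q ~= 0" if "a ~= 0 | b ~= 0"
proof
 assume e: "smult b p - smult a q = 0"
 show False
 proof (cases "b = 0")
  case True
  thus False using e that q0 by simp
 next
  case False
  have "p = smult (1/b) (smult b p)" using False by simp
  also have "... = smult (a/b) q" using e by (simp add: smult_diff_right)
  finally have pq: "p = smult (a/b) q" .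
  hence "q dvd p" by (metis dvd_smult dvd_refl)
  hence u: "is_unit q" using cop by (metis coprime_common_divisor dvd_refl)
  hence "degree q = 0" by (simp add: is_unit_iff_degree q0)
  moreover have "degree p <= degree q" using pq degree_smult_le by metis
  ultimately show False using deg d2 by simp
 qed
qed

lemma finite_fiber: "finite (R -` {y})"
proof -
 obtain a b where ab: "y = hpt a b" "a ~= 0 | b ~= 0" by (rule rsphere_hpt)
 have "R -` {y} <= insert Infty (Fin ` {z. poly (smult b p - smult a q) z = 0})"
 proof
  fix x assume "x : R -` {y}"
  thus "x : insert Infty (Fin ` {z. poly (smult b p - smult a q) z = 0})"
   using fiber_Fin[OF ab(2)] ab(1) by (cases x) auto
 qed
 thus ?thesis using poly_roots_finite[OF fiber_poly_nz[OF ab(2)]] finite_subset by blast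
qed

lemma finite_fiber_n: "finite ((R^^n) -` {y})"
proof (induction n arbitrary: y)
 case (Suc n)
 have "(R^^Suc n) -` {y} = (\<Union>x \<in> R -` {y}. (R^^n) -` {x})" by auto
 thus ?case using Suc finite_fiber by (simp del: funpow.simps)
qed simp

text \<open>Three things are excluded: \<open>Infty\<close>, so that the fibre consists of the roots
  of \<open>p - w*q\<close>; the value \<open>R Infty\<close>, so that this polynomial has exact
  degree \<open>d\<close>; and the critical values, so that its roots are simple.\<close>

lemma generic_fiber:
 "EX E. finite E & (ALL y. y ~: E --> card (R -` {y}) = d)"
proof (intro exI conjI allI impI)
 show "finite (insert Infty (insert (R Infty) (R ` crit)))" using finite_crit by simp
 fix y assume y: "y ~: insert Infty (insert (R Infty) (R ` crit))"
 then obtain w where w: "y = Fin w" by (cases y) auto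
 define f where "f = p - smult w q"
 have yw: "y = hpt w 1" by (simp add: w)
 have fr: "R (Fin z) = y \<longleftrightarrow> poly f z = 0" for z
  unfolding yw f_def using fiber_Fin[of w 1 z] by simp
 have f0: "f ~= 0" using fiber_poly_nz[of w 1] by (simp add: f_def)
 have fib: "R -` {y} = Fin ` {z. poly f z = 0}"
 proof
  show "R -` {y} <= Fin ` {z. poly f z = 0}"
  proof
   fix x assume x: "x : R -` {y}"
   hence "x ~= Infty" using y by auto
   then obtain z where "x = Fin z" by (cases x) auto
   thus "x : Fin ` {z. poly f z = 0}" using x fr by auto
  qed
 qed (use fr in auto)
 have dle: "degree f <= d" unfolding f_def
  using dp dq degree_diff_le[of p d "smult w q"] degree_smult_le[of w q] by simp
 have "coeff f d ~= 0"
 proof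
  assume c: "coeff f d = 0"
  have "R Infty = hpt (coeff p d) (coeff q d)"
   using R_hpt[of 1 0] by (simp add: hom_0)
  moreover have "coeff p d ~= 0 | coeff q d ~= 0" using hom_ne[of 1 0] by (simp add: hom_0)
  moreover have "coeff p d*1 = w*coeff q d" using c by (simp add: f_def)
  ultimately have "R Infty = hpt w 1" using hpt_eq_iff[of "coeff p d" "coeff q d" w 1] by force
  thus False using y yw by simp
 qed
 hence df: "degree f = d" using dle le_degree[of f d] by simp
 have sf: "rsquarefree f"
  unfolding rsquarefree_roots
 proof (intro allI notI)
  fix z assume z: "poly f z = 0 & poly (pderiv f) z = 0"
  hence "poly p z = w*poly q z" "poly (pderiv p) z = w*poly (pderiv q) z"
   by (auto simp: f_def pderiv_diff pderiv_smult)
  hence "poly wr z = 0" by (simp add: wr_def)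
  hence "Fin z : crit" by (simp add: crit_Fin)
  moreover have "R (Fin z) = y" using fr z by simp
  ultimately show False using y by blast
 qed
 have "card {z. poly f z = 0} = degree f"
  using arg_cong[OF complex_poly_decompose_rsquarefree[OF sf], of degree] f0
  by (simp add: degree_prod_eq_sum_degree)
 thus "card (R -` {y}) = d"
  unfolding fib using df by (simp add: card_image inj_on_def)
qed

end

lemma open_kinv_image: "open V ==> open (kinv c ` V)"
proof -
 assume V: "open V"
 have e: "kinv c ` V = - {Fin c} Int kap c -` V"
 proof
  show "- {Fin c} Int kap c -` V <= kinv c ` V"
  proof
   fix x assume "x : - {Fin c} Int kap c -` V"
   thus "x : kinv c ` V" using kinv_kap[of x c] by (metis ComplD Int_iff imageI singletonI vimageE)
  qed
 qed auto
 show ?thesis unfolding e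
  using continuous_on_open_vimage[of "- {Fin c}" "kap c"] continuous_on_kap[of c] V
  by (metis Int_commute open_minus_Fin)
qed

lemma open_kinv_vimage: "open U ==> open (kinv c -` U)"
 using continuous_on_open_vimage[of UNIV "kinv c" ] continuous_on_kinv[of UNIV c] by auto

lemma connected_nbhd:
 fixes U :: "rsphere set"
 assumes "open U" "x : U"
 obtains N where "open N" "connected N" "x : N" "N <= U"
proof -
 obtain c where c: "x ~= Fin c" using ex_chart by blast
 have "open (kinv c -` U)" "kap c x : kinv c -` U"
  using open_kinv_vimage assms c by auto
 then obtain r where r: "r > 0" "ball (kap c x) r <= kinv c -` U" using openE by blast
 have "connected (kinv c ` ball (kap c x) r)"
  by (intro connected_continuous_image continuous_on_kinv) auto
 moreover have "x : kinv c ` ball (kap c x) r" using r(1) c by (intro image_eqI[of _ _ "kap c x"]) auto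
 ultimately show ?thesis using that[of "kinv c ` ball (kap c x) r"] r(2) open_kinv_image by auto
qed

lemma holomorphic_bounded_lipschitz:
 assumes h: "h holomorphic_on ball z r" and B: "!!w. w : ball z r ==> cmod (h w) <= B" and r: "r > 0"
  and u: "u : ball z (r/2)" and w: "w : ball z (r/2)"
 shows "cmod (h u - h w) <= 4*B/r*cmod (u - w)"
proof -
 have d: "cmod (deriv h v) <= 4*B/r" if v: "v : ball z (r/2)" for v
 proof -
  have sub: "cball v (r/4) <= ball z r"
  proof
   fix y assume "y : cball v (r/4)"
   thus "y : ball z r" using v r dist_triangle[of z y v] by (simp add: dist_commute)
  qed
  have "cmod ((deriv^^1) h v) <= fact 1*B/(r/4)^1"
  proof (rule Cauchy_inequality)
   show "h holomorphic_on ball v (r/4)" using h sub ball_subset_cball holomorphic_on_subset by blast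
   show "continuous_on (cball v (r/4)) h"
    using h sub holomorphic_on_subset holomorphic_on_imp_continuous_on by blast
   fix x assume "cmod (v - x) = r/4"
   hence "x : cball v (r/4)" by (simp add: dist_norm)
   thus "cmod (h x) <= B" using sub B by blast
  qed (use r in auto)
  thus ?thesis by (simp add: field_simps)
 qed
 show ?thesis
 proof (rule field_differentiable_bound[of "ball z (r/2)" h "deriv h"])
  fix v assume v: "v : ball z (r/2)"
  hence "v : ball z r" using r by auto
  thus "(h has_field_derivative deriv h v) (at v within ball z (r/2))"
   using h holomorphic_derivI[of h "ball z r" v] has_field_derivative_at_within by blast
 qed (use d u w in auto)
qed

section \<open>Montel's theorem\<close>

text \<open>The Moebius map that sends \<open>a\<close>, \<open>b\<close>, \<open>c\<close> to
  \<open>0\<close>, \<open>1\<close> and infinity, written through \<open>kap c\<close>; at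
  \<open>c\<close> itself it has a finite junk value.\<close>

definition mob :: "complex => complex => complex => rsphere => complex" where
 "mob a b c x = (b - c)/(b - a)*(1 + (c - a) * kap c x)"

lemma mob_Fin: "z ~= c ==> mob a b c (Fin z) = (b - c)*(z - a)/((b - a)*(z - c))"
 by (simp add: mob_def add_divide_distrib[symmetric] field_simps)

lemma mob_inverse:
 assumes "a ~= b" "b ~= c" "x ~= Fin a" "x ~= Fin c"
 shows "mob c b a x = 1/mob a b c x"
proof (cases x)
 case (Fin z)
 thus ?thesis using assms by (simp add: mob_Fin)
next
 case Infty
 thus ?thesis using assms by (simp add: mob_def)
qed

lemma mob_omits:
 assumes "a ~= b" "b ~= c" "a ~= c" "x ~= Fin a" "x ~= Fin b" "x ~= Fin c"
 shows "mob a b c x ~= 0" "mob a b c x ~= 1"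
proof -
 show "mob a b c x ~= 0"
 proof (cases x)
  case (Fin z)
  thus ?thesis using assms by (simp add: mob_Fin)
 next
  case Infty
  thus ?thesis using assms by (simp add: mob_def)
 qed
 show "mob a b c x ~= 1"
 proof (cases x)
  case (Fin z)
  hence z: "z ~= a" "z ~= b" "z ~= c" using assms by auto
  show ?thesis
  proof
   assume "mob a b c x = 1"
   hence "(b - c)*(z - a) = (b - a)*(z - c)" using z assms by (simp add: Fin mob_Fin)
   hence "(c - a)*(z - b) = 0" by (simp add: algebra_simps)
   thus False using z assms by simp
  qed
 next
  case Infty
  thus ?thesis using assms by (simp add: mob_def)
 qed
qed

lemma kap_mob:
 assumes "a ~= b" "b ~= c" "a ~= c"
 shows "kap c x = (mob a b c x*(b - a)/(b - c) - 1)/(c - a)"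
 using assms by (simp add: mob_def)

text \<open>Montel's theorem in quantitative form, by Schottky's theorem.\<close>

lemma montel_lipschitz_half:
 assumes d: "a ~= b" "b ~= c" "a ~= c" and e: "e > 0"
 shows "EX L. ALL f. sphol f (ball u0 e) & (ALL u:ball u0 e. f u ~= Fin a & f u ~= Fin b & f u ~= Fin c)
   & cmod (mob a b c (f u0)) <= 1 --> (ALL u:ball u0 (e/8). dist (f u) (f u0) <= L*cmod (u - u0))"
proof -
 \<comment> \<open>\<open>B\<close> is Schottky's bound for initial modulus at most one and relative
   radius \<open>1/2\<close>, that is on the ball of radius \<open>e/4\<close>. \<open>L\<close>
   multiplies Cauchy's estimate for \<open>mob\<close> by the Lipschitz constants of the way back to
   \<open>kap c\<close> and to the sphere.\<close>
 define B where "B = exp (pi*exp (pi*(2 + 2*1 + 12*(1/2)/(1 - 1/2))))"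
 define L where "L = pi*(cmod ((b - a)/(b - c))/cmod (c - a)*(4*B/(e/4)))*(1 + cmod c)^2"
 have "ALL u:ball u0 (e/8). dist (f u) (f u0) <= L*cmod (u - u0)"
  if f: "sphol f (ball u0 e)" and om: "!!u. u : ball u0 e ==> f u ~= Fin a & f u ~= Fin b & f u ~= Fin c"
   and le: "cmod (mob a b c (f u0)) <= 1" for f
 proof -
  define h where "h u = mob a b c (f u)" for u
  have hh: "h holomorphic_on ball u0 e"
   unfolding h_def mob_def using d om
   by (intro holomorphic_intros sphol_kap_holomorphic f) auto
  have sub: "u0 + complex_of_real (e/2)*z : ball u0 e" if "z : cball 0 1" for z
  proof -
   have "cmod z*(e/2) <= 1*(e/2)" using that e by (intro mult_right_mono) auto
   thus ?thesis using e by (simp add: dist_norm norm_mult mult.commute)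
  qed
  have bd: "cmod (h u) <= B" if u: "u : ball u0 (e/4)" for u
  proof -
   define z where "z = (u - u0)/complex_of_real (e/2)"
   have "cmod z = cmod (u - u0)/(e/2)" using e by (simp add: z_def norm_divide del: of_real_divide)
   hence z: "cmod z <= 1/2" using u e by (simp add: dist_norm norm_minus_commute)
   have uz: "u0 + complex_of_real (e/2)*z = u"
    unfolding z_def using e by (subst nonzero_mult_divide_mult_cancel_left[symmetric, of "1::complex"]) (auto simp del: of_real_divide)
   have "cmod (h (u0 + complex_of_real (e/2)*z)) <= B"
    unfolding B_def
   proof (rule Schottky[where f = "%z. h (u0 + complex_of_real (e/2)*z)" and t = "1/2"])
    show "(%z. h (u0 + complex_of_real (e/2)*z)) holomorphic_on cball 0 1"
     by (rule holomorphic_on_compose_gen[OF _ hh, unfolded o_def])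
       (use sub in "auto intro!: holomorphic_intros")
    show "~ (h (u0 + complex_of_real (e/2)*z) = 0 | h (u0 + complex_of_real (e/2)*z) = 1)" if "z : cball 0 1" for z
     unfolding h_def using mob_omits[OF d] om sub[OF that] by blast
   qed (use le z in "auto simp: h_def")
   thus ?thesis unfolding uz .
  qed
  show ?thesis
  proof
   fix u assume u: "u : ball u0 (e/8)"
   have "ball u0 (e/4) <= ball u0 e" using e by auto
   hence "cmod (h u - h u0) <= 4*B/(e/4)*cmod (u - u0)"
    using holomorphic_bounded_lipschitz[of h u0 "e/4" B u u0] bd hh holomorphic_on_subset u e by auto
   hence h1: "cmod ((b - a)/(b - c))/cmod (c - a)*cmod (h u - h u0) <= cmod ((b - a)/(b - c))/cmod (c - a)*(4*B/(e/4)*cmod (u - u0))"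
    by (intro mult_left_mono) auto
   define k where "k = (b - a)/(b - c)"
   have kk: "kap c x = (mob a b c x * k - 1)/(c - a)" for x
    using kap_mob[OF d, of x] by (simp add: k_def)
   have "kap c (f u) - kap c (f u0) = (h u - h u0)*((b - a)/(b - c))/(c - a)"
    unfolding kk h_def k_def[symmetric] by (simp add: diff_divide_distrib left_diff_distrib)
   hence "cmod (kap c (f u) - kap c (f u0)) = cmod ((b - a)/(b - c))/cmod (c - a)*cmod (h u - h u0)"
    by (simp add: norm_mult norm_divide)
   also note h1
   finally have k: "cmod (kap c (f u) - kap c (f u0)) <= cmod ((b - a)/(b - c))/cmod (c - a)*(4*B/(e/4)*cmod (u - u0))" .
   have fu: "f u ~= Fin c" "f u0 ~= Fin c" using om[of u] om[of u0] u e by auto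
   have "dist (f u) (f u0) <= pi*cmod (kap c (f u) - kap c (f u0))*(1 + cmod c)^2"
    using dist_kinv_le[of c "kap c (f u)" "kap c (f u0)"] fu by simp
   also have "... <= pi*(cmod ((b - a)/(b - c))/cmod (c - a)*(4*B/(e/4)*cmod (u - u0)))*(1 + cmod c)^2"
    by (intro mult_right_mono mult_left_mono k) auto
   also have "... = L*cmod (u - u0)" by (simp add: L_def)
   finally show "dist (f u) (f u0) <= L*cmod (u - u0)" .
  qed
 qed
 thus ?thesis by blast
qed

text \<open>Schottky's theorem needs a bound at the centre. Exchanging \<open>a\<close> and
  \<open>c\<close> inverts \<open>mob\<close>, so one of the two normalizations has modulus at most
  one there.\<close>

lemma montel_lipschitz:
 assumes d: "a ~= b" "b ~= c" "a ~= c" and e: "e > 0"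
 shows "EX L>0. ALL f. sphol f (ball u0 e) & (ALL u:ball u0 e. f u ~= Fin a & f u ~= Fin b & f u ~= Fin c)
   --> (ALL u:ball u0 (e/8). dist (f u) (f u0) <= L*cmod (u - u0))"
proof -
 obtain L1 where L1: "!!f. sphol f (ball u0 e) ==> (ALL u:ball u0 e. f u ~= Fin a & f u ~= Fin b & f u ~= Fin c)
   ==> cmod (mob a b c (f u0)) <= 1 ==> (ALL u:ball u0 (e/8). dist (f u) (f u0) <= L1*cmod (u - u0))"
  using montel_lipschitz_half[OF d e] by meson
 have d': "c ~= b" "b ~= a" "c ~= a" using d by auto
 obtain L2 where L2: "!!f. sphol f (ball u0 e) ==> (ALL u:ball u0 e. f u ~= Fin c & f u ~= Fin b & f u ~= Fin a)
   ==> cmod (mob c b a (f u0)) <= 1 ==> (ALL u:ball u0 (e/8). dist (f u) (f u0) <= L2*cmod (u - u0))"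
  using montel_lipschitz_half[OF d' e] by meson
 define L where "L = max 1 (max L1 L2)"
 have "ALL u:ball u0 (e/8). dist (f u) (f u0) <= L*cmod (u - u0)"
  if f: "sphol f (ball u0 e)" and om: "ALL u:ball u0 e. f u ~= Fin a & f u ~= Fin b & f u ~= Fin c" for f
 proof
  fix u assume u: "u : ball u0 (e/8)"
  have u0: "u0 : ball u0 e" using e by simp
  have "cmod (mob a b c (f u0)) <= 1 | cmod (mob c b a (f u0)) <= 1"
   using mob_inverse[of a b c "f u0"] om u0 d by (simp add: norm_divide divide_le_eq_1)
    (metis linorder_not_less order_less_imp_le)
  hence "dist (f u) (f u0) <= L1*cmod (u - u0) | dist (f u) (f u0) <= L2*cmod (u - u0)"
   using L1[OF f om] L2[OF f] om u by blast
  moreover have "L1*cmod (u - u0) <= L*cmod (u - u0)" "L2*cmod (u - u0) <= L*cmod (u - u0)"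
   by (auto simp: L_def intro!: mult_right_mono)
  ultimately show "dist (f u) (f u0) <= L*cmod (u - u0)" by linarith
 qed
 moreover have "L > 0" by (simp add: L_def)
 ultimately show ?thesis by blast
qed

text \<open>Pointwise equicontinuity of the iterates, on open sets equivalent to normality. It
  replaces the subsequences in the definition of the Fatou set by an estimate uniform in
  \<open>n\<close>.\<close>

definition equi :: "(rsphere => rsphere) => rsphere set => bool" where
 "equi f U \<longleftrightarrow> (ALL x:U. ALL e>0. EX dl>0. ALL y. dist y x < dl --> (ALL n. dist ((f^^n) y) ((f^^n) x) < e))"

lemma equiD:
 assumes "equi f U" "x : U" "e > 0"
 obtains dl where "dl > 0" "!!y n. dist y x < dl ==> dist ((f^^n) y) ((f^^n) x) < e"
 using assms unfolding equi_def by metis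

lemma rsphere_convergent_subseq:
 fixes y :: "nat => rsphere"
 obtains l r where "strict_mono (r :: nat => nat)" "(y o r) ----> l"
 using compact_rsphere unfolding compact_def by (metis UNIV_I)

lemma Cauchy_rsphere_convergent: "Cauchy (y :: nat => rsphere) ==> convergent y"
 using compact_imp_complete[OF compact_rsphere] unfolding complete_def convergent_def by (metis UNIV_I)

lemma normal_imp_equi:
 assumes "open U" "normal_family_on U (range (%n. f^^n))" and cont: "!!n. continuous_on UNIV (f^^n)"
 shows "equi f U"
proof (rule ccontr)
 assume "~ equi f U"
 then obtain x e where x: "x : U" and e: "e > 0"
  and n: "!!dl. dl > 0 ==> EX y n. dist y x < dl & e <= dist ((f^^n) y) ((f^^n) x)"
  unfolding equi_def by (meson not_less)
 have "EX y n. dist y x < 1/real (Suc k) & e <= dist ((f^^n) y) ((f^^n) x)" for k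
  by (rule n) simp
 then obtain y N where yN: "!!k. dist (y k) x < 1/real (Suc k)" "!!k. e <= dist ((f^^N k) (y k)) ((f^^N k) x)"
  by metis
 define F where "F k = f^^N k" for k
 have "range F <= range (%n. f^^n)" by (auto simp: F_def)
 then obtain r g where r: "strict_mono r"
  and ul: "!!K. compact K ==> K <= U ==> uniform_limit K (F o r) g sequentially"
  using assms(2) unfolding normal_family_on_def by meson
 obtain ro where ro: "ro > 0" "cball x ro <= U" using assms(1) x open_contains_cball by blast
 let ?K = "cball x ro"
 have uK: "uniform_limit ?K (F o r) g sequentially"
  using ul[OF closed_imp_compact_rsphere[OF closed_cball] ro(2)] .
 have cg: "continuous_on ?K g"
  by (rule uniform_limit_theorem[OF _ uK])
    (auto intro!: always_eventually continuous_on_subset[OF cont] simp: F_def)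
 obtain dl where dl: "dl > 0" "!!z. z : ?K ==> dist z x < dl ==> dist (g z) (g x) < e/3"
  using cg[unfolded continuous_on_iff, rule_format, of x "e/3"] e ro by auto
 have "EVS k. ALL z:?K. dist ((F o r) k z) (g z) < e/3"
  using uK[unfolded uniform_limit_iff, rule_format, of "e/3"] e by simp
 moreover have "EVS k. dist (y (r k)) x < min dl ro"
 proof -
  have "(%k. 1/real (Suc k)) ----> 0" by (rule LIMSEQ_Suc) (rule lim_1_over_n)
  hence "EVS k. 1/real (Suc k) < min dl ro"
   using dl(1) ro(1) by (intro order_tendstoD) auto
  hence "EVS k. dist (y k) x < min dl ro"
   by eventually_elim (use yN(1) less_trans in blast)
  thus ?thesis using r by (rule eventually_subseq[rotated])
 qed
 ultimately have "EVS k. False"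
 proof eventually_elim
  case (elim k)
  have yk: "y (r k) : ?K" using elim(2) by (simp add: dist_commute)
  have "dist (F (r k) (y (r k))) (F (r k) x) <= dist (F (r k) (y (r k))) (g (y (r k))) + dist (g (y (r k))) (g x) + dist (g x) (F (r k) x)"
   using dist_triangle[of "F (r k) (y (r k))" "F (r k) x" "g (y (r k))"] dist_triangle[of "g (y (r k))" "F (r k) x" "g x"] by linarith
  also have "... < e/3 + e/3 + e/3"
   using elim yk dl(2)[OF yk] ro(1) by (intro add_strict_mono) (auto simp: dist_commute)
  finally show False using yN(2)[of "r k"] by (simp add: F_def)
 qed
 thus False by simp
qed

lemma countable_dense_rsphere: "EX D. countable D & (ALL U::rsphere set. open U --> U ~= {} --> D Int U ~= {})"
proof -
 obtain D0 :: "complex set" where D0: "countable D0" "!!X. open X ==> X ~= {} ==> EX d:D0. d : X"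
  using countable_dense_exists by blast
 have "kinv 0 ` D0 Int U ~= {}" if U: "open U" "U ~= {}" for U
 proof -
  obtain N x where N: "open N" "x : N" "N <= U" using U by blast
  have "kinv 0 -` U ~= {}"
  proof (cases "x = Fin 0")
   case False
   hence "kap 0 x : kinv 0 -` U" using N by auto
   thus ?thesis by blast
  next
   case True
   have "\<forall>\<^sub>F y in at x. y : U" using N U by (intro eventually_at_in_open') auto
   moreover have "\<forall>\<^sub>F y in at x. y ~= x" by (rule eventually_neq_at_within)
   ultimately have "\<forall>\<^sub>F y in at x. y : U & y ~= x" by (rule eventually_conj)
   then obtain y where "y : U" "y ~= x"
    using eventually_happens at_rsphere_ne_bot by blast
   hence "kap 0 y : kinv 0 -` U" using True by auto
   thus ?thesis by blast
  qed
  thus ?thesis using D0(2)[OF open_kinv_vimage[OF U(1), of 0]] by blast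
 qed
 thus ?thesis using D0(1) by (intro exI[of _ "kinv 0 ` D0"]) auto
qed

text \<open>The Arzela-Ascoli argument: a diagonal subsequence converges on a countable dense set,
  with \<open>stereo\<close> providing a bounded Euclidean target, and equicontinuity spreads the
  Cauchy property uniformly over compact sets.\<close>

lemma equi_imp_normal:
 assumes U: "open U" and eq: "equi f U"
 shows "normal_family_on U (range (%n. f^^n))"
 unfolding normal_family_on_def
proof (intro allI impI)
 fix F :: "nat => rsphere => rsphere"
 assume F: "range F <= range (%n. f^^n)"
 obtain D :: "rsphere set" where D: "countable D" "!!U. open U ==> U ~= {} ==> D Int U ~= {}"
  using countable_dense_rsphere by blast
 obtain r where r: "strict_mono (r :: nat => nat)" and rl: "!!x. x : D ==> EX l. (%n. stereo (F (r n) x)) ----> l"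
 proof (rule function_convergent_subsequence[of D "%n x. stereo (F n x)" 1])
  show "norm (stereo (F n x)) <= 1" for n x by (simp add: norm_stereo)
 qed (use D in auto)
 define G where "G n = F (r n)" for n
 have Geq: "EX dl>0. ALL y. dist y x < dl --> (ALL n. dist (G n y) (G n x) < e)" if x: "x : U" and e: "e > 0" for x e
 proof -
  obtain dl where dl: "dl > 0" "!!y n. dist y x < dl ==> dist ((f^^n) y) ((f^^n) x) < e"
   using equiD[OF eq x e] by metis
  have "EX k. G n = f^^k" for n using F by (auto simp: G_def)
  thus ?thesis using dl by (metis (no_types, lifting))
 qed
 have CD: "EX M. ALL i>=M. ALL j>=M. dist (G i x) (G j x) < e" if xD: "x : D" and e: "e > 0" for x e
 proof -
  obtain l where "(%n. stereo (G n x)) ----> l" using rl[OF xD] by (auto simp: G_def)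
  hence "Cauchy (%n. stereo (G n x))" by (rule LIMSEQ_imp_Cauchy)
  then obtain M where M: "ALL i>=M. ALL j>=M. dist (stereo (G i x)) (stereo (G j x)) < e/(pi/2)"
   unfolding Cauchy_def using e by (metis divide_pos_pos pi_half_gt_zero)
  show ?thesis
  proof (intro exI allI impI)
   fix i j assume "i >= M" "j >= M"
   hence "chord (G i x) (G j x) < e/(pi/2)" using M by (simp add: chord_def dist_norm)
   thus "dist (G i x) (G j x) < e" using dist_le_chord[of "G i x" "G j x"] by (simp add: field_simps)
  qed
 qed
 have UC: "EX M. ALL i>=M. ALL j>=M. ALL y:K. dist (G i y) (G j y) < e" if K: "compact K" "K <= U" and e: "e > 0" for K e
 proof -
  have "ALL x:K. EX dl>0. ALL y. dist y x < dl --> (ALL n. dist (G n y) (G n x) < e/5)"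
   using Geq[of _ "e/5"] K e by auto
  then obtain dl where dl: "!!x. x : K ==> dl x > 0" "!!x y n. x : K ==> dist y x < dl x ==> dist (G n y) (G n x) < e/5"
   by metis
  have "K <= (\<Union>x\<in>K. ball x (dl x))" using dl(1) by force
  then obtain X where X: "X <= K" "finite X" "K <= (\<Union>x\<in>X. ball x (dl x))"
   using compactE_image[OF K(1), of K "%x. ball x (dl x)"] by auto
  have "ALL x:X. EX z. z : D Int ball x (dl x)" using D(2)[OF open_ball] dl(1) X(1)
   by (metis centre_in_ball empty_iff equals0I subsetD)
  then obtain z where z: "!!x. x : X ==> z x : D Int ball x (dl x)" by metis
  have "ALL x:X. EX M. ALL i>=M. ALL j>=M. dist (G i (z x)) (G j (z x)) < e/5"
   using CD z e by (metis IntD1 divide_pos_pos zero_less_numeral)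
  then obtain M where M: "!!x i j. x : X ==> i >= M x ==> j >= M x ==> dist (G i (z x)) (G j (z x)) < e/5" by metis
  define M0 where "M0 = Max (insert 0 (M ` X))"
  show ?thesis
  proof (intro exI allI impI ballI)
   fix i j y assume ij: "i >= M0" "j >= M0" and y: "y : K"
   obtain x where x: "x : X" "dist y x < dl x" using X(3) y by (auto simp: dist_commute)
   have zx: "dist (z x) x < dl x" using z[OF x(1)] by (simp add: dist_commute)
   have "M x <= M0" unfolding M0_def using X(2) x(1) by auto
   hence 3: "dist (G i (z x)) (G j (z x)) < e/5" using M[OF x(1)] ij by auto
   have xK: "x : K" using x X by auto
   have "dist (G i y) (G i x) < e/5" "dist (G j y) (G j x) < e/5" "dist (G i (z x)) (G i x) < e/5" "dist (G j (z x)) (G j x) < e/5"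
    using dl(2)[OF xK] x zx by auto
   moreover have "dist (G i y) (G j y) <= dist (G i y) (G i x) + dist (G i (z x)) (G i x) + dist (G i (z x)) (G j (z x)) + dist (G j (z x)) (G j x) + dist (G j y) (G j x)"
    using dist_triangle[of "G i y" "G j y" "G i x"] dist_triangle[of "G i x" "G j y" "G i (z x)"]
     dist_triangle[of "G i (z x)" "G j y" "G j (z x)"] dist_triangle[of "G j (z x)" "G j y" "G j x"]
     dist_commute[of "G i x" "G i (z x)"] dist_commute[of "G j x" "G j y"] by linarith
   ultimately show "dist (G i y) (G j y) < e" using 3 by linarith
  qed
 qed
 have "EX l. (%n. G n x) ----> l" if x: "x : U" for x
 proof -
  have "Cauchy (%n. G n x)"
   unfolding Cauchy_def using UC[of "{x}"] x by auto
  thus ?thesis using Cauchy_rsphere_convergent convergent_def by blast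
 qed
 then obtain g where g: "!!x. x : U ==> (%n. G n x) ----> g x" by metis
 have "uniform_limit K (F o r) g sequentially" if K: "compact K" "K <= U" for K
  unfolding uniform_limit_iff
 proof (intro allI impI)
  fix e :: real assume e: "e > 0"
  obtain M where M: "ALL i>=M. ALL j>=M. ALL y:K. dist (G i y) (G j y) < e/2" using UC[OF K, of "e/2"] e by auto
  have "dist (G i y) (g y) < e" if "i >= M" "y : K" for i y
  proof -
   have "(%j. dist (G i y) (G j y)) ----> dist (G i y) (g y)"
    using g K that by (intro tendsto_intros) auto
   hence "dist (G i y) (g y) <= e/2"
    by (rule LIMSEQ_le_const2) (use M that in "auto intro!: exI[of _ M] less_imp_le")
   thus ?thesis using e by linarith
  qed
  thus "EVS n. ALL x:K. dist ((F o r) n x) (g x) < e"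
   unfolding eventually_sequentially by (auto simp: G_def intro!: exI[of _ M])
 qed
 thus "EX r g. strict_mono r & (ALL K. compact K & K <= U --> uniform_limit K (F o r) g sequentially)"
  using r by blast
qed

lemma fatou_iff:
 assumes cont: "!!n. continuous_on UNIV (f^^n)"
 shows "x : fatou f \<longleftrightarrow> (EX U. open U & x : U & equi f U)"
 unfolding fatou_def using normal_imp_equi[OF _ _ cont] equi_imp_normal by blast

lemma open_fatou: "open (fatou f)"
proof (subst open_subopen, intro ballI)
 fix x assume "x : fatou f"
 then obtain U where "open U" "x : U" "normal_family_on U (range (%n. f^^n))"
  unfolding fatou_def by blast
 moreover from this have "U <= fatou f" unfolding fatou_def by blast
 ultimately show "EX T. open T & x : T & T <= fatou f" by blast
qed

lemma closed_julia: "closed (julia f)"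
 by (simp add: julia_def closed_Compl open_fatou)

lemma compact_julia: "compact (julia f)"
 by (intro closed_imp_compact_rsphere closed_julia)

section \<open>The Julia set of a rational map: invariance, Montel's theorem, local behaviour at
  critical points\<close>

context rational
begin

abbreviation J where "J \<equiv> julia R"

lemma fatouR_iff: "x : fatou R \<longleftrightarrow> (EX U. open U & x : U & equi R U)"
 by (rule fatou_iff) (rule cont_Rn)

lemma equi_fatou: "equi R (fatou R)"
 unfolding equi_def
proof (intro ballI allI impI)
 fix x e assume "x : fatou R" and e: "(0::real) < e"
 then obtain U where "x : U" "equi R U" using fatouR_iff by blast
 thus "EX dl>0. ALL y. dist y x < dl --> (ALL n. dist ((R^^n) y) ((R^^n) x) < e)"
  using e unfolding equi_def by blast
qed

lemma infinite_open: "open U ==> x : U ==> infinite (U :: rsphere set)"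
proof
 assume U: "open U" "x : U" "finite U"
 have "finite (U - {x})" using U by simp
 hence "open (U - (U - {x}))" by (intro open_Diff U(1) finite_imp_closed)
 moreover have "U - (U - {x}) = {x}" using U by auto
 ultimately have "open {x}" by simp
 hence "\<forall>\<^sub>F y in at x. y : {x}" by (intro eventually_at_in_open') auto
 hence "\<forall>\<^sub>F y in at x. False"
  using eventually_neq_at_within[of x x UNIV] by eventually_elim simp
 thus False by (simp add: eventually_False)
qed

lemma local_coordinate:
 assumes U: "open U" "x : U" and c: "x ~= Fin c" and c': "R x ~= Fin c'"
 obtains e where "e > 0" "kinv c ` ball (kap c x) e <= U"
  "!!u. u : ball (kap c x) e ==> R (kinv c u) ~= Fin c'"
  "(%u. kap c' (R (kinv c u))) holomorphic_on ball (kap c x) e"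
proof -
 have cR: "continuous_on UNIV (%u. R (kinv c u))" by (intro sphol_continuous rmap_sphol rmap_R)
 have "open ((%u. R (kinv c u)) -` (- {Fin c'}))"
  using continuous_on_open_vimage[of UNIV "%u. R (kinv c u)"] cR by simp
 hence "open (kinv c -` U Int (%u. R (kinv c u)) -` (- {Fin c'}))"
  using open_kinv_vimage[OF U(1)] by (rule open_Int[rotated])
 moreover have "kap c x : kinv c -` U Int (%u. R (kinv c u)) -` (- {Fin c'})"
  using U c c' by simp
 ultimately obtain e where e: "e > 0" "ball (kap c x) e <= kinv c -` U Int (%u. R (kinv c u)) -` (- {Fin c'})"
  using openE by blast
 have "(%u. kap c' (R (kinv c u))) holomorphic_on ball (kap c x) e"
  using e by (intro sphol_kap_holomorphic rmap_sphol rmap_R) auto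
 moreover have "kinv c ` ball (kap c x) e <= U" using e(2) by blast
 moreover have "R (kinv c u) ~= Fin c'" if "u : ball (kap c x) e" for u using e(2) that by blast
 ultimately show ?thesis using that[OF e(1)] by blast
qed

lemma nonconst_coordinate:
 assumes "e > 0" "!!u. u : ball u0 e ==> R (kinv c u) ~= Fin c'"
 shows "~ (%u. kap c' (R (kinv c u))) constant_on ball u0 e"
proof
 assume "(%u. kap c' (R (kinv c u))) constant_on ball u0 e"
 then obtain k where k: "!!u. u : ball u0 e ==> kap c' (R (kinv c u)) = k" unfolding constant_on_def by blast
 have "R (kinv c u) = kinv c' k" if "u : ball u0 e" for u
  using k[OF that] kinv_kap[OF assms(2)[OF that]] by simp
 hence "kinv c ` ball u0 e <= R -` {kinv c' k}" by auto
 hence "finite (kinv c ` ball u0 e)" using finite_fiber finite_subset by blast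
 moreover have "open (kinv c ` ball u0 e)" "kinv c u0 : kinv c ` ball u0 e"
  using assms(1) by (auto intro: open_kinv_image)
 ultimately show False using infinite_open by blast
qed

lemma open_R:
 assumes U: "open U" shows "open (R ` U)"
proof (subst open_subopen, intro ballI)
 fix y assume "y : R ` U"
 then obtain x where x: "x : U" "y = R x" by blast
 obtain c where c: "x ~= Fin c" using ex_chart by blast
 obtain c' where c': "R x ~= Fin c'" using ex_chart by blast
 obtain e where e: "e > 0" "kinv c ` ball (kap c x) e <= U"
  "!!u. u : ball (kap c x) e ==> R (kinv c u) ~= Fin c'"
  "(%u. kap c' (R (kinv c u))) holomorphic_on ball (kap c x) e"
  using local_coordinate[OF U x(1) c c'] by metis
 let ?h = "%u. kap c' (R (kinv c u))"
 have "open (?h ` ball (kap c x) e)"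
  by (rule open_mapping_thm[OF e(4) open_ball connected_ball open_ball subset_refl nonconst_coordinate[OF e(1) e(3)]])
 hence "open (kinv c' ` ?h ` ball (kap c x) e)" by (rule open_kinv_image)
 moreover have "kinv c' ` ?h ` ball (kap c x) e = R ` kinv c ` ball (kap c x) e"
  using e(3) by (auto simp: image_image intro!: image_cong)
 moreover have "y : R ` kinv c ` ball (kap c x) e" using x c e(1)
  by (intro image_eqI[of _ _ x] image_eqI[of _ _ "kap c x"]) auto
 ultimately show "EX T. open T & y : T & T <= R ` U"
  using e(2) by (intro exI[of _ "R ` kinv c ` ball (kap c x) e"]) auto
qed

lemma open_Rn: "open U ==> open ((R^^n) ` U)"
proof (induction n)
 case (Suc n)
 have "(R^^Suc n) ` U = R ` (R^^n) ` U" by (simp add: image_comp)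
 thus ?case using Suc open_R by metis
qed simp

lemma surj_R: "surj R"
proof -
 have "open (range R)" by (rule open_R) simp
 moreover have "closed (range R)"
  using compact_continuous_image[OF cont_R compact_rsphere] compact_imp_closed by blast
 ultimately have "openin (top_of_set UNIV) (range R)" "closedin (top_of_set UNIV) (range R)" by simp_all
 hence "range R = {} | range R = UNIV"
  using connected_rsphere unfolding connected_clopen by blast
 thus ?thesis by blast
qed

text \<open>Openness of \<open>R\<close> carries equicontinuity forward, since points near
  \<open>R y\<close> have preimages near \<open>y\<close>. Continuity carries it backward, where the
  \<open>e\<close> in \<open>min e dl'\<close> takes care of the iterate \<open>0\<close>.\<close>

lemma fatou_R: "x : fatou R \<longleftrightarrow> R x : fatou R"
proof
 assume x: "x : fatou R"
 have "equi R (R ` fatou R)"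
  unfolding equi_def
 proof (intro ballI allI impI)
  fix y' e assume "y' : R ` fatou R" and e: "(0::real) < e"
  then obtain y where y: "y : fatou R" "y' = R y" by blast
  obtain dl where dl: "dl > 0" "!!z n. dist z y < dl ==> dist ((R^^n) z) ((R^^n) y) < e"
   using equiD[OF equi_fatou y(1) e] by metis
  have "open (R ` ball y dl)" "y' : R ` ball y dl" using open_R y dl(1) by auto
  then obtain dl' where dl': "dl' > 0" "ball y' dl' <= R ` ball y dl" using openE by blast
  show "EX dl>0. ALL z. dist z y' < dl --> (ALL n. dist ((R^^n) z) ((R^^n) y') < e)"
  proof (intro exI[of _ dl'] conjI allI impI)
   fix z n assume "dist z y' < dl'"
   hence "z : ball y' dl'" by (simp add: dist_commute)
   hence "z : R ` ball y dl" by (rule subsetD[OF dl'(2)])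
   then obtain w where w0: "w : ball y dl" "z = R w" by blast
   hence w: "dist w y < dl" "z = R w" by (auto simp: dist_commute)
   show "dist ((R^^n) z) ((R^^n) y') < e"
    using dl(2)[OF w(1), of "Suc n"] w(2) y(2) by (simp add: funpow_swap1)
  qed (use dl' in auto)
 qed
 moreover have "open (R ` fatou R)" using open_R open_fatou by blast
 ultimately show "R x : fatou R" using x fatouR_iff[of "R x"] by blast
next
 assume x: "R x : fatou R"
 have "equi R (R -` fatou R)"
  unfolding equi_def
 proof (intro ballI allI impI)
  fix y e assume y: "y : R -` fatou R" and e: "(0::real) < e"
  have "R y : fatou R" using y by simp
  then obtain dl where dl: "dl > 0" "!!z n. dist z (R y) < dl ==> dist ((R^^n) z) ((R^^n) (R y)) < e"
   using equiD[OF equi_fatou _ e] by metis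
  obtain dl' where dl': "dl' > 0" "!!z. dist z y < dl' ==> dist (R z) (R y) < dl"
   using cont_R[of UNIV, unfolded continuous_on_iff] dl(1) by (metis UNIV_I)
  show "EX dl>0. ALL z. dist z y < dl --> (ALL n. dist ((R^^n) z) ((R^^n) y) < e)"
  proof (intro exI[of _ "min e dl'"] conjI allI impI)
   fix z n assume z: "dist z y < min e dl'"
   show "dist ((R^^n) z) ((R^^n) y) < e"
   proof (cases n)
    case 0
    thus ?thesis using z by simp
   next
    case (Suc k)
    thus ?thesis using dl(2)[OF dl'(2), of z k] z by (simp add: funpow_swap1)
   qed
  qed (use dl' e in auto)
 qed
 moreover have "open (R -` fatou R)" using continuous_on_open_vimage[of UNIV R] cont_R open_fatou by auto
 ultimately show "x : fatou R" using x fatouR_iff[of x] by blast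
qed

lemma J_R: "R x : J \<longleftrightarrow> x : J" using fatou_R by (simp add: julia_def)

lemma J_Rn: "(R^^n) x : J \<longleftrightarrow> x : J" by (induction n) (auto simp: J_R)

lemma fatou_Rn: "(R^^n) x : fatou R \<longleftrightarrow> x : fatou R" using J_Rn[of n x] by (simp add: julia_def)

lemma surj_Rn: "EX x. (R^^n) x = y"
 by (induction n arbitrary: y) (auto, metis surj_R surj_def comp_apply funpow_swap1)

lemma montel_omit:
 assumes U: "open U" and xU: "x : U" "x : J" and abc: "a ~= b" "b ~= c" "a ~= c"
 shows "EX n. EX y:U. (R^^n) y : {Fin a, Fin b, Fin c}"
proof (rule ccontr)
 assume "~ (EX n. EX y:U. (R^^n) y : {Fin a, Fin b, Fin c})"
 hence om: "!!n y. y : U ==> (R^^n) y ~= Fin a & (R^^n) y ~= Fin b & (R^^n) y ~= Fin c" by blast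
 have "equi R U"
  unfolding equi_def
 proof (intro ballI allI impI)
  fix z e assume z: "z : U" and e: "(0::real) < e"
  obtain k where k: "z ~= Fin k" using ex_chart by blast
  have "open (kinv k -` U)" "kap k z : kinv k -` U" using open_kinv_vimage U k z by auto
  then obtain r where r: "r > 0" "ball (kap k z) r <= kinv k -` U" using openE by blast
  obtain L where L: "L > 0" "!!f. sphol f (ball (kap k z) r) ==> (ALL u:ball (kap k z) r. f u ~= Fin a & f u ~= Fin b & f u ~= Fin c)
   ==> (ALL u:ball (kap k z) (r/8). dist (f u) (f (kap k z)) <= L*cmod (u - kap k z))"
   using montel_lipschitz[OF abc r(1), of "kap k z"] by metis
  have ff: "ALL u:ball (kap k z) (r/8). dist ((R^^n) (kinv k u)) ((R^^n) z) <= L*cmod (u - kap k z)" for n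
   using L(2)[OF rmap_sphol[OF rmap_Rn[of n], of k]] om r(2) k by auto
  let ?V = "kinv k ` (ball (kap k z) (min (r/8) (e/L)))"
  have "open ?V" by (intro open_kinv_image open_ball)
  moreover have "z : ?V" using r(1) L(1) e k by (intro image_eqI[of _ _ "kap k z"]) auto
  ultimately obtain dl where dl: "dl > 0" "ball z dl <= ?V" using openE by blast
  show "EX dl>0. ALL y. dist y z < dl --> (ALL n. dist ((R^^n) y) ((R^^n) z) < e)"
  proof (intro exI[of _ dl] conjI allI impI)
   fix y n assume "dist y z < dl"
   hence "y : ball z dl" by (simp add: dist_commute)
   hence "y : ?V" using subsetD[OF dl(2)] by blast
   then obtain u where u: "y = kinv k u" "u : ball (kap k z) (r/8)" "dist (kap k z) u < e/L" by auto
   have "dist ((R^^n) y) ((R^^n) z) <= L*cmod (u - kap k z)" using ff u by blast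
   also have "... < e" using u(3) L(1) by (simp add: dist_norm norm_minus_commute field_simps)
   finally show "dist ((R^^n) y) ((R^^n) z) < e" .
  qed (use dl in auto)
 qed
 hence "x : fatou R" using fatouR_iff U xU by blast
 thus False using xU by (simp add: julia_def)
qed

lemma coordinate_deriv:
 assumes "x ~= Fin c" "R x ~= Fin c'" "e > 0"
  "(%u. kap c' (R (kinv c u))) holomorphic_on ball (kap c x) e"
 shows "deriv (%u. kap c' (R (kinv c u))) (kap c x) = 0 \<longleftrightarrow> x : crit"
proof -
 have "((%u. kap c' (R (kinv c u))) has_field_derivative deriv (%u. kap c' (R (kinv c u))) (kap c x)) (at (kap c x))"
  using assms by (intro holomorphic_derivI[OF assms(4)]) auto
 from sph_deriv_chart[OF rmap_R _ this] assms
 have "sph_deriv R x = cmod (deriv (%u. kap c' (R (kinv c u))) (kap c x))*hw c' (kap c' (R x))/hw c (kap c x)"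
  by simp
 thus ?thesis using hw_pos[of c' "kap c' (R x)"] hw_pos[of c "kap c x"] by (auto simp: crit_def)
qed

lemma locally_injective:
 assumes "x ~: crit"
 obtains U where "open U" "x : U" "inj_on R U"
proof -
 obtain c where c: "x ~= Fin c" using ex_chart by blast
 obtain c' where c': "R x ~= Fin c'" using ex_chart by blast
 obtain e where e: "e > 0" "kinv c ` ball (kap c x) e <= UNIV"
  "!!u. u : ball (kap c x) e ==> R (kinv c u) ~= Fin c'"
  "(%u. kap c' (R (kinv c u))) holomorphic_on ball (kap c x) e"
  using local_coordinate[OF open_UNIV UNIV_I c c'] by metis
 have "deriv (%u. kap c' (R (kinv c u))) (kap c x) ~= 0"
  using coordinate_deriv[OF c c' e(1,4)] assms by simp
 then obtain r where r: "r > 0" "ball (kap c x) r <= ball (kap c x) e" "inj_on (%u. kap c' (R (kinv c u))) (ball (kap c x) r)"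
  using has_complex_derivative_locally_injective[OF e(4), of "kap c x"] e(1) by auto
 have "inj_on R (kinv c ` ball (kap c x) r)"
 proof (rule inj_onI, elim imageE)
  fix y z u w assume a: "R y = R z" "y = kinv c u" "z = kinv c w" "u : ball (kap c x) r" "w : ball (kap c x) r"
  have "kap c' (R (kinv c u)) = kap c' (R (kinv c w))" using a by simp
  from inj_onD[OF r(3) this a(4,5)] show "y = z" using a by simp
 qed
 moreover have "x : kinv c ` ball (kap c x) r" using r(1) c by (intro image_eqI[of _ _ "kap c x"]) auto
 ultimately show ?thesis using that[of "kinv c ` ball (kap c x) r"] open_kinv_image by blast
qed

text \<open>In coordinates the map is \<open>h u0 + px w^k\<close> with \<open>px\<close> open near
  \<open>u0\<close>, and the vanishing derivative forces \<open>k >= 2\<close>. The two preimages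
  come from two different \<open>k\<close>-th roots, \<open>z\<close> and \<open>og*z\<close> with
  \<open>og\<close> a primitive root of unity.\<close>

lemma critical_two_preimages:
 assumes x: "x : crit" and U: "open U" "x : U"
 obtains V where "open V" "R x : V" "!!y. y : V ==> y ~= R x ==> EX z w. z : U & w : U & z ~= w & R z = y & R w = y"
proof -
 obtain c where c: "x ~= Fin c" using ex_chart by blast
 obtain c' where c': "R x ~= Fin c'" using ex_chart by blast
 obtain e where e: "e > 0" "kinv c ` ball (kap c x) e <= U"
  "!!u. u : ball (kap c x) e ==> R (kinv c u) ~= Fin c'"
  "(%u. kap c' (R (kinv c u))) holomorphic_on ball (kap c x) e"
  using local_coordinate[OF U c c'] by metis
 define h where "h u = kap c' (R (kinv c u))" for u
 define u0 where "u0 = kap c x"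
 have hh: "h holomorphic_on ball u0 e" using e(4) by (simp add: h_def[abs_def] u0_def)
 have d0: "deriv h u0 = 0" using coordinate_deriv[OF c c' e(1,4)] x by (simp add: h_def[abs_def] u0_def)
 have nc: "~ h constant_on ball u0 e" using nonconst_coordinate[OF e(1,3)] by (simp add: h_def[abs_def] u0_def)
 obtain k g r where kgr: "0 < k" "0 < r" "g holomorphic_on ball u0 r" "ball u0 r <= ball u0 e"
   "!!w. w : ball u0 r ==> h w - h u0 = (w - u0)^k*g w" "!!w. w : ball u0 r ==> g w ~= 0"
 proof (rule holomorphic_factor_zero_nonconstant[of "%w. h w - h u0" "ball u0 e" u0])
  show "~ (%w. h w - h u0) constant_on ball u0 e"
  proof
   assume "(%w. h w - h u0) constant_on ball u0 e"
   then obtain q where "!!w. w : ball u0 e ==> h w - h u0 = q" unfolding constant_on_def by blast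
   hence "h constant_on ball u0 e" unfolding constant_on_def
    by (intro exI[of _ "q + h u0"]) (simp add: algebra_simps)
   thus False using nc by blast
  qed
 qed (use hh e(1) in "auto intro!: holomorphic_intros")
 have k2: "k >= 2"
 proof (rule ccontr)
  assume "~ k >= 2"
  hence k1: "k = 1" using kgr(1) by simp
  have "((%w. (w - u0)^k*g w + h u0) has_field_derivative g u0) (at u0)"
  proof -
   have "(g has_field_derivative deriv g u0) (at u0)" using kgr by (intro holomorphic_derivI[OF kgr(3)]) auto
   thus ?thesis by (auto intro!: derivative_eq_intros simp: k1)
  qed
  moreover have "\<forall>\<^sub>F w in nhds u0. h w = (w - u0)^k*g w + h u0"
  proof -
   have "\<forall>\<^sub>F w in nhds u0. w : ball u0 r" using kgr(2) by (intro eventually_nhds_in_open) auto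
   thus ?thesis by eventually_elim (use kgr(5) in "auto simp: algebra_simps")
  qed
  ultimately have "(h has_field_derivative g u0) (at u0)"
   by (subst DERIV_cong_ev[OF refl _ refl])
  hence "g u0 = 0" using d0 DERIV_imp_deriv[of h "g u0" u0] by simp
  thus False using kgr(2,6) by simp
 qed
 have "EX s. s holomorphic_on ball u0 r & (ALL w:ball u0 r. g w = s w^k)"
 proof -
  obtain l where l: "l holomorphic_on ball u0 r" "!!w. w : ball u0 r ==> g w = exp (l w)"
   using contractible_imp_holomorphic_log[OF kgr(3) convex_imp_contractible[OF convex_ball] kgr(6)] by metis
  have "exp (l w) = exp (l w/of_nat k)^k" for w
   using kgr(1) by (simp flip: exp_of_nat_mult)
  thus ?thesis using l kgr(1)
   by (intro exI[of _ "%w. exp (l w/of_nat k)"]) (auto intro!: holomorphic_intros)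
 qed
 then obtain s where s: "s holomorphic_on ball u0 r" "!!w. w : ball u0 r ==> g w = s w^k" by blast
 define px where "px w = (w - u0) * s w" for w
 have px: "px holomorphic_on ball u0 r" unfolding px_def by (intro holomorphic_intros s)
 have hpx: "h w = h u0 + px w^k" if "w : ball u0 r" for w
 proof -
  have "px w^k = (w - u0)^k * s w^k" by (simp add: px_def power_mult_distrib)
  thus ?thesis using kgr(5)[OF that] s(2)[OF that] by (simp add: diff_eq_eq)
 qed
 have "~ px constant_on ball u0 r"
 proof
  assume "px constant_on ball u0 r"
  then obtain q where "!!w. w : ball u0 r ==> px w = q" unfolding constant_on_def by blast
  moreover have "px u0 = 0" by (simp add: px_def)
  ultimately have z: "!!w. w : ball u0 r ==> px w = 0" using kgr(2) by (metis centre_in_ball)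
  have w: "u0 + of_real (r/2) : ball u0 r" using kgr(2) by (simp add: dist_norm)
  have "s (u0 + of_real (r/2)) = 0" using z[OF w] kgr(2) by (simp add: px_def)
  thus False using kgr(6)[OF w] s(2)[OF w] kgr(1) by (simp add: zero_power)
 qed
 hence "open (px ` ball u0 r)"
  by (intro open_mapping_thm[OF px open_ball connected_ball open_ball subset_refl])
 moreover have "0 : px ` ball u0 r" using kgr(2) by (intro image_eqI[of _ _ u0]) (auto simp: px_def)
 ultimately obtain ro where ro: "ro > 0" "ball 0 ro <= px ` ball u0 r" using openE by blast
 let ?V = "kinv c' ` ball (h u0) (ro^k)"
 show ?thesis
 proof (rule that[of ?V])
  show "open ?V" by (intro open_kinv_image open_ball)
  show "R x : ?V" using c c' ro(1) by (intro image_eqI[of _ _ "h u0"]) (auto simp: h_def u0_def)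
  fix y assume y: "y : ?V" "y ~= R x"
  then obtain v where v: "y = kinv c' v" "v : ball (h u0) (ro^k)" by blast
  have Rx: "R x = kinv c' (h u0)" using c c' by (simp add: h_def u0_def)
  define t where "t = v - h u0"
  have t0: "t ~= 0" using y v Rx by (auto simp: t_def)
  define z where "z = exp (ln t/of_nat k)"
  define og where "og = exp (2 * of_real pi*\<i>/of_nat k)"
  have zk: "z^k = t" using t0 kgr(1) by (simp add: z_def flip: exp_of_nat_mult)
  have wk: "og^k = 1" using kgr(1) by (simp add: og_def exp_two_pi_i flip: exp_of_nat_mult)
  have w1: "og ~= 1"
  proof
   assume "og = 1"
   then obtain j :: int where "2 * of_real pi*\<i>/of_nat k = 2 * of_int j * of_real pi*\<i>"
    unfolding og_def exp_eq_1 by (auto simp: complex_eq_iff)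
   hence "(2 * of_real pi*\<i>)*(1/of_nat k) = (2 * of_real pi*\<i>)*(of_int j :: complex)"
    by (simp add: mult_ac)
   hence "1/of_nat k = (of_int j :: complex)" by (subst (asm) mult_left_cancel) auto
   hence "of_real (1/real k) = (of_real (real_of_int j) :: complex)" by simp
   hence "1/real k = real_of_int j" using of_real_eq_iff by blast
   hence "real_of_int 1 = real_of_int (j*int k)" using kgr(1) by (simp add: field_simps)
   hence "1 = j*int k" using of_int_eq_iff by blast
   hence "int k dvd 1" by (metis dvd_triv_right)
   thus False using k2 by simp
  qed
  have zn: "cmod z < ro"
  proof -
   have "cmod z^k = cmod t" using zk by (simp flip: norm_power)
   also have "... < ro^k" using v(2) by (simp add: t_def dist_norm norm_minus_commute)
   finally show ?thesis using ro(1) power_less_imp_less_base by (metis less_imp_le)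
  qed
  have "cmod og = 1" by (simp add: og_def)
  hence "z : ball 0 ro" "og*z : ball 0 ro" using zn by (auto simp: norm_mult)
  then obtain a b where ab: "a : ball u0 r" "b : ball u0 r" "px a = z" "px b = og*z"
   using ro(2) by (metis imageE subsetD)
  have ha: "h a = v" using hpx[OF ab(1)] ab zk by (simp add: t_def)
  have hb: "h b = v" using hpx[OF ab(2)] ab zk wk by (simp add: t_def power_mult_distrib)
  have z0: "z ~= 0" by (simp add: z_def)
  have "a ~= b" using ab w1 z0 by auto
  moreover have "R (kinv c a) = y" "R (kinv c b) = y"
   using ha hb ab(1,2) kgr(4) e(3)[of a] e(3)[of b] kinv_kap v(1)
   unfolding h_def u0_def by (metis subsetD)+
  moreover have "kinv c a : U" "kinv c b : U" using e(2) subsetD[OF kgr(4)] ab(1,2) unfolding u0_def by blast+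
  moreover have "kinv c a ~= kinv c b" using `a ~= b` by (metis kap_kinv)
  ultimately show "EX z w. z : U & w : U & z ~= w & R z = y & R w = y" by blast
 qed
qed

end

section \<open>Expansive rational maps\<close>

locale expansive_rational = rational +
 assumes expansive: "expansive R" and uncountable_julia: "uncountable (julia R)"
begin

lemma finite_omitted:
 assumes U: "open U" "x : U" "x : J"
 shows "finite {z. ALL n. ALL y:U. (R^^n) y ~= Fin z}"
proof (rule ccontr)
 let ?E = "{z. ALL n. ALL y:U. (R^^n) y ~= Fin z}"
 assume "infinite ?E"
 then obtain T where T: "finite T" "card T = 3" "T <= ?E"
  using infinite_arbitrarily_large by blast
 then obtain a b c where abc: "T = {a, b, c}" "a ~= b" "b ~= c" "a ~= c"
  by (auto simp: card_3_iff)
 obtain n y where "y : U" "(R^^n) y : {Fin a, Fin b, Fin c}"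
  using montel_omit[OF U abc(2-4)] by blast
 moreover have "a : ?E" "b : ?E" "c : ?E" using T(3) abc(1) by auto
 ultimately show False by auto
qed

text \<open>By Montel's theorem the forward images of \<open>U Int J\<close> cover all of
  \<open>J\<close> but finitely many points, so countability would spread from one piece to the
  whole Julia set.\<close>

lemma uncountable_julia_open:
 assumes U: "open U" "x : U" "x : J"
 shows "uncountable (U Int J)"
proof
 assume c: "countable (U Int J)"
 let ?E = "{z. ALL n. ALL y:U. (R^^n) y ~= Fin z}"
 have "J <= insert Infty (Fin ` ?E) Un (\<Union>n. (R^^n) ` (U Int J))"
 proof
  fix y assume y: "y : J"
  show "y : insert Infty (Fin ` ?E) Un (\<Union>n. (R^^n) ` (U Int J))"
  proof (cases y)
   case (Fin z)
   show ?thesis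
   proof (cases "z : ?E")
    case False
    then obtain n w where w: "w : U" "(R^^n) w = Fin z" by blast
    hence "w : J" using y Fin J_Rn[of n w] by simp
    hence "y : (R^^n) ` (U Int J)" using w Fin by (intro image_eqI[of _ _ w]) auto
    thus ?thesis by blast
   qed (use Fin in blast)
  qed simp
 qed
 moreover have "countable (insert Infty (Fin ` ?E) Un (\<Union>n. (R^^n) ` (U Int J)))"
  using c finite_omitted[OF U] by (auto intro!: countable_finite)
 ultimately show False using uncountable_julia countable_subset by blast
qed

lemma julia_perfect:
 assumes "x : J" "e > 0"
 obtains y where "y : J" "y ~= x" "dist y x < e"
proof -
 have "uncountable (ball x e Int J)" using assms by (intro uncountable_julia_open) auto
 hence "~ (ball x e Int J <= {x})" using countable_subset by (metis countable_empty countable_insert)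
 then obtain y where "y : ball x e Int J" "y ~= x" by blast
 thus ?thesis using that[of y] by (auto simp: dist_commute)
qed

definition v where "v = (SOME v. v > 0 & (ALL x:J. ALL y:J. x ~= y --> (SUP n. dist ((R^^n) x) ((R^^n) y)) > v))"

lemma v_props: "v > 0" "x : J ==> y : J ==> x ~= y ==> (SUP n. dist ((R^^n) x) ((R^^n) y)) > v"
proof -
 have "v > 0 & (ALL x:J. ALL y:J. x ~= y --> (SUP n. dist ((R^^n) x) ((R^^n) y)) > v)"
  unfolding v_def by (rule someI_ex) (use expansive in "simp add: expansive_def")
 thus "v > 0" "x : J ==> y : J ==> x ~= y ==> (SUP n. dist ((R^^n) x) ((R^^n) y)) > v" by blast+
qed

lemma expand:
 assumes "x : J" "y : J" "!!n. dist ((R^^n) x) ((R^^n) y) <= v"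
 shows "x = y"
proof (rule ccontr)
 assume "x ~= y"
 hence "(SUP n. dist ((R^^n) x) ((R^^n) y)) > v" using v_props assms by blast
 moreover have "(SUP n. dist ((R^^n) x) ((R^^n) y)) <= v" by (rule cSUP_least) (use assms in auto)
 ultimately show False by simp
qed

lemma inj_small: "x : J ==> y : J ==> R x = R y ==> dist x y <= v ==> x = y"
proof (rule expand)
 fix n assume a: "R x = R y" "dist x y <= v"
 show "dist ((R^^n) x) ((R^^n) y) <= v"
 proof (cases n)
  case 0
  thus ?thesis using a by simp
 next
  case (Suc k)
  thus ?thesis using a v_props(1) by (simp add: funpow_swap1)
 qed
qed

text \<open>Expansivity makes \<open>R\<close> injective on \<open>J\<close> at scale
  \<open>v\<close>. At a critical point, however, every nearby value has two nearby preimages, and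
  since \<open>J\<close> is perfect some such value lies in \<open>J\<close>, as do then its
  preimages.\<close>

lemma crit_not_julia: "x : J ==> x ~: crit"
proof
 assume x: "x : J" "x : crit"
 obtain V where V: "open V" "R x : V"
  "!!y. y : V ==> y ~= R x ==> EX z w. z : ball x (v/2) & w : ball x (v/2) & z ~= w & R z = y & R w = y"
  using critical_two_preimages[OF x(2), of "ball x (v/2)"] v_props(1)
  by (metis centre_in_ball half_gt_zero open_ball)
 obtain r where r: "r > 0" "ball (R x) r <= V" using V openE by blast
 obtain y where y: "y : J" "y ~= R x" "dist y (R x) < r" using julia_perfect[of "R x" r] x r J_R by blast
 hence "y : V" using r(2) by (auto simp: dist_commute)
 then obtain z w where zw: "z : ball x (v/2)" "w : ball x (v/2)" "z ~= w" "R z = y" "R w = y" using V(3) y by blast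
 have "z : J" "w : J" using y(1) zw J_R by metis+
 moreover have "dist z w <= v" using zw(1,2) dist_triangle[of z w x] by (simp add: dist_commute)
 ultimately show False using inj_small[of z w] zw(3-5) by simp
qed

lemma sph_deriv_pos: "x : J ==> sph_deriv R x > 0"
 using crit_not_julia[of x] sph_deriv_nonneg[OF rmap_R, of x] by (simp add: crit_def less_le)

lemma sph_deriv_n_pos: "x : J ==> sph_deriv (R^^n) x > 0"
 unfolding sph_deriv_prod by (intro prod_pos) (use sph_deriv_pos J_Rn in blast)

text \<open>If \<open>a\<close> were the only preimage of \<open>y\<close>, all preimages of points
  near \<open>y\<close> would lie in a neighbourhood of \<open>a\<close> where \<open>R\<close> is
  injective. But all points outside a finite set have \<open>d >= 2\<close> preimages.\<close>

lemma two_preimages: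
 assumes y: "y : J"
 shows "card (R -` {y}) >= 2"
proof (rule ccontr)
 assume "~ card (R -` {y}) >= 2"
 moreover obtain a where a: "R a = y" using surj_R by (metis surjD)
 ultimately have "card (R -` {y}) = 1"
  using finite_fiber[of y] card_0_eq[OF finite_fiber[of y]] by fastforce
 then obtain x where "R -` {y} = {x}" by (auto simp: card_1_singleton_iff)
 moreover have "a : R -` {y}" using a by simp
 ultimately have fib: "R -` {y} = {a}" by simp
 have "a : J" using y a J_R by metis
 hence "a ~: crit" by (rule crit_not_julia)
 then obtain U where U: "open U" "a : U" "inj_on R U" by (rule locally_injective)
 have "compact (R ` (- U))"
  using U(1) by (intro compact_continuous_image cont_R closed_imp_compact_rsphere) (simp add: closed_Compl)
 hence oV: "open (- R ` (- U))" by (simp add: compact_imp_closed open_Compl)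
 moreover have yV: "y : - R ` (- U)" using fib U(2) by auto
 ultimately have inf: "infinite (- R ` (- U))" by (rule infinite_open)
 obtain E where E: "finite E" "!!y. y ~: E ==> card (R -` {y}) = d" using generic_fiber by blast
 obtain z where z: "z : - R ` (- U)" "z ~: E" using inf E(1) by (meson finite_subset subsetI)
 have "R -` {z} <= U" using z(1) by auto
 hence "inj_on R (R -` {z})" using U(3) inj_on_subset by blast
 moreover have "R ` (R -` {z}) <= {z}" by auto
 ultimately have "card (R -` {z}) <= card {z}" by (rule card_inj_on_le[of R]) simp
 thus False using E(2)[OF z(2)] d2 by simp
qed

text \<open>A finite backward orbit contains its own preimage, which by \<open>two_preimages\<close>
  would have at least twice as many points.\<close>

lemma infinite_backward_orbit:
 assumes e: "e : J"
 shows "infinite {x. EX n. (R^^n) x = e}" (is "infinite ?B")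
proof
 assume fin: "finite ?B"
 have BJ: "?B <= J" using e J_Rn by auto
 have sub: "R -` ?B <= ?B"
 proof
  fix x assume "x : R -` ?B"
  then obtain n where "(R^^n) (R x) = e" by auto
  hence "(R^^Suc n) x = e" by (simp add: funpow_swap1)
  thus "x : ?B" by blast
 qed
 have "R -` ?B = (\<Union>b\<in>?B. R -` {b})" by auto
 hence "card (R -` ?B) = (\<Sum>b\<in>?B. card (R -` {b}))"
  by (simp only:) (rule card_UN_disjoint, use fin finite_fiber in auto)
 also have "... >= (\<Sum>b\<in>?B. 2)" by (intro sum_mono two_preimages) (use BJ in auto)
 finally have "2*card ?B <= card (R -` ?B)" by simp
 moreover have "card (R -` ?B) <= card ?B" using sub fin by (rule card_mono[rotated])
 moreover have "e : ?B" by (auto intro: exI[of _ 0])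
 hence "card ?B > 0" using fin card_gt_0_iff by blast
 ultimately show False by linarith
qed

text \<open>The forward images of \<open>U\<close> omit only finitely many points, while the
  backward orbit of \<open>e\<close> is infinite. So some preimage of \<open>e\<close> is hit from
  \<open>U\<close>.\<close>

lemma reach:
 assumes U: "open U" "x : U" "x : J" and e: "e : J"
 obtains n y where "y : U" "y : J" "(R^^n) y = e"
proof -
 let ?B = "{x. EX n. (R^^n) x = e}"
 let ?E = "{z. ALL n. ALL y:U. (R^^n) y ~= Fin z}"
 have "~ ?B <= insert Infty (Fin ` ?E)"
  using infinite_backward_orbit[OF e] finite_omitted[OF U] finite_subset by blast
 then obtain b where b: "b : ?B" "b ~: insert Infty (Fin ` ?E)" by blast
 then obtain z where z: "b = Fin z" by (cases b) auto
 hence "z ~: ?E" using b(2) by blast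
 then obtain n y where y: "y : U" "(R^^n) y = b" using z by blast
 obtain k where k: "(R^^k) b = e" using b by blast
 have "(R^^(k + n)) y = e" using y k by (simp add: funpow_add)
 moreover have "y : J" using calculation e J_Rn by metis
 ultimately show ?thesis using that y by blast
qed

section \<open>Lifting of orbits and shadowing\<close>

lemma tendsto_Rn: "(f ---> l) F ==> ((%x. (R^^n) (f x)) ---> (R^^n) l) F"
 using continuous_on_tendsto_compose[OF cont_Rn[of UNIV n]] by auto

lemma lim_julia: "(f ---> l) sequentially ==> (!!n. f n : J) ==> l : J"
 using closed_sequentially[OF closed_julia] by blast

lemma uniform_expansion:
 assumes th: "th > 0"
 obtains N where "!!x y. x : J ==> y : J ==> (!!i. i <= N ==> dist ((R^^i) x) ((R^^i) y) <= v) ==> dist x y < th"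
proof (rule ccontr)
 assume a: "~ thesis"
 have "EX x y. x : J & y : J & (ALL i<=N. dist ((R^^i) x) ((R^^i) y) <= v) & th <= dist x y" for N
  using that[of N] a by (meson not_less)
 then obtain x y where xy: "!!N. x N : J" "!!N. y N : J" "!!N i. i <= N ==> dist ((R^^i) (x N)) ((R^^i) (y N)) <= v"
  "!!N. th <= dist (x N) (y N)" by metis
 obtain l r where r: "strict_mono (r :: nat => nat)" "(x o r) ----> l" by (rule rsphere_convergent_subseq)
 obtain l' r' where r': "strict_mono (r' :: nat => nat)" "((y o r) o r') ----> l'" by (rule rsphere_convergent_subseq)
 define s where "s = r o r'"
 have s: "strict_mono s" using r r' by (simp add: s_def strict_mono_o)
 have lx: "(%k. x (s k)) ----> l" using LIMSEQ_subseq_LIMSEQ[OF r(2) r'(1)] by (simp add: s_def o_def)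
 have ly: "(%k. y (s k)) ----> l'" using r'(2) by (simp add: s_def o_def)
 have "l : J" "l' : J" using lim_julia[OF lx] lim_julia[OF ly] xy by auto
 moreover have "dist ((R^^i) l) ((R^^i) l') <= v" for i
 proof (rule LIMSEQ_le_const2)
  show "(%k. dist ((R^^i) (x (s k))) ((R^^i) (y (s k)))) ----> dist ((R^^i) l) ((R^^i) l')"
   by (intro tendsto_dist tendsto_Rn lx ly)
  show "EX N. ALL n>=N. dist ((R^^i) (x (s n))) ((R^^i) (y (s n))) <= v"
   using xy(3) s by (meson order_trans seq_suble)
 qed
 ultimately have "l = l'" by (rule expand)
 moreover have "th <= dist l l'"
  by (rule LIMSEQ_le_const[OF tendsto_dist[OF lx ly]]) (use xy in auto)
 ultimately show False using th by simp
qed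

lemma uniform_open:
 assumes et: "et > 0"
 obtains ka where "ka > 0" "!!w y. dist y (R w) < ka ==> EX z. dist z w < et & R z = y"
proof (rule ccontr)
 assume a: "~ thesis"
 have "EX w y. dist y (R w) < 1/real (Suc n) & ~ (EX z. dist z w < et & R z = y)" for n
  using that[of "1/real (Suc n)"] a by (metis of_nat_0_less_iff zero_less_Suc zero_less_divide_1_iff)
 then obtain w y where wy: "!!n. dist (y n) (R (w n)) < 1/real (Suc n)" "!!n z. dist z (w n) < et ==> R z ~= y n" by metis
 obtain l r where r: "strict_mono (r :: nat => nat)" "(w o r) ----> l" by (rule rsphere_convergent_subseq)
 have "open (R ` ball l (et/2))" "R l : R ` ball l (et/2)" using et by (auto intro: open_R)
 then obtain e where e: "e > 0" "ball (R l) e <= R ` ball l (et/2)" using openE by blast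
 have Rw: "(%k. R (w (r k))) ----> R l" using tendsto_Rn[OF r(2), of 1] by (simp add: o_def)
 note inv = inverse_Suc_subseq[OF r(1)]
 have "EVS k. dist (R (w (r k))) (R l) < e/2" using tendstoD[OF Rw, of "e/2"] e by simp
 moreover have "EVS k. dist (w (r k)) l < et/2" using tendstoD[OF r(2), of "et/2"] et by simp
 moreover have "EVS k. 1/real (Suc (r k)) < e/2" using order_tendstoD(2)[OF inv, of "e/2"] e by simp
 ultimately have "EVS k. False"
 proof eventually_elim
  case (elim k)
  have "dist (y (r k)) (R l) < e" using wy(1)[of "r k"] elim dist_triangle[of "y (r k)" "R l" "R (w (r k))"] by linarith
  hence "y (r k) : R ` ball l (et/2)" using e(2) by (auto simp: dist_commute)
  then obtain z where z0: "z : ball l (et/2)" "y (r k) = R z" by blast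
  hence z: "dist z l < et/2" "R z = y (r k)" by (auto simp: dist_commute)
  have "dist z (w (r k)) < et" using z(1) elim(2) dist_triangle[of z "w (r k)" l] by (simp add: dist_commute)
  thus False using wy(2) z(2) by blast
 qed
 thus False by simp
qed

abbreviation (input) pullback where
 "pullback n y w th z \<equiv> (R^^n) z = y & (ALL i<=n. dist ((R^^i) z) ((R^^i) w) < th)"

lemma lift_steps:
 assumes "th > 0"
 shows "EX et>0. ALL w y. dist y ((R^^N) w) < et --> (EX z. (R^^N) z = y & (ALL i<=N. dist ((R^^i) z) ((R^^i) w) < th))"
 using assms
proof (induction N arbitrary: th)
 case 0
 thus ?case by auto
next
 case (Suc N)
 obtain ka where ka: "ka > 0" "!!w y. dist y (R w) < ka ==> EX z. dist z w < th & R z = y"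
  using uniform_open[OF Suc.prems] by metis
 obtain et where et: "et > 0" "!!w y. dist y ((R^^N) w) < et ==> (EX z. (R^^N) z = y & (ALL i<=N. dist ((R^^i) z) ((R^^i) w) < min th ka))"
  using Suc.IH[of "min th ka"] Suc.prems ka(1) by auto
 show ?case
 proof (intro exI[of _ et] conjI allI impI)
  fix w y assume "dist y ((R^^Suc N) w) < et"
  hence "dist y ((R^^N) (R w)) < et" by (simp add: funpow_swap1)
  then obtain z' where z': "(R^^N) z' = y" "!!i. i <= N ==> dist ((R^^i) z') ((R^^i) (R w)) < min th ka" using et(2) by blast
  have "dist z' (R w) < ka" using z'(2)[of 0] by simp
  then obtain z where z: "dist z w < th" "R z = z'" using ka(2) by blast
  have "dist ((R^^i) z) ((R^^i) w) < th" if "i <= Suc N" for i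
  proof (cases i)
   case (Suc k)
   thus ?thesis using z'(2)[of k] that z(2) by (simp add: funpow_swap1)
  qed (use z in simp)
  thus "EX z. (R^^Suc N) z = y & (ALL i<=Suc N. dist ((R^^i) z) ((R^^i) w) < th)"
   using z z' by (intro exI[of _ z]) (simp add: funpow_swap1)
 qed (use et in auto)
qed

lemma uniform_cont_steps:
 assumes "th > 0"
 obtains r where "r > 0" "!!x y i. dist x y <= r ==> i <= N ==> dist ((R^^i) x) ((R^^i) y) < th"
proof -
 have "EX r>0. ALL x y. dist x y <= r --> dist ((R^^i) x) ((R^^i) y) < th" for i
 proof -
  have "uniformly_continuous_on UNIV (R^^i)"
   by (intro compact_uniformly_continuous cont_Rn compact_rsphere)
  then obtain r where "r > 0" "!!x y. dist x y < r ==> dist ((R^^i) x) ((R^^i) y) < th"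
   using assms unfolding uniformly_continuous_on_def by (metis UNIV_I)
  thus ?thesis by (intro exI[of _ "r/2"]) auto
 qed
 then obtain r where r: "!!i. r i > 0" "!!i x y. dist x y <= r i ==> dist ((R^^i) x) ((R^^i) y) < th" by metis
 show ?thesis
 proof (rule that[of "Min (r ` {..N})"])
  show "Min (r ` {..N}) > 0" using r(1) by (subst Min_gr_iff) auto
  fix x y :: rsphere and i assume "dist x y <= Min (r ` {..N})" "i <= N"
  hence "dist x y <= r i" by (meson Min_le atMost_iff finite_atMost finite_imageI imageI order_trans)
  thus "dist ((R^^i) x) ((R^^i) y) < th" by (rule r(2))
 qed
qed

text \<open>Lifting along orbits close to the Julia set. Expansivity restores the initial closeness after
 every \<open>N\<close> backward steps, so the number of steps is unlimited.\<close>

lemma lift_orbit: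
 assumes th: "th > 0"
 obtains et r where "et > 0" "r > 0" "!!n w y. (!!i. i <= n ==> EX x:J. dist ((R^^i) w) x <= r) ==> y : J ==>
  dist y ((R^^n) w) < et ==> EX z:J. pullback n y w th z"
proof -
 define th' where "th' = min th (v/2)"
 have th': "th' > 0" "th' <= th" "th' <= v/2" using th v_props(1) by (auto simp: th'_def)
 obtain ka where ka: "ka > 0" "!!w y. dist y (R w) < ka ==> EX z. dist z w < th' & R z = y"
  using uniform_open[OF th'(1)] by metis
 obtain N where N: "!!x y. x : J ==> y : J ==> (!!i. i <= N ==> dist ((R^^i) x) ((R^^i) y) <= v) ==> dist x y < ka/2"
  using uniform_expansion[of "ka/2"] ka(1) by auto
 obtain r0 where r0: "r0 > 0" "!!x y i. dist x y <= r0 ==> i <= N ==> dist ((R^^i) x) ((R^^i) y) < v/2"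
  using uniform_cont_steps[of "v/2" N] v_props(1) by auto
 define r where "r = min r0 (ka/2)"
 have r: "r > 0" "r <= r0" "r <= ka/2" using r0 ka by (auto simp: r_def)
 have "EX et>0. ALL w y. dist y ((R^^n) w) < et --> (EX z. pullback n y w (min th' ka) z)" for n
  using lift_steps[of "min th' ka" n] th'(1) ka(1) by auto
 then obtain et where et: "!!n. et n > 0" "!!n w y. dist y ((R^^n) w) < et n ==>
   EX z. pullback n y w (min th' ka) z" by metis
 define et0 where "et0 = Min (et ` {..N})"
 have et0: "et0 > 0" using et(1) unfolding et0_def by (subst Min_gr_iff) auto
 have et0_le: "et0 <= et n" if "n <= N" for n unfolding et0_def using that by (intro Min_le) auto
 have main: "EX z:J. pullback n y w th' z & dist z w < ka"
  if "!!i. i <= n ==> EX x:J. dist ((R^^i) w) x <= r" "y : J" "dist y ((R^^n) w) < et0" for n w y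
  using that
 proof (induction n arbitrary: w)
  case 0
  show ?case
  proof (intro bexI[of _ y] conjI allI impI)
   obtain z where "(R^^0) z = y" "ALL i<=0. dist ((R^^i) z) ((R^^i) w) < min th' ka"
    using et(2)[of y 0 w] et0_le[of 0] 0(3) by force
   thus "dist y w < ka" "!!i. i <= 0 ==> dist ((R^^i) y) ((R^^i) w) < th'" by auto
  qed (use 0 in auto)
 next
  case (Suc n)
  show ?case
  proof (cases "Suc n <= N")
   case True
   then obtain z where z: "(R^^Suc n) z = y" "!!i. i <= Suc n ==> dist ((R^^i) z) ((R^^i) w) < min th' ka"
    using et(2)[of y "Suc n" w] et0_le[of "Suc n"] Suc.prems(3) by (metis order_less_le_trans)
   have "z : J" using z(1) Suc.prems(2) J_Rn by metis
   thus ?thesis using z(1) z(2)[of 0] z(2) by (intro bexI[of _ z]) auto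
  next
   case False
   have p: "EX x:J. dist ((R^^i) (R w)) x <= r" if "i <= n" for i
    using Suc.prems(1)[of "Suc i"] that by (simp add: funpow_swap1)
   have d: "dist y ((R^^n) (R w)) < et0" using Suc.prems(3) by (simp add: funpow_swap1)
   obtain z' where z': "z' : J" "(R^^n) z' = y" "!!i. i <= n ==> dist ((R^^i) z') ((R^^i) (R w)) < th'" "dist z' (R w) < ka"
    using Suc.IH[OF p Suc.prems(2) d] by blast
   obtain z where z: "dist z w < th'" "R z = z'" using ka(2)[OF z'(4)] by blast
   have zJ: "z : J" using z(2) z'(1) J_R by metis
   have cl: "dist ((R^^i) z) ((R^^i) w) < th'" if "i <= Suc n" for i
   proof (cases i)
    case (Suc k)
    thus ?thesis using z'(3)[of k] that z(2) by (simp add: funpow_swap1)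
   qed (use z in simp)
   obtain x where x: "x : J" "dist w x <= r" using Suc.prems(1)[of 0] by auto
   \<comment> \<open>This restores the closeness \<open>ka\<close> that the next backward step
     needs: for \<open>N\<close> steps \<open>z\<close> follows \<open>w\<close> and
     \<open>w\<close> follows \<open>x\<close>, each within \<open>v/2\<close>, so uniform expansion
     applies to the two points of \<open>J\<close>.\<close>
   have "dist z x < ka/2"
   proof (rule N[OF zJ x(1)])
    fix i assume i: "i <= N"
    have "dist ((R^^i) z) ((R^^i) w) < v/2" using cl[of i] False i th'(3) by simp
    moreover have "dist ((R^^i) w) ((R^^i) x) < v/2" using r0(2)[OF _ i] x(2) r by simp
    ultimately show "dist ((R^^i) z) ((R^^i) x) <= v"
     using dist_triangle[of "(R^^i) z" "(R^^i) x" "(R^^i) w"] by simp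
   qed
   hence "dist z w < ka" using x(2) r(3) dist_triangle[of z w x] by (simp add: dist_commute)
   thus ?thesis using zJ cl z z'(2) by (intro bexI[of _ z]) (auto simp: funpow_swap1)
  qed
 qed
 show ?thesis
 proof (rule that[OF et0 r(1)])
  fix n w y assume a: "!!i. i <= n ==> EX x:J. dist ((R^^i) w) x <= r" "y : J" "dist y ((R^^n) w) < et0"
  obtain z where z: "z : J" "(R^^n) z = y" "ALL i<=n. dist ((R^^i) z) ((R^^i) w) < th'" using main[OF a] by blast
  show "EX z:J. pullback n y w th z"
   using z th'(2) by (intro bexI[of _ z]) (auto intro: order_less_le_trans)
 qed
qed

lemma lift_julia:
 assumes th: "th > 0"
 obtains et where "et > 0" "!!n w y. w : J ==> y : J ==>
  dist y ((R^^n) w) < et ==> EX z:J. pullback n y w th z"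
proof (rule lift_orbit[OF th])
 fix et r assume et: "et > (0::real)" "r > (0::real)" and *: "!!n w y. (!!i. i <= n ==> EX x:J. dist ((R^^i) w) x <= r) ==> y : J ==>
  dist y ((R^^n) w) < et ==> EX z:J. pullback n y w th z"
 show thesis
 proof (rule that[OF et(1)])
  fix n w y assume a: "w : J" "y : J" "dist y ((R^^n) w) < et"
  have "EX x:J. dist ((R^^i) w) x <= r" for i
   using a(1) et(2) J_Rn by (intro bexI[of _ "(R^^i) w"]) auto
  thus "EX z:J. pullback n y w th z"
   using *[of n w y] a by blast
 qed
qed

text \<open>For each \<open>n\<close>, a point of \<open>J\<close> close to the \<open>n\<close>-th
  iterate is lifted back along the orbit. A limit of the starting points follows the orbit
  forever.\<close>

lemma shadowing:
 assumes th: "th > 0"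
 obtains r where "r > 0" "!!w. (!!i. EX x:J. dist ((R^^i) w) x <= r) ==> EX z:J. ALL i. dist ((R^^i) z) ((R^^i) w) <= th"
proof (rule lift_orbit[OF th])
 fix et r assume et: "et > (0::real)" "r > (0::real)" and *: "!!n w y. (!!i. i <= n ==> EX x:J. dist ((R^^i) w) x <= r) ==> y : J ==>
  dist y ((R^^n) w) < et ==> EX z:J. pullback n y w th z"
 show thesis
 proof (rule that[of "min r (et/2)"])
  fix w assume near: "!!i. EX x:J. dist ((R^^i) w) x <= min r (et/2)"
  have "EX z:J. ALL i<=n. dist ((R^^i) z) ((R^^i) w) < th" for n
  proof -
   obtain y where y: "y : J" "dist ((R^^n) w) y <= min r (et/2)" using near by blast
   have "EX x:J. dist ((R^^i) w) x <= r" for i using near[of i] by auto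
   moreover have "dist y ((R^^n) w) < et" using y(2) et(1) by (simp add: dist_commute)
   ultimately show ?thesis using *[of n w y] y(1) by blast
  qed
  then obtain z where z: "!!n. z n : J" "!!n i. i <= n ==> dist ((R^^i) (z n)) ((R^^i) w) < th" by metis
  obtain l s where s: "strict_mono (s :: nat => nat)" "(z o s) ----> l" by (rule rsphere_convergent_subseq)
  have "l : J" using lim_julia[OF s(2)] z(1) by simp
  moreover have "dist ((R^^i) l) ((R^^i) w) <= th" for i
  proof (rule LIMSEQ_le_const2)
   show "(%k. dist ((R^^i) (z (s k))) ((R^^i) w)) ----> dist ((R^^i) l) ((R^^i) w)"
    using tendsto_Rn[OF s(2), of i] by (intro tendsto_dist tendsto_const) (simp add: o_def)
   show "EX N. ALL n>=N. dist ((R^^i) (z (s n))) ((R^^i) w) <= th"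
    using z(2) s(1) by (intro exI[of _ i]) (meson less_imp_le order_trans seq_suble)
  qed
  ultimately show "EX z:J. ALL i. dist ((R^^i) z) ((R^^i) w) <= th" by blast
 qed (use et in auto)
qed

end

section \<open>Components of the Fatou set near the Julia set, and limit points of Fatou
  orbits\<close>

lemma connected_minus_point: "connected (- {x :: rsphere})"
proof (cases x)
 case (Fin c)
 have "connected (range (kinv c))" by (intro connected_continuous_image continuous_on_kinv connected_UNIV)
 thus ?thesis by (simp add: Fin range_kinv)
next
 case Infty
 have "connected (range Fin)" by (intro connected_continuous_image continuous_on_Fin connected_UNIV)
 moreover have "range Fin = - {Infty}"
 proof -
  have "y : range Fin" if "y ~= Infty" for y using that by (cases y) auto
  thus ?thesis by auto
 qed
 ultimately show ?thesis by (simp add: Infty)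
qed

lemma open_component:
 fixes S :: "rsphere set"
 assumes "open S" shows "open (connected_component_set S x)"
proof (subst open_subopen, intro ballI)
 fix y assume y: "y : connected_component_set S x"
 hence "y : S" using connected_component_in by blast
 then obtain N where N: "open N" "connected N" "y : N" "N <= S" using connected_nbhd[OF assms] by metis
 have "N <= connected_component_set S y" by (rule connected_component_maximal) (use N in auto)
 also have "... = connected_component_set S x" using y connected_component_eq by blast
 finally show "EX T. open T & y : T & T <= connected_component_set S x" using N by blast
qed

context expansive_rational
begin

text \<open>By periodicity, two such points that stay close for \<open>l\<close> steps stay close
  forever, and so coincide by expansivity. Hence they cannot accumulate.\<close>

lemma finite_fixed:
 assumes l: "l >= 1"
 shows "finite {y : J. (R^^l) y = y}" (is "finite ?F")
proof (rule ccontr)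
 assume inf: "infinite ?F"
 obtain r where r: "r > 0" "!!x y i. dist x y <= r ==> i <= l ==> dist ((R^^i) x) ((R^^i) y) < v"
  using uniform_cont_steps[of v l] v_props(1) by auto
 obtain y0 where y0: "y0 islimpt ?F" using compact_rsphere inf unfolding compact_eq_Bolzano_Weierstrass by blast
 have "infinite (?F Int ball y0 (r/2))" using y0 r(1) unfolding islimpt_eq_infinite_ball by simp
 then obtain x where x: "x : ?F Int ball y0 (r/2)" using infinite_imp_nonempty by blast
 have "infinite (?F Int ball y0 (r/2) - {x})" using `infinite (?F Int ball y0 (r/2))` by simp
 then obtain y where "y : ?F Int ball y0 (r/2) - {x}" using infinite_imp_nonempty by blast
 hence xy: "x : ?F Int ball y0 (r/2)" "y : ?F Int ball y0 (r/2)" "x ~= y" using x by auto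
 have d: "dist x y <= r" using xy dist_triangle[of x y y0] by (auto simp: dist_commute)
 have per: "(R^^i) w = (R^^(i mod l)) w" if "(R^^l) w = w" for w i
  using funpow_mod_eq[OF that, of i] by simp
 have "x = y"
 proof (rule expand)
  fix n
  have "dist ((R^^(n mod l)) x) ((R^^(n mod l)) y) < v"
   using l by (intro r(2) d) (simp add: less_imp_le)
  thus "dist ((R^^n) x) ((R^^n) y) <= v" using per[of x n] per[of y n] xy by simp
 qed (use xy in auto)
 thus False using xy by simp
qed

text \<open>A subsequence of iterates tending to a point of the Julia set somewhere on a connected part of
 the Fatou set does so everywhere on it, by Hurwitz' theorem.\<close>

lemma iterates_to_julia_local:
 assumes w: "w : fatou R" and lim: "(%j. (R^^k j) w) ----> a" and a: "a : J"
 obtains N where "open N" "w : N" "!!y. y : N ==> (%j. (R^^k j) y) ----> a"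
proof -
 obtain c where c: "w ~= Fin c" using ex_chart by blast
 obtain c' where c': "a ~= Fin c'" using ex_chart by blast
 define e where "e = dist a (Fin c')/2"
 have e: "e > 0" using c' by (simp add: e_def)
 obtain dl where dl: "dl > 0" "!!y n. dist y w < dl ==> dist ((R^^n) y) ((R^^n) w) < e/2"
  using equiD[OF equi_fatou w, of "e/2"] e by auto
 have "open (kinv c -` (ball w dl Int fatou R))" "kap c w : kinv c -` (ball w dl Int fatou R)"
  using w c dl(1) open_fatou by (auto intro!: open_kinv_vimage)
 then obtain ro where ro: "ro > 0" "ball (kap c w) ro <= kinv c -` (ball w dl Int fatou R)" using openE by blast
 define B where "B = ball (kap c w) ro"
 have "EVS j. dist ((R^^k j) w) a < e/2" using tendstoD[OF lim, of "e/2"] e by simp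
 then obtain j0 where j0: "!!j. j >= j0 ==> dist ((R^^k j) w) a < e/2" by (auto simp: eventually_sequentially)
 have cl: "dist ((R^^k j) (kinv c u)) a < e" if "j >= j0" "u : B" for j u
 proof -
  have "dist (kinv c u) w < dl" using ro(2) that(2) by (auto simp: B_def dist_commute)
  thus ?thesis using dl(2)[of "kinv c u" "k j"] j0[OF that(1)] dist_triangle[of "(R^^k j) (kinv c u)" a "(R^^k j) w"] by linarith
 qed
 have nc: "(R^^k j) (kinv c u) ~= Fin c'" if "j >= j0" "u : B" for j u
  using cl[OF that] e unfolding e_def by (auto simp: dist_commute)
 have "compact (kap c' ` cball a e)"
 proof (rule compact_continuous_image)
  have "Fin c' ~: cball a e" using e by (auto simp: e_def)
  thus "continuous_on (cball a e) (kap c')"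
   using continuous_on_subset[OF continuous_on_kap] by blast
 qed (simp add: closed_imp_compact_rsphere)
 hence "bounded (kap c' ` cball a e)" by (rule compact_imp_bounded)
 then obtain M where M: "!!y. y : cball a e ==> cmod (kap c' y) <= M"
  unfolding bounded_iff by (metis imageI)
 have "(%j. (R^^k j) y) ----> a" if y: "y : kinv c ` B" for y
 proof (rule ccontr)
  assume "~ (%j. (R^^k j) y) ----> a"
  then obtain ee where ee: "ee > 0" "\<exists>\<^sub>F j in sequentially. ~ dist ((R^^k j) y) a < ee"
   unfolding tendsto_iff by (auto simp: not_eventually)
  have "EX s. strict_mono (s::nat=>nat) & (ALL n. ~ dist ((R^^k (s n)) y) a < ee)"
  proof -
   have "infinite {j. ~ dist ((R^^k j) y) a < ee}"
    using ee(2) by (simp add: cofinite_eq_sequentially[symmetric] frequently_cofinite)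
   thus ?thesis using infinite_enumerate by blast
  qed
  then obtain s where s: "strict_mono (s::nat=>nat)" "!!n. ~ dist ((R^^k (s n)) y) a < ee" by blast
  \<comment> \<open>\<open>F n\<close> has no zero, since the orbits remain in the Fatou set and
    \<open>a\<close> is in \<open>J\<close>, but it tends to zero at the centre. By Hurwitz any
    limit function vanishes identically, which contradicts the choice of \<open>s\<close>.\<close>
  define F where "F n u = kap c' ((R^^k (s (n + j0))) (kinv c u)) - kap c' a" for n u
  have sj: "s (n + j0) >= j0" for n using seq_suble[OF s(1), of "n + j0"] by linarith
  have hF: "F n holomorphic_on B" for n
   unfolding F_def using nc[OF sj] by (intro holomorphic_intros sphol_kap_holomorphic rmap_sphol rmap_Rn) auto
  have Fb: "cmod (F n u) <= M + cmod (kap c' a)" if "u : B" for n u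
  proof -
   have "(R^^k (s (n + j0))) (kinv c u) : cball a e"
    using cl[OF sj that, of n] by (simp add: dist_commute)
   hence "cmod (kap c' ((R^^k (s (n + j0))) (kinv c u))) <= M" by (rule M)
   thus ?thesis unfolding F_def
    using norm_triangle_ineq4[of "kap c' ((R^^k (s (n + j0))) (kinv c u))" "kap c' a"] by linarith
  qed
  have F0: "F n u ~= 0" if "u : B" for n u
  proof
   assume "F n u = 0"
   hence "kap c' ((R^^k (s (n + j0))) (kinv c u)) = kap c' a" by (simp add: F_def)
   hence "(R^^k (s (n + j0))) (kinv c u) = a"
    using kinv_kap[OF nc[OF sj that, of n]] kinv_kap[OF c'] by metis
   hence "kinv c u : J" using a J_Rn by metis
   thus False using ro(2) that by (auto simp: B_def julia_def)
  qed
  obtain g t where g: "g holomorphic_on B" "strict_mono (t::nat=>nat)" "!!u. u : B ==> (%n. F (t n) u) ----> g u"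
   "!!K. compact K ==> K <= B ==> uniform_limit K (F o t) g sequentially"
  proof (rule Montel[of B "range F" F])
   show "open B" by (simp add: B_def)
   show "EX B'. ALL h:range F. ALL z:K. cmod (h z) <= B'" if "compact K" "K <= B" for K
    using Fb that(2) by (intro exI[of _ "M + cmod (kap c' a)"]) auto
  qed (use hF in auto)
  have u0: "kap c w : B" using ro(1) by (simp add: B_def)
  have idx: "filterlim (%n. s (t n + j0)) sequentially sequentially"
   using s(1) g(2) by (intro filterlim_subseq) (auto simp: strict_mono_def)
  have gval: "kap c' ((R^^k (s (t n + j0))) (kinv c u)) = F (t n) u + kap c' a" for n u by (simp add: F_def)
  have "(%n. (R^^k (s (t n + j0))) (kinv c (kap c w))) ----> a"
   using filterlim_compose[OF lim idx] c by simp
  hence "(%n. kap c' ((R^^k (s (t n + j0))) (kinv c (kap c w)))) ----> kap c' a"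
   using isCont_tendsto_compose[OF isCont_kap[OF c']] by blast
  hence "(%n. F (t n) (kap c w)) ----> kap c' a - kap c' a"
   unfolding F_def by (intro tendsto_diff tendsto_const) simp
  hence g0: "g (kap c w) = 0" using LIMSEQ_unique[OF g(3)[OF u0]] by simp
  have "g constant_on B"
  proof (rule ccontr)
   assume nc: "~ g constant_on B"
   have "g (kap c w) ~= 0"
    by (rule Hurwitz_no_zeros[of B "F o t" g]) (use nc g hF F0 u0 in "auto simp: B_def")
   thus False using g0 by simp
  qed
  hence gz: "g u = 0" if "u : B" for u using g0 u0 that unfolding constant_on_def by metis
  obtain u where u: "u : B" "y = kinv c u" using y by blast
  have "(%n. F (t n) u + kap c' a) ----> 0 + kap c' a"
   using g(3)[OF u(1)] gz[OF u(1)] by (intro tendsto_add tendsto_const) simp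
  hence "(%n. kinv c' (kap c' ((R^^k (s (t n + j0))) y))) ----> kinv c' (kap c' a)"
   unfolding u(2) gval by (intro isCont_tendsto_compose[OF isCont_kinv]) simp
  moreover have "kinv c' (kap c' ((R^^k (s (t n + j0))) y)) = (R^^k (s (t n + j0))) y" for n
   using nc[OF sj u(1), of "t n"] u(2) by simp
  ultimately have "(%n. (R^^k (s (t n + j0))) y) ----> a" using c' by simp
  hence "EVS n. dist ((R^^k (s (t n + j0))) y) a < ee" using ee(1) tendstoD by blast
  thus False using s(2) by simp
 qed
 moreover have "open (kinv c ` B)" by (simp add: B_def open_kinv_image)
 moreover have "w : kinv c ` B" using ro(1) c by (intro image_eqI[of _ _ "kap c w"]) (auto simp: B_def)
 ultimately show ?thesis using that by blast
qed

lemma iterates_to_julia: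
 assumes U: "open U" "connected U" "U <= fatou R" and w: "w : U" and lim: "(%j. (R^^k j) w) ----> a" and a: "a : J"
  and y: "y : U"
 shows "(%j. (R^^k j) y) ----> a"
proof -
 define A where "A = {x : U. (%j. (R^^k j) x) ----> a}"
 have oA: "open A"
 proof (subst open_subopen, intro ballI)
  fix x assume x: "x : A"
  then obtain N where N: "open N" "x : N" "!!y. y : N ==> (%j. (R^^k j) y) ----> a"
   using iterates_to_julia_local[of x k a] U(3) a unfolding A_def by blast
  thus "EX T. open T & x : T & T <= A"
   using x U(1) by (intro exI[of _ "N Int U"]) (auto simp: A_def)
 qed
 have oB: "open (U - A)"
 proof (subst open_subopen, intro ballI)
  fix x assume x: "x : U - A"
  then obtain ee where ee: "ee > 0" "~ (EVS j. dist ((R^^k j) x) a < ee)"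
   unfolding A_def tendsto_iff by blast
  have xf: "x : fatou R" using x U by auto
  obtain dl where dl: "dl > 0" "!!y n. dist y x < dl ==> dist ((R^^n) y) ((R^^n) x) < ee/2"
   using equiD[OF equi_fatou xf, of "ee/2"] ee(1) by auto
  have "y ~: A" if y: "dist y x < dl" for y
  proof
   assume "y : A"
   hence "(%j. (R^^k j) y) ----> a" by (simp add: A_def)
   hence "EVS j. dist ((R^^k j) y) a < ee/2" by (rule tendstoD) (use ee(1) in simp)
   hence "EVS j. dist ((R^^k j) x) a < ee"
   proof eventually_elim
    case (elim j)
    thus ?case using dl(2)[OF y, of "k j"] dist_triangle[of "(R^^k j) x" a "(R^^k j) y"] by (simp add: dist_commute)
   qed
   thus False using ee(2) by blast
  qed
  thus "EX T. open T & x : T & T <= U - A"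
   using x U(1) dl(1) by (intro exI[of _ "U Int ball x dl"]) (auto simp: dist_commute)
 qed
 have "A Int (U - A) = {}" "U <= A Un (U - A)" by auto
 hence "A Int U = {} | (U - A) Int U = {}" using connectedD[OF U(2) oA oB] by auto
 moreover have "w : A" using w lim by (simp add: A_def)
 ultimately have "y : A" using y w by blast
 thus ?thesis by (simp add: A_def)
qed

lemma uniform_injectivity: "EX iz>0. ALL x:J. inj_on R (cball x iz)"
proof (rule ccontr)
 assume a: "~ (EX iz>0. ALL x:J. inj_on R (cball x iz))"
 have "EX x y z. x : J & dist x y <= 1/real (Suc n) & dist x z <= 1/real (Suc n) & y ~= z & R y = R z" for n
 proof -
  have "1/real (Suc n) > 0" by simp
  then obtain x where "x : J" "~ inj_on R (cball x (1/real (Suc n)))" using a by blast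
  then obtain y z where "y : cball x (1/real (Suc n))" "z : cball x (1/real (Suc n))" "y ~= z" "R y = R z"
   unfolding inj_on_def by blast
  thus ?thesis using `x : J` unfolding mem_cball by blast
 qed
 then obtain x y z where xyz: "!!n. x n : J" "!!n. dist (x n) (y n) <= 1/real (Suc n)"
  "!!n. dist (x n) (z n) <= 1/real (Suc n)" "!!n. y n ~= z n" "!!n. R (y n) = R (z n)" by metis
 obtain l r where r: "strict_mono (r :: nat => nat)" "(x o r) ----> l" by (rule rsphere_convergent_subseq)
 have "l : J" using lim_julia[OF r(2)] xyz(1) by simp
 then obtain U where U: "open U" "l : U" "inj_on R U" using locally_injective crit_not_julia by metis
 obtain e where e: "e > 0" "ball l e <= U" using U openE by blast
 note inv = inverse_Suc_subseq[OF r(1)]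
 have "EVS k. dist (x (r k)) l < e/2" using tendstoD[OF r(2), of "e/2"] e by simp
 moreover have "EVS k. 1/real (Suc (r k)) < e/2" using order_tendstoD(2)[OF inv, of "e/2"] e by simp
 ultimately have "EVS k. False"
 proof eventually_elim
  case (elim k)
  have "dist l (y (r k)) < e"
   using xyz(2)[of "r k"] elim dist_triangle[of l "y (r k)" "x (r k)"] dist_commute[of l "x (r k)"] by linarith
  moreover have "dist l (z (r k)) < e"
   using xyz(3)[of "r k"] elim dist_triangle[of l "z (r k)" "x (r k)"] dist_commute[of l "x (r k)"] by linarith
  ultimately have "y (r k) : U" "z (r k) : U" using e(2) by auto
  thus False using inj_onD[OF U(3) xyz(5)] xyz(4) by blast
 qed
 thus False by simp
qed

definition iz where "iz = (SOME iz. iz > 0 & (ALL x:J. inj_on R (cball x iz)))"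

lemma iota: "iz > 0" "x : J ==> inj_on R (cball x iz)"
 using someI_ex[OF uniform_injectivity] unfolding iz_def by blast+

text \<open>The shadowing tolerance. The bound \<open>v/4\<close> leaves room for another error of
  \<open>v/4\<close> before uniqueness of the shadow is lost; the bound \<open>iz\<close> makes
  \<open>R\<close> injective on the balls around the shadow that contain the shadowed
  orbits.\<close>

definition ths where "ths = min (v/4) iz"

lemma thetas: "ths > 0" "ths <= v/4" "ths <= iz" using iota(1) v_props(1) by (auto simp: ths_def)

definition stays_near :: "real => rsphere => bool" where
 "stays_near r w \<longleftrightarrow> (ALL i. EX x:J. dist ((R^^i) w) x <= r)"

definition r0 where
 "r0 = (SOME r. r > 0 & (ALL w. stays_near r w --> (EX z:J. ALL i. dist ((R^^i) z) ((R^^i) w) <= ths)))"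

lemma r0: "r0 > 0" "stays_near r0 w ==> EX z:J. ALL i. dist ((R^^i) z) ((R^^i) w) <= ths"
proof -
 have "EX r. r > 0 & (ALL w. stays_near r w --> (EX z:J. ALL i. dist ((R^^i) z) ((R^^i) w) <= ths))"
  by (rule shadowing[OF thetas(1)]) (unfold stays_near_def, blast)
 from someI_ex[OF this] show "r0 > 0" "stays_near r0 w ==> EX z:J. ALL i. dist ((R^^i) z) ((R^^i) w) <= ths"
  unfolding r0_def by blast+
qed

definition sh :: "rsphere => rsphere" where
 "sh w = (SOME z. z : J & (ALL i. dist ((R^^i) z) ((R^^i) w) <= ths))"

lemma sh: "stays_near r0 w ==> sh w : J" "stays_near r0 w ==> dist ((R^^i) (sh w)) ((R^^i) w) <= ths"
proof -
 assume "stays_near r0 w"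
 hence "EX z. z : J & (ALL i. dist ((R^^i) z) ((R^^i) w) <= ths)" using r0 by blast
 from someI_ex[OF this] show "sh w : J" "dist ((R^^i) (sh w)) ((R^^i) w) <= ths" unfolding sh_def by blast+
qed

lemma shadow_unique:
 assumes "x : J" "y : J" "!!i. dist ((R^^i) x) ((R^^i) w) <= v/2" "!!i. dist ((R^^i) y) ((R^^i) w) <= v/2"
 shows "x = y"
proof (rule expand)
 fix n show "dist ((R^^n) x) ((R^^n) y) <= v"
  using assms(3)[of n] assms(4)[of n] dist_triangle[of "(R^^n) x" "(R^^n) y" "(R^^n) w"] by (simp add: dist_commute)
qed (use assms in auto)

lemma stays_near_mono: "stays_near r w ==> r <= r' ==> stays_near r' w"
 unfolding stays_near_def by (meson order_trans)

lemma stays_near_Rn: "stays_near r w ==> stays_near r ((R^^n) w)"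
 unfolding stays_near_def by (metis comp_apply funpow_add)

lemma sh_Rn:
 assumes "stays_near r0 w"
 shows "sh ((R^^n) w) = (R^^n) (sh w)"
proof (rule shadow_unique[of _ _ "(R^^n) w"])
 have s: "stays_near r0 ((R^^n) w)" by (rule stays_near_Rn[OF assms])
 show "sh ((R^^n) w) : J" "(R^^n) (sh w) : J" using sh(1)[OF s] sh(1)[OF assms] J_Rn by auto
 fix i
 have "ths <= v/2" using thetas v_props(1) by linarith
 thus "dist ((R^^i) (sh ((R^^n) w))) ((R^^i) ((R^^n) w)) <= v/2"
  "dist ((R^^i) ((R^^n) (sh w))) ((R^^i) ((R^^n) w)) <= v/2"
  using sh(2)[OF s, of i] sh(2)[OF assms, of "i + n"] by (auto simp: funpow_add)
qed

text \<open>A bound \<open>r' < r\<close> that is uniform in time, instead of just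
  \<open>stays_near r\<close>, makes this set open: by equicontinuity the orbits of nearby points
  differ by less than the margin.\<close>

definition Or :: "real => rsphere set" where
 "Or r = {w : fatou R. EX r'<r. stays_near r' w}"

lemma Or_near: "w : Or r ==> stays_near r w"
 unfolding Or_def using stays_near_mono less_imp_le by blast

lemma Or_mono: "r <= r' ==> Or r <= Or r'"
 unfolding Or_def by (blast intro: less_le_trans)

lemma Or_Rn: "w : Or r ==> (R^^n) w : Or r"
 unfolding Or_def using stays_near_Rn fatou_Rn by blast

lemma equi_near:
 assumes "w : fatou R" "e > 0"
 obtains N where "open N" "connected N" "w : N" "N <= fatou R"
  "!!y n. y : N ==> dist ((R^^n) y) ((R^^n) w) < e"
proof -
 obtain dl where dl: "dl > 0" "!!y n. dist y w < dl ==> dist ((R^^n) y) ((R^^n) w) < e"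
  using equiD[OF equi_fatou assms] by metis
 have "open (ball w dl Int fatou R)" "w : ball w dl Int fatou R" using open_fatou dl(1) assms by auto
 then obtain N where "open N" "connected N" "w : N" "N <= ball w dl Int fatou R" using connected_nbhd by metis
 thus ?thesis using that[of N] dl(2) by (auto simp: dist_commute subset_iff)
qed

lemma near_transfer:
 assumes "stays_near r w" "!!i. dist ((R^^i) y) ((R^^i) w) <= e"
 shows "stays_near (r + e) y"
 unfolding stays_near_def
proof
 fix i
 obtain x where "x : J" "dist ((R^^i) w) x <= r" using assms(1) unfolding stays_near_def by blast
 thus "EX x:J. dist ((R^^i) y) x <= r + e"
  using assms(2)[of i] dist_triangle[of "(R^^i) y" x "(R^^i) w"] by (intro bexI[of _ x]) linarith+
qed

lemma open_Or: "open (Or r)"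
proof (subst open_subopen, intro ballI)
 fix w assume "w : Or r"
 then obtain r' where w: "w : fatou R" "r' < r" "stays_near r' w" unfolding Or_def by blast
 have pos: "(r - r')/2 > 0" using w(2) by simp
 obtain N where N: "open N" "connected N" "w : N" "N <= fatou R"
  "!!y n. y : N ==> dist ((R^^n) y) ((R^^n) w) < (r - r')/2"
  using equi_near[OF w(1) pos] by metis
 have "y : Or r" if y: "y : N" for y
 proof -
  have "stays_near (r' + (r - r')/2) y"
   by (rule near_transfer[OF w(3)]) (use N(5)[OF y] in "simp add: less_imp_le")
  moreover have "r' + (r - r')/2 < r" using w(2) by (simp add: field_simps)
  ultimately show ?thesis using y N(4) unfolding Or_def by blast
 qed
 thus "EX T. open T & w : T & T <= Or r" using N by blast
qed

text \<open>By equicontinuity a neighbouring orbit stays within \<open>v/4\<close> forever, so both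
  shadows follow the orbit of \<open>a\<close> within \<open>v/2\<close> and coincide. The shadow is
  locally constant.\<close>

lemma sh_constant:
 assumes V: "connected V" "V <= Or r0" and wy: "w : V" "y : V"
 shows "sh w = sh y"
proof (rule connected_local_const[OF V(1) wy], rule ballI)
 fix a assume a: "a : V"
 hence aO: "a : Or r0" "a : fatou R" using V by (auto simp: Or_def)
 have v4: "v/4 > 0" using v_props(1) by simp
 obtain N where N: "open N" "connected N" "a : N" "N <= fatou R"
  "!!y n. y : N ==> dist ((R^^n) y) ((R^^n) a) < v/4"
  using equi_near[OF aO(2) v4] by metis
 have "sh a = sh b" if b: "b : N" "b : V" for b
 proof (rule shadow_unique[of _ _ a])
  have sa: "stays_near r0 a" and sb: "stays_near r0 b" using Or_near aO b V by blast+
  show "sh a : J" "sh b : J" using sh(1) sa sb by auto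
  fix i
  show "dist ((R^^i) (sh a)) ((R^^i) a) <= v/2" using sh(2)[OF sa, of i] thetas v_props(1) by linarith
  show "dist ((R^^i) (sh b)) ((R^^i) a) <= v/2"
   using sh(2)[OF sb, of i] thetas N(5)[OF b(1), of i] dist_triangle[of "(R^^i) (sh b)" "(R^^i) a" "(R^^i) b"] by linarith
 qed
 moreover have "\<forall>\<^sub>F b in at a within V. b : N & b : V"
  using N(1,3) by (auto simp: eventually_at_topological)
 ultimately show "\<forall>\<^sub>F b in at a within V. sh a = sh b" by (auto elim!: eventually_mono)
qed

text \<open>The closure of \<open>V\<close> thus meets \<open>J\<close> in at most one point, the
  common shadow, so nearly all of the boundary of a component of \<open>Or r\<close> is left to the
  Fatou set.\<close>

lemma sh_boundary:
 assumes V: "connected V" "V <= Or r0" and w: "w : V" and b: "b : closure V" "b : J"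
 shows "b = sh w"
proof -
 obtain s where s: "!!n. s n : V" "s ----> b" using b(1) closure_sequential by metis
 have sw: "stays_near r0 w" using Or_near w V by blast
 show ?thesis
 proof (rule shadow_unique[of _ _ b])
  fix i
  show "dist ((R^^i) b) ((R^^i) b) <= v/2" using v_props(1) by simp
  have "dist ((R^^i) (sh w)) ((R^^i) b) <= ths"
  proof (rule LIMSEQ_le_const2)
   show "(%n. dist ((R^^i) (sh w)) ((R^^i) (s n))) ----> dist ((R^^i) (sh w)) ((R^^i) b)"
    by (intro tendsto_dist tendsto_const tendsto_Rn s)
   have "dist ((R^^i) (sh w)) ((R^^i) (s n)) <= ths" for n
    using sh(2)[of "s n" i] sh_constant[OF V w s(1)[of n]] Or_near s(1) V by fastforce
   thus "EX N. ALL n>=N. dist ((R^^i) (sh w)) ((R^^i) (s n)) <= ths" by blast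
  qed
  thus "dist ((R^^i) (sh w)) ((R^^i) b) <= v/2" using thetas v_props(1) by linarith
 qed (use b sh(1)[OF sw] in auto)
qed

lemma closed_near_julia: "closed {y. EX x:J. dist y x <= r}"
 unfolding closed_sequential_limits
proof (intro allI impI, elim conjE)
 fix s l assume s: "ALL n. s n : {y. EX x:J. dist y x <= r}" "s ----> l"
 hence "ALL n. EX x:J. dist (s n) x <= r" by simp
 then obtain x where x: "!!n. x n : J" "!!n. dist (s n) (x n) <= r" by metis
 obtain b t where t: "strict_mono (t :: nat => nat)" "(x o t) ----> b" by (rule rsphere_convergent_subseq)
 have "b : J" using lim_julia[OF t(2)] x(1) by simp
 moreover have "dist l b <= r"
  by (rule LIMSEQ_le_const2[OF tendsto_dist[OF LIMSEQ_subseq_LIMSEQ[OF s(2) t(1)] t(2)]])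
    (use x in auto)
 ultimately show "l : {y. EX x:J. dist y x <= r}" by blast
qed

lemma stays_near_limit:
 assumes "s ----> b" "!!n. stays_near r (s n)"
 shows "stays_near r b"
 unfolding stays_near_def
proof
 fix i
 have "(R^^i) b : {y. EX x:J. dist y x <= r}"
  by (rule closed_sequentially[OF closed_near_julia _ tendsto_Rn[OF assms(1)]])
    (use assms(2) in "simp add: stays_near_def")
 thus "EX x:J. dist ((R^^i) b) x <= r" by simp
qed

text \<open>If the boundary of the component \<open>V\<close> were contained in
  \<open>{sh z}\<close>, then \<open>V\<close> would be open and closed in the connected complement
  of \<open>sh z\<close>, hence equal to it, and \<open>J\<close> would be a single point.\<close>

lemma component_boundary:
 assumes r: "r <= r0" and z: "z : Or r"
 obtains b where "b : closure (connected_component_set (Or r) z)" "b : fatou R" "b ~: Or r" "stays_near r b"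
proof -
 define V where "V = connected_component_set (Or r) z"
 have V: "open V" "connected V" "V <= Or r" "z : V"
  unfolding V_def using open_component[OF open_Or] z by (auto simp: connected_component_subset)
 have VO: "V <= Or r0" using V(3) Or_mono[OF r] by blast
 have "~ closure V <= V Un {sh z}"
 proof
  assume c: "closure V <= V Un {sh z}"
  have "sh z : J" using sh(1) Or_near V VO by blast
  hence "sh z ~: V" using V(3) by (auto simp: Or_def julia_def)
  hence "closure V Int - {sh z} = V" using c closure_subset by blast
  hence "closedin (top_of_set (- {sh z})) V"
   by (metis closed_closure closedin_closed_Int inf_commute)
  moreover have "openin (top_of_set (- {sh z})) V"
   using V(1) `sh z ~: V` by (metis open_subset Compl_iff singletonD subsetI)
  ultimately have "V = {} | V = - {sh z}" using connected_minus_point[of "sh z"] unfolding connected_clopen by blast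
  hence "V = - {sh z}" using V(4) by blast
  hence "J <= {sh z}" using V(3) by (auto simp: Or_def julia_def)
  hence "countable J" by (rule countable_subset) simp
  thus False using uncountable_julia by blast
 qed
 then obtain b where b: "b : closure V" "b ~: V" "b ~= sh z" by blast
 have bf: "b : fatou R" using sh_boundary[OF V(2) VO V(4) b(1)] b(3) by (auto simp: julia_def)
 have "b ~: Or r"
 proof
  assume "b : Or r"
  then obtain N where N: "open N" "connected N" "b : N" "N <= Or r" using connected_nbhd[OF open_Or] by metis
  then obtain y where y: "y : N" "y : V" using b(1) closure_iff_nhds_not_empty by (metis Int_emptyI subset_refl)
  have "N <= connected_component_set (Or r) y" by (rule connected_component_maximal) (use N y in auto)
  also have "... = V" using y(2) connected_component_eq unfolding V_def by blast
  finally show False using N(3) b(2) by blast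
 qed
 moreover have "stays_near r b"
 proof -
  obtain s where "!!n. s n : V" "s ----> b" using b(1) closure_sequential by metis
  thus ?thesis using stays_near_limit[of s b r] Or_near V(3) by blast
 qed
 ultimately show ?thesis using that b(1) bf unfolding V_def by blast
qed

text \<open>An orbit of the Fatou set that converges to the Julia set is trapped in a periodic open set
 all of whose points follow one periodic point. Otherwise the components of \<open>Or r0\<close> along the
 orbit would be pairwise disjoint, although each of them, some steps later, contains a set of a
 definite size: its points on the boundary of \<open>Or (r0/2)\<close> must get as far as \<open>r0/4\<close> from
 the Julia set.\<close>

lemma captured:
 assumes z: "z : fatou R" and near: "stays_near (r0/4) z"
 obtains V m l x where "l >= (1::nat)" "open V" "connected V" "V <= fatou R" "x : J" "(R^^m) z : V"
  "(R^^l) ` V <= V" "!!w i. w : V ==> dist ((R^^i) x) ((R^^i) w) <= ths" "(R^^l) x = x"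
proof -
 have r04: "r0/4 > 0" using r0(1) by simp
 define zz where "zz n = (R^^n) z" for n
 have zzR: "(R^^i) (zz n) = zz (n + i)" for i n by (simp add: zz_def add.commute[of n] funpow_add)
 have zO: "zz n : Or (r0/2)" for n
  unfolding Or_def using z fatou_Rn[of n z] stays_near_Rn[OF near, of n] r0(1) by (auto simp: zz_def intro!: exI[of _ "r0/4"])
 define W where "W n = connected_component_set (Or r0) (zz n)" for n
 have zO': "zz n : Or r0" for n using zO Or_mono[of "r0/2" r0] r0(1) by auto
 have W: "open (W n)" "connected (W n)" "W n <= Or r0" "zz n : W n" for n
  unfolding W_def using open_component[OF open_Or] zO' by (auto simp: connected_component_subset)
 have W_Rn: "(R^^i) ` W n <= W (n + i)" for n i
 proof -
  have "(R^^i) ` W n <= connected_component_set (Or r0) (zz (n + i))"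
  proof (rule connected_component_maximal)
   show "zz (n + i) : (R^^i) ` W n" using W(4)[of n] zzR by (metis imageI)
   show "connected ((R^^i) ` W n)" by (intro connected_continuous_image cont_Rn W)
   show "(R^^i) ` W n <= Or r0" using W(3)[of n] Or_Rn by blast
  qed
  thus ?thesis by (simp add: W_def)
 qed
 have "EX b i. b : closure (W (n + i)) & stays_near (r0/2) b & (ALL x:J. dist b x > r0/4)" for n
 proof -
  have r02: "r0/2 <= r0" using r0(1) by simp
  obtain b where b: "b : closure (connected_component_set (Or (r0/2)) (zz n))" "b : fatou R" "b ~: Or (r0/2)" "stays_near (r0/2) b"
   using component_boundary[OF r02 zO[of n]] by metis
  have "connected_component_set (Or (r0/2)) (zz n) <= W n"
   unfolding W_def by (rule connected_component_mono[OF Or_mono[OF r02]])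
  hence bW: "b : closure (W n)" using b(1) closure_mono by blast
  have "~ stays_near (r0/4) b" using b(2,3) r0(1) unfolding Or_def by (auto dest: spec[of _ "r0/4"])
  then obtain i where i: "!!x. x : J ==> dist ((R^^i) b) x > r0/4" unfolding stays_near_def by (meson not_less)
  have "(R^^i) b : (R^^i) ` closure (W n)" using bW by blast
  also have "... <= closure ((R^^i) ` W n)" by (rule image_closure_subset[OF cont_Rn closed_closure closure_subset])
  also have "... <= closure (W (n + i))" by (rule closure_mono[OF W_Rn])
  finally show ?thesis using i stays_near_Rn[OF b(4), of i] by blast
 qed
 then obtain b ii where b: "!!n. b n : closure (W (n + ii n))" "!!n. stays_near (r0/2) (b n)" "!!n x. x : J ==> dist (b n) x > r0/4"
  by metis
 obtain t l where t: "strict_mono (t :: nat => nat)" "(b o t) ----> l" by (rule rsphere_convergent_subseq)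
 have lf: "l : fatou R"
 proof (rule ccontr)
  assume "l ~: fatou R"
  hence "l : J" by (simp add: julia_def)
  hence "r0/4 < dist ((b o t) n) l" for n using b(3) by simp
  hence "~ (EVS n. dist ((b o t) n) l < r0/4)"
   by (auto simp: eventually_sequentially not_less dest!: spec[of _ "_::nat"] intro: less_imp_le)
  thus False using tendstoD[OF t(2) r04] by blast
 qed
 have r08: "r0/8 > 0" using r0(1) by simp
 obtain N where N: "open N" "connected N" "l : N" "N <= fatou R" "!!y n. y : N ==> dist ((R^^n) y) ((R^^n) l) < r0/8"
  using equi_near[OF lf r08] by metis
 have "EVS n. (b o t) n : N" using topological_tendstoD[OF t(2) N(1,3)] .
 then obtain n0 where n0: "!!n. n >= n0 ==> b (t n) : N" by (auto simp: eventually_sequentially)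
 have NO: "N <= Or r0"
 proof
  fix y assume y: "y : N"
  have "stays_near (r0/2 + r0/4) y"
  proof (rule near_transfer[OF b(2)])
   fix i
   show "dist ((R^^i) y) ((R^^i) (b (t n0))) <= r0/4"
    using N(5)[OF y, of i] N(5)[OF n0[OF order_refl], of i]
     dist_triangle[of "(R^^i) y" "(R^^i) (b (t n0))" "(R^^i) l"] by (simp add: dist_commute)
  qed
  thus "y : Or r0" using y N(4) r0(1) unfolding Or_def by (auto intro!: exI[of _ "r0/2 + r0/4"])
 qed
 define C where "C = connected_component_set (Or r0) l"
 have WC: "W (t n + ii (t n)) = C" if n: "n >= n0" for n
 proof -
  have "b (t n) : closure (W (t n + ii (t n)))" by (rule b)
  then obtain y where y: "y : N" "y : W (t n + ii (t n))"
   using N(1) n0[OF n] closure_iff_nhds_not_empty by (metis Int_emptyI subset_refl)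
  have "N <= C" unfolding C_def by (rule connected_component_maximal[OF N(3,2) NO])
  hence "y : C" using y by blast
  hence "connected_component_set (Or r0) y = C" unfolding C_def by (rule connected_component_eq)
  moreover have "connected_component_set (Or r0) y = W (t n + ii (t n))"
   using y(2) unfolding W_def by (rule connected_component_eq)
  ultimately show ?thesis by simp
 qed
 define m1 where "m1 = t n0 + ii (t n0)"
 \<comment> \<open>With \<open>k >= n0\<close> the component at time \<open>m2\<close> is again
   \<open>C\<close>, and \<open>m2 >= k > m1\<close> makes the two times different. Their difference
   is the period.\<close>
 define k where "k = Suc (max n0 m1)"
 define m2 where "m2 = t k + ii (t k)"
 have "m2 >= k" using seq_suble[OF t(1), of k] by (simp add: m2_def)
 hence m12: "m1 < m2" by (simp add: k_def)
 have W12: "W m1 = C" "W m2 = C" using WC[of n0] WC[of k] by (auto simp: m1_def m2_def k_def)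
 define l where "l = m2 - m1"
 have l: "l >= 1" "m1 + l = m2" using m12 by (auto simp: l_def)
 have RC: "(R^^l) ` C <= C" using W_Rn[of l m1] W12 l by simp
 have CO: "C <= Or r0" "connected C" "open C" "zz m1 : C" using W[of m1] W12 by auto
 define x where "x = sh (zz m1)"
 have near: "stays_near r0 w" if "w : C" for w using that CO(1) Or_near by blast
 have shC: "sh w = x" if "w : C" for w unfolding x_def by (rule sh_constant[OF CO(2,1) that CO(4)])
 have "x : J" unfolding x_def by (rule sh(1)[OF near[OF CO(4)]])
 moreover have "(R^^l) x = x"
  using sh_Rn[OF near[OF CO(4)], of l] shC[of "(R^^l) (zz m1)"] RC CO(4) by (auto simp: x_def)
 moreover have "dist ((R^^i) x) ((R^^i) w) <= ths" if "w : C" for w i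
  using sh(2)[OF near[OF that], of i] shC[OF that] by simp
 moreover have "C <= fatou R" using CO(1) by (auto simp: Or_def)
 moreover have "(R^^m1) z : C" using CO(4) by (simp add: zz_def)
 ultimately show ?thesis using that[of l C x m1] l(1) CO RC by blast
qed

text \<open>The alternative to being captured: an orbit that is far from \<open>J\<close> at
  infinitely many times accumulates at a Fatou point, and visiting its component twice makes this
  component periodic.\<close>

lemma returning:
 assumes z: "z : fatou R" and "~ (ALL ee>0. EX n0. ALL n>=n0. EX x:J. dist ((R^^n) z) x <= ee)"
 obtains V m l w s where "l >= (1::nat)" "open V" "connected V" "V <= fatou R" "(R^^m) z : V"
  "(R^^l) ` V <= V" "w : V" "strict_mono (s :: nat => nat)" "(%n. (R^^s n) z) ----> w"
proof -
 obtain ee where ee: "ee > 0" "!!n0. EX n>=n0. ~ (EX x:J. dist ((R^^n) z) x <= ee)" using assms(2) by blast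
 have "infinite {n. ~ (EX x:J. dist ((R^^n) z) x <= ee)}"
  unfolding infinite_nat_iff_unbounded_le using ee(2) by simp
 then obtain t where t: "strict_mono (t :: nat => nat)" "!!n x. x : J ==> dist ((R^^t n) z) x > ee"
  using infinite_enumerate by (metis (mono_tags, lifting) mem_Collect_eq not_less)
 obtain t' w where t': "strict_mono (t' :: nat => nat)" "((%n. (R^^t n) z) o t') ----> w"
  by (rule rsphere_convergent_subseq)
 define s where "s = t o t'"
 have s: "strict_mono s" "(%n. (R^^s n) z) ----> w"
  using strict_mono_o[OF t(1) t'(1)] t'(2) by (simp_all add: s_def o_def)
 have wf: "w : fatou R"
 proof (rule ccontr)
  assume "w ~: fatou R"
  hence "w : J" by (simp add: julia_def)
  hence lt: "ee < dist ((R^^s n) z) w" for n using t(2) by (simp add: s_def)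
  have "EVS n. dist ((R^^s n) z) w < ee" using tendstoD[OF s(2) ee(1)] .
  hence "EVS n. False" by eventually_elim (use lt less_asym in blast)
  thus False by simp
 qed
 define V where "V = connected_component_set (fatou R) w"
 have V: "open V" "connected V" "V <= fatou R" "w : V"
  unfolding V_def using open_component[OF open_fatou] wf by (auto simp: connected_component_subset)
 have "EVS n. (R^^s n) z : V" using topological_tendstoD[OF s(2) V(1,4)] .
 then obtain n0 where n0: "!!n. n >= n0 ==> (R^^s n) z : V" by (auto simp: eventually_sequentially)
 define m where "m = s n0"
 define l where "l = s (Suc n0) - s n0"
 have ms: "s n0 < s (Suc n0)" using s(1) by (simp add: strict_mono_Suc_iff)
 have l: "l >= 1" "l + m = s (Suc n0)" using ms by (auto simp: l_def m_def)
 have "(R^^l) ` V <= V"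
 proof -
  define y where "y = (R^^l) ((R^^m) z)"
  have "y = (R^^s (Suc n0)) z" unfolding y_def l(2)[symmetric] by (simp add: funpow_add)
  hence yV: "y : V" using n0[of "Suc n0"] by simp
  have "(R^^l) ` V <= connected_component_set (fatou R) y"
  proof (rule connected_component_maximal)
   show "y : (R^^l) ` V" using n0[of n0] by (simp add: y_def m_def)
   show "connected ((R^^l) ` V)" by (intro connected_continuous_image cont_Rn V)
   show "(R^^l) ` V <= fatou R" using V(3) fatou_Rn by auto
  qed
  also have "... = V" using yV unfolding V_def by (rule connected_component_eq)
  finally show ?thesis .
 qed
 thus ?thesis using that[OF l(1) V(1-3) _ _ V(4) s] n0[of n0] by (simp add: m_def)
qed

lemma subseq_mod:
 assumes s: "filterlim s at_top sequentially" and l: "l >= (1::nat)"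
 obtains i t where "i < l" "strict_mono (t :: nat => nat)" "!!n. s (t n) >= m & s (t n) = m + l*((s (t n) - m) div l) + i"
proof -
 obtain n0 where n0: "!!n. n >= n0 ==> m <= s n" using s unfolding filterlim_at_top eventually_sequentially by blast
 have "EX i:{..<l}. infinite {n : {n0..}. (s n - m) mod l = i}"
 proof (rule ccontr)
  assume "~ ?thesis"
  hence "finite (\<Union>i\<in>{..<l}. {n : {n0..}. (s n - m) mod l = i})" by blast
  moreover have "(\<Union>i\<in>{..<l}. {n : {n0..}. (s n - m) mod l = i}) = {n0..}" using l by auto
  ultimately have "finite {n0..}" by (simp only:)
  thus False using infinite_Ici by blast
 qed
 then obtain i where i: "i < l" "infinite {n : {n0..}. (s n - m) mod l = i}" by auto
 obtain t where t: "strict_mono (t :: nat => nat)" "!!n. t n : {n : {n0..}. (s n - m) mod l = i}"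
  using infinite_enumerate[OF i(2)] by blast
 have "s (t n) >= m" for n using t(2)[of n] n0 by auto
 moreover have "s (t n) = m + l*((s (t n) - m) div l) + i" for n
  using calculation[of n] t(2)[of n] mult_div_mod_eq[of l "s (t n) - m"] by simp
 ultimately show ?thesis using that[OF i(1) t(1)] by blast
qed

lemma fixed_mult: "(R^^l) x = x ==> (R^^(l*n)) x = x"
 by (induction n) (auto simp: funpow_add)

lemma captured_limit:
 assumes V: "l >= (1::nat)" "x : J" "(R^^l) x = x" "!!i. dist ((R^^i) x) ((R^^i) w) <= ths"
  and a: "a : J" and lim: "(%n. (R^^(l*u n + i)) w) ----> a"
 shows "a = (R^^i) x"
proof (rule shadow_unique[of _ _ a])
 fix j
 show "dist ((R^^j) a) ((R^^j) a) <= v/2" using v_props(1) by simp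
 have le: "dist ((R^^j) ((R^^i) x)) ((R^^j) ((R^^(l*u n + i)) w)) <= ths" for n
  using V(4)[of "j + i + l*u n"] fixed_mult[OF V(3), of "u n"] by (simp add: funpow_add add.commute[of "l*u n" i])
 have "dist ((R^^j) ((R^^i) x)) ((R^^j) a) <= ths"
  by (intro LIMSEQ_le_const2[OF tendsto_dist[OF tendsto_const tendsto_Rn[OF lim]]]) (use le in auto)
 thus "dist ((R^^j) ((R^^i) x)) ((R^^j) a) <= v/2" using thetas v_props(1) by linarith
qed (use a V(2) J_Rn in auto)

text \<open>If the orbit approaches \<open>J\<close>, it is captured, and its limit points in
  \<open>J\<close> lie on the cycle of the shadow. Otherwise it enters a periodic component
  \<open>V\<close>: along a sequence of times converging to a point \<open>a1\<close> of
  \<open>J\<close>, all points of \<open>V\<close> have the limit \<open>a1\<close>. Comparing a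
  point with its image under \<open>R^^l\<close> shows that \<open>R^^l\<close> fixes
  \<open>a1\<close>.\<close>

lemma limit_points_periodic:
 assumes z: "z : fatou R"
 obtains l where "l >= 1" "!!a s. a : J ==> strict_mono s ==> (%n. (R^^s n) z) ----> a ==> (R^^l) a = a"
proof (cases "ALL ee>0. EX n0. ALL n>=n0. EX x:J. dist ((R^^n) z) x <= ee")
 case True
 have r04: "r0/4 > 0" using r0(1) by simp
 obtain n1 where n1: "!!n. n >= n1 ==> EX x:J. dist ((R^^n) z) x <= r0/4" using True r04 by blast
 have "stays_near (r0/4) ((R^^n1) z)" unfolding stays_near_def using n1 by (simp add: funpow_add[THEN fun_cong, simplified, symmetric])
 then obtain V m l x where V: "l >= (1::nat)" "x : J" "(R^^m) ((R^^n1) z) : V"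
  "!!w i. w : V ==> dist ((R^^i) x) ((R^^i) w) <= ths" "(R^^l) x = x"
  using captured[of "(R^^n1) z"] z fatou_Rn by metis
 show ?thesis
 proof (rule that[OF V(1)])
  fix a s assume a: "a : J" and s: "strict_mono (s :: nat => nat)" and lim: "(%n. (R^^s n) z) ----> a"
  obtain i t where t: "i < l" "strict_mono (t :: nat => nat)" "!!n. s (t n) >= m + n1 & s (t n) = (m + n1) + l*((s (t n) - (m + n1)) div l) + i"
   using subseq_mod[OF filterlim_subseq[OF s] V(1)] by metis
  define u where "u n = (s (t n) - (m + n1)) div l" for n
  have "(R^^s (t n)) z = (R^^(l*u n + i)) ((R^^m) ((R^^n1) z))" for n
  proof -
   have "s (t n) = l*u n + i + m + n1" using t(3)[of n] unfolding u_def by presburger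
   thus ?thesis by (simp add: funpow_add)
  qed
  hence "(%n. (R^^(l*u n + i)) ((R^^m) ((R^^n1) z))) ----> a"
   using LIMSEQ_subseq_LIMSEQ[OF lim t(2)] by (simp add: o_def)
  hence "a = (R^^i) x" by (rule captured_limit[OF V(1,2,5) V(4)[OF V(3)] a])
  thus "(R^^l) a = a" using V(5) by (metis add.commute comp_apply funpow_add)
 qed
next
 case False
 obtain V m l w s0 where V: "l >= (1::nat)" "open V" "connected V" "V <= fatou R" "(R^^m) z : V"
  "(R^^l) ` V <= V" "w : V" using returning[OF z False] by metis
 show ?thesis
 proof (rule that[OF V(1)])
  fix a s assume a: "a : J" and s: "strict_mono (s :: nat => nat)" and lim: "(%n. (R^^s n) z) ----> a"
  obtain i t where t: "i < l" "strict_mono (t :: nat => nat)" "!!n. s (t n) >= m & s (t n) = m + l*((s (t n) - m) div l) + i"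
   using subseq_mod[OF filterlim_subseq[OF s] V(1)] by metis
  define y where "y n = (R^^(l*((s (t n) - m) div l))) ((R^^m) z)" for n
  obtain t' a1 where t': "strict_mono (t' :: nat => nat)" "(y o t') ----> a1" by (rule rsphere_convergent_subseq)
  have iy: "(R^^i) (y n) = (R^^s (t n)) z" for n
  proof -
   define u where "u = (s (t n) - m) div l"
   have st: "s (t n) = i + l*u + m" using t(3)[of n] unfolding u_def by presburger
   show ?thesis unfolding y_def u_def[symmetric] unfolding st by (simp add: funpow_add)
  qed
  have "(%n. (R^^i) ((y o t') n)) ----> (R^^i) a1" by (rule tendsto_Rn[OF t'(2)])
  moreover have "(%n. (R^^i) ((y o t') n)) ----> a"
   using LIMSEQ_subseq_LIMSEQ[OF LIMSEQ_subseq_LIMSEQ[OF lim t(2)] t'(1)] by (simp add: iy o_def)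
  ultimately have ia: "(R^^i) a1 = a" using LIMSEQ_unique by blast
  hence a1: "a1 : J" using a J_Rn by metis
  define k where "k n = l*((s (t (t' n)) - m) div l)" for n
  have l1: "(%n. (R^^k n) ((R^^m) z)) ----> a1" using t'(2) by (simp add: y_def k_def o_def)
  have "(R^^l) ((R^^m) z) : V" using V(5,6) by blast
  hence l2: "(%n. (R^^k n) ((R^^l) ((R^^m) z))) ----> a1"
   by (rule iterates_to_julia[OF V(2-5) l1 a1])
  have "(R^^k n) ((R^^l) ((R^^m) z)) = (R^^l) ((R^^k n) ((R^^m) z))" for n
   by (metis add.commute comp_apply funpow_add)
  hence "(%n. (R^^k n) ((R^^l) ((R^^m) z))) ----> (R^^l) a1" using tendsto_Rn[OF l1, of l] by simp
  hence "(R^^l) a1 = a1" using l2 LIMSEQ_unique by blast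
  thus "(R^^l) a = a" using ia by (metis add.commute comp_apply funpow_add)
 qed
qed

end

section \<open>Distortion of univalent functions\<close>

text \<open>A bound for \<open>w0*(1 - h^2)\<close>, where \<open>cmod w0 < 2\<close> and
  \<open>h\<close> is bounded by Schottky's theorem with initial modulus one and relative radius
  \<open>2/3\<close>, namely \<open>1/2\<close> within a disc of radius \<open>3/4\<close>.\<close>

definition koebe_M :: real where
 "koebe_M = 2*(1 + (exp (pi*exp (pi*(2 + 2*1 + 12*(2/3)/(1 - 2/3)))))^2)"

text \<open>If \<open>ph\<close> omits \<open>w0\<close>, then \<open>h = sqrt (1 - ph / w0)\<close> omits \<open>0\<close>, and \<open>- h\<close> has no value in common
 with \<open>h\<close>; in particular \<open>h\<close> omits \<open>- h 0\<close>, and Schottky's theorem applies.\<close>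

lemma koebe_growth:
 assumes hol: "ph holomorphic_on ball 0 1" and inj: "inj_on ph (ball 0 1)" and "ph 0 = 0" and d1: "deriv ph 0 = 1"
  and z: "cmod z <= 1/2"
 shows "cmod (ph z) <= koebe_M"
proof -
 \<comment> \<open>Otherwise the inverse of \<open>ph\<close> would map the disc of radius
   \<open>2\<close> into the unit disc with derivative \<open>1\<close> at the origin, against
   Cauchy's estimate.\<close>
 have "EX w. cmod w < 2 & w ~: ph ` ball 0 1"
 proof (rule ccontr)
  assume "~ ?thesis"
  hence sub: "ball 0 2 <= ph ` ball 0 1" by auto
  obtain g where g: "g holomorphic_on ph ` ball 0 1" "!!z. z : ball 0 1 ==> deriv ph z*deriv g (ph z) = 1"
   "!!z. z : ball 0 1 ==> g (ph z) = z"
   using holomorphic_has_inverse[OF hol open_ball inj] by metis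
  have "deriv g 0 = 1" using g(2)[of 0] assms(3) d1 by simp
  have gb: "cmod (g w) <= 1" if w: "w : ball 0 2" for w
  proof -
   obtain y where "y : ball 0 1" "w = ph y" using sub w by blast
   thus ?thesis using g(3)[of y] by simp
  qed
  have s2: "cball 0 (3/2) <= ph ` ball 0 1" using sub by (auto simp: subset_iff)
  have "cmod ((deriv^^1) g 0) <= fact 1*1/(3/2)^1"
  proof (rule Cauchy_inequality)
   show "g holomorphic_on ball 0 (3/2)" using g(1) s2 ball_subset_cball holomorphic_on_subset by blast
   show "continuous_on (cball 0 (3/2)) g" using g(1) s2 holomorphic_on_subset holomorphic_on_imp_continuous_on by blast
   show "cmod (g x) <= 1" if "cmod (0 - x) = 3/2" for x using that gb[of x] by simp
  qed simp
  thus False using `deriv g 0 = 1` by simp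
 qed
 then obtain w0 where w0: "cmod w0 < 2" "w0 ~: ph ` ball 0 1" by blast
 have w00: "w0 ~= 0" using w0(2) assms(3) by (metis centre_in_ball imageI zero_less_one)
 have hol1: "(%z. 1 - ph z/w0) holomorphic_on ball 0 1" using w00 by (intro holomorphic_intros hol)
 have nz1: "1 - ph z/w0 ~= 0" if "z : ball 0 1" for z
  using w0(2) w00 that by (auto simp: field_simps)
 obtain h1 where h1: "h1 holomorphic_on ball 0 1" "!!z. z : ball 0 1 ==> 1 - ph z/w0 = (h1 z)^2"
  using contractible_imp_holomorphic_sqrt[OF hol1 convex_imp_contractible[OF convex_ball] nz1] by metis
 define h where "h z = - h1 z/h1 0" for z
 have h10: "(h1 0)^2 = 1" using h1(2)[of 0] assms(3) by simp
 hence h10': "h1 0 ~= 0" by auto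
 have h: "h holomorphic_on ball 0 1" unfolding h_def using h10' by (intro holomorphic_intros h1)
 have hsq: "(h z)^2 = 1 - ph z/w0" if "z : ball 0 1" for z
  using h1(2)[OF that] h10 by (simp add: h_def power_divide)
 have om: "h z ~= 0" "h z ~= 1" if "z : ball 0 1" for z
 proof -
  show "h z ~= 0" using hsq[OF that] w0(2) w00 that by (auto simp: field_simps)
  show "h z ~= 1"
  proof
   assume a: "h z = 1"
   hence "ph z = ph 0" using hsq[OF that] w00 assms(3) by simp
   hence "z = 0" using inj that by (auto simp: inj_on_def)
   thus False using a h10' by (simp add: h_def)
  qed
 qed
 define f where "f z = h (of_real (3/4)*z)" for z
 have sub: "of_real (3/4)*y : ball 0 1" if "y : cball 0 1" for y :: complex
  using that by (simp add: norm_mult)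
 have "cmod (f (of_real (4/3)*z)) <= exp (pi*exp (pi*(2 + 2*1 + 12*(2/3)/(1 - 2/3))))"
 proof (rule Schottky[where f = f and t = "2/3" and r = 1])
  show "f holomorphic_on cball 0 1" unfolding f_def
   by (rule holomorphic_on_compose_gen[OF _ h, unfolded o_def]) (use sub in "auto intro!: holomorphic_intros")
  show "cmod (f 0) <= 1" using h10' by (simp add: f_def h_def)
  show "~ (f y = 0 | f y = 1)" if "y : cball 0 1" for y using om[OF sub[OF that]] by (simp add: f_def)
  show "cmod (of_real (4/3)*z) <= 2/3" using z by (simp add: norm_mult)
 qed auto
 hence hz: "cmod (h z) <= exp (pi*exp (pi*(2 + 2*1 + 12*(2/3)/(1 - 2/3))))" by (simp add: f_def)
 have zb: "z : ball 0 1" using z by simp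
 have "ph z = w0*(1 - (h z)^2)" using hsq[OF zb] w00 by (simp add: field_simps)
 hence "cmod (ph z) = cmod w0*cmod (1 - (h z)^2)" by (simp add: norm_mult)
 also have "... <= 2*(1 + (cmod (h z))^2)"
  using w0(1) norm_triangle_ineq4[of 1 "(h z)^2"] by (intro mult_mono) (auto simp: norm_power)
 also have "... <= koebe_M" unfolding koebe_M_def
  by (intro mult_left_mono add_left_mono power_mono hz) auto
 finally show ?thesis .
qed

definition kK :: real where "kK = max 1 (8 * koebe_M)"

lemma kK: "kK >= 1" "kK > 0" by (auto simp: kK_def)

lemma koebe_deriv:
 assumes hol: "ph holomorphic_on ball u r" and inj: "inj_on ph (ball u r)" and r: "r > 0"
  and z: "dist u z < r/4"
 shows "cmod (deriv ph z) <= kK*cmod (deriv ph u)"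
proof -
 have d0: "deriv ph w ~= 0" if "w : ball u r" for w
  using holomorphic_injective_imp_regular[OF hol open_ball inj that] .
 have du: "deriv ph u ~= 0" using d0 r by simp
 define D where "D = of_real r*deriv ph u"
 have D0: "D ~= 0" using du r by (simp add: D_def)
 define px where "px w = (ph (u + of_real r*w) - ph u)/D" for w
 have sub: "u + of_real r*w : ball u r" if "w : ball 0 1" for w
  using that r by (simp add: dist_norm norm_mult)
 have dphi: "(ph has_field_derivative deriv ph w) (at w)" if "w : ball u r" for w
  using holomorphic_derivI[OF hol open_ball that] .
 have dpsi: "(px has_field_derivative deriv ph (u + of_real r*w) * of_real r/D) (at w)" if "w : ball 0 1" for w
 proof -
  have "((%w. ph (u + of_real r*w)) has_field_derivative deriv ph (u + of_real r*w) * of_real r) (at w)"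
   by (rule DERIV_chain2[where g = "%w. u + of_real r*w"])
     (use dphi[OF sub[OF that]] in "auto intro!: derivative_eq_intros")
  thus ?thesis unfolding px_def using D0 by (auto intro!: derivative_eq_intros)
 qed
 have psih: "px holomorphic_on ball 0 1"
  using dpsi by (meson field_differentiable_def field_differentiable_at_within holomorphic_on_def)
 have psii: "inj_on px (ball 0 1)"
 proof (rule inj_onI)
  fix a b :: complex assume ab: "a : ball 0 1" "b : ball 0 1" "px a = px b"
  hence "ph (u + of_real r*a) = ph (u + of_real r*b)" using D0 by (simp add: px_def)
  hence "u + of_real r*a = u + of_real r*b" using inj sub ab by (metis inj_onD)
  thus "a = b" using r by simp
 qed
 have psi1: "deriv px 0 = 1" using DERIV_imp_deriv[OF dpsi[of 0]] D0 by (simp add: D_def mult.commute)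
 define y where "y = (z - u)/of_real r"
 have y: "cmod y < 1/4" using z r by (simp add: y_def norm_divide dist_norm norm_minus_commute field_simps)
 have "cmod ((deriv^^1) px y) <= fact 1 * koebe_M/(1/4)^1"
 proof (rule Cauchy_inequality)
  have s: "cball y (1/4) <= ball 0 1"
  proof
   fix x assume "x : cball y (1/4)"
   thus "x : ball 0 1" using y dist_triangle[of 0 x y] by simp
  qed
  show "px holomorphic_on ball y (1/4)" using psih s ball_subset_cball holomorphic_on_subset by blast
  show "continuous_on (cball y (1/4)) px" using psih s holomorphic_on_subset holomorphic_on_imp_continuous_on by blast
  fix x assume "cmod (y - x) = 1/4"
  hence "cmod x <= 1/2" using y norm_triangle_ineq2[of x y] by (simp add: norm_minus_commute)
  thus "cmod (px x) <= koebe_M" by (intro koebe_growth psih psii psi1) (auto simp: px_def)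
 qed auto
 moreover have "deriv px y = deriv ph z/deriv ph u"
 proof -
  have "u + of_real r*y = z" using r by (simp add: y_def)
  thus ?thesis using DERIV_imp_deriv[OF dpsi[of y]] y r by (simp add: D_def field_simps)
 qed
 ultimately have "cmod (deriv ph z)/cmod (deriv ph u) <= 4 * koebe_M" by (simp add: norm_divide)
 hence "cmod (deriv ph z) <= 4 * koebe_M*cmod (deriv ph u)" using du by (simp add: divide_le_eq)
 also have "... <= kK*cmod (deriv ph u)"
  by (intro mult_right_mono) (auto simp: kK_def koebe_M_def max_def)
 finally show ?thesis .
qed

text \<open>Recentred at \<open>w\<close>: the ball of radius \<open>9/10*r\<close> around
  \<open>w\<close> lies in the given one, and \<open>z\<close> is within \<open>r/5\<close> of
  \<open>w\<close>, less than a quarter of that radius.\<close>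

lemma koebe_two_point:
 assumes hol: "ph holomorphic_on ball u r" and inj: "inj_on ph (ball u r)" and r: "r > 0"
  and z: "z : ball u (r/10)" and w: "w : ball u (r/10)"
 shows "cmod (deriv ph z) <= kK*cmod (deriv ph w)"
proof -
 have sub: "ball w (9/10*r) <= ball u r"
 proof
  fix x assume "x : ball w (9/10*r)"
  thus "x : ball u r" using w dist_triangle[of u x w] by simp
 qed
 have "dist w z < 9/10*r/4" using z w r dist_triangle[of w z u] by (simp add: dist_commute)
 thus ?thesis
  by (intro koebe_deriv[of ph w "9/10*r"] holomorphic_on_subset[OF hol sub] inj_on_subset[OF inj sub]) (use r in auto)
qed

text \<open>The radius \<open>s\<close> is so small that, by Cauchy's estimate for the derivative,
  \<open>deriv ph\<close> at most doubles on \<open>ball w s\<close>. Bloch's lemma then covers a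
  disc with the factor \<open>3 - 2 * sqrt 2\<close>, which exceeds \<open>1/10\<close>.\<close>

lemma koebe_cover:
 assumes hol: "ph holomorphic_on ball u r" and inj: "inj_on ph (ball u r)" and r: "r > 0"
  and w: "w : ball u (r/20)" and s: "0 < s" "s <= r/(160 * kK)"
 shows "ball (ph w) (s/10*cmod (deriv ph w)) <= ph ` ball w s"
proof -
 have sub: "ball w (r/20) <= ball u (r/10)"
 proof
  fix x assume "x : ball w (r/20)"
  thus "x : ball u (r/10)" using w dist_triangle[of u x w] by simp
 qed
 have sub2: "ball w (r/20) <= ball u r" using sub r by (auto simp: subset_iff)
 have wb: "w : ball w (r/20)" using r by simp
 have dh: "deriv ph holomorphic_on ball w (r/20)"
  using holomorphic_deriv[OF hol open_ball] sub2 holomorphic_on_subset by blast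
 have "r/(160 * kK) <= r/(160*1)" using kK r by (intro divide_left_mono) auto
 hence s40: "s < r/40" using r s(2) by simp
 have le2: "cmod (deriv ph z) <= 2*cmod (deriv ph w)" if z: "z : ball w s" for z
 proof -
  have "cmod (deriv ph z - deriv ph w) <= 4*(kK*cmod (deriv ph w))/(r/20)*cmod (z - w)"
  proof (rule holomorphic_bounded_lipschitz[OF dh])
   fix x assume "x : ball w (r/20)"
   thus "cmod (deriv ph x) <= kK*cmod (deriv ph w)"
    using koebe_two_point[OF hol inj r] sub wb by blast
  qed (use r z s40 in auto)
  also have "... <= 4*(kK*cmod (deriv ph w))/(r/20)*(r/(160 * kK))"
   using z s kK r by (intro mult_left_mono) (auto simp: dist_norm norm_minus_commute)
  also have "... = cmod (deriv ph w)/2" using r kK by simp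
  finally show ?thesis using norm_triangle_ineq2[of "deriv ph z" "deriv ph w"] norm_ge_zero[of "deriv ph w"] by linarith
 qed
 have "ball (ph w) ((3 - 2 * sqrt 2) * s*cmod (deriv ph w)) <= ph ` ball w s"
 proof (rule Bloch_lemma[OF _ s(1) le2])
  have "cball w s <= ball w (r/20)" using s40 r by auto
  hence "cball w s <= ball u r" using sub2 by blast
  thus "ph holomorphic_on cball w s" using hol holomorphic_on_subset by blast
 qed
 moreover have "s/10*cmod (deriv ph w) <= (3 - 2 * sqrt 2) * s*cmod (deriv ph w)"
 proof (intro mult_right_mono)
  have "sqrt 2 <= 29/20" by (rule real_le_lsqrt) (auto simp: power2_eq_square)
  hence "1/10 * s <= (3 - 2 * sqrt 2) * s" using s by (intro mult_right_mono) auto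
  thus "s/10 <= (3 - 2 * sqrt 2) * s" by simp
 qed simp
 ultimately show ?thesis using subset_ball by blast
qed

lemma koebe_bilipschitz:
 assumes hol: "ph holomorphic_on ball u r" and inj: "inj_on ph (ball u r)" and r: "r > 0"
  and z: "z : ball u (r/10)" and y: "y : ball u (r/10)" and w: "w : ball u (r/10)"
 shows "cmod (ph z - ph y) <= kK*cmod (deriv ph w)*cmod (z - y)"
proof (rule field_differentiable_bound[of "ball u (r/10)" ph "deriv ph"])
 fix x assume x: "x : ball u (r/10)"
 hence "x : ball u r" using r by auto
 thus "(ph has_field_derivative deriv ph x) (at x within ball u (r/10))"
  using holomorphic_derivI[OF hol open_ball] has_field_derivative_at_within by blast
 show "cmod (deriv ph x) <= kK*cmod (deriv ph w)" by (rule koebe_two_point[OF hol inj r x w])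
qed (use z y in auto)

section \<open>Inverse branches\<close>

lemma finite_separated:
 fixes X :: "'a::metric_space set"
 assumes "finite X"
 obtains e where "e > 0" "!!a b. a : X ==> b : X ==> a ~= b ==> e <= dist a b"
proof -
 have "EX e>0. ALL b:X. b ~= a --> e <= dist a b" for a using finite_set_avoid[OF assms, of a] by (auto simp: dist_commute)
 then obtain f where f: "!!a. f a > 0" "!!a b. b : X ==> b ~= a ==> f a <= dist a b" by metis
 show ?thesis
 proof (rule that[of "Min (insert 1 (f ` X))"])
  show "Min (insert 1 (f ` X)) > 0" using assms f(1) by (subst Min_gr_iff) auto
  fix a b assume "a : X" "b : X" "a ~= b"
  hence "Min (insert 1 (f ` X)) <= f a" using assms by (intro Min_le) auto
  thus "Min (insert 1 (f ` X)) <= dist a b" using f(2)[of b a] `b : X` `a ~= b` by auto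
 qed
qed

section \<open>The postcritical set and the discs that avoid it\<close>

context expansive_rational
begin

definition PV :: "rsphere set" where "PV = (\<Union>n\<in>{1..}. (R^^n) ` crit)"

text \<open>The points of \<open>J\<close> that have no neighbourhood free of critical orbits, and
  near which inverse branches of all iterates may fail to exist.\<close>

definition P0 :: "rsphere set" where "P0 = closure PV Int J"

lemma PV_I: "x : crit ==> n >= 1 ==> (R^^n) x : PV" unfolding PV_def by blast

lemma crit_fatou: "x : crit ==> x : fatou R" using crit_not_julia by (auto simp: julia_def)

text \<open>Critical orbits stay in the Fatou set, so they never reach \<open>a\<close> and can
  approach it only at times tending to infinity. As there are finitely many critical points, one
  orbit does so.\<close>

lemma P0_limit:
 assumes a: "a : P0"
 obtains c s where "c : crit" "strict_mono (s :: nat => nat)" "(%n. (R^^s n) c) ----> a"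
proof -
 have aJ: "a : J" using a by (simp add: P0_def)
 have near: "EX c:crit. EX n>N. dist ((R^^n) c) a < ee" if ee: "ee > 0" for ee N
 proof -
  have "finite (\<Union>n\<le>N. (R^^n) ` crit)" using finite_crit by auto
  moreover have "a ~: (\<Union>n\<le>N. (R^^n) ` crit)"
   using aJ crit_fatou fatou_Rn by (auto simp: julia_def)
  ultimately obtain dl where dl: "dl > 0" "!!x. x : (\<Union>n\<le>N. (R^^n) ` crit) ==> dl <= dist a x"
   using finite_set_avoid by metis
  have "a : closure PV" using a by (simp add: P0_def)
  then obtain y where y: "y : PV" "dist y a < min ee dl" using ee dl(1) unfolding closure_approachable by (metis min_less_iff_conj)
  then obtain n c where n: "c : crit" "y = (R^^n) c" unfolding PV_def by blast
  have "~ n <= N"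
  proof
   assume "n <= N"
   hence "dl <= dist a y" using dl(2)[of y] n by auto
   thus False using y(2) by (simp add: dist_commute)
  qed
  thus ?thesis using n y(2) by (intro bexI[of _ c] exI[of _ n]) auto
 qed
 have "EX c:crit. ALL ee>0. ALL N. EX n>N. dist ((R^^n) c) a < ee"
 proof (rule ccontr)
  assume "~ ?thesis"
  hence "ALL c:crit. EX ee>0. EX N. ALL n>N. ee <= dist ((R^^n) c) a" by (meson not_less)
  then obtain e N where eN: "!!c. c : crit ==> e c > 0" "!!c n. c : crit ==> n > N c ==> e c <= dist ((R^^n) c) a" by metis
  define e0 where "e0 = Min (insert 1 (e ` crit))"
  define N0 where "N0 = Max (insert 0 (N ` crit))"
  have e0: "e0 > 0" unfolding e0_def using eN(1) finite_crit by (subst Min_gr_iff) auto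
  obtain c n where cn: "c : crit" "n > N0" "dist ((R^^n) c) a < e0" using near[OF e0, of N0] by blast
  have "N c <= N0" unfolding N0_def using finite_crit cn(1) by (intro Max_ge) auto
  moreover have "e0 <= e c" unfolding e0_def using finite_crit cn(1) by (intro Min_le) auto
  ultimately show False using eN(2)[OF cn(1), of n] cn(2,3) by simp
 qed
 then obtain c where c: "c : crit" "!!ee N. ee > 0 ==> EX n>N. dist ((R^^n) c) a < ee" by blast
 have "EX s. ALL n. dist ((R^^s n) c) a < 1/real (Suc n) & s n < s (Suc n)"
 proof (rule dependent_nat_choice)
  show "EX x. dist ((R^^x) c) a < 1/real (Suc 0)" using c(2)[of 1 0] by auto
  fix x n show "EX y. dist ((R^^y) c) a < 1/real (Suc (Suc n)) & x < y" using c(2)[of "1/real (Suc (Suc n))" x] by auto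
 qed
 then obtain s where s: "!!n. dist ((R^^s n) c) a < 1/real (Suc n)" "!!n. s n < s (Suc n)" by blast
 have "(%n. dist ((R^^s n) c) a) ----> 0"
  by (rule Lim_null_comparison[OF _ LIMSEQ_Suc[OF lim_1_over_n]])
    (use s(1) in "auto intro!: always_eventually less_imp_le")
 hence "(%n. (R^^s n) c) ----> a" by (rule iffD2[OF tendsto_dist_iff])
 moreover have "strict_mono s" using s(2) by (simp add: strict_mono_Suc_iff)
 ultimately show ?thesis using that c(1) by blast
qed

lemma P0_J: "a : P0 ==> a : J" by (simp add: P0_def)

lemma P0_periodic: "EX L>=1. ALL a:P0. (R^^L) a = a"
proof -
 have "EX l>=1. ALL a s. a : J --> strict_mono s --> (%n. (R^^s n) c) ----> a --> (R^^l) a = a" if "c : crit" for c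
  using limit_points_periodic[OF crit_fatou[OF that]] by metis
 then obtain l where l: "!!c. c : crit ==> l c >= (1::nat)"
  "!!c a s. c : crit ==> a : J ==> strict_mono s ==> (%n. (R^^s n) c) ----> a ==> (R^^l c) a = a" by metis
 define L where "L = prod l crit"
 have "(R^^L) a = a" if a: "a : P0" for a
 proof -
  obtain c s where c: "c : crit" "strict_mono (s :: nat => nat)" "(%n. (R^^s n) c) ----> a" using P0_limit[OF a] by metis
  have "(R^^l c) a = a" using l(2)[OF c(1) P0_J[OF a] c(2,3)] .
  moreover have "L = l c*prod l (crit - {c})" unfolding L_def using prod.remove[OF finite_crit c(1)] .
  ultimately show ?thesis using fixed_mult by simp
 qed
 moreover have "L >= 1" unfolding L_def using l(1) by (intro prod_ge_1) auto
 ultimately show ?thesis by blast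
qed

lemma finite_P0: "finite P0"
proof -
 obtain L where L: "L >= 1" "ALL a:P0. (R^^L) a = a" using P0_periodic by blast
 hence "P0 <= {y : J. (R^^L) y = y}" using P0_J by blast
 thus ?thesis using finite_fixed[OF L(1)] finite_subset by blast
qed

lemma R_P0: "a : P0 ==> R a : P0"
proof -
 assume a: "a : P0"
 have "R ` PV <= PV"
 proof
  fix y assume "y : R ` PV"
  then obtain n c where "n >= 1" "c : crit" "y = (R^^Suc n) c" unfolding PV_def by auto
  thus "y : PV" using PV_I[of c "Suc n"] by simp
 qed
 hence "R ` closure PV <= closure PV"
  using image_closure_subset[OF cont_R closed_closure, of PV PV] closure_subset by blast
 thus ?thesis using a J_R unfolding P0_def by blast
qed

text \<open>The point sent to infinity from here on. It lies in the Fatou set, so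
  \<open>kap c0\<close> is bounded on \<open>J\<close>; its later orbit lies in \<open>PV\<close>,
  so inverse branches of positive order on a disc that avoids \<open>PV\<close> never take the value
  \<open>c0\<close>.\<close>

definition c0 :: complex where "c0 = (SOME c. Fin c : crit)"

lemma c0: "Fin c0 : crit" unfolding c0_def using ex_crit by (rule someI_ex)

definition disc :: "complex => real => rsphere set" where "disc u r = kinv c0 ` ball u r"

text \<open>The second condition keeps all inverse branches on the disc away from the critical point \<open>c0\<close>, which
 makes the coordinate \<open>kap c0\<close> bounded on them.\<close>

definition good :: "complex => real => bool" where
 "good u r \<longleftrightarrow> r > 0 & disc u r Int PV = {} & (EX ro>0. ALL n. ALL x:ball (Fin c0) ro. (R^^n) x ~: disc u r)"

lemma disc_mono: "r <= s ==> disc u r <= disc u s" unfolding disc_def by auto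

lemma good_subset: "good u r ==> 0 < s ==> s <= r ==> good u s"
 unfolding good_def using disc_mono[of s r u] by (meson disjoint_iff subsetD)

lemma disc_open: "open (disc u r)" and disc_connected: "connected (disc u r)"
 unfolding disc_def by (auto intro!: open_kinv_image connected_continuous_image continuous_on_kinv)

lemma disc_centre: "r > 0 ==> kinv c0 u : disc u r" unfolding disc_def by auto

lemma disc_kap: "y : disc u r ==> kap c0 y : ball u r" "y : disc u r ==> kinv c0 (kap c0 y) = y"
 unfolding disc_def by auto

text \<open>The orbit of \<open>c0\<close>, including time \<open>0\<close>, keeps a distance of at
  least \<open>2 * si\<close> from \<open>y\<close>. Equicontinuity at \<open>c0\<close> extends
  this, with half the distance, to the orbits of a whole ball around \<open>c0\<close>.\<close>

lemma good_disc:
 assumes y: "y : J" "y ~: P0"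
 obtains r where "good (kap c0 y) r"
proof -
 have yc: "y ~= Fin c0" using y(1) c0 crit_fatou by (auto simp: julia_def)
 have "y : - (closure PV)" using y by (simp add: P0_def)
 then obtain si1 where si1: "si1 > 0" "ball y si1 <= - closure PV" using openE[of "- closure PV" y] by (auto simp: open_Compl)
 define si where "si = min si1 (dist y (Fin c0))/2"
 have si: "si > 0" using si1(1) yc by (simp add: si_def)
 obtain ro where ro: "ro > 0" "!!x n. dist x (Fin c0) < ro ==> dist ((R^^n) x) ((R^^n) (Fin c0)) < si"
  using equiD[OF equi_fatou crit_fatou[OF c0] si] by metis
 have far: "2 * si <= dist y ((R^^n) (Fin c0))" for n
 proof (cases "n = 0")
  case True
  thus ?thesis by (simp add: si_def)
 next
  case False
  hence "(R^^n) (Fin c0) : PV" using PV_I[OF c0, of n] by simp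
  hence "(R^^n) (Fin c0) ~: ball y si1" using si1(2) closure_subset by blast
  thus ?thesis by (simp add: si_def)
 qed
 have "open (kinv c0 -` ball y si)" "kap c0 y : kinv c0 -` ball y si"
  using si yc by (auto intro!: open_kinv_vimage)
 then obtain r where r: "r > 0" "ball (kap c0 y) r <= kinv c0 -` ball y si" using openE by blast
 have sub: "disc (kap c0 y) r <= ball y si" using r(2) by (auto simp: disc_def)
 show ?thesis
 proof (rule that[of r], unfold good_def, intro conjI exI[of _ ro] allI ballI)
  have "ball y si <= ball y si1" using si1(1) by (auto simp: si_def)
  thus "disc (kap c0 y) r Int PV = {}" using sub si1(2) closure_subset by blast
  fix n x assume "x : ball (Fin c0) ro"
  hence "dist ((R^^n) x) ((R^^n) (Fin c0)) < si" using ro(2) by (simp add: dist_commute)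
  hence "dist y ((R^^n) x) > si"
   using far[of n] dist_triangle[of y "(R^^n) (Fin c0)" "(R^^n) x"] by linarith
  thus "(R^^n) x ~: disc (kap c0 y) r" using sub by auto
 qed (use r ro in auto)
qed

section \<open>Existence and regularity of inverse branches\<close>

definition sect :: "nat => complex => real => (rsphere => rsphere) => bool" where
 "sect n u r g \<longleftrightarrow> continuous_on (disc u r) g & (ALL y:disc u r. (R^^n) (g y) = y)"

lemma locally_injective_n:
 assumes "!!k. k < n ==> (R^^k) a ~: crit"
 shows "EX U. open U & a : U & inj_on (R^^n) U"
 using assms
proof (induction n)
 case 0
 thus ?case by (intro exI[of _ UNIV]) auto
next
 case (Suc n)
 obtain U where U: "open U" "a : U" "inj_on (R^^n) U" using Suc by (meson less_SucI)
 obtain V where V: "open V" "(R^^n) a : V" "inj_on R V" using locally_injective Suc.prems lessI by metis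
 let ?W = "U Int (R^^n) -` V"
 have "open ((R^^n) -` V)" using continuous_on_open_vimage[of UNIV "R^^n"] cont_Rn V(1) by auto
 hence "open ?W" using U(1) by auto
 moreover have "inj_on (R^^Suc n) ?W"
 proof (rule inj_onI)
  fix x y assume xy: "x : ?W" "y : ?W" "(R^^Suc n) x = (R^^Suc n) y"
  hence "(R^^n) x = (R^^n) y" using inj_onD[OF V(3)] by auto
  thus "x = y" using inj_onD[OF U(3)] xy by auto
 qed
 ultimately show ?case using U(2) V(2) by (intro exI[of _ ?W]) (auto simp: o_def)
qed

definition En :: "nat => rsphere set" where "En n = (\<Union>k\<in>{1..n}. (R^^k) ` crit)"

lemma finite_En: "finite (En n)" unfolding En_def using finite_crit by auto

lemma En_PV: "En n <= PV" unfolding En_def PV_def by auto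

lemma not_En_crit: "(R^^n) x ~: En n ==> k < n ==> (R^^k) x ~: crit"
proof
 assume a: "(R^^n) x ~: En n" "k < n" "(R^^k) x : crit"
 have "(R^^n) x = (R^^(n - k)) ((R^^k) x)" using a(2) by (metis comp_apply funpow_add le_add_diff_inverse2 less_imp_le)
 thus False using a unfolding En_def by auto
qed

text \<open>A locally injective open map of a compact space with finite fibres is a covering. Evenly
  covered are the points of \<open>T0\<close>: each of the disjoint sets \<open>U a\<close> maps
  onto them, and their whole fibre lies in the union of the \<open>U a\<close>. No point outside
  \<open>En n\<close> has \<open>c0\<close> in its fibre, so the coordinate loses nothing.\<close>

lemma covering:
 assumes n: "n >= 1"
 shows "covering_space {u. (R^^n) (kinv c0 u) ~: insert (Fin c0) (En n)} (%u. kap c0 ((R^^n) (kinv c0 u))) {w. kinv c0 w ~: En n}"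
  (is "covering_space ?C ?p ?S")
proof -
 have cRk: "continuous_on UNIV (%u. (R^^n) (kinv c0 u))" by (intro sphol_continuous rmap_sphol rmap_Rn)
 have oC: "open ?C"
 proof -
  have "?C = (%u. (R^^n) (kinv c0 u)) -` (- insert (Fin c0) (En n))" by auto
  moreover have "open (- insert (Fin c0) (En n))" using finite_En by (simp add: open_Compl finite_imp_closed)
  ultimately show ?thesis using continuous_on_open_vimage[of UNIV "%u. (R^^n) (kinv c0 u)"] cRk by auto
 qed
 have oS: "open ?S"
 proof -
  have "?S = kinv c0 -` (- En n)" by auto
  moreover have "open (- En n)" using finite_En by (simp add: open_Compl finite_imp_closed)
  ultimately show ?thesis using open_kinv_vimage by metis
 qed
 have hp: "?p holomorphic_on ?C" by (intro sphol_kap_holomorphic rmap_sphol rmap_Rn) auto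
 have kp: "kinv c0 (?p u) = (R^^n) (kinv c0 u)" if "u : ?C" for u using that by simp
 have c0E: "(R^^n) (Fin c0) : En n" unfolding En_def using n c0 by auto
 have pre: "x ~= Fin c0 & kap c0 x : ?C & ?p (kap c0 x) = w" if "(R^^n) x = kinv c0 w" "w : ?S" for x w
 proof -
  have "x ~= Fin c0" using that c0E by auto
  thus ?thesis using that by simp
 qed
 have pS: "?p ` ?C = ?S"
 proof
  show "?p ` ?C <= ?S" using kp by auto
  show "?S <= ?p ` ?C"
  proof
   fix w assume w: "w : ?S"
   obtain x where "(R^^n) x = kinv c0 w" using surj_Rn by blast
   thus "w : ?p ` ?C" using pre[OF _ w, of x] by (intro image_eqI[of _ _ "kap c0 x"]) auto
  qed
 qed
 show ?thesis
  unfolding covering_space_def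
 proof (intro conjI ballI)
  show "continuous_on ?C ?p" using hp by (rule holomorphic_on_imp_continuous_on)
  show "?p ` ?C = ?S" by (rule pS)
  fix w assume w: "w : ?S"
  define X where "X = (R^^n) -` {kinv c0 w}"
  have fX: "finite X" unfolding X_def by (rule finite_fiber_n)
  obtain e where e: "e > 0" "!!a b. a : X ==> b : X ==> a ~= b ==> e <= dist a b" using finite_separated[OF fX] by metis
  have "EX U. open U & a : U & inj_on (R^^n) U" if "a : X" for a
   using that w not_En_crit[of n a] by (intro locally_injective_n) (auto simp: X_def)
  then obtain U0 where U0: "!!a. a : X ==> open (U0 a)" "!!a. a : X ==> a : U0 a" "!!a. a : X ==> inj_on (R^^n) (U0 a)" by metis
  define U where "U a = U0 a Int ball a (e/2)" for a
  have U: "open (U a)" "a : U a" "inj_on (R^^n) (U a)" if "a : X" for a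
   using U0[OF that] e(1) by (auto simp: U_def intro: inj_on_subset)
  have Ud: "a = b" if "a : X" "b : X" "x : U a" "x : U b" for a b x
  proof (rule ccontr)
   assume "a ~= b"
   hence "e <= dist a b" using e(2) that by blast
   thus False using that(3,4) dist_triangle[of a b x] by (auto simp: U_def dist_commute)
  qed
  define T0 where "T0 = (\<Inter>a\<in>X. (R^^n) ` U a) Int - (R^^n) ` (- (\<Union>a\<in>X. U a))"
  have oU: "open (\<Union>a\<in>X. U a)" using U(1) by auto
  have "open T0"
   unfolding T0_def
  proof (intro open_Int open_INT fX ballI)
   show "open ((R^^n) ` U a)" if "a : X" for a using U(1)[OF that] by (rule open_Rn)
   have "compact ((R^^n) ` (- (\<Union>a\<in>X. U a)))"
    by (intro compact_continuous_image cont_Rn closed_imp_compact_rsphere closed_Compl oU)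
   thus "open (- (R^^n) ` (- (\<Union>a\<in>X. U a)))" by (simp add: compact_imp_closed open_Compl)
  qed
  have wT0: "kinv c0 w : T0"
  proof -
   have "kinv c0 w : (R^^n) ` U a" if "a : X" for a
    using U(2)[OF that] that by (intro image_eqI[of _ _ a]) (auto simp: X_def)
   moreover have "kinv c0 w ~: (R^^n) ` (- (\<Union>a\<in>X. U a))"
   proof
    assume "kinv c0 w : (R^^n) ` (- (\<Union>a\<in>X. U a))"
    then obtain x where x: "x ~: (\<Union>a\<in>X. U a)" "kinv c0 w = (R^^n) x" by blast
    hence "x : X" by (simp add: X_def)
    thus False using U(2) x(1) by blast
   qed
   ultimately show ?thesis unfolding T0_def by blast
  qed
  define T where "T = ?S Int kinv c0 -` T0"
  have oT: "open T" unfolding T_def using oS open_kinv_vimage[OF `open T0`] by auto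
  define V where "V a = {u : ?C. kinv c0 u : U a & ?p u : T}" for a
  have oV: "open (V a)" if "a : X" for a
  proof -
   have "open (?C Int ?p -` T)"
    using continuous_on_open_vimage[OF oC] holomorphic_on_imp_continuous_on[OF hp] oT by (metis (no_types, lifting) inf_commute)
   moreover have "V a = (?C Int ?p -` T) Int kinv c0 -` U a" by (auto simp: V_def)
   ultimately show ?thesis using open_kinv_vimage[OF U(1)[OF that]] by auto
  qed
  show "EX T. w : T & openin (top_of_set ?S) T & (EX v. \<Union> v = ?C Int ?p -` T & (ALL u:v. openin (top_of_set ?C) u) & pairwise disjnt v & (ALL u:v. EX q. homeomorphism u T ?p q))"
  proof (intro exI[of _ T] exI[of _ "V ` X"] conjI)
   show "w : T" using w wT0 by (simp add: T_def)
   show "openin (top_of_set ?S) T" using oT by (intro open_subset) (auto simp: T_def)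
   show "\<Union> (V ` X) = ?C Int ?p -` T"
   proof
    show "?C Int ?p -` T <= \<Union> (V ` X)"
    proof
     fix u assume u: "u : ?C Int ?p -` T"
     hence "(R^^n) (kinv c0 u) : T0" using kp[of u] by (auto simp: T_def)
     hence "kinv c0 u : (\<Union>a\<in>X. U a)" unfolding T0_def by blast
     thus "u : \<Union> (V ` X)" using u by (auto simp: V_def)
    qed
   qed (auto simp: V_def)
   show "ALL u:V ` X. openin (top_of_set ?C) u"
    using oV by (auto intro!: open_subset simp: V_def)
   show "pairwise disjnt (V ` X)"
    unfolding pairwise_def disjnt_def using Ud by (auto simp: V_def)
   show "ALL u:V ` X. EX q. homeomorphism u T ?p q"
   proof
    fix Va assume "Va : V ` X"
    then obtain a where a: "a : X" "Va = V a" by blast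
    have VC: "V a <= ?C" by (auto simp: V_def)
    have inj: "inj_on ?p (V a)"
    proof (rule inj_onI)
     fix x y assume xy: "x : V a" "y : V a" "?p x = ?p y"
     hence "(R^^n) (kinv c0 x) = (R^^n) (kinv c0 y)" using kp[of x] kp[of y] VC by (metis subsetD)
     hence "kinv c0 x = kinv c0 y" using U(3)[OF a(1)] xy(1,2) by (auto simp: V_def inj_on_def)
     thus "x = y" using inj_kinv injD by metis
    qed
    have hV: "?p holomorphic_on V a" using hp VC holomorphic_on_subset by blast
    obtain q where q: "q holomorphic_on ?p ` V a" "!!z. z : V a ==> q (?p z) = z"
     using holomorphic_has_inverse[OF hV oV[OF a(1)] inj] by metis
    have im: "?p ` V a = T"
    proof
     show "T <= ?p ` V a"
     proof
      fix t assume t: "t : T"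
      then obtain x where x: "x : U a" "(R^^n) x = kinv c0 t" using a(1) unfolding T_def T0_def by force
      have "t : ?S" using t by (simp add: T_def)
      thus "t : ?p ` V a" using pre[OF x(2)] x(1) t by (intro image_eqI[of _ _ "kap c0 x"]) (auto simp: V_def)
     qed
    qed (auto simp: V_def)
    show "EX q. homeomorphism Va T ?p q"
     unfolding a(2) homeomorphism_def
     using q im hV by (intro exI[of _ q]) (auto intro!: holomorphic_on_imp_continuous_on simp: image_image)
   qed
  qed
 qed
qed

lemma sect_exists:
 assumes g: "good u r" and y: "y : disc u r" and x: "(R^^n) x = y"
 obtains g where "sect n u r g" "g y = x"
proof (cases "n = 0")
 case True
 thus ?thesis using that[of id] x by (auto simp: sect_def)
next
 case False
 hence n: "n >= 1" by simp
 have dE: "kinv c0 w ~: En n" if "w : ball u r" for w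
  using g that En_PV unfolding good_def disc_def by blast
 have xc: "x ~= Fin c0" 
 proof
  assume "x = Fin c0"
  hence "y : PV" using x PV_I[OF c0 n] by simp
  thus False using g y unfolding good_def by blast
 qed
 have y': "y = kinv c0 (kap c0 y)" "kap c0 y : ball u r" using disc_kap[OF y] by auto
 have xC: "kap c0 x : {u. (R^^n) (kinv c0 u) ~: insert (Fin c0) (En n)}"
  using xc x dE[OF y'(2)] y'(1) by auto
 obtain h where h: "continuous_on (ball u r) h" "h : ball u r \<rightarrow> {u. (R^^n) (kinv c0 u) ~: insert (Fin c0) (En n)}"
  "h (kap c0 y) = kap c0 x" "!!w. w : ball u r ==> kap c0 ((R^^n) (kinv c0 (h w))) = w"
 proof (rule covering_space_lift_strong[OF covering[OF n] xC y'(2), of "%w. w"])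
  show "simply_connected (ball u r)" by (simp add: convex_imp_simply_connected)
  show "locally path_connected (ball u r)" by (simp add: open_imp_locally_path_connected)
  show "(%w. w) : ball u r \<rightarrow> {w. kinv c0 w ~: En n}" using dE by auto
  show "kap c0 y = kap c0 ((R^^n) (kinv c0 (kap c0 x)))" using xc x by simp
 qed (auto intro: continuous_intros)
 define g' where "g' z = kinv c0 (h (kap c0 z))" for z
 have "continuous_on (disc u r) g'"
  unfolding g'_def
 proof (intro continuous_on_compose2[OF continuous_on_kinv[of UNIV]] continuous_on_compose2[OF h(1)])
  show "continuous_on (disc u r) (kap c0)"
   by (rule continuous_on_subset[OF continuous_on_kap]) (auto simp: disc_def)
 qed (use disc_kap in auto)
 moreover have "(R^^n) (g' z) = z" if z: "z : disc u r" for z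
 proof -
  have "h (kap c0 z) : {u. (R^^n) (kinv c0 u) ~: insert (Fin c0) (En n)}" using h(2) disc_kap[OF z] by blast
  hence "(R^^n) (g' z) ~= Fin c0" by (simp add: g'_def)
  hence "(R^^n) (g' z) = kinv c0 (kap c0 ((R^^n) (g' z)))" by simp
  also have "... = z" using h(4)[OF disc_kap(1)[OF z]] disc_kap(2)[OF z] by (simp add: g'_def)
  finally show ?thesis .
 qed
 moreover have "g' y = x" using h(3) xc by (simp add: g'_def)
 ultimately show ?thesis using that unfolding sect_def by blast
qed

definition hat :: "(rsphere => rsphere) => complex => complex" where
 "hat g w = kap c0 (g (kinv c0 w))"

lemma sect_ne_c0:
 assumes "good u r" "sect n u r g" "y : disc u r"
 shows "g y ~= Fin c0"
proof
 assume a: "g y = Fin c0"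
 obtain ro where "ro > 0" "!!n x. x : ball (Fin c0) ro ==> (R^^n) x ~: disc u r" using assms(1) unfolding good_def by blast
 moreover have "(R^^n) (Fin c0) = y" using assms(2,3) a unfolding sect_def by auto
 ultimately show False using assms(3) by (metis centre_in_ball)
qed

lemma sect_hat: "good u r ==> sect n u r g ==> w : ball u r ==> kinv c0 (hat g w) = g (kinv c0 w)"
 unfolding hat_def by (rule kinv_kap[OF sect_ne_c0]) (auto simp: disc_def)

lemma sect_Rn: "sect n u r g ==> w : ball u r ==> (R^^n) (g (kinv c0 w)) = kinv c0 w"
 unfolding sect_def disc_def by auto

lemma sect_regular:
 assumes "good u r" "sect n u r g" "w : ball u r"
 shows "sph_deriv (R^^n) (g (kinv c0 w)) ~= 0"
proof -
 have "(R^^n) (g (kinv c0 w)) ~: En n"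
 proof -
  have "kinv c0 w : disc u r" using assms(3) by (simp add: disc_def)
  hence "kinv c0 w ~: PV" using assms(1) unfolding good_def by blast
  thus ?thesis using sect_Rn[OF assms(2,3)] En_PV[of n] by auto
 qed
 thus ?thesis using not_En_crit unfolding sph_deriv_prod by (auto simp: crit_def)
qed

lemma hat_deriv:
 assumes g: "good u r" and s: "sect n u r g" and w: "w : ball u r"
 shows "(hat g has_field_derivative deriv (hat g) w) (at w)"
  "sph_deriv (R^^n) (g (kinv c0 w))*(cmod (deriv (hat g) w)*hw c0 (hat g w)) = hw c0 w"
proof -
 define F where "F x = kap c0 ((R^^n) (kinv c0 x))" for x
 have cRk: "continuous_on UNIV (%x. (R^^n) (kinv c0 x))" by (intro sphol_continuous rmap_sphol rmap_Rn)
 define O1 where "O1 = (%x. (R^^n) (kinv c0 x)) -` (- {Fin c0})"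
 have O1: "open O1" unfolding O1_def using continuous_on_open_vimage[of UNIV "%x. (R^^n) (kinv c0 x)"] cRk by auto
 have hF: "F holomorphic_on O1" unfolding F_def O1_def by (intro sphol_kap_holomorphic rmap_sphol rmap_Rn) auto
 have e: "(R^^n) (kinv c0 (hat g x)) = kinv c0 x" if "x : ball u r" for x
  using sect_hat[OF g s that] sect_Rn[OF s that] by simp
 have inO: "hat g w : O1" using e[OF w] by (simp add: O1_def)
 have dF: "(F has_field_derivative deriv F (hat g w)) (at (hat g w))" using holomorphic_derivI[OF hF O1 inO] .
 have "sph_deriv (R^^n) (kinv c0 (hat g w)) = cmod (deriv F (hat g w))*hw c0 (kap c0 ((R^^n) (kinv c0 (hat g w))))/hw c0 (hat g w)"
  by (rule sph_deriv_chart[OF rmap_Rn]) (use e[OF w] dF in "auto simp: F_def[abs_def]")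
 hence sd: "sph_deriv (R^^n) (g (kinv c0 w)) = cmod (deriv F (hat g w))*hw c0 w/hw c0 (hat g w)"
  using e[OF w] sect_hat[OF g s w] by simp
 hence F0: "deriv F (hat g w) ~= 0" using sect_regular[OF g s w] by auto
 have "continuous_on (ball u r) (hat g)"
  unfolding hat_def
 proof (rule continuous_on_compose2[OF continuous_on_kap])
  show "continuous_on (ball u r) (%x. g (kinv c0 x))"
   using s unfolding sect_def disc_def by (intro continuous_on_compose2[OF _ continuous_on_kinv]) auto
  have "g (kinv c0 x) ~= Fin c0" if "x : ball u r" for x by (rule sect_ne_c0[OF g s]) (use that in "simp add: disc_def")
  thus "(%x. g (kinv c0 x)) ` ball u r <= - {Fin c0}" unfolding image_subset_iff by simp
 qed
 hence cg: "isCont (hat g) w" using w continuous_on_eq_continuous_at open_ball by blast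
 have "(hat g has_field_derivative inverse (deriv F (hat g w))) (at w)"
 proof (rule has_field_derivative_inverse_basic[OF dF F0 cg open_ball w])
  show "F (hat g z) = z" if "z : ball u r" for z using e[OF that] by (simp add: F_def)
 qed
 moreover from this have d: "deriv (hat g) w = inverse (deriv F (hat g w))" by (rule DERIV_imp_deriv)
 ultimately show "(hat g has_field_derivative deriv (hat g) w) (at w)" by simp
 show "sph_deriv (R^^n) (g (kinv c0 w))*(cmod (deriv (hat g) w)*hw c0 (hat g w)) = hw c0 w"
  unfolding sd d using F0 hw_pos[of c0 "hat g w"] by (simp add: norm_inverse)
qed

lemma hat_holomorphic: "good u r ==> sect n u r g ==> hat g holomorphic_on ball u r"
 using hat_deriv(1) by (meson field_differentiable_at_within field_differentiable_def holomorphic_on_def)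

lemma hat_inj:
 assumes "good u r" "sect n u r g" shows "inj_on (hat g) (ball u r)"
proof (rule inj_onI)
 fix x y assume xy: "x : ball u r" "y : ball u r" "hat g x = hat g y"
 hence "g (kinv c0 x) = g (kinv c0 y)" using sect_hat[OF assms] by metis
 hence "kinv c0 x = kinv c0 y" using sect_Rn[OF assms(2)] xy by metis
 thus "x = y" using inj_kinv injD by metis
qed

lemma hat_deriv_pos:
 assumes "good u r" "sect n u r g" "w : ball u r"
 shows "cmod (deriv (hat g) w) > 0"
 using holomorphic_injective_imp_regular[OF hat_holomorphic[OF assms(1,2)] open_ball hat_inj[OF assms(1,2)] assms(3)] by simp

definition cA :: real where "cA = pi*(1 + cmod c0)^2"

lemma cA: "cA > 0" "dist (kinv c0 x) (kinv c0 y) <= cA*cmod (x - y)"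
proof -
 have "1 + cmod c0 > 0" using norm_ge_zero[of c0] by linarith
 thus "cA > 0" unfolding cA_def by (intro mult_pos_pos pi_gt_zero zero_less_power)
 show "dist (kinv c0 x) (kinv c0 y) <= cA*cmod (x - y)"
  using dist_kinv_le[of c0 x y] by (simp add: cA_def mult_ac)
qed

section \<open>Contraction of inverse branches\<close>

lemma uniformly_perfect:
 assumes "et > 0"
 obtains ta where "ta > 0" "!!y. y : J ==> EX z:J. ta <= dist z y & dist z y < et"
proof (rule ccontr)
 assume a: "~ thesis"
 have "EX y:J. ALL z:J. dist z y < et --> dist z y < 1/real (Suc n)" for n
  using that[of "1/real (Suc n)"] a by (metis not_less of_nat_0_less_iff zero_less_Suc zero_less_divide_1_iff)
 then obtain y where y: "!!n. y n : J" "!!n z. z : J ==> dist z (y n) < et ==> dist z (y n) < 1/real (Suc n)" by metis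
 obtain l r where r: "strict_mono (r :: nat => nat)" "(y o r) ----> l" by (rule rsphere_convergent_subseq)
 have "l : J" using lim_julia[OF r(2)] y(1) by simp
 then obtain z where z: "z : J" "z ~= l" "dist z l < et" using julia_perfect assms by metis
 have lim: "(%k. dist z (y (r k))) ----> dist z l"
  using tendsto_dist[OF tendsto_const r(2), of z] by (simp add: o_def)
 note inv = inverse_Suc_subseq[OF r(1)]
 have "EVS k. dist z (y (r k)) < et" using order_tendstoD(2)[OF lim z(3)] .
 hence "EVS k. dist z (y (r k)) <= 1/real (Suc (r k))"
  by eventually_elim (use y(2) z(1) in "auto intro: less_imp_le")
 hence "dist z l <= 0" using tendsto_le[OF sequentially_bot inv lim] by blast
 thus False using z by simp
qed

lemma kap_uniform:
 assumes "ee > 0"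
 obtains ta where "ta > 0" "!!x y. x : J ==> dist y x < ta ==> y ~= Fin c0 & cmod (kap c0 y - kap c0 x) < ee"
proof (rule ccontr)
 assume a: "~ thesis"
 have "EX x y. x : J & dist y x < 1/real (Suc n) & ~ (y ~= Fin c0 & cmod (kap c0 y - kap c0 x) < ee)" for n
  using that[of "1/real (Suc n)"] a by (metis of_nat_0_less_iff zero_less_Suc zero_less_divide_1_iff)
 then obtain x y where xy: "!!n. x n : J" "!!n. dist (y n) (x n) < 1/real (Suc n)"
  "!!n. ~ (y n ~= Fin c0 & cmod (kap c0 (y n) - kap c0 (x n)) < ee)" by metis
 obtain l r where r: "strict_mono (r :: nat => nat)" "(x o r) ----> l" by (rule rsphere_convergent_subseq)
 have "l : J" using lim_julia[OF r(2)] xy(1) by simp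
 hence lc: "l ~= Fin c0" using c0 crit_fatou by (auto simp: julia_def)
 note inv = inverse_Suc_subseq[OF r(1)]
 have lx: "(%k. x (r k)) ----> l" using r(2) by (simp add: o_def)
 have "(%k. dist (y (r k)) (x (r k))) ----> 0"
  by (rule Lim_null_comparison[OF _ inv]) (use xy(2) in "auto intro!: always_eventually less_imp_le")
 moreover have "(%k. dist (x (r k)) l) ----> 0" using lx by (rule iffD1[OF tendsto_dist_iff])
 ultimately have "(%k. dist (y (r k)) (x (r k)) + dist (x (r k)) l) ----> 0 + 0" by (rule tendsto_add)
 hence "(%k. dist (y (r k)) l) ----> 0"
  by (intro Lim_null_comparison[of "%k. dist (y (r k)) l"]) (auto intro!: always_eventually dist_triangle)
 hence ly: "(%k. y (r k)) ----> l" by (rule iffD2[OF tendsto_dist_iff])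
 have "(%k. kap c0 (y (r k)) - kap c0 (x (r k))) ----> kap c0 l - kap c0 l"
  by (intro tendsto_diff isCont_tendsto_compose[OF isCont_kap[OF lc]] lx ly)
 hence "EVS k. dist (kap c0 (y (r k)) - kap c0 (x (r k))) 0 < ee"
  using tendstoD assms by (metis diff_self)
 moreover have "EVS k. y (r k) ~= Fin c0" by (rule tendsto_imp_eventually_ne[OF ly lc])
 ultimately have "EVS k. False" by eventually_elim (use xy(3) in auto)
 thus False by simp
qed

text \<open>Inverse branches contract. Otherwise \<open>R ^^ n\<close> would map a disc of definite size into a small one,
 with bounded distortion; but by expansivity it maps an arbitrarily small piece of the Julia set onto one of
 definite size.\<close>

lemma shrink_deriv_centre:
 assumes g: "good u r" and u: "kinv c0 u : J" and ee: "ee > 0"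
 obtains N where "!!n g. n >= N ==> sect n u r g ==> cmod (deriv (hat g) u) < ee"
proof -
 have r: "r > 0" using g by (simp add: good_def)
 obtain et where et: "et > 0" "!!n w y. w : J ==> y : J ==>
  dist y ((R^^n) w) < et ==> EX z:J. pullback n y w v z"
  by (rule lift_julia[OF v_props(1)]) blast
 obtain ta1 where ta1: "ta1 > 0" "!!y. y : J ==> EX z:J. ta1 <= dist z y & dist z y < et" using uniformly_perfect[OF et(1)] by metis
 \<comment> \<open>The first bound is the one required by \<open>koebe_cover\<close>. The second
   keeps the disc of radius \<open>s\<close> on the sphere within less than \<open>ta1\<close> of
   its centre, so that it cannot contain the point \<open>z\<close> chosen below at distance at
   least \<open>ta1\<close>.\<close>
 define s where "s = min (r/(160 * kK)) (ta1/(2*cA))"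
 have s: "0 < s" "s <= r/(160 * kK)" "cA * s < ta1"
 proof -
  show "0 < s" "s <= r/(160 * kK)" using r kK cA(1) ta1(1) by (auto simp: s_def)
  have "cA * s <= cA*(ta1/(2*cA))" using cA(1) by (intro mult_left_mono) (auto simp: s_def)
  thus "cA * s < ta1" using cA(1) ta1(1) by simp
 qed
 have p: "s/10*ee > 0" using s ee by simp
 obtain ta where ta: "ta > 0" "!!x y. x : J ==> dist y x < ta ==> y ~= Fin c0 & cmod (kap c0 y - kap c0 x) < s/10*ee"
  using kap_uniform[OF p] by metis
 obtain N where N: "!!x y. x : J ==> y : J ==> (!!i. i <= N ==> dist ((R^^i) x) ((R^^i) y) <= v) ==> dist x y < ta"
  using uniform_expansion[OF ta(1)] by metis
 have "cmod (deriv (hat g) u) < ee" if n: "n >= N" and sg: "sect n u r g" for n g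
 proof (rule ccontr)
  assume "~ cmod (deriv (hat g) u) < ee"
  hence de: "ee <= cmod (deriv (hat g) u)" by simp
  have ub: "u : ball u r" using r by simp
  define x0 where "x0 = g (kinv c0 u)"
  have Rx0: "(R^^n) x0 = kinv c0 u" unfolding x0_def by (rule sect_Rn[OF sg ub])
  have x0J: "x0 : J" using u Rx0 J_Rn by metis
  have cov: "ball (hat g u) (s/10*cmod (deriv (hat g) u)) <= hat g ` ball u s"
   by (rule koebe_cover[OF hat_holomorphic[OF g sg] hat_inj[OF g sg] r _ s(1,2)]) (use r in simp)
  obtain z where z: "z : J" "ta1 <= dist z (kinv c0 u)" "dist z (kinv c0 u) < et" using ta1(2)[OF u] by blast
  obtain x where x: "x : J" "(R^^n) x = z" "!!i. i <= n ==> dist ((R^^i) x) ((R^^i) x0) < v"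
   using et(2)[OF x0J z(1), of n] z(3) Rx0 by auto
  have "dist x x0 < ta" by (rule N[OF x(1) x0J]) (use x(3) n in "auto intro: less_imp_le")
  hence xc: "x ~= Fin c0" and xc2: "cmod (kap c0 x - kap c0 x0) < s/10*ee" using ta(2)[OF x0J] by auto
  note xc2
  also have "s/10*ee <= s/10*cmod (deriv (hat g) u)" using de s by (intro mult_left_mono) auto
  finally have "kap c0 x : ball (hat g u) (s/10*cmod (deriv (hat g) u))"
   by (simp add: hat_def x0_def dist_norm norm_minus_commute)
  then obtain w where w: "w : ball u s" "kap c0 x = hat g w" using cov by blast
  have "r/(160 * kK) <= r/160" using r kK by (intro divide_left_mono) auto
  hence "s < r" using s(2) r by linarith
  hence wb: "w : ball u r" using w(1) by auto
  have "x = g (kinv c0 w)" using sect_hat[OF g sg wb] w(2) kinv_kap[OF xc] by simp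
  hence "z = kinv c0 w" using x(2) sect_Rn[OF sg wb] by simp
  hence "dist z (kinv c0 u) <= cA*cmod (w - u)" using cA(2) by simp
  also have "... <= cA * s" using w(1) cA(1) by (intro mult_left_mono) (auto simp: dist_norm norm_minus_commute)
  finally show False using z(2) s(3) by simp
 qed
 thus ?thesis using that by blast
qed

lemma shrink_deriv:
 assumes g: "good u r" and u: "kinv c0 u : J" and ee: "ee > 0"
 obtains N where "!!n g w. n >= N ==> sect n u r g ==> w : ball u (r/10) ==> cmod (deriv (hat g) w) < ee"
proof -
 have p: "ee/kK > 0" using ee kK by simp
 have r: "r > 0" using g by (simp add: good_def)
 obtain N where N: "!!n g. n >= N ==> sect n u r g ==> cmod (deriv (hat g) u) < ee/kK"
  using shrink_deriv_centre[OF g u p] by metis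
 show ?thesis
 proof (rule that)
  fix n h w assume a: "n >= N" "sect n u r h" "w : ball u (r/10)"
  have "cmod (deriv (hat h) w) <= kK*cmod (deriv (hat h) u)"
   by (rule koebe_two_point[OF hat_holomorphic[OF g a(2)] hat_inj[OF g a(2)] r a(3)]) (use r in simp)
  also have "... < kK*(ee/kK)" using N[OF a(1,2)] kK by (intro mult_strict_left_mono) auto
  finally show "cmod (deriv (hat h) w) < ee" using kK by simp
 qed
qed

lemma sect_lipschitz:
 assumes g: "good u r" and s: "sect n u r g" and w: "w : ball u (r/10)"
  and y: "y : disc u (r/10)" "z : disc u (r/10)"
 shows "dist (g y) (g z) <= cA*(kK*cmod (deriv (hat g) w)*cmod (kap c0 y - kap c0 z))"
proof -
 have r: "r > 0" using g by (simp add: good_def)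
 have b: "kap c0 y : ball u (r/10)" "kap c0 z : ball u (r/10)" "kinv c0 (kap c0 y) = y" "kinv c0 (kap c0 z) = z"
  using disc_kap(1)[OF y(1)] disc_kap(1)[OF y(2)] disc_kap(2)[OF y(1)] disc_kap(2)[OF y(2)] by auto
 hence b': "kap c0 y : ball u r" "kap c0 z : ball u r" using r by auto
 have "dist (g y) (g z) = dist (kinv c0 (hat g (kap c0 y))) (kinv c0 (hat g (kap c0 z)))"
  using sect_hat[OF g s] b' b by simp
 also have "... <= cA*cmod (hat g (kap c0 y) - hat g (kap c0 z))" by (rule cA)
 also have "... <= cA*(kK*cmod (deriv (hat g) w)*cmod (kap c0 y - kap c0 z))"
  using cA(1) by (intro mult_left_mono koebe_bilipschitz[OF hat_holomorphic[OF g s] hat_inj[OF g s] r b(1,2) w]) auto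
 finally show ?thesis .
qed

lemma shrink_dist:
 assumes g: "good u r" and u: "kinv c0 u : J" and ee: "ee > 0"
 obtains N where "!!n g y z. n >= N ==> sect n u r g ==> y : disc u (r/10) ==> z : disc u (r/10) ==> dist (g y) (g z) < ee"
proof -
 have r: "r > 0" using g by (simp add: good_def)
 define e where "e = ee/(cA * kK*r)"
 have e: "e > 0" using ee cA(1) kK r by (simp add: e_def)
 obtain N where N: "!!n g w. n >= N ==> sect n u r g ==> w : ball u (r/10) ==> cmod (deriv (hat g) w) < e"
  using shrink_deriv[OF g u e] by metis
 show ?thesis
 proof (rule that)
  fix n h y z assume a: "n >= N" "sect n u r h" "y : disc u (r/10)" "z : disc u (r/10)"
  have ub: "u : ball u (r/10)" using r by simp
  have "cmod (kap c0 y - kap c0 z) < r"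
  proof -
   have "dist (kap c0 y) (kap c0 z) < r/10 + r/10"
    using disc_kap(1)[OF a(3)] disc_kap(1)[OF a(4)] dist_triangle[of "kap c0 y" "kap c0 z" u] by (simp add: dist_commute)
   thus ?thesis using r by (simp add: dist_norm)
  qed
  hence "cmod (deriv (hat h) u)*cmod (kap c0 y - kap c0 z) <= cmod (deriv (hat h) u)*r"
   by (intro mult_left_mono) auto
  also have "... < e*r" using N[OF a(1,2) ub] r by (intro mult_strict_right_mono) auto
  finally have "cA*(kK*(cmod (deriv (hat h) u)*cmod (kap c0 y - kap c0 z))) < cA*(kK*(e*r))"
   using cA(1) kK by (intro mult_strict_left_mono) auto
  thus "dist (h y) (h z) < ee"
   using sect_lipschitz[OF g a(2) ub a(3,4)] cA(1) kK r by (simp add: e_def mult.assoc)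
 qed
qed

lemma sect_unique:
 assumes g: "good u r" and s1: "sect n u r g" and s2: "sect n u r h"
  and y: "y : disc u r" "g y = h y" and z: "z : disc u r"
 shows "g z = h z"
proof -
 define A where "A = {z : disc u r. g z = h z}"
 have c: "continuous_on (disc u r) g" "continuous_on (disc u r) h" using s1 s2 by (auto simp: sect_def)
 have "closedin (top_of_set (disc u r)) {z : disc u r. dist (g z) (h z) = 0}"
  by (intro continuous_closedin_preimage_constant continuous_intros c)
 hence cl: "closedin (top_of_set (disc u r)) A" by (simp add: A_def)
 have "open A"
  unfolding open_subopen[of A]
 proof
  fix x assume "x : A"
  hence x: "x : disc u r" "g x = h x" by (auto simp: A_def)
  have Rx: "(R^^n) (g x) = x" using s1 x(1) by (simp add: sect_def)
  have "x ~: En n" using x(1) g En_PV[of n] unfolding good_def by blast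
  hence "!!k. k < n ==> (R^^k) (g x) ~: crit" using not_En_crit[of n "g x"] Rx by simp
  then obtain U where U: "open U" "g x : U" "inj_on (R^^n) U" using locally_injective_n[of n "g x"] by blast
  define B where "B = disc u r Int g -` U Int (disc u r Int h -` U)"
  have oB: "open B" unfolding B_def
   by (intro open_Int continuous_open_preimage c disc_open U(1))
  have "x : B" using x U(2) by (simp add: B_def)
  moreover have "B <= A"
  proof
   fix w assume w: "w : B"
   hence "(R^^n) (g w) = (R^^n) (h w)" using s1 s2 by (simp add: B_def sect_def)
   hence "g w = h w" by (rule inj_onD[OF U(3)]) (use w in "simp_all add: B_def")
   thus "w : A" using w by (simp add: A_def B_def)
  qed
  ultimately show "EX T. open T & x : T & T <= A" using oB by blast
 qed
 hence op: "openin (top_of_set (disc u r)) A" by (rule open_subset[rotated]) (auto simp: A_def)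
 have "A = {} | A = disc u r" using disc_connected op cl unfolding connected_clopen by blast
 thus ?thesis using y z unfolding A_def by blast
qed

lemma sect_subset: "sect n u r g ==> s <= r ==> sect n u s g"
 unfolding sect_def using disc_mono[of s r u] continuous_on_subset by blast

lemma sect_J: "sect n u r g ==> y : disc u r ==> g y : J \<longleftrightarrow> y : J"
 unfolding sect_def using J_Rn[of n "g y"] by simp

text \<open>The ball of radius \<open>e = cmod (x - y)/(160 * kK)\<close> around \<open>x\<close>
  does not contain \<open>y\<close>, and its image covers a disc around \<open>hat g x\<close> by
  \<open>koebe_cover\<close>. Since \<open>hat g\<close> is injective, \<open>hat g y\<close> lies
  outside that disc. The factor is \<open>10*160\<close>, with one \<open>kK\<close> from
  \<open>e\<close> and one from moving the derivative to \<open>u0\<close>.\<close>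

lemma hat_lower:
 assumes g: "good u r" and s: "sect n u r g" and x: "x : ball u (r/20)" and y: "y : ball u (r/20)"
 shows "cmod (deriv (hat g) u)*cmod (x - y)/(1600 * kK^2) <= cmod (hat g x - hat g y)"
proof (cases "x = y")
 case False
 have r: "r > 0" using g by (simp add: good_def)
 have d: "cmod (x - y) < r/10"
  using x y dist_triangle[of x y u] by (simp add: dist_norm[symmetric] dist_commute)
 define e where "e = cmod (x - y)/(160 * kK)"
 have e: "e > 0" "e <= r/(160 * kK)" "e <= cmod (x - y)"
 proof -
  show "e > 0" "e <= r/(160 * kK)" using False kK d r by (auto simp: e_def intro!: divide_right_mono)
  have "cmod (x - y)*1 <= cmod (x - y)*(160 * kK)" using kK by (intro mult_left_mono) auto
  thus "e <= cmod (x - y)" using kK by (simp add: e_def divide_le_eq)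
 qed
 have xr: "x : ball u r" "y : ball u r" using x y r by auto
 have "hat g y ~: hat g ` ball x e"
 proof
  assume "hat g y : hat g ` ball x e"
  then obtain w where w: "w : ball x e" "hat g y = hat g w" by blast
  have "dist u w < r"
   using dist_triangle[of u w x] x w(1) e(3) d r by auto
  hence "y = w" using inj_onD[OF hat_inj[OF g s] w(2) xr(2)] by simp
  thus False using w(1) e(3) by (simp add: dist_norm)
 qed
 hence "hat g y ~: ball (hat g x) (e/10*cmod (deriv (hat g) x))"
  using koebe_cover[OF hat_holomorphic[OF g s] hat_inj[OF g s] r x e(1,2)] by blast
 hence "e/10*cmod (deriv (hat g) x) <= cmod (hat g x - hat g y)" by (simp add: dist_norm)
 moreover have "e/10*(cmod (deriv (hat g) u)/kK) <= e/10*cmod (deriv (hat g) x)"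
 proof (rule mult_left_mono)
  have "cmod (deriv (hat g) u) <= kK*cmod (deriv (hat g) x)"
   by (rule koebe_two_point[OF hat_holomorphic[OF g s] hat_inj[OF g s] r]) (use r x in auto)
  thus "cmod (deriv (hat g) u)/kK <= cmod (deriv (hat g) x)" using kK by (simp add: divide_le_eq mult.commute)
 qed (use e in simp)
 ultimately show ?thesis by (simp add: e_def power2_eq_square mult_ac)
qed simp

end

section \<open>Families of inverse branches\<close>

text \<open>The good disc is ten times as large as the working disc because the Koebe estimates hold
  on a tenth of the disc of univalence.\<close>

locale based = expansive_rational +
 fixes u0 :: complex and r1 :: real
 assumes good10: "good u0 (10*r1)" and u0J: "kinv c0 u0 : J"
begin

lemma r1: "r1 > 0" using good10 by (simp add: good_def)

lemma good1: "good u0 r1" using good_subset[OF good10 r1] r1 by simp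

abbreviation "D1 \<equiv> disc u0 r1"
abbreviation "D2 \<equiv> disc u0 (r1/40)"
abbreviation "yy \<equiv> kinv c0 u0"

text \<open>The letters. That the image lies in the much smaller disc \<open>D2\<close> bounds the
  derivative by Cauchy's estimate and keeps the points at which the next branch is evaluated inside
  the discs where the Koebe estimates hold.\<close>

definition ret :: "nat => (rsphere => rsphere) => bool" where
 "ret n g \<longleftrightarrow> sect n u0 r1 g & g ` D1 <= D2"

definition aa :: "(rsphere => rsphere) => real" where "aa g = cmod (deriv (hat g) u0)"

lemma D21: "D2 <= D1" using disc_mono r1 by simp

lemma yy: "yy : D2" "yy : D1" "yy : J" using u0J r1 by (auto simp: disc_def)

lemma ret_sect: "ret n g ==> sect n u0 r1 g" by (simp add: ret_def)

lemma ret_D2: "ret n g ==> y : D1 ==> g y : D2" "ret n g ==> y : D1 ==> g y : D1"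
 using D21 unfolding ret_def by blast+

lemma sect_R: "sect n u0 r1 g ==> y : D1 ==> (R^^n) (g y) = y" by (simp add: sect_def)

lemma sect_comp:
 assumes s: "sect n u0 r1 g" and h: "ret k h"
 shows "sect (n + k) u0 r1 (g o h)"
proof -
 have "continuous_on D1 (g o h)"
 proof (rule continuous_on_compose)
  show "continuous_on D1 h" using h by (simp add: sect_def ret_def)
  show "continuous_on (h ` D1) g"
   by (rule continuous_on_subset[of D1]) (use s h D21 in "auto simp: sect_def ret_def")
 qed
 moreover have "(R^^(n + k)) (g (h y)) = y" if "y : D1" for y
 proof -
  have "(R^^(n + k)) (g (h y)) = (R^^k) ((R^^n) (g (h y)))" by (simp add: add.commute[of n k] funpow_add)
  thus ?thesis using sect_R[OF s ret_D2(2)[OF h that]] sect_R[OF ret_sect[OF h] that] by simp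
 qed
 ultimately show ?thesis by (simp add: sect_def)
qed

lemma ret_comp: "ret n g ==> ret k h ==> ret (n + k) (g o h)"
 using sect_comp[OF ret_sect] ret_D2 unfolding ret_def by (auto simp: image_subset_iff)

lemma aa_pos: "sect n u0 r1 g ==> aa g > 0"
 unfolding aa_def using hat_deriv_pos[OF good1] r1 by simp

text \<open>The chain rule takes the derivative of \<open>g\<close> at the image of the centre, and
  moving it back to the centre costs one Koebe constant. Hence \<open>aa g/kK\<close> is
  supermultiplicative, and weights are built from it.\<close>

lemma aa_comp:
 assumes s: "sect n u0 r1 g" and h: "ret k h"
 shows "aa g/kK*aa h <= aa (g o h)"
proof -
 have u: "u0 : ball u0 r1" "u0 : ball u0 (r1/10)" using r1 by auto
 have hu: "hat h u0 : ball u0 (r1/40)" using disc_kap(1)[OF ret_D2(1)[OF h yy(2)]] by (simp add: hat_def)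
 hence hu': "hat h u0 : ball u0 r1" "hat h u0 : ball u0 (r1/10)" using r1 by auto
 have e: "hat (g o h) w = hat g (hat h w)" if "w : ball u0 r1" for w
  using sect_hat[OF good1 ret_sect[OF h] that] by (simp add: hat_def)
 have "((%w. hat g (hat h w)) has_field_derivative deriv (hat g) (hat h u0)*deriv (hat h) u0) (at u0)"
  using DERIV_chain2[OF hat_deriv(1)[OF good1 s hu'(1)] hat_deriv(1)[OF good1 ret_sect[OF h] u(1)]] .
 hence "(hat (g o h) has_field_derivative deriv (hat g) (hat h u0)*deriv (hat h) u0) (at u0)"
  by (rule has_field_derivative_transform_within_open[OF _ open_ball u(1)]) (simp add: e)
 hence a: "aa (g o h) = cmod (deriv (hat g) (hat h u0))*aa h"
  by (simp add: aa_def norm_mult DERIV_imp_deriv)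
 have "aa g <= kK*cmod (deriv (hat g) (hat h u0))"
  unfolding aa_def by (rule koebe_two_point[OF hat_holomorphic[OF good1 s] hat_inj[OF good1 s] r1 u(2) hu'(2)])
 hence "aa g/kK <= cmod (deriv (hat g) (hat h u0))" using kK by (simp add: divide_le_eq mult.commute)
 thus ?thesis unfolding a by (intro mult_right_mono) (simp_all add: aa_def)
qed

definition fam :: "(nat \<times> (rsphere => rsphere)) set => bool" where
 "fam F \<longleftrightarrow> finite F & (ALL x:F. fst x >= 1 & ret (fst x) (snd x)) &
  (ALL x:F. ALL y:F. x ~= y --> snd x ` D1 Int snd y ` D1 = {})"

lemma fam_ret: "fam F ==> x : F ==> ret (fst x) (snd x)" by (auto simp: fam_def)

lemma fam_eqI: "fam F ==> x : F ==> y : F ==> a : D1 ==> b : D1 ==> snd x a = snd y b ==> x = y"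
 unfolding fam_def by (metis disjoint_iff image_eqI)

end

text \<open>The measure lives on a space of codes, and only a measurable superset \<open>B\<close>
  of the preimage of \<open>U\<close> is asked for, so measurability of \<open>pt\<close> never
  comes up. The error \<open>et\<close> handles sets of diameter zero; for the \<open>i\<close>-th
  set of a cover it is \<open>(1/2)^(i + 2)\<close>, altogether half of the mass.\<close>

lemma mass_distribution:
 fixes P :: "'b measure" and pt :: "'b => 'a::metric_space"
 assumes "prob_space P" and pt: "!!x. x : space P ==> pt x : A" and C: "C >= 0"
  and B: "!!U et. bounded U ==> et > 0 ==>
   EX B:sets P. {x : space P. pt x : U} <= B & emeasure P B <= ennreal (C*diameter U powr s + et)"
 shows "hausdorff_outer s A > 0"
proof -
 have half: "(\<Sum>i. ennreal ((1/2)^(i + 2))) = ennreal (1/2)"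
 proof -
  have "(%i. (1/2::real)^Suc i/2) sums (1/2)" using sums_divide[OF power_half_series, of 2] .
  hence "(%i. (1/2::real)^(i + 2)) sums (1/2)" by simp
  thus ?thesis by (rule suminf_ennreal_eq[rotated]) simp
 qed
 have "ennreal (1/(2*(C + 1))) <= hausdorff_pre s 1 A"
  unfolding hausdorff_pre_def
 proof (rule INF_greatest)
  fix U assume "U : {U. A <= (\<Union>i::nat. U i) & (ALL i. bounded (U i) & diameter (U i) <= 1)}"
  hence U: "A <= (\<Union>i. U i)" "!!i. bounded (U i)" by auto
  have "EX V:sets P. {x : space P. pt x : U i} <= V & emeasure P V <= ennreal (C*diameter (U i) powr s + (1/2)^(i + 2))" for i
   by (rule B) (use U in auto)
  then obtain V where V: "!!i. V i : sets P" "!!i. {x : space P. pt x : U i} <= V i"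
   "!!i. emeasure P (V i) <= ennreal (C*diameter (U i) powr s + (1/2)^(i + 2))" by metis
  have "space P <= (\<Union>i. V i)"
  proof
   fix x assume x: "x : space P"
   then obtain i where "pt x : U i" using pt U(1) by blast
   thus "x : (\<Union>i. V i)" using V(2)[of i] x by blast
  qed
  hence "emeasure P (space P) <= emeasure P (\<Union>i. V i)" by (intro emeasure_mono) (use V(1) in auto)
  also have "... <= (\<Sum>i. emeasure P (V i))" by (rule emeasure_subadditive_countably) (use V(1) in auto)
  also have "... <= (\<Sum>i. ennreal C*ennreal (diameter (U i) powr s) + ennreal ((1/2)^(i + 2)))"
  proof (rule suminf_le)
   show "emeasure P (V i) <= ennreal C*ennreal (diameter (U i) powr s) + ennreal ((1/2)^(i + 2))" for i
    using V(3)[of i] C by (subst (asm) ennreal_plus) (simp_all add: ennreal_mult del: power_Suc)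
  qed auto
  also have "... = ennreal C*(\<Sum>i. ennreal (diameter (U i) powr s)) + ennreal (1/2)"
   by (simp only: half[symmetric] ennreal_suminf_cmult[symmetric]) (rule suminf_add[symmetric]; simp)
  finally have le: "1 <= ennreal C*(\<Sum>i. ennreal (diameter (U i) powr s)) + ennreal (1/2)"
   by (simp only: prob_space.emeasure_space_1[OF assms(1)])
  show "ennreal (1/(2*(C + 1))) <= (\<Sum>i. ennreal (diameter (U i) powr s))"
  proof (cases "(\<Sum>i. ennreal (diameter (U i) powr s))")
   case (real t)
   have "ennreal C*ennreal t + ennreal (1/2) = ennreal (C*t + 1/2)"
    using C real(1) by (subst ennreal_plus) (auto simp: ennreal_mult)
   hence "ennreal 1 <= ennreal (C*t + 1/2)" using le unfolding real(2) ennreal_1 by (simp only:)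
   hence "1 <= C*t + 1/2" using C real(1) by (subst (asm) ennreal_le_iff) simp_all
   hence "1/2 <= t*(C + 1)" using real(1) by (simp add: algebra_simps)
   hence "1/(2*(C + 1)) <= t" using C by (simp add: divide_le_eq algebra_simps)
   thus ?thesis using real by (simp add: ennreal_leI)
  qed simp
 qed
 moreover have "hausdorff_pre s 1 A <= hausdorff_outer s A"
  unfolding hausdorff_outer_def by (rule SUP_upper) simp
 moreover have "0 < ennreal (1/(2*(C + 1)))" using C by simp
 ultimately show ?thesis by (metis less_le_trans)
qed

lemma finite_uniform:
 fixes P :: "'a => real => bool"
 assumes "finite Z" "!!z. z : Z ==> EX e>0. P z e" "!!z e e'. P z e ==> 0 < e' ==> e' <= e ==> P z e'"
 shows "EX e>0. ALL z:Z. P z e"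
 using assms(1,2)
proof (induction Z rule: finite_induct)
 case empty
 thus ?case by (auto intro: exI[of _ 1])
next
 case (insert z Z)
 obtain e where e: "e > 0" "ALL z:Z. P z e" using insert by auto
 obtain e' where e': "e' > 0" "P z e'" using insert.prems by auto
 have "ALL y:insert z Z. P y (min e e')" using e e' assms(3)[of _ _ "min e e'"] by auto
 thus ?case using e(1) e'(1) by (intro exI[of _ "min e e'"]) simp
qed

lemma slow_sequence:
 fixes P :: "nat => nat => bool"
 assumes "!!j. EX N. ALL i>=N. P j i" "!!i. P 0 i"
 obtains j where "filterlim j at_top sequentially" "!!i. P (j i) i"
proof -
 obtain N where N: "!!j i. i >= N j ==> P j i" using assms(1) by metis
 define A where "A i = {k. k <= i & (k = 0 | N k <= i)}" for i
 have A: "finite (A i)" "A i ~= {}" for i unfolding A_def by auto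
 show ?thesis
 proof (rule that)
  show "filterlim (%i. Max (A i)) at_top sequentially"
   unfolding filterlim_at_top
  proof
   fix k
   have "k <= Max (A i)" if "i >= max k (N k)" for i using that A by (intro Max_ge) (auto simp: A_def)
   thus "EVS i. k <= Max (A i)" by (rule eventually_sequentiallyI)
  qed
  show "P (Max (A i)) i" for i using Max_in[OF A, of i] N assms(2) unfolding A_def by auto
 qed
qed

definition bsum :: "(rsphere => rsphere) => (rsphere => real) => nat => rsphere => real" where
 "bsum R ph n x = (\<Sum>k<n. ph ((R^^k) x))"

lemma bsum_add: "bsum R ph (m + n) x = bsum R ph m x + bsum R ph n ((R^^m) x)"
proof (induction n)
 case (Suc n)
 have "(R^^(m + n)) x = (R^^n) ((R^^m) x)" by (simp add: add.commute[of m n] funpow_add)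
 thus ?case using Suc unfolding bsum_def by simp
qed (simp add: bsum_def)

lemma bsum_bound:
 assumes "!!k. k < n ==> \<bar>ph ((R^^k) x) - c\<bar> <= B"
 shows "\<bar>bsum R ph n x - real n*c\<bar> <= real n*B"
proof -
 have "bsum R ph n x - real n*c = (\<Sum>k<n. ph ((R^^k) x) - c)" by (simp add: bsum_def sum_subtractf)
 also have "\<bar>...\<bar> <= (\<Sum>k<n. \<bar>ph ((R^^k) x) - c\<bar>)" by (rule sum_abs)
 also have "... <= (\<Sum>k<n. B)" by (rule sum_mono) (use assms in auto)
 finally show ?thesis by simp
qed

lemma level_I:
 assumes "x : julia R" "!!ee. ee > 0 ==> EX C. ALL n. \<bar>bsum R ph n x - real n*al\<bar> <= ee*real n + C"
 shows "x : birkhoff_level R ph al"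
proof -
 have "(%n. birkhoff_avg R ph n x) ----> al"
 proof (rule LIMSEQ_I)
  fix e :: real assume e: "e > 0"
  obtain C where C: "!!n. \<bar>bsum R ph n x - real n*al\<bar> <= e/2*real n + C" using assms(2)[of "e/2"] e by auto
  obtain N where N: "real N > 2*\<bar>C\<bar>/e" using reals_Archimedean2 by blast
  have "norm (birkhoff_avg R ph n x - al) < e" if n: "n >= Suc N" for n
  proof -
   have "2*\<bar>C\<bar>/e < real n" using N n by linarith
   hence "\<bar>C\<bar> < e/2*real n" using e by (simp add: divide_less_eq mult.commute)
   hence lt: "\<bar>bsum R ph n x - real n*al\<bar> < e*real n" using C[of n] abs_ge_self[of C] by (simp add: field_simps)
   have "birkhoff_avg R ph n x - al = (bsum R ph n x - real n*al)/real n"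
    using n by (simp add: birkhoff_avg_def bsum_def field_simps)
   thus ?thesis using lt n by (simp add: abs_divide divide_less_eq)
  qed
  thus "EX no. ALL n>=no. norm (birkhoff_avg R ph n x - al) < e" by blast
 qed
 thus ?thesis using assms(1) by (simp add: birkhoff_level_def)
qed

section \<open>Coding by infinite words of letters\<close>

context based
begin

definition Dc :: "rsphere set" where "Dc = kinv c0 ` cball u0 (r1/40)"

lemma Dc: "D2 <= Dc" "Dc <= D1" "compact Dc" "yy : Dc"
proof -
 show "D2 <= Dc" "Dc <= D1" "yy : Dc" using r1 by (auto simp: Dc_def disc_def)
 show "compact Dc" unfolding Dc_def by (intro compact_continuous_image continuous_on_kinv compact_cball)
qed

lemma Dc_kap: "y : Dc ==> kap c0 y : cball u0 (r1/40)" "y : Dc ==> kinv c0 (kap c0 y) = y"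
 unfolding Dc_def by auto

lemma aa_le: "ret n g ==> aa g <= 1"
proof -
 assume g: "ret n g"
 have b: "hat g w : ball u0 (r1/40)" if "w : ball u0 r1" for w
  using disc_kap(1)[OF ret_D2(1)[OF g, of "kinv c0 w"]] that by (simp add: hat_def disc_def)
 have h: "hat g holomorphic_on ball u0 r1" by (rule hat_holomorphic[OF good1 ret_sect[OF g]])
 have sub: "ball u0 (r1/2) <= ball u0 r1" "cball u0 (r1/2) <= ball u0 r1" using r1 by auto
 have "norm ((deriv^^1) (hat g) u0) <= fact 1*(r1/40)/(r1/2)^1"
 proof (rule Cauchy_higher_deriv_bound)
  show "hat g holomorphic_on ball u0 (r1/2)" using h sub(1) by (rule holomorphic_on_subset)
  show "continuous_on (cball u0 (r1/2)) (hat g)"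
   using holomorphic_on_imp_continuous_on[OF h] sub(2) by (rule continuous_on_subset)
  show "hat g w : ball u0 (r1/40)" if "w : ball u0 (r1/2)" for w using b sub(1) that by blast
 qed (use r1 in auto)
 thus ?thesis using r1 by (simp add: aa_def)
qed

primrec wd :: "(nat => nat \<times> (rsphere => rsphere)) => nat => rsphere => rsphere" where
 "wd c 0 = id"
| "wd c (Suc n) = wd c n o snd (c n)"

definition tm :: "(nat => nat \<times> (rsphere => rsphere)) => nat => nat" where
 "tm c n = (\<Sum>k<n. fst (c k))"

lemma wd_sect: "(!!k. ret (fst (c k)) (snd (c k))) ==> sect (tm c n) u0 r1 (wd c n)"
proof (induction n)
 case 0
 thus ?case by (simp add: sect_def tm_def)
next
 case (Suc n)
 thus ?case using sect_comp[of "tm c n" "wd c n" "fst (c n)" "snd (c n)"] by (simp add: tm_def comp_def)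
qed

lemma wd_aa:
 assumes "!!k. ret (fst (c k)) (snd (c k))"
 shows "(\<Prod>k<n. aa (snd (c k))/kK) <= aa (wd c n)"
proof (induction n)
 case 0
 have "hat (%a. a) = (%w. w)" by (simp add: hat_def fun_eq_iff)
 thus ?case by (simp add: aa_def id_def)
next
 case (Suc n)
 have "(\<Prod>k<Suc n. aa (snd (c k))/kK) = (\<Prod>k<n. aa (snd (c k))/kK)*(aa (snd (c n))/kK)" by simp
 also have "... <= aa (wd c n)*(aa (snd (c n))/kK)"
  using Suc aa_pos[OF ret_sect[OF assms]] kK by (intro mult_right_mono) (auto simp: less_imp_le)
 also have "... <= aa (wd c (Suc n))" using aa_comp[OF wd_sect[of c, OF assms] assms, of n n] by (simp add: mult_ac)
 finally show ?case .
qed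

lemma wd_cong: "(!!k. k < n ==> c k = c' k) ==> wd c n = wd c' n"
 by (induction n) auto

lemma wd_nested: "ret (fst (c n)) (snd (c n)) ==> wd c (Suc n) ` (Dc Int J) <= wd c n ` (Dc Int J)"
proof -
 assume g: "ret (fst (c n)) (snd (c n))"
 have "snd (c n) y : Dc Int J" if "y : Dc Int J" for y
  using that Dc ret_D2(1)[OF g] sect_J[OF ret_sect[OF g]] by blast
 thus ?thesis by auto
qed

lemma code_point:
 assumes r: "!!k. ret (fst (c k)) (snd (c k))"
 shows "EX x. ALL n. x : wd c n ` (Dc Int J)"
proof -
 let ?W = "%n. wd c n ` (Dc Int J)"
 have dec: "decseq ?W" by (intro decseq_SucI wd_nested r)
 define z where "z n = wd c n yy" for n
 have z: "z n : ?W n" for n unfolding z_def using Dc(4) yy(3) by (intro imageI) simp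
 obtain l t where t: "strict_mono (t :: nat => nat)" "(z o t) ----> l" by (rule rsphere_convergent_subseq)
 have "l : ?W n" for n
 proof -
  have "continuous_on (Dc Int J) (wd c n)"
   using wd_sect[of c n, OF r] Dc(2) unfolding sect_def by (meson continuous_on_subset inf.coboundedI1)
  hence "compact (?W n)" by (intro compact_continuous_image compact_Int_closed Dc(3) closed_julia)
  hence cl: "closed (?W n)" by (rule compact_imp_closed)
  have lim: "(%k. z (t (k + n))) ----> l" using LIMSEQ_ignore_initial_segment[OF t(2), of n] by (simp add: o_def)
  have "z (t (k + n)) : ?W n" for k
  proof -
   have "n <= t (k + n)" using seq_suble[OF t(1), of "k + n"] by linarith
   thus ?thesis using decseqD[OF dec, of n "t (k+n)"] z[of "t (k+n)"] by blast
  qed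
  thus ?thesis using closed_sequentially[OF cl _ lim] by blast
 qed
 thus ?thesis by blast
qed

text \<open>Complete letters have errors with a relative size tending to zero by \<open>av\<close>.
  Between the ends of two letters the sum changes by at most \<open>B\<close> times the length of
  one letter, and \<open>small\<close> makes this negligible compared with the time elapsed.\<close>

lemma code_level:
 assumes r: "!!k. ret (fst (c k)) (snd (c k))" and one: "!!k. fst (c k) >= 1"
  and x: "!!n. x : wd c n ` (Dc Int J)"
  and j: "filterlim j at_top sequentially" and small: "!!k. fst (c k)*j k <= k"
  and B: "!!y. y : J ==> \<bar>ph y - al\<bar> <= B"
  and av: "!!k y. y : D1 Int J ==>
   \<bar>bsum R ph (fst (c k)) (snd (c k) y) - real (fst (c k))*al\<bar> <= real (fst (c k))/real (Suc (j k))"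
 shows "x : birkhoff_level R ph al"
proof (rule level_I)
 have xJ: "x : J" using x[of 0] by simp
 thus "x : J" .
 have B0: "B >= 0" using B[OF xJ] by linarith
 have bnd: "\<bar>bsum R ph n y - real n*al\<bar> <= real n*B" if "y : J" for n y
  by (rule bsum_bound) (use B J_Rn that in blast)
 have Rx: "(R^^tm c n) x : J" "EX y:D1 Int J. (R^^tm c n) x = snd (c n) y" for n
 proof -
  show "(R^^tm c n) x : J" using xJ J_Rn by blast
  obtain y where y: "y : Dc Int J" "x = wd c n (snd (c n) y)" using x[of "Suc n"] by auto
  have "snd (c n) y : D1" using ret_D2(2)[OF r[of n]] y(1) Dc(2) by blast
  hence "(R^^tm c n) x = snd (c n) y" using sect_R[OF wd_sect[of c, OF r]] y(2) by blast
  thus "EX y:D1 Int J. (R^^tm c n) x = snd (c n) y" using y(1) Dc(2) by blast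
 qed
 have tS: "tm c (Suc n) = tm c n + fst (c n)" for n by (simp add: tm_def)
 have tn: "n <= tm c n" for n
 proof (induction n)
  case (Suc n) thus ?case using one[of n] tS[of n] by linarith
 qed simp
 fix ee :: real assume ee: "ee > 0"
 obtain m0 where m0: "real m0 > max (2/ee) (2*B/ee)" using reals_Archimedean2 by blast
 have "EVS n. m0 <= j n" using j unfolding filterlim_at_top by blast
 then obtain n0 where n0: "!!n. n >= n0 ==> m0 <= j n" unfolding eventually_sequentially by blast
 have e1: "real (fst (c n))/real (Suc (j n)) <= ee/2*real (fst (c n))" if "n >= n0" for n
 proof -
  have "2/ee < real (Suc (j n))" using n0[OF that] m0 by linarith
  hence "1 <= ee/2*real (Suc (j n))" using ee by (simp add: divide_less_eq mult.commute)
  hence "real (fst (c n))*1 <= real (fst (c n))*(ee/2*real (Suc (j n)))" by (intro mult_left_mono) auto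
  thus ?thesis by (simp add: divide_le_eq mult_ac)
 qed
 have e2: "real (fst (c n))*B <= ee/2*real n" if "n >= n0" for n
 proof -
  have "2*B/ee < real (j n)" using n0[OF that] m0 by linarith
  hence "B <= ee/2*real (j n)" using ee by (simp add: divide_less_eq mult.commute)
  hence "real (fst (c n))*B <= real (fst (c n))*(ee/2*real (j n))" by (intro mult_left_mono) auto
  also have "... = ee/2*real (fst (c n)*j n)" by simp
  also have "... <= ee/2*real n" using small[of n] ee by (intro mult_left_mono) (auto simp del: of_nat_mult)
  finally show ?thesis .
 qed
 let ?E = "%n. \<bar>bsum R ph n x - real n*al\<bar>"
 define C where "C = real (tm c n0)*B"
 have add: "?E (n + k) <= ?E n + \<bar>bsum R ph k ((R^^n) x) - real k*al\<bar>" for n k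
  unfolding bsum_add of_nat_add distrib_right by linarith
 have main: "?E (tm c n) <= C + ee/2*real (tm c n)" if "n >= n0" for n
  using that
 proof (induction n rule: dec_induct)
  case base
  thus ?case using bnd[OF xJ, of "tm c n0"] ee by (simp add: C_def add_increasing2)
 next
  case (step n)
  obtain y where y: "y : D1 Int J" "(R^^tm c n) x = snd (c n) y" using Rx(2) by blast
  have "?E (tm c (Suc n)) <= ?E (tm c n) + real (fst (c n))/real (Suc (j n))"
   using add[of "tm c n" "fst (c n)"] av[OF y(1), of n] y(2) by (simp add: tS)
  thus ?case using step e1[of n] by (simp add: tS algebra_simps)
 qed
 have "?E m <= ee*real m + C" for m
 proof (cases "m <= tm c n0")
  case True
  have "?E m <= real m*B" by (rule bnd[OF xJ])
  also have "... <= C" unfolding C_def using True B0 by (intro mult_right_mono) auto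
  finally show ?thesis using ee by (simp add: add_increasing)
 next
  case False
  define n where "n = Max {n. tm c n <= m}"
  have fin: "finite {n. tm c n <= m}" by (rule finite_subset[of _ "{..m}"]) (auto intro: order_trans[OF tn])
  have "n0 : {n. tm c n <= m}" using False by simp
  hence n: "n0 <= n" "tm c n <= m" using Max_ge[OF fin, of n0] Max_in[OF fin] unfolding n_def by auto
  have "tm c (Suc n) > m" using Max_ge[OF fin, of "Suc n"] unfolding n_def[symmetric] by force
  hence k: "m = tm c n + (m - tm c n)" "m - tm c n <= fst (c n)" using n(2) tS[of n] by linarith+
  have "?E m <= ?E (tm c n) + real (m - tm c n)*B"
   using add[of "tm c n" "m - tm c n"] bnd[OF Rx(1)[of n], of "m - tm c n"] k(1) by simp
  also have "... <= C + ee/2*real (tm c n) + real (fst (c n))*B"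
   using main[OF n(1)] k(2) B0 by (intro add_mono mult_right_mono) auto
  also have "... <= C + ee/2*real m + ee/2*real m"
  proof -
   have "ee/2*real n <= ee/2*real m" "ee/2*real (tm c n) <= ee/2*real m"
    using tn[of n] n(2) ee by (auto intro!: mult_left_mono)
   thus ?thesis using e2[OF n(1)] by linarith
  qed
  finally show ?thesis by (simp add: field_simps)
 qed
 thus "EX C. ALL n. \<bar>bsum R ph n x - real n*al\<bar> <= ee*real n + C" by blast
qed

lemma fam_gap:
 assumes F: "fam F"
 shows "EX e>0. ALL x:F. ALL y:F. ALL a:Dc. ALL b:Dc. x ~= y --> e <= cmod (kap c0 (snd x a) - kap c0 (snd y b))"
proof -
 let ?S = "%x. (%a. kap c0 (snd x a)) ` Dc"
 have r: "sect (fst x) u0 r1 (snd x)" if "x : F" for x using ret_sect[OF fam_ret[OF F that]] .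
 have ne: "snd x a ~= Fin c0" if "x : F" "a : Dc" for x a
  using sect_ne_c0[OF good1 r[OF that(1)]] that(2) Dc(2) by blast
 have cs: "compact (?S x)" if x: "x : F" for x
 proof (intro compact_continuous_image Dc(3) continuous_on_compose2[OF continuous_on_kap])
  show "continuous_on Dc (snd x)" using r[OF x] Dc(2) unfolding sect_def by (meson continuous_on_subset)
  have "snd x a : - {Fin c0}" if "a : Dc" for a using ne[OF x that] by simp
  thus "snd x ` Dc <= - {Fin c0}" by (rule image_subsetI)
 qed
 let ?P = "%z e. ALL a:?S (fst z). ALL b:?S (snd z). e <= dist a b"
 have "EX e>0. ALL z:{z : F \<times> F. fst z ~= snd z}. ?P z e"
 proof (rule finite_uniform)
  show "finite {z : F \<times> F. fst z ~= snd z}" using F by (simp add: fam_def)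
  show "?P z e'" if "?P z e" "e' <= e" for z and e e' :: real using that order_trans by blast
  fix z assume "z : {z : F \<times> F. fst z ~= snd z}"
  hence z: "fst z : F" "snd z : F" "fst z ~= snd z" by auto
  have "?S (fst z) Int ?S (snd z) = {}"
  proof (rule ccontr)
   assume "?S (fst z) Int ?S (snd z) ~= {}"
   then obtain a b where ab: "a : Dc" "b : Dc" "kap c0 (snd (fst z) a) = kap c0 (snd (snd z) b)" by auto
   hence "snd (fst z) a = snd (snd z) b" using kinv_kap[OF ne[OF z(1) ab(1)]] kinv_kap[OF ne[OF z(2) ab(2)]] by metis
   thus False using fam_eqI[OF F z(1,2)] ab(1,2) Dc(2) z(3) by blast
  qed
  thus "EX e>0. ?P z e" using separate_compact_closed[OF cs[OF z(1)] compact_imp_closed[OF cs[OF z(2)]]] by blast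
 qed
 then obtain e where e: "e > 0" "ALL z:{z : F \<times> F. fst z ~= snd z}. ?P z e" by blast
 have "e <= cmod (kap c0 (snd x a) - kap c0 (snd y b))" if "x : F" "y : F" "a : Dc" "b : Dc" "x ~= y" for x y a b
  using bspec[OF e(2), of "(x, y)"] that by (simp add: dist_norm)
 thus ?thesis using e(1) by blast
qed

lemma code_separation:
 obtains C where "C > 0" "!!w n x y. sect n u0 r1 w ==> x : D2 ==> y : D2 ==> w x : Dc ==> w y : Dc ==>
  aa w*cmod (kap c0 x - kap c0 y) <= C*dist (w x) (w y)"
proof
 let ?L = "(1 + (1 + cmod c0)*(cmod u0 + r1))^2"
 have "(1 + cmod c0)*(cmod u0 + r1) >= 0" using r1 by simp
 hence "?L > 0" by (intro zero_less_power) linarith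
 thus "1600 * kK^2*?L > 0" using kK by simp
 fix w n x y assume w: "sect n u0 r1 w" and xy: "x : D2" "y : D2" and wxy: "w x : Dc" "w y : Dc"
 have k: "kap c0 z : ball u0 (r1/20)" if "z : D2" for z using disc_kap(1)[OF that] r1 by simp
 have b: "cmod (kap c0 z) <= cmod u0 + r1" if "z : Dc" for z
  using Dc_kap(1)[OF that] norm_triangle_ineq[of u0 "kap c0 z - u0"] r1 by (simp add: dist_norm norm_minus_commute)
 have "aa w*cmod (kap c0 x - kap c0 y)/(1600 * kK^2) <= cmod (hat w (kap c0 x) - hat w (kap c0 y))"
  unfolding aa_def by (rule hat_lower[OF good1 w k[OF xy(1)] k[OF xy(2)]])
 also have "... = cmod (kap c0 (w x) - kap c0 (w y))" using disc_kap(2)[OF xy(1)] disc_kap(2)[OF xy(2)] by (simp add: hat_def)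
 also have "... <= ?L*dist (w x) (w y)"
  using dist_kinv_ge[OF b[OF wxy(1)] b[OF wxy(2)], of c0] Dc_kap(2)[OF wxy(1)] Dc_kap(2)[OF wxy(2)] by simp
 finally have "aa w*cmod (kap c0 x - kap c0 y) <= ?L*dist (w x) (w y)*(1600 * kK^2)"
  using kK by (subst (asm) pos_divide_le_eq) auto
 thus "aa w*cmod (kap c0 x - kap c0 y) <= 1600 * kK^2*?L*dist (w x) (w y)" by (simp only: mult_ac)
qed

text \<open>The coding measure: independent letters, the letter \<open>g\<close> having weight proportional to \<open>(aa g / kK) powr s\<close>.
 The surplus \<open>2\<close> in the sum makes up for the separation of the images, which may degenerate slowly.\<close>

lemma dimension_from_families:
 fixes F :: "nat => (nat \<times> (rsphere => rsphere)) set"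
 assumes s: "s > 0" and F: "!!j. fam (F j)" and sum2: "!!j. (\<Sum>x\<in>F j. (aa (snd x)/kK) powr s) >= 2"
  and B: "!!y. y : J ==> \<bar>ph y - al\<bar> <= B"
  and av: "!!j x y. x : F j ==> y : D1 Int J ==>
   \<bar>bsum R ph (fst x) (snd x y) - real (fst x)*al\<bar> <= real (fst x)/real (Suc j)"
 shows "hausdorff_outer s (birkhoff_level R ph al) > 0"
proof -
 have "EX e>0. ALL x:F j. ALL y:F j. ALL a:Dc. ALL b:Dc. x ~= y --> e <= cmod (kap c0 (snd x a) - kap c0 (snd y b))" for j
  by (rule fam_gap[OF F])
 then obtain gap where gap: "!!j. gap j > (0::real)"
  "!!j x y a b. x : F j ==> y : F j ==> a : Dc ==> b : Dc ==> x ~= y ==> gap j <= cmod (kap c0 (snd x a) - kap c0 (snd y b))"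
  by metis
 define T where "T j = sum fst (F j)" for j
 have T: "fst x <= T j" if "x : F j" for x j unfolding T_def using F[of j] that by (intro member_le_sum) (auto simp: fam_def)
 define cc where "cc = min 1 (gap 0 powr s)"
 have cc: "0 < cc" "cc <= 1" "cc <= gap 0 powr s" using gap(1)[of 0] by (auto simp: cc_def)
 \<comment> \<open>Level \<open>i\<close> uses the family \<open>F (j i)\<close>. The index grows so
   slowly that the gaps, to the power \<open>s\<close>, decay no faster than the factor
   \<open>(1/2)^i\<close> gained from sums of at least \<open>2\<close>, and that one letter is
   short compared with the elapsed time. The constant \<open>cc\<close> makes \<open>j = 0\<close>
   admissible from the start.\<close>
 obtain j where j: "filterlim j at_top sequentially"
  "!!i. cc*(1/2)^i <= gap (j i) powr s & T (j i)*j i <= i"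
 proof (rule slow_sequence[of "%j i. cc*(1/2)^i <= gap j powr s & T j*j <= i"])
  fix k
  have "0 < gap k powr s" using gap(1)[of k] by simp
  then obtain n where n: "(1/2::real)^n < gap k powr s" using real_arch_pow_inv[of "gap k powr s" "1/2"] by auto
  have "cc*(1/2)^i <= gap k powr s" if "i >= n" for i
  proof -
   have "cc*(1/2)^i <= 1*(1/2)^n" using cc that by (intro mult_mono power_decreasing) auto
   thus ?thesis using n by linarith
  qed
  thus "EX N. ALL i>=N. cc*(1/2)^i <= gap k powr s & T k * k <= i"
   by (intro exI[of _ "max n (T k * k)"]) auto
 next
  fix i
  have "cc*(1/2)^i <= cc*1" using cc by (intro mult_left_mono power_le_one) auto
  thus "cc*(1/2)^i <= gap 0 powr s & T 0*0 <= i" using cc(3) by simp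
 qed (rule that)
 let ?Z = "%k. \<Sum>x\<in>F (j k). (aa (snd x)/kK) powr s"
 define w where "w k x = (aa (snd x)/kK) powr s/?Z k" for k and x :: "nat \<times> (rsphere => rsphere)"
 have Z: "?Z k >= 2" for k by (rule sum2)
 have w: "0 <= w k x" "w k x <= (1/2)*(aa (snd x)/kK) powr s" for k x
 proof -
  show "0 <= w k x" unfolding w_def using Z[of k] by (intro divide_nonneg_nonneg powr_ge_zero) linarith
  have "(aa (snd x)/kK) powr s/?Z k <= (aa (snd x)/kK) powr s/2"
   using Z[of k] by (intro divide_left_mono powr_ge_zero mult_pos_pos) linarith+
  thus "w k x <= (1/2)*(aa (snd x)/kK) powr s" by (simp add: w_def)
 qed
 define M where "M k = point_measure (F (j k)) (%x. ennreal (w k x))" for k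
 have finF: "finite (F i)" for i using F by (simp add: fam_def)
 have spM: "space (M k) = F (j k)" "sets (M k) = Pow (F (j k))" for k
  by (simp_all add: M_def space_point_measure sets_point_measure)
 have prob: "prob_space (M k)" for k
 proof (rule prob_spaceI)
  have "(\<Sum>x\<in>F (j k). w k x) = 1" unfolding w_def using Z[of k] by (simp add: sum_divide_distrib[symmetric])
  moreover have "emeasure (M k) (F (j k)) = (\<Sum>x\<in>F (j k). ennreal (w k x))"
   unfolding M_def by (rule emeasure_point_measure_finite) (use finF in auto)
  ultimately show "emeasure (M k) (space (M k)) = 1" using w(1) by (simp add: spM sum_ennreal)
 qed
 interpret product_prob_space M UNIV using prob by (intro product_prob_spaceI)
 define P where "P = PiM UNIV M"
 have inF: "c k : F (j k)" if "c : space P" for c k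
  using that by (auto simp: P_def space_PiM PiE_iff spM)
 have rt: "ret (fst (c k)) (snd (c k))" if "c : space P" for c k using fam_ret[OF F inF[OF that]] .
 define cyl where "cyl c n = {x : space P. ALL i:{..<n}. x i : {c i}}" for c n
 have cyl: "cyl c n : sets P" "emeasure P (cyl c n) <= ennreal ((1/2)^n*aa (wd c n) powr s)"
  "emeasure P (cyl c n) <= ennreal ((1/2)^n)" if c: "c : space P" for c n
 proof -
  have cs: "{c i} : sets (M i)" for i using inF[OF c] by (simp add: spM)
  show "cyl c n : sets P" unfolding cyl_def P_def by measurable (use cs in auto)
  have "emeasure P (cyl c n) = (\<Prod>i<n. emeasure (M i) {c i})"
   unfolding cyl_def P_def by (rule emeasure_PiM_Collect) (use cs in auto)
  also have "... = (\<Prod>i<n. ennreal (w i (c i)))"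
   using inF[OF c] finF unfolding M_def by (intro prod.cong) (auto simp: emeasure_point_measure_finite)
  also have "... = ennreal (\<Prod>i<n. w i (c i))" by (rule prod_ennreal) (use w in auto)
  finally have e: "emeasure P (cyl c n) = ennreal (\<Prod>i<n. w i (c i))" .
  have a: "0 <= aa (snd (c i))/kK" "aa (snd (c i))/kK <= 1" for i
   using aa_pos[OF ret_sect[OF rt[OF c]]] aa_le[OF rt[OF c]] kK by (auto simp: less_imp_le divide_le_eq intro: order_trans)
  have "(\<Prod>i<n. w i (c i)) <= (\<Prod>i<n. (1/2)*(aa (snd (c i))/kK) powr s)" using w by (intro prod_mono) auto
  also have "... = (1/2)^n*(\<Prod>i<n. aa (snd (c i))/kK) powr s"
   unfolding prod.distrib using a by (subst prod_powr_distrib) simp_all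
  finally have le: "(\<Prod>i<n. w i (c i)) <= (1/2)^n*(\<Prod>i<n. aa (snd (c i))/kK) powr s" .
  have p0: "0 <= (\<Prod>i<n. aa (snd (c i))/kK)" using a by (intro prod_nonneg) auto
  have "(\<Prod>i<n. aa (snd (c i))/kK) powr s <= aa (wd c n) powr s"
   using wd_aa[of c, OF rt[OF c]] s p0 by (intro powr_mono2) auto
  thus "emeasure P (cyl c n) <= ennreal ((1/2)^n*aa (wd c n) powr s)" unfolding e
   using le by (intro ennreal_leI order_trans[OF le] mult_left_mono) auto
  have "(\<Prod>i<n. aa (snd (c i))/kK) <= 1" using a by (intro prod_le_1) auto
  hence "(\<Prod>i<n. aa (snd (c i))/kK) powr s <= 1" using p0 s powr_mono2[of s _ 1] by fastforce
  hence "(1/2)^n*(\<Prod>i<n. aa (snd (c i))/kK) powr s <= (1/2)^n" by (intro mult_left_le) auto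
  thus "emeasure P (cyl c n) <= ennreal ((1/2)^n)" unfolding e using le by (intro ennreal_leI) linarith
 qed
 have "EX x. ALL n. x : wd c n ` (Dc Int J)" if "c : space P" for c by (rule code_point) (use rt that in auto)
 then obtain pt where pt: "!!c n. c : space P ==> pt c : wd c n ` (Dc Int J)" by metis
 obtain C where C: "C > 0" "!!w n x y. sect n u0 r1 w ==> x : D2 ==> y : D2 ==> w x : Dc ==> w y : Dc ==>
  aa w*cmod (kap c0 x - kap c0 y) <= C*dist (w x) (w y)" by (rule code_separation) blast
 show ?thesis
 proof (rule mass_distribution[of P pt _ "C powr s/cc"])
  show "prob_space P" unfolding P_def by (rule prob_space_axioms)
  show "0 <= C powr s/cc" using cc by simp
  show "pt c : birkhoff_level R ph al" if c: "c : space P" for c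
  proof (rule code_level[OF rt[OF c] _ pt[OF c] j(1) _ B])
   show "1 <= fst (c k)" for k using F[of "j k"] inF[OF c, of k] by (simp add: fam_def)
   have "fst (c k)*j k <= T (j k)*j k" for k using T[OF inF[OF c]] by (intro mult_right_mono) auto
   thus "fst (c k)*j k <= k" for k using j(2) order_trans by blast
  qed (use av[OF inF[OF c]] in auto)
  fix U :: "rsphere set" and et :: real assume U: "bounded U" and et: "et > 0"
  let ?A = "{x : space P. pt x : U}"
  have nn: "0 <= C powr s/cc*diameter U powr s" using cc by simp
  \<comment> \<open>Either \<open>U\<close> contains the point of at most one code, whose cylinders
    have arbitrarily small measure; or there is a first place \<open>n\<close> where two codes in
    \<open>U\<close> differ. Then all these codes lie in one cylinder of length \<open>n\<close>,
    and the gap between the two letters bounds the diameter of \<open>U\<close> below.\<close>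
  show "EX V:sets P. ?A <= V & emeasure P V <= ennreal (C powr s/cc*diameter U powr s + et)"
  proof (cases "EX x:?A. EX y:?A. x ~= y")
   case False
   show ?thesis
   proof (cases "?A = {}")
    case True
    thus ?thesis by (intro bexI[of _ "{}"]) auto
   next
    case ne: False
    then obtain c where c: "c : ?A" by blast
    obtain n where n: "(1/2::real)^n < et" using real_arch_pow_inv[OF et, of "1/2"] by auto
    have cP: "c : space P" using c by simp
    have "?A <= cyl c n"
    proof
     fix x assume "x : ?A"
     hence "x = c" using c False by blast
     thus "x : cyl c n" using cP by (simp add: cyl_def)
    qed
    moreover have "emeasure P (cyl c n) <= ennreal (C powr s/cc*diameter U powr s + et)"
     using n nn by (intro order_trans[OF cyl(3)[OF cP]] ennreal_leI) linarith
    ultimately show ?thesis using cyl(1)[OF cP] by blast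
   qed
  next
   case True
   then obtain x0 y0 where "x0 : ?A" "y0 : ?A" "x0 ~= y0" by blast
   hence "EX n. EX x:?A. EX y:?A. x n ~= y n" unfolding fun_eq_iff by blast
   define n where "n = (LEAST n. EX x:?A. EX y:?A. x n ~= y n)"
   have "EX x:?A. EX y:?A. x n ~= y n" unfolding n_def by (rule LeastI_ex) fact
   then obtain x y where xy: "x : ?A" "y : ?A" "x n ~= y n" by blast
   have before: "a k = b k" if "k < n" "a : ?A" "b : ?A" for k a b
    using not_less_Least[of k "%n. EX x:?A. EX y:?A. x n ~= y n"] that unfolding n_def by blast
   have P: "x : space P" "y : space P" and ptU: "pt x : U" "pt y : U" using xy by auto
   have wxy: "wd y n = wd x n" by (rule wd_cong) (use before xy in blast)
   obtain a where a: "a : Dc Int J" "pt x = wd x n (snd (x n) a)" using pt[OF P(1), of "Suc n"] by auto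
   obtain b where b: "b : Dc Int J" "pt y = wd x n (snd (y n) b)" using pt[OF P(2), of "Suc n"] wxy by auto
   have D: "snd (x n) a : D2" "snd (y n) b : D2"
    using ret_D2(1)[OF rt[OF P(1)]] ret_D2(1)[OF rt[OF P(2)]] a(1) b(1) Dc(2) by blast+
   have ptD: "pt x : Dc" "pt y : Dc" using pt[OF P(1), of 0] pt[OF P(2), of 0] by auto
   have sx: "sect (tm x n) u0 r1 (wd x n)" by (rule wd_sect) (rule rt[OF P(1)])
   have ap: "aa (wd x n) > 0" by (rule aa_pos[OF sx])
   have "aa (wd x n)*gap (j n) <= aa (wd x n)*cmod (kap c0 (snd (x n) a) - kap c0 (snd (y n) b))"
    using ap gap(2)[OF inF[OF P(1)] inF[OF P(2)] _ _ xy(3)] a(1) b(1) by (intro mult_left_mono) auto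
   also have "... <= C*dist (pt x) (pt y)" using C(2)[OF sx D] ptD a(2) b(2) by simp
   also have "... <= C*diameter U" using diameter_bounded_bound[OF U ptU] C(1) by (intro mult_left_mono) auto
   finally have "(aa (wd x n)*gap (j n)) powr s <= (C*diameter U) powr s"
    using ap gap(1)[of "j n"] s by (intro powr_mono2) auto
   hence p: "aa (wd x n) powr s*gap (j n) powr s <= C powr s*diameter U powr s"
    using ap gap(1)[of "j n"] C(1) diameter_ge_0[OF U] by (simp add: powr_mult)
   have "aa (wd x n) powr s*(cc*(1/2)^n) <= aa (wd x n) powr s*gap (j n) powr s"
    using j(2) by (intro mult_left_mono) auto
   hence "cc*((1/2)^n*aa (wd x n) powr s) <= C powr s*diameter U powr s" using p by (simp add: mult_ac)
   hence "(1/2)^n*aa (wd x n) powr s <= C powr s/cc*diameter U powr s" using cc(1) by (simp add: field_simps)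
   hence "emeasure P (cyl x n) <= ennreal (C powr s/cc*diameter U powr s + et)"
    using et by (intro order_trans[OF cyl(2)[OF P(1)]] ennreal_leI) linarith
   moreover have "?A <= cyl x n"
   proof
    fix z assume z: "z : ?A"
    thus "z : cyl x n" using before[OF _ z xy(1)] by (simp add: cyl_def)
   qed
   ultimately show ?thesis using cyl(1)[OF P(1)] by blast
  qed
 qed
qed

end

lemma positive_bounds:
 fixes f :: "'a::metric_space => real"
 assumes "compact K" "continuous_on K f" "!!x. x : K ==> f x > 0"
 obtains c where "c >= 1" "!!x. x : K ==> 1/c <= f x & f x <= c"
proof (cases "K = {}")
 case False
 obtain a where a: "a : K" "!!x. x : K ==> f a <= f x" using continuous_attains_inf[OF assms(1) False assms(2)] by blast
 obtain b where b: "b : K" "!!x. x : K ==> f x <= f b" using continuous_attains_sup[OF assms(1) False assms(2)] by blast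
 have fa: "f a > 0" using assms(3) a(1) by simp
 let ?c = "max (max 1 (f b)) (1/f a)"
 show ?thesis
 proof (rule that[of ?c])
  fix x assume x: "x : K"
  have "1/?c <= 1/(1/f a)" using fa by (intro divide_left_mono mult_pos_pos) auto
  thus "1/?c <= f x & f x <= ?c" using a(2)[OF x] b(2)[OF x] by auto
 qed simp
qed (use that[of 1] in auto)

context expansive_rational
begin

text \<open>The conformal measure speaks of spherical derivatives and the letters of coordinate
  derivatives. Disc and image stay in a bounded part of the plane, where the density
  \<open>hw c0\<close> is bounded above and below.\<close>

lemma sph_deriv_sect:
 assumes g: "good u r"
 obtains c where "c >= 1" "!!n g w. sect n u r g ==> hat g u : ball u r ==> cmod (deriv (hat g) u) <= 1 ==> w : ball u (r/10) ==>
  1/c <= sph_deriv (R^^n) (g (kinv c0 w))*cmod (deriv (hat g) u)"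
proof -
 have r: "r > 0" using g by (simp add: good_def)
 obtain b where b: "b >= 1" "!!x. x : cball u (r + kK*r) ==> 1/b <= hw c0 x & hw c0 x <= b"
  using positive_bounds[OF compact_cball continuous_hw hw_pos] by metis
 show ?thesis
 proof (rule that[of "b*b * kK"])
  show "b*b * kK >= 1" using b(1) kK by (metis mult_mono' mult_1 zero_le_one)
  fix n h w assume s: "sect n u r h" and hu: "hat h u : ball u r" "cmod (deriv (hat h) u) <= 1" and w: "w : ball u (r/10)"
  have wr: "w : ball u r" "u : ball u (r/10)" using w r by auto
  let ?S = "sph_deriv (R^^n) (h (kinv c0 w))" and ?d = "cmod (deriv (hat h) w)" and ?h = "hw c0 (hat h w)" and ?a = "cmod (deriv (hat h) u)"
  note hh = hat_holomorphic[OF g s] hat_inj[OF g s]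
  have e: "?S*(?d*?h) = hw c0 w" by (rule hat_deriv(2)[OF g s wr(1)])
  have "cmod (hat h w - hat h u) <= kK*?a*cmod (w - u)" by (rule koebe_bilipschitz[OF hh r w wr(2) wr(2)])
  also have "... <= kK*1*r" using hu(2) wr(1) kK by (intro mult_mono) (auto simp: dist_norm norm_minus_commute)
  finally have "dist u (hat h w) <= r + kK*r"
   using hu(1) dist_triangle[of u "hat h w" "hat h u"] by (simp add: dist_norm norm_minus_commute)
  hence h: "?h <= b" using b(2) by simp
  have "w : cball u (r + kK*r)" using wr(1) r kK by (simp add: add_increasing2 less_imp_le)
  hence hww: "1/b <= hw c0 w" using b(2) by blast
  have S: "?S >= 0" by (rule sph_deriv_nonneg[OF rmap_Rn])
  have k: "?d <= kK*?a" by (rule koebe_two_point[OF hh r w wr(2)])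
  have "1/b <= ?S*(?d*?h)" using e hww by simp
  also have "... <= ?S*(kK*?a*b)" using k h S hw_pos[of c0 "hat h w"] kK by (intro mult_left_mono mult_mono) auto
  finally have "1/b/(b * kK) <= ?S*?a" using b(1) kK by (subst pos_divide_le_eq) (auto simp: mult_ac)
  thus "1/(b*b * kK) <= ?S*?a" by (simp add: mult.assoc)
 qed
qed

end

section \<open>Long branches and stays near a neutral cycle\<close>

context based
begin

text \<open>A long branch moves its image of \<open>D1\<close> by less than \<open>r1/80\<close> in
  the coordinate. Starting within \<open>r1/80\<close> of the centre, it remains within
  \<open>r1/40\<close>, that is in \<open>D2\<close>.\<close>

lemma ret_exists:
 obtains N where "!!n x. n >= N ==> x : J ==> x : disc u0 (r1/80) ==> (R^^n) x : D1 ==>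
  EX g. ret n g & sect n u0 (10*r1) g & g ((R^^n) x) = x"
proof -
 have "r1/80 > 0" using r1 by simp
 then obtain ta where ta: "ta > 0" "!!x y. x : J ==> dist y x < ta ==> y ~= Fin c0 & cmod (kap c0 y - kap c0 x) < r1/80"
  by (rule kap_uniform) blast
 obtain N where N: "!!n g y z. n >= N ==> sect n u0 (10*r1) g ==> y : disc u0 (10*r1/10) ==> z : disc u0 (10*r1/10) ==> dist (g y) (g z) < ta"
  by (rule shrink_dist[OF good10 u0J ta(1)]) blast
 show ?thesis
 proof (rule that)
  fix n x assume n: "n >= N" and x: "x : J" "x : disc u0 (r1/80)" and Rx: "(R^^n) x : D1"
  have D10: "y : D1 ==> y : disc u0 (10*r1)" for y using disc_mono[of r1 "10*r1" u0] r1 by auto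
  obtain g where g: "sect n u0 (10*r1) g" "g ((R^^n) x) = x" by (rule sect_exists[OF good10 D10[OF Rx] refl])
  have "g y : D2" if y: "y : D1" for y
  proof -
   have "dist (g y) x < ta" using N[OF n g(1), of y "(R^^n) x"] y Rx g(2) by simp
   hence k: "g y ~= Fin c0" "cmod (kap c0 (g y) - kap c0 x) < r1/80" using ta(2)[OF x(1)] by auto
   have "dist u0 (kap c0 (g y)) < r1/40"
    using disc_kap(1)[OF x(2)] k(2) dist_triangle[of u0 "kap c0 (g y)" "kap c0 x"]
    by (simp add: dist_norm norm_minus_commute)
   hence "kinv c0 (kap c0 (g y)) : D2" unfolding disc_def by (intro imageI) simp
   thus ?thesis using kinv_kap[OF k(1)] by simp
  qed
  hence "ret n g" using sect_subset[OF g(1), of r1] r1 by (auto simp: ret_def)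
  thus "EX g. ret n g & sect n u0 (10*r1) g & g ((R^^n) x) = x" using g by blast
 qed
qed

lemma unif_cont_J:
 fixes px :: "rsphere => real"
 assumes "continuous_on J px" "ee > 0"
 obtains th where "th > 0" "!!x y. x : J ==> y : J ==> dist x y < th ==> \<bar>px x - px y\<bar> <= ee"
 using compact_uniformly_continuous[OF assms(1) compact_julia] assms(2)
 unfolding uniformly_continuous_on_def dist_real_def by (metis dist_commute less_imp_le)

lemma bounded_J:
 fixes px :: "rsphere => real"
 assumes "continuous_on J px"
 obtains B where "B >= 0" "!!x. x : J ==> \<bar>px x\<bar> <= B"
proof -
 have "bounded (px ` J)" using compact_continuous_image[OF assms compact_julia] by (rule compact_imp_bounded)
 then obtain B where "!!x. x : J ==> \<bar>px x\<bar> <= B" unfolding bounded_iff by auto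
 thus ?thesis using that[of "max B 0"] by (simp add: le_max_iff_disj)
qed

text \<open>The \<open>k\<close>-th iterate of \<open>g\<close> is a branch of order
  \<open>n - k\<close>; when this order is large, its image of \<open>D1\<close> is smaller than the
  modulus of continuity of \<open>px\<close>. Only the last \<open>N\<close> terms escape, and they
  give \<open>C\<close>.\<close>

lemma bsum_sect:
 assumes px: "continuous_on J px" and ee: "ee > 0"
 obtains C where "C >= 0" "!!n g y z. sect n u0 (10*r1) g ==> y : D1 Int J ==> z : D1 Int J ==>
  \<bar>bsum R px n (g y) - bsum R px n (g z)\<bar> <= ee*real n + C"
proof -
 obtain B where B: "B >= 0" "!!x. x : J ==> \<bar>px x\<bar> <= B" by (rule bounded_J[OF px]) blast
 obtain th where th: "th > 0" "!!x y. x : J ==> y : J ==> dist x y < th ==> \<bar>px x - px y\<bar> <= ee"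
  by (rule unif_cont_J[OF assms]) blast
 obtain N where N: "!!n g y z. n >= N ==> sect n u0 (10*r1) g ==> y : disc u0 (10*r1/10) ==> z : disc u0 (10*r1/10) ==> dist (g y) (g z) < th"
  by (rule shrink_dist[OF good10 u0J th(1)]) blast
 show ?thesis
 proof (rule that[of "real N*(2*B)"])
  fix n g y z assume g: "sect n u0 (10*r1) g" and y: "y : D1 Int J" and z: "z : D1 Int J"
  have D10: "x : D1 ==> x : disc u0 (10*r1)" for x using disc_mono[of r1 "10*r1" u0] r1 by auto
  have J: "(R^^k) (g x) : J" if "x : D1 Int J" for k x
   using sect_J[OF g D10, of x] that unfolding J_Rn by blast
  have t: "\<bar>px ((R^^k) (g y)) - px ((R^^k) (g z))\<bar> <= ee + (if n - Suc k < N then 2*B else 0)" if k: "k < n" for k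
  proof (cases "n - Suc k < N")
   case True
   have "\<bar>px ((R^^k) (g y)) - px ((R^^k) (g z))\<bar> <= B + B"
    using B(2)[OF J[OF y, of k]] B(2)[OF J[OF z, of k]] by linarith
   thus ?thesis using True ee by simp
  next
   case False
   have "(R^^(n - k)) ((R^^k) (g x)) = (R^^n) (g x)" for x using k funpow_add[of "n - k" k R] by simp
   hence s: "sect (n - k) u0 (10*r1) ((R^^k) o g)"
    using g unfolding sect_def by (auto intro!: continuous_on_compose2[OF cont_Rn])
   have "dist (((R^^k) o g) y) (((R^^k) o g) z) < th" by (rule N[OF _ s]) (use False y z in auto)
   thus ?thesis using th(2)[OF J[OF y, of k] J[OF z, of k]] False by simp
  qed
  have "\<bar>bsum R px n (g y) - bsum R px n (g z)\<bar> <= (\<Sum>k<n. \<bar>px ((R^^k) (g y)) - px ((R^^k) (g z))\<bar>)"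
   unfolding bsum_def sum_subtractf[symmetric] by (rule sum_abs)
  also have "... <= (\<Sum>k<n. ee + (if n - Suc k < N then 2*B else 0))" by (rule sum_mono) (use t in auto)
  also have "... = ee*real n + (\<Sum>k<n. if k < N then 2*B else 0)"
   unfolding sum.distrib using sum.nat_diff_reindex[of "%k. if k < N then 2*B else 0" n] by simp
  also have "(\<Sum>k<n. if k < N then 2*B else 0) = (\<Sum>k\<in>{..<n} Int {..<N}. 2*B)" using sum.inter_restrict[of "{..<n}" "%_. 2*B" "{..<N}"] by (simp only: finite_lessThan lessThan_iff)
  also have "... <= real N*(2*B)"
  proof -
   have "card ({..<n} Int {..<N}) <= N" using card_mono[of "{..<N}" "{..<n} Int {..<N}"] by simp
   thus ?thesis using B(1) by (simp only: sum_constant) (intro mult_right_mono, auto)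
  qed
  finally show "\<bar>bsum R px n (g y) - bsum R px n (g z)\<bar> <= ee*real n + real N*(2*B)" by simp
 qed (use B in simp)
qed

lemma bsum_shadow:
 assumes "!!i. i < n ==> \<bar>px ((R^^i) x) - px ((R^^i) y)\<bar> <= ee"
 shows "\<bar>bsum R px n x - bsum R px n y\<bar> <= ee*real n"
proof -
 have "\<bar>bsum R px n x - bsum R px n y\<bar> <= (\<Sum>i<n. \<bar>px ((R^^i) x) - px ((R^^i) y)\<bar>)"
  unfolding bsum_def sum_subtractf[symmetric] by (rule sum_abs)
 also have "... <= (\<Sum>i<n. ee)" by (rule sum_mono) (use assms in auto)
 finally show ?thesis by (simp add: mult.commute)
qed

lemma bsum_periodic:
 assumes "(R^^L) x = x"
 shows "bsum R px (k*L) x = real k*bsum R px L x"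
proof (induction k)
 case (Suc k)
 have "(R^^(k*L)) x = x" using fixed_mult[OF assms] by (metis mult.commute)
 thus ?case using bsum_add[of R px "k*L" L x] Suc by (simp add: algebra_simps)
qed (simp add: bsum_def)

definition lg :: "rsphere => real" where "lg x = ln (sph_deriv R x)"

lemma lg_cont: "continuous_on J lg"
 unfolding lg_def by (intro continuous_on_ln continuous_sph_deriv rmap_R) (use sph_deriv_pos in force)

lemma exp_bsum_lg: "x : J ==> exp (bsum R lg n x) = sph_deriv (R^^n) x"
 unfolding bsum_def sph_deriv_prod by (simp add: exp_sum lg_def sph_deriv_pos J_Rn)

text \<open>A section whose orbit lingers near a neutral cycle for as long as prescribed: start at a point of the
 working disc that is mapped onto the cycle, and shadow its orbit until it is time to leave.\<close>

lemma excursion: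
 assumes og: "og : J" "(R^^L) og = og" "L >= 1" "sph_deriv (R^^L) og = 1"
  and ph: "continuous_on J ph" and ee: "ee > 0"
 obtains C where "C >= 0" "!!N0. EX n h. N0 < n & real n <= real N0 + C & ret n h & exp (- (ee*real n + C)) <= aa h &
  (ALL y:D1 Int J. \<bar>bsum R ph n (h y) - real n*(bsum R ph L og/real L)\<bar> <= ee*real n + C)"
proof -
 have e2: "ee/2 > 0" using ee by simp
 obtain c where c: "c >= 1" "!!n g w. sect n u0 r1 g ==> hat g u0 : ball u0 r1 ==> cmod (deriv (hat g) u0) <= 1 ==> w : ball u0 (r1/10) ==>
  1/c <= sph_deriv (R^^n) (g (kinv c0 w))*cmod (deriv (hat g) u0)" by (rule sph_deriv_sect[OF good1]) blast
 obtain N where N: "!!n x. n >= N ==> x : J ==> x : disc u0 (r1/80) ==> (R^^n) x : D1 ==>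
  EX g. ret n g & sect n u0 (10*r1) g & g ((R^^n) x) = x" by (rule ret_exists) blast
 obtain C1 where C1: "C1 >= 0" "!!n g y z. sect n u0 (10*r1) g ==> y : D1 Int J ==> z : D1 Int J ==>
  \<bar>bsum R ph n (g y) - bsum R ph n (g z)\<bar> <= ee/2*real n + C1" by (rule bsum_sect[OF ph e2]) blast
 obtain th1 where th1: "th1 > 0" "!!x y. x : J ==> y : J ==> dist x y < th1 ==> \<bar>ph x - ph y\<bar> <= ee/2"
  by (rule unif_cont_J[OF ph e2]) blast
 obtain th2 where th2: "th2 > 0" "!!x y. x : J ==> y : J ==> dist x y < th2 ==> \<bar>lg x - lg y\<bar> <= ee/2"
  by (rule unif_cont_J[OF lg_cont e2]) blast
 have "yy : disc u0 (r1/80)" using disc_centre r1 by simp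
 then obtain n1 a where a: "a : disc u0 (r1/80)" "a : J" "(R^^n1) a = og" by (rule reach[OF disc_open _ u0J og(1)]) blast
 obtain th3 where th3: "th3 > 0" "ball a th3 <= disc u0 (r1/80)" by (rule openE[OF disc_open a(1)]) blast
 let ?th = "min th1 (min th2 th3)"
 have "?th > 0" using th1(1) th2(1) th3(1) by simp
 then obtain et where et: "et > 0" "!!n w y. w : J ==> y : J ==> dist y ((R^^n) w) < et ==>
  EX z:J. pullback n y w ?th z" by (rule lift_julia) blast
 have "og : ball og et" using et(1) by simp
 then obtain n2 b where b: "b : ball og et" "b : J" "(R^^n2) b = yy" by (rule reach[OF open_ball _ og(1) u0J]) blast
 define K where "K px = \<bar>bsum R px n2 b\<bar> + \<bar>bsum R px n1 a\<bar> + real (n1 + n2)*\<bar>bsum R px L og/real L\<bar>" for px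
 define C where "C = real (n1 + n2 + N + L) + C1 + K ph + K lg + ln c"
 have K0: "K px >= 0" for px unfolding K_def by (intro add_nonneg_nonneg mult_nonneg_nonneg) auto
 have lgL: "bsum R lg L og = 0" using exp_bsum_lg[OF og(1), of L] og(4) by (metis exp_eq_one_iff)
 have lc: "ln c >= 0" using c(1) by simp
 show ?thesis
 proof (rule that[of C])
  show "C >= 0" using C1(1) K0[of ph] K0[of lg] lc by (simp add: C_def)
  fix N0
  \<comment> \<open>So many periods that the total time exceeds both \<open>N0\<close> and the
    threshold \<open>N\<close> of \<open>ret_exists\<close>, yet exceeds \<open>N0\<close> by at
    most a constant.\<close>
  define k where "k = Suc ((N0 + N) div L)"
  have "(N0 + N) div L*L <= N0 + N" "N0 + N < Suc ((N0 + N) div L)*L"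
   using og(3) dividend_less_div_times[of L "N0 + N"] by simp_all
  hence k: "N0 + N < k*L" "k*L <= N0 + N + L" unfolding k_def by simp_all
  define n' where "n' = n1 + k*L"
  have "(R^^(k*L)) og = og" using fixed_mult[OF og(2)] by (metis mult.commute)
  hence Ra: "(R^^n') a = og" using a(3) by (simp add: n'_def add.commute[of n1] funpow_add)
  obtain z where z: "z : J" "(R^^n') z = b" "!!i. i <= n' ==> dist ((R^^i) z) ((R^^i) a) < ?th"
   using et(2)[OF a(2) b(2), of n'] b(1) Ra by (auto simp: dist_commute)
  define n where "n = n' + n2"
  have Rz: "(R^^n) z = yy" using z(2) b(3) by (simp add: n_def add.commute[of n'] funpow_add)
  have zb: "z : disc u0 (r1/80)" using z(3)[of 0] th3(2) by (auto simp: dist_commute)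
  have nN: "n >= N" "N0 < n" "real n <= real N0 + real (n1 + n2 + N + L)" using k unfolding n_def n'_def by linarith+
  obtain h where h: "ret n h" "sect n u0 (10*r1) h" "h yy = z" using N[OF nN(1) z(1) zb] Rz yy(2) by auto
  \<comment> \<open>Used twice: for \<open>ph\<close> it gives the average, and for
    \<open>lg\<close> the size of the derivative, since \<open>lg\<close> has sum zero over the
    neutral cycle.\<close>
  have est: "\<bar>bsum R px n z - real n*(bsum R px L og/real L)\<bar> <= ee/2*real n + K px"
   if *: "!!x y. x : J ==> y : J ==> dist x y < ?th ==> \<bar>px x - px y\<bar> <= ee/2" for px
  proof -
   let ?b = "bsum R px L og/real L"
   have 1: "\<bar>bsum R px n' z - bsum R px n' a\<bar> <= ee/2*real n'"
   proof (rule bsum_shadow)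
    fix i assume "i < n'"
    thus "\<bar>px ((R^^i) z) - px ((R^^i) a)\<bar> <= ee/2"
     using *[of "(R^^i) z" "(R^^i) a"] z(1) a(2) z(3)[of i] J_Rn by auto
   qed
   have 2: "bsum R px n z = bsum R px n' z + bsum R px n2 b" using bsum_add[of R px n' n2 z] z(2) by (simp add: n_def)
   have 3: "bsum R px n' a = bsum R px n1 a + real k*bsum R px L og"
    using bsum_add[of R px n1 "k*L" a] a(3) bsum_periodic[OF og(2)] by (simp add: n'_def)
   have 4: "real n*?b = real (n1 + n2)*?b + real k*bsum R px L og"
    using og(3) by (simp add: n_def n'_def field_simps)
   have 5: "\<bar>real (n1 + n2)*?b\<bar> = real (n1 + n2)*\<bar>?b\<bar>" by (simp only: abs_mult abs_of_nat)
   have 6: "ee/2*real n' <= ee/2*real n" using ee by (simp add: n_def)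
   have "\<bar>s - X\<bar> <= E + (\<bar>t2\<bar> + \<bar>t1\<bar> + W)"
    if "\<bar>s' - s1\<bar> <= E'" "E' <= E" "s = s' + t2" "s1 = t1 + y" "X = Y + y" "\<bar>Y\<bar> = W"
    for s X E t2 t1 W s' s1 E' y Y :: real using that by linarith
   from this[OF 1 6 2 3 4 5] show ?thesis unfolding K_def .
  qed
  have eph: "\<bar>bsum R ph n z - real n*(bsum R ph L og/real L)\<bar> <= ee/2*real n + K ph" by (rule est) (use th1(2) in auto)
  have "\<bar>bsum R lg n z - real n*(bsum R lg L og/real L)\<bar> <= ee/2*real n + K lg" by (rule est) (use th2(2) in auto)
  hence elg: "bsum R lg n z <= ee/2*real n + K lg" unfolding lgL by simp
  have half: "ee/2*real n <= ee*real n" using ee by simp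
  have ap: "aa h > 0" by (rule aa_pos[OF ret_sect[OF h(1)]])
  have ub: "u0 : ball u0 (r1/10)" using r1 by simp
  have hu: "hat h u0 : ball u0 r1" using disc_kap(1)[OF ret_D2(2)[OF h(1) yy(2)]] by (simp add: hat_def)
  have "1/c <= exp (bsum R lg n z)*aa h"
   using c(2)[OF ret_sect[OF h(1)] hu aa_le[OF h(1), unfolded aa_def] ub] h(3) exp_bsum_lg[OF z(1), of n] by (simp add: aa_def)
  also have "... <= exp (ee/2*real n + K lg)*aa h" using elg ap by (intro mult_right_mono) auto
  finally have "exp (- ln c)/exp (ee/2*real n + K lg) <= aa h"
   using c(1) by (simp add: divide_le_eq exp_minus inverse_eq_divide mult_ac)
  hence "exp (- ln c - (ee/2*real n + K lg)) <= aa h" by (simp only: exp_diff)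
  moreover have "exp (- (ee*real n + C)) <= exp (- ln c - (ee/2*real n + K lg))"
   using half C1(1) K0[of ph] by (simp only: exp_le_cancel_iff) (simp add: C_def)
  ultimately have "exp (- (ee*real n + C)) <= aa h" by linarith
  moreover have "\<bar>bsum R ph n (h y) - real n*(bsum R ph L og/real L)\<bar> <= ee*real n + C" if y: "y : D1 Int J" for y
  proof -
   have "\<bar>bsum R ph n (h y) - bsum R ph n z\<bar> <= ee/2*real n + C1" using C1(2)[OF h(2) y, of yy] h(3) yy by simp
   moreover have "ee/2*real n + ee/2*real n = ee*real n" by simp
   moreover have "C1 + K ph <= C" using K0[of lg] lc by (simp add: C_def)
   ultimately show ?thesis using eph by linarith
  qed
  moreover have "real n <= real N0 + C" using nN(3) C1(1) K0[of ph] K0[of lg] lc by (simp add: C_def)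
  ultimately show "EX n h. N0 < n & real n <= real N0 + C & ret n h & exp (- (ee*real n + C)) <= aa h &
   (ALL y:D1 Int J. \<bar>bsum R ph n (h y) - real n*(bsum R ph L og/real L)\<bar> <= ee*real n + C)" using nN(2) h(1) by blast
 qed
qed

end

section \<open>Rationally indifferent points\<close>

context expansive_rational
begin

definition crd :: "complex => nat => complex => complex" where
 "crd c n w = kap c ((R^^n) (kinv c w))"

lemma crd_holomorphic: "(!!w. w : W ==> (R^^n) (kinv c w) ~= Fin c) ==> crd c n holomorphic_on W"
 unfolding crd_def[abs_def] by (intro sphol_kap_holomorphic rmap_sphol rmap_Rn)

lemma crd_ne_open: "open {w. (R^^n) (kinv c w) ~= Fin c}"
proof -
 have "continuous_on UNIV (%w. (R^^n) (kinv c w))" by (intro sphol_continuous rmap_sphol rmap_Rn)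
 hence "open ((%w. (R^^n) (kinv c w)) -` (- {Fin c}))" by (intro open_vimage) auto
 thus ?thesis by (simp add: vimage_def)
qed

lemma crd_deriv:
 assumes "(R^^n) x = x" "x ~= Fin c"
 shows "(crd c n has_field_derivative deriv (crd c n) (kap c x)) (at (kap c x))"
 by (rule holomorphic_derivI[OF crd_holomorphic crd_ne_open[of n c]]) (use assms in auto)

lemma crd_iter:
 assumes x: "(R^^n) x = x" "x ~= Fin c"
 shows "deriv (crd c (n * k)) (kap c x) = deriv (crd c n) (kap c x)^k"
proof (induction k)
 case 0
 have "crd c 0 = (%w. w)" by (simp add: crd_def fun_eq_iff)
 thus ?case by simp
next
 case (Suc k)
 let ?W = "{w. (R^^(n * k)) (kinv c w) ~= Fin c}"
 have fk: "(R^^(n * k)) x = x" by (rule fixed_mult[OF x(1)])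
 have "((%w. crd c n (crd c (n * k) w)) has_field_derivative deriv (crd c n) (kap c x)*deriv (crd c (n * k)) (kap c x)) (at (kap c x))"
  by (rule DERIV_chain2[OF _ crd_deriv[OF fk x(2)]]) (use crd_deriv[OF x] fk x(2) in \<open>simp add: crd_def[of c "n * k"]\<close>)
 hence "(crd c (n*Suc k) has_field_derivative deriv (crd c n) (kap c x)*deriv (crd c (n * k)) (kap c x)) (at (kap c x))"
 proof (rule has_field_derivative_transform_within_open[OF _ crd_ne_open])
  show "kap c x : ?W" using fk x(2) by simp
  show "crd c n (crd c (n * k) w) = crd c (n*Suc k) w" if "w : ?W" for w using that by (simp add: crd_def funpow_add)
 qed
 thus ?case using Suc by (simp add: DERIV_imp_deriv)
qed

lemma crd_sph:
 assumes "(R^^n) x = x" "x ~= Fin c"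
 shows "sph_deriv (R^^n) x = cmod (deriv (crd c n) (kap c x))"
 using sph_deriv_chart[OF rmap_Rn, of n c "kap c x" c] crd_deriv[OF assms] assms hw_pos[of c "kap c x"] by (simp add: crd_def[abs_def])

text \<open>The multiplier is defined through \<open>chart\<close>, the estimates use
  \<open>kap c\<close>. The derivative at a fixed point does not depend on the coordinate:
  \<open>m\<close> and \<open>M\<close> are the coordinate changes in the two directions, so
  \<open>M' * m' = 1\<close>.\<close>

lemma crd_chart:
 assumes x: "(R^^n) x = x" "x ~= Fin c"
 shows "chart_deriv (R^^n) x = deriv (crd c n) (kap c x)"
proof -
 obtain m M m' M' where mM: "(m has_field_derivative m') (at (chart x x))" "(M has_field_derivative M') (at (kap c x))"
  "M' * m' = 1" "m (chart x x) = kap c x" "\<forall>\<^sub>F t in nhds (chart x x). kinv c (m t) = chart_inv x t"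
  "\<forall>\<^sub>F w in nhds (kap c x). chart x (kinv c w) = M w"
 proof (cases x)
  case (Fin z)
  have zc: "z - c ~= 0" using x(2) Fin by simp
  show ?thesis
  proof (rule that[of "%t. 1/(t - c)" "- (1/(z - c)^2)" "%w. c + 1/w" "- ((z - c)^2)"])
   show "((%t. 1/(t - c)) has_field_derivative - (1/(z - c)^2)) (at (chart x x))"
    using zc by (auto simp: Fin power2_eq_square intro!: derivative_eq_intros)
   show "((%w. c + 1/w) has_field_derivative - ((z - c)^2)) (at (kap c x))"
    using zc by (auto simp: Fin power2_eq_square field_simps intro!: derivative_eq_intros)
   have "\<forall>\<^sub>F t in nhds z. t ~= c" using zc by (intro t1_space_nhds) auto
   thus "\<forall>\<^sub>F t in nhds (chart x x). kinv c (1/(t - c)) = chart_inv x t"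
    unfolding Fin chart.simps by eventually_elim (use kinv_kap[of "Fin _" c] in auto)
   have "\<forall>\<^sub>F w in nhds (kap c x). w ~= 0" using zc Fin by (intro t1_space_nhds) auto
   thus "\<forall>\<^sub>F w in nhds (kap c x). chart x (kinv c w) = c + 1/w"
    unfolding Fin by eventually_elim (simp add: kinv_def hpt_def field_simps)
  qed (use zc Fin in "auto simp: field_simps")
 next
  case Infty
  show ?thesis
  proof (rule that[of "%t. t/(1 - c*t)" 1 "%w. w/(1 + c*w)" 1])
   have ev: "\<forall>\<^sub>F t in nhds 0. 1 - b*t ~= (0::complex)" for b
    by (rule isCont_eventually_ne) (auto intro!: continuous_intros)
   show "\<forall>\<^sub>F t in nhds (chart x x). kinv c (t/(1 - c*t)) = chart_inv x t"
    using ev[of c] unfolding Infty chart.simps by eventually_elim (auto simp: kinv_def hpt_def field_simps)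
   show "\<forall>\<^sub>F w in nhds (kap c x). chart x (kinv c w) = w/(1 + c*w)"
    using ev[of "- c"] unfolding Infty kap.simps by eventually_elim (auto simp: kinv_def hpt_def mult.commute)
  qed (auto simp: Infty intro!: derivative_eq_intros)
 qed
 have Fk: "crd c n (kap c x) = kap c x" using x by (simp add: crd_def)
 have "((%t. M (crd c n (m t))) has_field_derivative M'*(deriv (crd c n) (kap c x) * m')) (at (chart x x))"
  by (intro DERIV_chain2[of M] DERIV_chain2[of "crd c n"]) (use mM crd_deriv[OF x] Fk in auto)
 moreover have "\<forall>\<^sub>F t in nhds (chart x x). M (crd c n (m t)) = chart x ((R^^n) (chart_inv x t))"
 proof -
  have m0: "filterlim m (nhds (kap c x)) (nhds (chart x x))" using isCont_nhds[OF DERIV_isCont[OF mM(1)]] mM(4) by simp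
  have f0: "filterlim (crd c n) (nhds (kap c x)) (nhds (kap c x))" using isCont_nhds[OF DERIV_isCont[OF crd_deriv[OF x]]] Fk by simp
  have "\<forall>\<^sub>F t in nhds (chart x x). chart x (kinv c (crd c n (m t))) = M (crd c n (m t))"
   using eventually_compose_filterlim[OF mM(6) filterlim_compose[OF f0 m0]] .
  moreover have "\<forall>\<^sub>F w in nhds (kap c x). (R^^n) (kinv c w) ~= Fin c"
   using eventually_nhds_in_open[OF crd_ne_open, of "kap c x" n c] x by simp
  hence "\<forall>\<^sub>F t in nhds (chart x x). (R^^n) (kinv c (m t)) ~= Fin c" by (rule eventually_compose_filterlim[OF _ m0])
  ultimately show ?thesis using mM(5) by eventually_elim (simp add: crd_def)
 qed
 ultimately have "((%t. chart x ((R^^n) (chart_inv x t))) has_field_derivative M'*(deriv (crd c n) (kap c x) * m')) (at (chart x x))"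
  by (subst (asm) DERIV_cong_ev[OF refl _ refl])
 hence "chart_deriv (R^^n) x = M'*(deriv (crd c n) (kap c x) * m')"
  unfolding chart_deriv_def by (simp add: x(1) DERIV_imp_deriv)
 also have "... = (M' * m')*deriv (crd c n) (kap c x)" by (simp add: mult_ac)
 finally show ?thesis using mM(3) by simp
qed

lemma period:
 assumes "n >= 1" "(R^^n) x = x"
 shows "period R x >= 1" "(R^^period R x) x = x" "period R x dvd n"
proof -
 have P: "period R x >= 1 & (R^^period R x) x = x" unfolding period_def by (rule LeastI[of _ n]) (use assms in simp)
 thus "period R x >= 1" "(R^^period R x) x = x" by auto
 let ?l = "period R x"
 have "(R^^(n mod ?l + ?l*(n div ?l))) x = (R^^(n mod ?l)) x" using fixed_mult[of ?l x "n div ?l"] P by (simp only: funpow_add o_apply)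
 hence "(R^^(n mod ?l)) x = x" using assms(2) by (simp only: mod_mult_div_eq)
 moreover have "n mod ?l < ?l" using P by simp
 ultimately have "~ n mod ?l >= 1" using not_less_Least[of "n mod ?l" "%l. l >= 1 & (R^^l) x = x"] unfolding period_def by auto
 thus "?l dvd n" by (simp add: dvd_eq_mod_eq_0)
qed

text \<open>Passing from the period to a multiple of it raises the multiplier to a power, which
  turns a root of unity into \<open>1\<close>.\<close>

lemma rationally_indifferent_iff:
 assumes c: "x ~= Fin c"
 shows "x : rationally_indifferent R \<longleftrightarrow> (EX n>=1. (R^^n) x = x & deriv (crd c n) (kap c x) = 1)"
proof
 assume "x : rationally_indifferent R"
 then obtain n k where n: "n >= 1" "(R^^n) x = x" "k >= 1" "multiplier R x^k = 1"
  unfolding rationally_indifferent_def periodic_point_def by blast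
 note p = period[OF n(1,2)]
 have "deriv (crd c (period R x * k)) (kap c x) = 1"
  using crd_iter[OF p(2) c, of k] crd_chart[OF p(2) c] n(4) by (simp add: multiplier_def)
 thus "EX n>=1. (R^^n) x = x & deriv (crd c n) (kap c x) = 1"
  using p(1,2) n(3) fixed_mult[OF p(2), of k] by (intro exI[of _ "period R x * k"]) auto
next
 assume "EX n>=1. (R^^n) x = x & deriv (crd c n) (kap c x) = 1"
 then obtain n where n: "n >= 1" "(R^^n) x = x" "deriv (crd c n) (kap c x) = 1" by blast
 note p = period[OF n(1,2)]
 obtain k where k: "n = period R x * k" using p(3) by blast
 have "multiplier R x^k = 1" using crd_iter[OF p(2) c, of k] crd_chart[OF p(2) c] n(3) by (simp add: multiplier_def k)
 moreover have "k >= 1" using k n(1) by (cases k) auto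
 ultimately show "x : rationally_indifferent R" using n unfolding rationally_indifferent_def periodic_point_def by blast
qed

text \<open>By the identity theorem \<open>R^^n\<close> would be the identity wherever the
  coordinate is defined before and after, so almost all of \<open>J\<close> would be fixed by
  \<open>R^^n\<close>; expansivity allows only finitely many such points.\<close>

lemma no_local_identity:
 assumes n: "n >= 1" and U: "open U" "U ~= {}" "!!w. w : U ==> (R^^n) (kinv c w) ~= Fin c & crd c n w = w"
 shows False
proof -
 let ?W = "{w. (R^^n) (kinv c w) ~= Fin c}" and ?E = "kinv c -` (R^^n) -` {Fin c}"
 have "finite ?E" by (rule finite_vimageI[OF finite_fiber_n inj_kinv])
 hence "connected (UNIV - ?E)" by (intro connected_open_delete_finite) auto
 moreover have "UNIV - ?E = ?W" by auto
 ultimately have con: "connected ?W" by simp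
 have id: "crd c n w = w" if "w : ?W" for w
  by (rule analytic_continuation_open[OF U(1) crd_ne_open U(2) con _ crd_holomorphic holomorphic_on_ident _ that]) (use U(3) in auto)
 have "J <= {y : J. (R^^n) y = y} Un insert (Fin c) ((R^^n) -` {Fin c})"
 proof
  fix y assume y: "y : J"
  show "y : {y : J. (R^^n) y = y} Un insert (Fin c) ((R^^n) -` {Fin c})"
  proof (cases "y = Fin c | (R^^n) y = Fin c")
   case False
   hence "kap c ((R^^n) y) = kap c y" using id[of "kap c y"] by (simp add: crd_def)
   hence "(R^^n) y = y" using False kinv_kap by metis
   thus ?thesis using y by simp
  qed auto
 qed
 hence "finite J" using finite_fixed[OF n] finite_fiber_n[of n "Fin c"] finite_subset by blast
 thus False using uncountable_julia countable_finite by blast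
qed

text \<open>A rationally indifferent point cannot lie in the Fatou set: the averages of the iterates of a map
 \<open>f\<close> with \<open>f' = 1\<close> are uniformly injective near the fixed point, and composing with \<open>f\<close> hardly changes them.\<close>

lemma omega_julia:
 assumes x: "x : rationally_indifferent R"
 shows "x : J"
proof (rule ccontr)
 assume "x ~: J"
 hence xf: "x : fatou R" by (simp add: julia_def)
 obtain c where c: "x ~= Fin c" using ex_chart by blast
 obtain n where n: "n >= 1" "(R^^n) x = x" "deriv (crd c n) (kap c x) = 1" using x rationally_indifferent_iff[OF c] by blast
 define ze where "ze = kap c x"
 have "\<forall>\<^sub>F y in nhds x. y ~= Fin c" using c by (intro t1_space_nhds)
 moreover have "\<forall>\<^sub>F y in nhds x. dist (kap c y) ze < 1" using tendstoD[OF isCont_nhds[OF isCont_kap[OF c]], of 1] by (simp add: ze_def)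
 ultimately have "\<forall>\<^sub>F y in nhds x. y ~= Fin c & dist (kap c y) ze < 1" by eventually_elim simp
 then obtain ee where ee: "ee > 0" "!!y. dist y x < ee ==> y ~= Fin c & dist (kap c y) ze < 1" unfolding eventually_nhds_metric by blast
 obtain dl where dl: "dl > 0" "!!y n. dist y x < dl ==> dist ((R^^n) y) ((R^^n) x) < ee" by (rule equiD[OF equi_fatou xf ee(1)]) blast
 have "\<forall>\<^sub>F w in nhds ze. dist (kinv c w) x < dl" using tendstoD[OF isCont_nhds[OF isCont_kinv] dl(1), of c ze] c by (simp add: ze_def)
 then obtain ro where ro: "ro > 0" "!!w. w : ball ze ro ==> dist (kinv c w) x < dl" unfolding eventually_nhds_metric by (auto simp: dist_commute)
 define f where "f k = crd c (n * k)" for k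
 have fxd: "(R^^(n * k)) x = x" for k by (rule fixed_mult[OF n(2)])
 have ok: "(R^^(n * k)) (kinv c w) ~= Fin c & dist (f k w) ze < 1" if "w : ball ze ro" for k w
  using ee(2)[of "(R^^(n * k)) (kinv c w)"] dl(2)[OF ro(2)[OF that], of "n * k"] fxd[of k] by (simp add: f_def crd_def)
 have fh: "f k holomorphic_on ball ze ro" for k unfolding f_def by (rule crd_holomorphic) (use ok in blast)
 have d1: "deriv (f k) ze = 1" for k using crd_iter[OF n(2) c, of k] n(3) by (simp add: f_def ze_def)
 have fS: "f k (f 1 w) = f (Suc k) w" if "w : ball ze ro" for k w
  using ok[OF that, of 1] arg_cong[of "n * k + n" "n + n * k" "%j. (R^^j) (kinv c w)"] by (simp add: f_def crd_def funpow_add)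
 \<comment> \<open>Cauchy's estimates for \<open>T N - id\<close> with the averages
   \<open>T N\<close> defined below: \<open>C1\<close> bounds its first derivative, and
   \<open>C2\<close> is a Lipschitz constant of that derivative, which vanishes at
   \<open>ze\<close>. On the ball of radius \<open>si\<close> it is therefore at most
   \<open>1/2\<close>, for all \<open>N\<close> at once.\<close>
 define C1 where "C1 = 4*(2 + ro)/ro"
 define C2 where "C2 = 4*C1/(ro/2)"
 have C: "C1 > 0" "C2 > 0" using ro(1) by (simp_all add: C1_def C2_def)
 define si where "si = min (ro/8) (1/(2*C2))"
 have si: "si > 0" "si <= ro/8" "C2 * si <= 1/2"
 proof -
  show "si > 0" "si <= ro/8" using ro(1) C by (auto simp: si_def)
  have "C2 * si <= C2*(1/(2*C2))" using C by (intro mult_left_mono) (auto simp: si_def)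
  thus "C2 * si <= 1/2" using C by simp
 qed
 define T where "T N w = (\<Sum>k<N. f k w)/of_nat N" for N w
 have inj: "cmod (w - y) <= 2*cmod (T N w - T N y)" if N: "N >= 1" and wy: "w : ball ze si" "y : ball ze si" for N w y
 proof -
  define g where "g w = T N w - w" for w
  have gh: "g holomorphic_on ball ze ro" unfolding g_def T_def using N by (intro holomorphic_intros fh) auto
  have gb: "cmod (g w) < 2 + ro" if w: "w : ball ze ro" for w
  proof -
   have "T N w - ze = (\<Sum>k<N. f k w - ze)/of_nat N" using N by (simp add: T_def sum_subtractf field_simps)
   hence "cmod (T N w - ze) = cmod (\<Sum>k<N. f k w - ze)/real N" by (simp add: norm_divide)
   also have "... <= (\<Sum>k<N. 1)/real N"
    by (intro divide_right_mono sum_norm_le) (use ok[OF w] in "auto simp: dist_norm intro: less_imp_le")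
   finally have "cmod (T N w - ze) <= 1" using N by simp
   moreover have "g w = (T N w - ze) - (w - ze)" by (simp add: g_def)
   ultimately show ?thesis using w norm_triangle_ineq4[of "T N w - ze" "w - ze"] by (simp add: dist_norm norm_minus_commute)
  qed
  have fd: "(f k has_field_derivative 1) (at ze)" for k using holomorphic_derivI[OF fh open_ball, of ze k] ro(1) d1 by simp
  have "(g has_field_derivative (\<Sum>k<N. 1)/of_nat N - 1) (at ze)"
   unfolding g_def T_def by (intro DERIV_diff DERIV_cdivide DERIV_ident DERIV_sum fd)
  hence g0: "deriv g ze = 0" using N by (simp add: DERIV_imp_deriv)
  have gd: "cmod (deriv g w) <= C1" if w: "w : ball ze (ro/2)" for w
  proof -
   have sub: "cball w (ro/4) <= ball ze ro"
   proof
    fix v assume "v : cball w (ro/4)"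
    thus "v : ball ze ro" using w dist_triangle[of ze v w] ro(1) by simp
   qed
   have "norm ((deriv^^1) g w) <= fact 1*(2 + ro)/(ro/4)^1"
    by (rule Cauchy_higher_deriv_bound[where y = 0])
     (use gb ro(1) sub ball_subset_cball[of w "ro/4"] holomorphic_on_subset[OF gh]
       continuous_on_subset[OF holomorphic_on_imp_continuous_on[OF gh] sub] in "auto simp: subset_iff")
   thus ?thesis by (simp add: C1_def mult_ac)
  qed
  have b2: "cmod (deriv g w) <= 1/2" if w: "w : ball ze si" for w
  proof -
   have "cmod (deriv g w - deriv g ze) <= 4*C1/(ro/2)*cmod (w - ze)"
   proof (rule holomorphic_bounded_lipschitz)
    show "deriv g holomorphic_on ball ze (ro/2)" using holomorphic_deriv[OF gh open_ball] by (rule holomorphic_on_subset) (use ro(1) in auto)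
   qed (use gd ro(1) w si in auto)
   also have "... <= C2 * si" unfolding C2_def[symmetric] using w C by (intro mult_left_mono) (auto simp: dist_norm norm_minus_commute)
   finally show ?thesis using g0 si(3) by simp
  qed
  have "cmod (g w - g y) <= 1/2*cmod (w - y)"
  proof (rule field_differentiable_bound[of "ball ze si" g "deriv g"])
   fix v assume v: "v : ball ze si"
   hence "v : ball ze ro" using si by auto
   thus "(g has_field_derivative deriv g v) (at v within ball ze si)" using holomorphic_derivI[OF gh open_ball] by blast
  qed (use b2 wy in auto)
  moreover have "T N w - T N y = (w - y) + (g w - g y)" by (simp add: g_def)
  ultimately show ?thesis using norm_diff_ineq[of "w - y" "g w - g y"] by simp
 qed
 have cf: "isCont (f 1) ze" using holomorphic_on_imp_continuous_on[OF fh] ro(1) by (simp add: continuous_on_eq_continuous_at)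
 have f1: "f 1 ze = ze" using fxd[of 1] c by (simp add: f_def crd_def ze_def)
 obtain ta where ta: "ta > 0" "!!w. dist w ze < ta ==> dist (f 1 w) ze < si"
  using cf si(1) f1 unfolding continuous_at_eps_delta by metis
 define U where "U = ball ze (min si ta)"
 show False
 proof (rule no_local_identity[OF n(1), of U c])
  show "open U" "U ~= {}" using si(1) ta(1) by (auto simp: U_def)
  fix w assume "w : U"
  hence w: "w : ball ze si" "w : ball ze ro" "f 1 w : ball ze si" using ta(2)[of w] si by (auto simp: U_def dist_commute)
  have le: "cmod (f 1 w - w) <= 4*(1/real (Suc N))" for N
  proof -
   have "T (Suc N) (f 1 w) - T (Suc N) w = (\<Sum>k<Suc N. f (Suc k) w - f k w)/of_nat (Suc N)"
    using fS[OF w(2)] by (simp only: T_def sum_subtractf diff_divide_distrib)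
   also have "... = (f (Suc N) w - f 0 w)/of_nat (Suc N)" using sum_lessThan_telescope[of "%k. f k w" "Suc N"] by (simp only:)
   finally have "cmod (T (Suc N) (f 1 w) - T (Suc N) w) = cmod (f (Suc N) w - f 0 w)/real (Suc N)" by (simp only: norm_divide norm_of_nat)
   also have "... <= 2/real (Suc N)"
    using ok[OF w(2), of "Suc N"] ok[OF w(2), of 0] dist_triangle2[of "f (Suc N) w" "f 0 w" ze]
    by (intro divide_right_mono) (auto simp: dist_norm)
   finally show ?thesis using inj[of "Suc N" "f 1 w" w] w by simp
  qed
  have "cmod (f 1 w - w) <= 4*0"
   by (rule LIMSEQ_le_const[OF tendsto_mult[OF tendsto_const LIMSEQ_Suc[OF lim_1_over_n]]]) (use le in auto)
  thus "(R^^n) (kinv c w) ~= Fin c & crd c n w = w" using ok[OF w(2), of 1] by (simp add: f_def)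
 qed
qed

lemma sph_deriv_iter:
 assumes "(R^^n) x = x" shows "sph_deriv (R^^(n * k)) x = sph_deriv (R^^n) x^k"
proof -
 obtain c where c: "x ~= Fin c" using ex_chart by blast
 show ?thesis using crd_sph[OF fixed_mult[OF assms] c, of k] crd_sph[OF assms c] crd_iter[OF assms c, of k] by (simp add: norm_power)
qed

lemma omega_neutral:
 assumes "x : rationally_indifferent R"
 obtains n where "n >= 1" "(R^^n) x = x" "sph_deriv (R^^n) x = 1"
proof -
 obtain c where c: "x ~= Fin c" using ex_chart by blast
 obtain n where "n >= 1" "(R^^n) x = x" "deriv (crd c n) (kap c x) = 1" using assms rationally_indifferent_iff[OF c] by blast
 thus ?thesis using that crd_sph[OF _ c] by simp
qed

lemma sph_deriv_sect_point:
 assumes "good u r" "sect n u r g" "w : ball u r" "g (kinv c0 w) = x"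
 shows "sph_deriv (R^^n) x*(cmod (deriv (hat g) w)*hw c0 (kap c0 x)) = hw c0 w"
 using hat_deriv(2)[OF assms(1-3)] assms(4) by (simp add: hat_def)

text \<open>Outside \<open>P0\<close> a fixed point of \<open>R^^n\<close> would have inverse
  branches of all orders \<open>n*N\<close> that fix it, and these contract; but at a rationally
  indifferent point their derivatives have modulus one.\<close>

lemma omega_P0: "rationally_indifferent R <= P0"
proof
 fix x assume x: "x : rationally_indifferent R"
 have xJ: "x : J" by (rule omega_julia[OF x])
 obtain n where n: "n >= 1" "(R^^n) x = x" "sph_deriv (R^^n) x = 1" by (rule omega_neutral[OF x])
 have xc: "x ~= Fin c0" using xJ c0 crit_fatou by (auto simp: julia_def)
 show "x : P0"
 proof (rule ccontr)
  assume "x ~: P0"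
  then obtain r where r: "good (kap c0 x) r" by (rule good_disc[OF xJ])
  hence r0: "r > 0" by (simp add: good_def)
  have kx: "kinv c0 (kap c0 x) = x" by (rule kinv_kap[OF xc])
  obtain N where N: "!!n g. n >= N ==> sect n (kap c0 x) r g ==> cmod (deriv (hat g) (kap c0 x)) < 1"
   by (rule shrink_deriv_centre[OF r, of 1]) (use kx xJ in auto)
  have "x : disc (kap c0 x) r" using disc_centre[OF r0, of "kap c0 x"] kx by simp
  then obtain g where g: "sect (n*N) (kap c0 x) r g" "g x = x" by (rule sect_exists[OF r _ fixed_mult[OF n(2)]])
  have "cmod (deriv (hat g) (kap c0 x))*hw c0 (kap c0 x) = hw c0 (kap c0 x)"
   using sph_deriv_sect_point[OF r g(1), of "kap c0 x" x] r0 kx g(2) sph_deriv_iter[OF n(2), of N] n(3) by simp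
  hence "cmod (deriv (hat g) (kap c0 x)) = 1" using hw_pos[of c0 "kap c0 x"] by simp
  moreover have "N <= n*N" using n(1) by simp
  ultimately show False using N g(1) by fastforce
 qed
qed

text \<open>Otherwise a nearby point of the perfect set \<open>J\<close> would stay close to the
  orbit of \<open>a\<close> forever, against expansivity.\<close>

lemma not_attracting:
 assumes a: "a : J" "(R^^L) a = a" "L >= 1"
 shows "1 <= sph_deriv (R^^L) a"
proof (rule ccontr)
 assume "~ 1 <= sph_deriv (R^^L) a"
 hence "\<forall>\<^sub>F y in at a. dist ((R^^L) y) ((R^^L) a)/dist y a < 1" by (intro order_tendstoD(2)[OF sph_deriv_tendsto[OF rmap_Rn]]) simp
 then obtain et where et: "et > 0" "!!y. y ~= a ==> dist y a < et ==> dist ((R^^L) y) a/dist y a < 1"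
  unfolding eventually_at using a(2) by auto
 obtain r where r: "r > 0" "!!x y i. dist x y <= r ==> i <= L ==> dist ((R^^i) x) ((R^^i) y) < v" by (rule uniform_cont_steps[OF v_props(1), of L]) blast
 have "min et r > 0" using et(1) r(1) by simp
 then obtain y where y: "y : J" "y ~= a" "dist y a < min et r" by (rule julia_perfect[OF a(1)])
 have near: "dist ((R^^(L * k)) y) a < min et r" for k
 proof (induction k)
  case (Suc k)
  let ?z = "(R^^(L * k)) y"
  have "dist ((R^^L) ?z) a <= dist ?z a"
  proof (cases "?z = a")
   case False
   thus ?thesis using et(2)[OF False] Suc by (simp add: divide_less_eq)
  qed (use a in simp)
  thus ?case using Suc by (simp add: funpow_add)
 qed (use y in simp)
 have "y = a"
 proof (rule expand[OF y(1) a(1)])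
  fix n
  have e: "(R^^n) w = (R^^(n mod L)) ((R^^(L*(n div L))) w)" for w
  proof -
   have "(R^^(n mod L + L*(n div L))) w = (R^^(n mod L)) ((R^^(L*(n div L))) w)" by (simp only: funpow_add o_apply)
   thus ?thesis by (simp only: mod_mult_div_eq)
  qed
  have "n mod L <= L" using a(3) by (simp add: less_imp_le)
  thus "dist ((R^^n) y) ((R^^n) a) <= v"
   unfolding e[of y] e[of a] fixed_mult[OF a(2)] using r(2)[of "(R^^(L*(n div L))) y" a] near[of "n div L"] by (simp add: less_imp_le)
 qed
 thus False using y(2) by simp
qed

text \<open>Let \<open>S = R ^^ l\<close> fix \<open>x \<in> J\<close> with multiplier \<open>\<lambda>\<close> of modulus one, and let a sequence of iterates of \<open>S\<close>, all of
 them injective on \<open>V\<close>, converge to \<open>x\<close> on \<open>V\<close>. If \<open>\<lambda> \<noteq> 1\<close>, then \<open>S\<close> moves points near \<open>x\<close> by an amount comparable with their distance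
 to \<open>x\<close>, so by Koebe the image of a small disc \<open>B\<close> contains a disc of such a size. Hence \<open>S ^^ k\<close> maps the
 centre of \<open>B\<close> into \<open>B\<close> whenever \<open>\<lambda> ^ k\<close> is close to \<open>1\<close>, and its orbit stays in a compact subset of \<open>V\<close>.\<close>

lemma neutral_parabolic:
 assumes V: "open V" "connected V" "V <= fatou R" "(R^^l) ` V <= V" and inj: "!!j. inj_on (R^^j) V"
  and x: "x : J" "(R^^l) x = x" "sph_deriv (R^^l) x = 1" and z: "z : V"
  and lim: "(%n. (R^^(l*u n)) z) ----> x" and l: "l >= 1"
 shows "x : rationally_indifferent R"
proof -
 \<comment> \<open>The coordinate is centred at a point of \<open>J\<close> other than
   \<open>x\<close>: it is then defined on the whole Fatou set, hence on \<open>V\<close> and all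
   its images.\<close>
 have "~ J <= {x, Infty}" using uncountable_julia countable_subset by (metis countable_empty countable_insert)
 then obtain y where "y : J" "y ~= x" "y ~= Infty" by blast
 then obtain c where c: "Fin c : J" "x ~= Fin c" by (cases y) auto
 have fc: "y ~= Fin c" if "y : fatou R" for y using that c(1) by (auto simp: julia_def)
 define lam where "lam = deriv (crd c l) (kap c x)"
 have nl: "cmod lam = 1" using crd_sph[OF x(2) c(2)] x(3) by (simp add: lam_def)
 define W where "W = kinv c -` V"
 have Vk: "kap c y : W & kinv c (kap c y) = y" if "y : V" for y using kinv_kap[OF fc] that V(3) by (auto simp: W_def)
 have W: "open W" "connected W"
 proof -
  show "open W" unfolding W_def by (rule open_kinv_vimage[OF V(1)])
  have "W = kap c ` V" using Vk by (force simp: W_def)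
  moreover have "connected (kap c ` V)"
   by (rule connected_continuous_image[OF continuous_on_subset[OF continuous_on_kap] V(2)]) (use V(3) fc in auto)
  ultimately show "connected W" by simp
 qed
 define ph where "ph n = crd c (l*u n)" for n
 define p' where "p' n y = kap c ((R^^(l*u n)) y) - kap c x" for n y
 have SV: "(R^^(l * k)) y : V" if "y : V" for k y
 proof (induction k)
  case (Suc k) thus ?case using V(4) by (auto simp: funpow_add)
 qed (use that in simp)
 have Rf: "(R^^j) y ~= Fin c" "(R^^j) y ~= x" if "y : V" for j y
  using fc fatou_Rn[of j y] V(3) that x(1) by (auto simp: julia_def)
 have hol: "ph n holomorphic_on W" for n unfolding ph_def by (rule crd_holomorphic) (use Rf(1) in "auto simp: W_def")
 have php: "ph n (kap c y) = p' n y + kap c x" if "y : V" for n y using Vk[OF that] by (simp add: ph_def p'_def crd_def)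
 have injW: "inj_on (ph n) W" for n
 proof (rule inj_onI)
  fix a b assume ab: "a : W" "b : W" "ph n a = ph n b"
  hence "(R^^(l*u n)) (kinv c a) = (R^^(l*u n)) (kinv c b)"
   using kinv_kap[OF Rf(1)] unfolding ph_def crd_def W_def by (metis vimageE)
  hence "kinv c a = kinv c b" using inj_onD[OF inj] ab by (auto simp: W_def)
  thus "a = b" using inj_kinv injD by metis
 qed
 have p0: "p' n y ~= 0" if "y : V" for n y
 proof
  assume "p' n y = 0"
  hence "kinv c (kap c ((R^^(l*u n)) y)) = kinv c (kap c x)" by (simp add: p'_def)
  thus False using kinv_kap[OF Rf(1)[OF that]] kinv_kap[OF c(2)] Rf(2)[OF that] by simp
 qed
 have limy: "(%n. (R^^(l*u n)) y) ----> x" if "y : V" for y by (rule iterates_to_julia[OF V(1-3) z lim x(1) that])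
 have r1: "(%n. p' n ((R^^l) y)/p' n y) ----> lam" if y: "y : V" for y
 proof -
  have d: "((%w. (crd c l w - crd c l (kap c x))/(w - kap c x)) ---> lam) (at (kap c x))"
   using crd_deriv[OF x(2) c(2)] unfolding has_field_derivative_iff lam_def .
  have "filterlim (%n. kap c ((R^^(l*u n)) y)) (at (kap c x)) sequentially"
   by (rule filterlim_atI[OF isCont_tendsto_compose[OF isCont_kap[OF c(2)] limy[OF y]]]) (use p0[OF y] in "simp add: p'_def")
  from filterlim_compose[OF d this]
  have "(%n. (crd c l (kap c ((R^^(l*u n)) y)) - crd c l (kap c x))/p' n y) ----> lam" by (simp add: p'_def)
  moreover have "crd c l (kap c ((R^^(l*u n)) y)) - crd c l (kap c x) = p' n ((R^^l) y)" for n
   using kinv_kap[OF Rf(1)[OF y]] kinv_kap[OF c(2)] x(2) arg_cong[of "l + l*u n" "l*u n + l" "%j. (R^^j) y"] by (simp add: crd_def p'_def funpow_add)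
  ultimately show ?thesis by simp
 qed
 have r2: "(%n. p' n ((R^^(l * k)) z)/p' n z) ----> lam^k" for k
 proof (induction k)
  case 0
  thus ?case using p0[OF z] by simp
 next
  case (Suc k)
  have "(%n. p' n ((R^^l) ((R^^(l * k)) z))/p' n ((R^^(l * k)) z)*(p' n ((R^^(l * k)) z)/p' n z)) ----> lam*lam^k"
   by (rule tendsto_mult[OF r1[OF SV[OF z]] Suc])
  thus ?case using p0[OF SV[OF z, of k]] by (simp add: funpow_add)
 qed
 define og where "og = kap c z"
 have ogW: "og : W" using Vk[OF z] by (simp add: og_def)
 have "lam = 1"
 proof (rule ccontr)
  assume ne: "lam ~= 1"
  have "EX c1>0. \<exists>\<^sub>F n in sequentially. c1*cmod (p' n z) <= cmod (deriv (ph n) og)"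
  proof (rule ccontr)
   assume "~ ?thesis"
   hence small: "EVS n. cmod (deriv (ph n) og) < c1*cmod (p' n z)" if "c1 > 0" for c1
    using that by (simp add: frequently_def not_le)
   \<comment> \<open>\<open>A\<close> holds where the derivatives of \<open>ph n\<close>, and the
     distances of its values from those at \<open>og\<close>, are negligible against
     \<open>p' n z\<close>. By Koebe this property is locally constant on \<open>W\<close>; it would
     pass from \<open>og\<close> to the image of \<open>z\<close> under \<open>R^^l\<close>, where
     the second limit is \<open>lam - 1\<close>.\<close>
   define A where "A ze \<longleftrightarrow> (%n. deriv (ph n) ze/p' n z) ----> 0 & (%n. (ph n ze - ph n og)/p' n z) ----> 0" for ze
   have "A og"
   proof -
    have "(%n. deriv (ph n) og/p' n z) ----> 0"
    proof (rule tendstoI)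
     fix e :: real assume "e > 0"
     from small[OF this] show "EVS n. dist (deriv (ph n) og/p' n z) 0 < e"
      by eventually_elim (use p0[OF z] in "simp add: norm_divide divide_less_eq")
    qed
    thus ?thesis by (simp add: A_def)
   qed
   have step: "A b" if a: "A a" and r: "r > 0" "ball ze r <= W" "a : ball ze (r/10)" "b : ball ze (r/10)" for a b ze r
   proof -
    note h = holomorphic_on_subset[OF hol r(2)] inj_on_subset[OF injW r(2)]
    have a0: "(%n. deriv (ph n) a/p' n z) ----> 0" "(%n. (ph n a - ph n og)/p' n z) ----> 0" using a by (auto simp: A_def)
    have 1: "(%n. deriv (ph n) b/p' n z) ----> 0"
    proof (rule tendsto_0_le[OF a0(1), of _ kK], intro always_eventually allI)
     fix n
     have "cmod (deriv (ph n) b) <= kK*cmod (deriv (ph n) a)" by (rule koebe_two_point[OF h r(1) r(4) r(3)])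
     from divide_right_mono[OF this, of "cmod (p' n z)"]
     show "norm (deriv (ph n) b/p' n z) <= norm (deriv (ph n) a/p' n z) * kK" by (simp add: norm_divide mult_ac)
    qed
    have 2: "(%n. (ph n b - ph n a)/p' n z) ----> 0"
    proof (rule tendsto_0_le[OF a0(1), of _ "kK*cmod (b - a)"], intro always_eventually allI)
     fix n
     have "cmod (ph n b - ph n a) <= kK*cmod (deriv (ph n) a)*cmod (b - a)" by (rule koebe_bilipschitz[OF h r(1) r(4) r(3) r(3)])
     from divide_right_mono[OF this, of "cmod (p' n z)"]
     show "norm ((ph n b - ph n a)/p' n z) <= norm (deriv (ph n) a/p' n z)*(kK*cmod (b - a))" by (simp add: norm_divide mult_ac)
    qed
    have "(%n. (ph n b - ph n a)/p' n z + (ph n a - ph n og)/p' n z) ----> 0 + 0" by (rule tendsto_add[OF 2 a0(2)])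
    thus ?thesis using 1 by (simp add: A_def diff_divide_distrib)
   qed
   have "A og = A (kap c ((R^^l) z))"
   proof (rule connected_local_const[OF W(2) ogW])
    show "kap c ((R^^l) z) : W" using Vk[OF SV[OF z, of 1]] by simp
    show "ALL a:W. \<forall>\<^sub>F b in at a within W. A a = A b"
    proof
     fix a assume "a : W"
     then obtain r where r: "r > 0" "ball a r <= W" by (rule openE[OF W(1)])
     have "A a = A b" if "b : ball a (r/10)" for b using step[OF _ r, of a b] step[OF _ r, of b a] that r(1) by auto
     moreover have "\<forall>\<^sub>F b in at a within W. b : ball a (r/10)" using r(1) by (intro eventually_at_in_open'[THEN filter_leD[OF at_le[OF subset_UNIV]]]) auto
     ultimately show "\<forall>\<^sub>F b in at a within W. A a = A b" by (auto elim: eventually_mono)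
    qed
   qed
   hence "(%n. (ph n (kap c ((R^^l) z)) - ph n og)/p' n z) ----> 0" using `A og` by (simp add: A_def)
   moreover have "(ph n (kap c ((R^^l) z)) - ph n og)/p' n z = p' n ((R^^l) z)/p' n z - 1" for n
    using php[OF SV[OF z, of 1]] php[OF z] p0[OF z] by (simp add: og_def diff_divide_distrib)
   ultimately have "(%n. p' n ((R^^l) z)/p' n z - 1) ----> 0" by simp
   hence "(%n. p' n ((R^^l) z)/p' n z) ----> 1" by (simp add: LIM_zero_iff)
   thus False using r1[OF z] LIMSEQ_unique ne by blast
  qed
  then obtain c1 where c1: "c1 > 0" "\<exists>\<^sub>F n in sequentially. c1*cmod (p' n z) <= cmod (deriv (ph n) og)" by blast
  obtain ro where ro: "ro > 0" "ball og ro <= W" by (rule openE[OF W(1) ogW])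
  define s where "s = ro/(160 * kK)"
  have "ro/(160 * kK) <= ro/160" using ro(1) kK by (intro divide_left_mono) auto
  hence s: "0 < s" "s < ro" using ro(1) kK by (auto simp: s_def)
  define si where "si = s/10*c1"
  have si: "si > 0" using s c1 by (simp add: si_def)
  define B where "B = kinv c ` cball og s"
  have cb: "cball og s <= W" using ro(2) s(2) by (auto simp: subset_iff)
  have B: "B <= V" "compact B" using cb unfolding B_def W_def by (auto intro!: compact_continuous_image continuous_on_kinv)
  have hit: "(R^^(l * k)) z : B" if k: "cmod (lam^k - 1) < si" for k
  proof -
   have ev: "EVS n. cmod (p' n ((R^^(l * k)) z)/p' n z - 1) < si"
    using order_tendstoD(2)[OF tendsto_norm[OF tendsto_diff[OF r2[of k] tendsto_const]] k] .
   obtain n where n: "cmod (p' n ((R^^(l * k)) z)/p' n z - 1) < si" "c1*cmod (p' n z) <= cmod (deriv (ph n) og)"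
    using frequently_ex[OF frequently_eventually_frequently[OF c1(2) ev]] by blast
   let ?y = "(R^^(l * k)) z"
   have "p' n ?y/p' n z - 1 = (p' n ?y - p' n z)/p' n z" using p0[OF z] by (simp add: diff_divide_distrib)
   hence "cmod (p' n ?y - p' n z) < si*cmod (p' n z)" using n(1) p0[OF z] by (simp add: norm_divide divide_less_eq)
   also have "... <= s/10*cmod (deriv (ph n) og)" unfolding si_def using mult_left_mono[OF n(2), of "s/10"] s by (simp add: mult_ac)
   finally have "ph n (kap c ?y) : ball (ph n og) (s/10*cmod (deriv (ph n) og))"
    using php[OF SV[OF z]] php[OF z] by (simp add: og_def dist_norm norm_minus_commute)
   also have "... <= ph n ` ball og s"
    by (rule koebe_cover[OF holomorphic_on_subset[OF hol ro(2)] inj_on_subset[OF injW ro(2)] ro(1) _ s(1)]) (use ro(1) in "auto simp: s_def")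
   finally obtain w where w: "w : ball og s" "ph n (kap c ?y) = ph n w" by blast
   have "kap c ?y = w" by (rule inj_onD[OF injW w(2)]) (use Vk[OF SV[OF z]] cb w(1) in auto)
   thus ?thesis using Vk[OF SV[OF z, of k]] w(1) unfolding B_def by (metis ball_subset_cball imageI subsetD)
  qed
  have cp: "compact (closure (range (%j. lam^j)))"
   by (rule compact_closure[THEN iffD2]) (auto simp: bounded_iff norm_power nl)
  have cov: "closure (range (%j. lam^j)) <= (\<Union>e\<in>UNIV. ball (lam^e) si)"
   using si by (force simp: closure_approachable)
  obtain E where E: "finite E" "closure (range (%j. lam^j)) <= (\<Union>e\<in>E. ball (lam^e) si)"
   by (rule compactE_image[OF cp _ cov]) auto
  define G where "G = Max (insert 0 E)"
  \<comment> \<open>Each \<open>lam^j\<close> is within \<open>si\<close> of some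
    \<open>lam^e\<close> with \<open>e\<close> in \<open>E\<close>. If \<open>e <= j\<close>, then
    \<open>lam^(j - e)\<close> is close to \<open>1\<close> and \<open>hit\<close> applies to
    \<open>j - e\<close>; the finitely many remaining \<open>j\<close> are added one by one.\<close>
  define Q where "Q = (\<Union>e\<in>E. (R^^(l*e)) ` B) Un (%j. (R^^(l*j)) z) ` {..G}"
  have "compact ((R^^(l*e)) ` B)" for e by (intro compact_continuous_image cont_Rn B(2))
  hence "compact Q" unfolding Q_def using E(1) by (intro compact_Un compact_UN) (auto intro: finite_imp_compact)
  hence "closed Q" by (rule compact_imp_closed)
  moreover have "Q <= V" unfolding Q_def using B(1) SV z by blast
  moreover have "(R^^(l*j)) z : Q" for j
  proof -
   have "lam^j : closure (range (%j. lam^j))" by (rule subsetD[OF closure_subset]) simp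
   hence "lam^j : (\<Union>e\<in>E. ball (lam^e) si)" by (rule subsetD[OF E(2)])
   then obtain e where e: "e : E" "dist (lam^e) (lam^j) < si" by auto
   show ?thesis
   proof (cases "e <= j")
    case True
    have "lam^j = lam^e*lam^(j - e)" using True by (simp add: power_add[symmetric])
    hence "lam^j - lam^e = lam^e*(lam^(j - e) - 1)" by (simp add: algebra_simps)
    hence "cmod (lam^j - lam^e) = cmod (lam^(j - e) - 1)" by (simp only: norm_mult norm_power nl power_one mult_1)
    hence "cmod (lam^(j - e) - 1) = dist (lam^e) (lam^j)" by (simp only: dist_norm norm_minus_commute[of "lam^e" "lam^j"])
    hence "(R^^(l*(j - e))) z : B" using hit e(2) by simp
    moreover have "(R^^(l*e + l*(j - e))) z = (R^^(l*e)) ((R^^(l*(j - e))) z)" by (simp only: funpow_add o_apply)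
    moreover have "l*e + l*(j - e) = l*j" using True by (simp add: distrib_left[symmetric])
    ultimately have "(R^^(l*j)) z : (R^^(l*e)) ` B" by simp
    thus ?thesis using e(1) unfolding Q_def by blast
   next
    case False
    have "e <= G" unfolding G_def using e(1) E(1) by (intro Max_ge) auto
    hence "j <= G" using False by linarith
    thus ?thesis unfolding Q_def by blast
   qed
  qed
  ultimately have "x : V" using closed_sequentially[OF _ _ lim] by blast
  thus False using V(3) x(1) by (auto simp: julia_def)
 qed
 thus ?thesis using rationally_indifferent_iff[OF c(2)] l x(2) unfolding lam_def by blast
qed

text \<open>The points of \<open>P0\<close> are separated, so an orbit that stays close to
  \<open>P0\<close> follows the orbit of one of them, step by step. By expansivity it would then lie
  in \<open>P0\<close>.\<close>

lemma away_from_P0: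
 obtains et where "et > 0" "!!x N. x : J ==> (!!n. (R^^n) x ~: P0) ==> EX n>=N. ALL a:P0. et <= dist ((R^^n) x) a"
proof -
 obtain e where e: "e > 0" "!!a b. a : P0 ==> b : P0 ==> a ~= b ==> e <= dist a b" by (rule finite_separated[OF finite_P0]) blast
 have "e/2 > 0" using e(1) by simp
 then obtain t where t: "t > 0" "!!x y i. dist x y <= t ==> i <= 1 ==> dist ((R^^i) x) ((R^^i) y) < e/2"
  using uniform_cont_steps[of "e/2" 1] by blast
 let ?et = "min t (min (e/2) v)"
 show ?thesis
 proof (rule that[of ?et])
  show "?et > 0" using t(1) e(1) v_props(1) by simp
  fix x N assume x: "x : J" "!!n. (R^^n) x ~: P0"
  show "EX n>=N. ALL a:P0. ?et <= dist ((R^^n) x) a"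
  proof (rule ccontr)
   assume "~ ?thesis"
   hence near: "EX a:P0. dist ((R^^n) x) a < ?et" if "n >= N" for n using that by force
   obtain a where a: "a : P0" "dist ((R^^N) x) a < ?et" using near[of N] by blast
   have Ra: "(R^^k) a : P0" for k using a(1) R_P0 by (induction k) auto
   have d: "dist ((R^^k) ((R^^N) x)) ((R^^k) a) < ?et" for k
   proof (induction k)
    case (Suc k)
    have "dist ((R^^Suc k) ((R^^N) x)) ((R^^Suc k) a) < e/2" using t(2)[of "(R^^k) ((R^^N) x)" "(R^^k) a" 1] Suc by simp
    moreover obtain b where b: "b : P0" "dist ((R^^Suc k) ((R^^N) x)) b < ?et"
     using near[of "Suc k + N"] by (auto simp: funpow_add)
    ultimately have "dist b ((R^^Suc k) a) < e"
     using dist_triangle3[of b "(R^^Suc k) a" "(R^^Suc k) ((R^^N) x)"] by simp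
    hence "b = (R^^Suc k) a" using e(2)[OF b(1) Ra[of "Suc k"]] by fastforce
    thus ?case using b(2) by simp
   qed (use a in simp)
   have "(R^^N) x = a"
    by (rule expand) (use x(1) J_Rn P0_J[OF a(1)] less_imp_le[OF d] in "auto intro: order_trans")
   thus False using x(2)[of N] a(1) by simp
  qed
 qed
qed

text \<open>If an orbit of the Fatou set accumulates at \<open>a \<in> J\<close>, so does one that stays near \<open>J\<close>: follow the given
 orbit from the last time it is far from \<open>J\<close> before it gets close to \<open>a\<close>, and pass to the limit.\<close>

lemma near_orbit:
 assumes cf: "c : fatou R" and s: "strict_mono (s :: nat => nat)" "(%n. (R^^s n) c) ----> a" and a: "a : J"
 obtains z k where "z : fatou R" "stays_near (r0/4) z" "filterlim k at_top sequentially" "(%n. (R^^k n) z) ----> a"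
proof -
 define r where "r = r0/8"
 have r: "r > 0" "r + r = r0/4" using r0(1) by (auto simp: r_def)
 define near where "near n \<longleftrightarrow> (EX x:J. dist ((R^^n) c) x <= r)" for n
 have sl: "n <= s n" for n by (rule seq_suble[OF s(1)])
 show ?thesis
 proof (cases "EX n1. ALL n>=n1. near n")
  case True
  then obtain n1 where n1: "!!n. n >= n1 ==> near n" by blast
  show ?thesis
  proof (rule that)
   show "(R^^n1) c : fatou R" using cf fatou_Rn by blast
   show "stays_near (r0/4) ((R^^n1) c)"
    unfolding stays_near_def
   proof
    fix i
    obtain y where "y : J" "dist ((R^^(i + n1)) c) y <= r" using n1[of "i + n1"] by (auto simp: near_def)
    thus "EX y:J. dist ((R^^i) ((R^^n1) c)) y <= r0/4" using r by (intro bexI[of _ y]) (auto simp: funpow_add)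
   qed
   show "filterlim (%n. s (n + n1) - n1) at_top sequentially"
    unfolding filterlim_at_top
   proof
    fix Z show "EVS n. Z <= s (n + n1) - n1"
    proof (rule eventually_sequentiallyI[of Z])
     fix n assume "Z <= n" thus "Z <= s (n + n1) - n1" using sl[of "n + n1"] by linarith
    qed
   qed
   have "(R^^(s (n + n1) - n1)) ((R^^n1) c) = (R^^s (n + n1)) c" for n
   proof -
    have "(R^^(s (n + n1) - n1 + n1)) c = (R^^(s (n + n1) - n1)) ((R^^n1) c)" by (simp only: funpow_add o_apply)
    thus ?thesis using sl[of "n + n1"] by simp
   qed
   thus "(%n. (R^^(s (n + n1) - n1)) ((R^^n1) c)) ----> a"
    using LIMSEQ_ignore_initial_segment[OF s(2), of n1] by simp
  qed
 next
  case False
  then obtain e0 where e0: "~ near e0" by blast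
  define M where "M n = Max {m. m <= s n & ~ near m}" for n
  have fin: "finite {m. m <= s n & ~ near m}" for n by simp
  have M: "M n <= s n & ~ near (M n)" if "n >= e0" for n
  proof -
   have "e0 : {m. m <= s n & ~ near m}" using e0 that sl[of n] by auto
   hence "M n : {m. m <= s n & ~ near m}" unfolding M_def using Max_in[OF fin[of n]] by blast
   thus ?thesis by simp
  qed
  have after: "near (M n + i)" if "1 <= i" "M n + i <= s n" for n i
  proof (rule ccontr)
   assume "~ near (M n + i)"
   hence "M n + i <= M n" unfolding M_def using that(2) by (intro Max_ge[OF fin]) (simp add: M_def)
   thus False using that(1) by simp
  qed
  define b where "b n = (R^^M (n + e0)) c" for n
  define s' where "s' n = s (n + e0)" for n
  obtain t l where t: "strict_mono (t :: nat => nat)" "(b o t) ----> l" by (rule rsphere_convergent_subseq)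
  define g where "g n = s' (t n) - M (t n + e0)" for n
  have bl: "(%n. b (t n)) ----> l" using t(2) by (simp add: o_def)
  have far: "r < dist (b n) x" if "x : J" for n x using M[of "n + e0"] that unfolding near_def b_def by force
  have lf: "l ~: J"
  proof
   assume "l : J"
   have "EVS n. dist (b (t n)) l < r" by (rule tendstoD[OF bl r(1)])
   hence "EVS n. False" by eventually_elim (use far[OF `l : J`] less_asym in blast)
   thus False by simp
  qed
  have gs: "(R^^g n) (b (t n)) = (R^^s' (t n)) c" "M (t n + e0) + g n = s' (t n)" for n
  proof -
   show e: "M (t n + e0) + g n = s' (t n)" using M[of "t n + e0"] by (simp add: g_def s'_def)
   show "(R^^g n) (b (t n)) = (R^^s' (t n)) c" unfolding e[symmetric] b_def by (simp add: add.commute[of "M _"] funpow_add)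
  qed
  have sa: "(%n. (R^^s' (t n)) c) ----> a"
   using LIMSEQ_subseq_LIMSEQ[OF LIMSEQ_ignore_initial_segment[OF s(2), of e0] t(1)] by (simp add: o_def s'_def)
  \<comment> \<open>If \<open>g n\<close> took a value \<open>i\<close> infinitely often, the limit
    would be \<open>(R^^i) l = a\<close>; but \<open>l\<close> is not in \<open>J\<close>.\<close>
  have gne: "EVS n. g n ~= i" for i
  proof -
   have "(R^^i) l ~= a" using lf a J_Rn by metis
   hence "dist ((R^^i) l) a > 0" by simp
   hence "EVS n. dist ((R^^i) (b (t n))) ((R^^s' (t n)) c) > 0"
    by (rule order_tendstoD(1)[OF tendsto_dist[OF tendsto_Rn[OF bl] sa]])
   thus ?thesis by eventually_elim (use gs(1) in auto)
  qed
  have gtop: "EVS n. Z <= g n" for Z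
  proof -
   have "EVS n. ALL i:{..<Z}. g n ~= i" using gne by (intro eventually_ball_finite) auto
   thus ?thesis by eventually_elim (use not_less in blast)
  qed
  show ?thesis
  proof (rule that)
   have lF: "l : fatou R" using lf by (simp add: julia_def)
   \<comment> \<open>The new orbit begins with \<open>R l\<close>, since \<open>l\<close> is the
     limit of the last far points themselves and only the later ones are near
     \<open>J\<close>.\<close>
   thus "R l : fatou R" using fatou_R by blast
   show "stays_near (r0/4) (R l)"
    unfolding stays_near_def
   proof
    fix i
    have "EVS n. dist ((R^^Suc i) (b (t n))) ((R^^Suc i) l) < r" by (rule tendstoD[OF tendsto_Rn[OF bl] r(1)])
    hence "EVS n. dist ((R^^Suc i) (b (t n))) ((R^^Suc i) l) < r & Suc i <= g n"
     using gtop[of "Suc i"] by eventually_elim simp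
    then obtain n where n: "dist ((R^^Suc i) (b (t n))) ((R^^Suc i) l) < r" "Suc i <= g n" using eventually_happens[of _ sequentially] by auto
    have "near (M (t n + e0) + Suc i)" using gs(2)[of n] n(2) by (intro after) (auto simp: s'_def)
    then obtain y where y: "y : J" "dist ((R^^(M (t n + e0) + Suc i)) c) y <= r" by (auto simp: near_def)
    have "(R^^(M (t n + e0) + Suc i)) c = (R^^Suc i) (b (t n))" unfolding b_def by (simp only: add.commute[of "M _"] funpow_add o_apply)
    hence "dist ((R^^Suc i) l) y <= r0/4"
     using y(2) n(1) dist_triangle3[of "(R^^Suc i) l" y "(R^^Suc i) (b (t n))"] r(2) by simp
    thus "EX x:J. dist ((R^^i) (R l)) x <= r0/4" using y(1) by (auto simp: funpow_swap1)
   qed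
   show "filterlim (%n. g n - 1) at_top sequentially"
    unfolding filterlim_at_top
   proof
    fix Z show "EVS n. Z <= g n - 1" using gtop[of "Suc Z"] by eventually_elim simp
   qed
   have "(%n. dist ((R^^g n) l) ((R^^s' (t n)) c)) ----> 0"
   proof (rule tendstoI)
    fix e :: real assume e: "e > 0"
    obtain dl where dl: "dl > 0" "!!y n. dist y l < dl ==> dist ((R^^n) y) ((R^^n) l) < e" by (rule equiD[OF equi_fatou lF e]) blast
    show "EVS n. dist (dist ((R^^g n) l) ((R^^s' (t n)) c)) 0 < e"
     using tendstoD[OF bl dl(1)]
    proof eventually_elim
     case (elim n)
     thus ?case using dl(2)[OF elim, of "g n"] gs(1)[of n] by (simp add: dist_commute)
    qed
   qed
   hence "(%n. dist ((R^^g n) l) ((R^^s' (t n)) c) + dist ((R^^s' (t n)) c) a) ----> 0 + 0"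
    by (intro tendsto_add iffD1[OF tendsto_dist_iff sa])
   hence "(%n. dist ((R^^g n) l) a) ----> 0"
    by (intro Lim_null_comparison[of "%n. dist ((R^^g n) l) a"]) (auto intro!: always_eventually dist_triangle)
   hence "(%n. (R^^g n) l) ----> a" by (rule iffD2[OF tendsto_dist_iff])
   moreover have "EVS n. (R^^g n) l = (R^^(g n - 1)) (R l)"
    using gtop[of 1]
   proof eventually_elim
    case (elim n)
    then obtain j where "g n = Suc j" by (cases "g n") auto
    thus ?case by (simp add: funpow_swap1)
   qed
   ultimately show "(%n. (R^^(g n - 1)) (R l)) ----> a" by (rule Lim_transform_eventually)
  qed
 qed
qed

text \<open>The rationally indifferent point found is the shadow \<open>x\<close> of the captured
  orbit, which lies on the cycle of \<open>a\<close>. By the chain rule its multiplier has modulus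
  one too, and since \<open>ths <= iz\<close> all iterates are injective on the capturing set, as
  \<open>neutral_parabolic\<close> requires.\<close>

lemma neutral_omega:
 assumes a: "a : P0" and L: "L >= 1" "(R^^L) a = a" "sph_deriv (R^^L) a = 1"
 shows "rationally_indifferent R ~= {}"
proof -
 have aJ: "a : J" by (rule P0_J[OF a])
 obtain c s where c: "c : crit" "strict_mono (s :: nat => nat)" "(%n. (R^^s n) c) ----> a" by (rule P0_limit[OF a])
 obtain z k where z: "z : fatou R" "stays_near (r0/4) z" "filterlim k at_top sequentially" "(%n. (R^^k n) z) ----> a"
  by (rule near_orbit[OF crit_fatou[OF c(1)] c(2,3) aJ])
 obtain V m l x where V: "l >= (1::nat)" "open V" "connected V" "V <= fatou R" "x : J" "(R^^m) z : V"
  "(R^^l) ` V <= V" "!!w i. w : V ==> dist ((R^^i) x) ((R^^i) w) <= ths" "(R^^l) x = x"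
  by (rule captured[OF z(1,2)]) blast
 let ?z = "(R^^m) z"
 obtain i t where t: "i < l" "strict_mono (t :: nat => nat)" "!!n. k (t n) >= m & k (t n) = m + l*((k (t n) - m) div l) + i"
  by (rule subseq_mod[OF z(3) V(1)]) blast
 define u where "u n = (k (t n) - m) div l" for n
 have ki: "(R^^k (t n)) z = (R^^i) ((R^^(l*u n)) ?z)" for n
 proof -
  have "k (t n) = i + (l*u n + m)" using t(3)[of n] unfolding u_def by linarith
  thus ?thesis by (simp only: funpow_add o_apply)
 qed
 obtain t' a1 where t': "strict_mono (t' :: nat => nat)" "((%n. (R^^(l*u n)) ?z) o t') ----> a1" by (rule rsphere_convergent_subseq)
 have l1: "(%n. (R^^(l*u (t' n) + 0)) ?z) ----> a1" using t'(2) by (simp add: o_def)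
 have "(%n. (R^^i) ((R^^(l*u (t' n) + 0)) ?z)) ----> a"
  using LIMSEQ_subseq_LIMSEQ[OF LIMSEQ_subseq_LIMSEQ[OF z(4) t(2)] t'(1)] by (simp add: ki o_def)
 hence ia: "(R^^i) a1 = a" using tendsto_Rn[OF l1] LIMSEQ_unique by blast
 hence "a1 : J" using aJ J_Rn by metis
 hence a1: "a1 = x" using captured_limit[OF V(1,5,9) V(8)[OF V(6)] _ l1] by simp
 have "sph_deriv (R^^(l*L)) a = 1"
  using sph_deriv_iter[OF L(2), of l] L(3) by (simp add: mult.commute)
 moreover have "sph_deriv (R^^(l*L + i)) x = sph_deriv (R^^(l*L)) a * sph_deriv (R^^i) x" using sph_deriv_add ia a1 by simp
 moreover have "sph_deriv (R^^(i + l*L)) x = sph_deriv (R^^i) x * sph_deriv (R^^(l*L)) x" using sph_deriv_add fixed_mult[OF V(9)] by simp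
 ultimately have "sph_deriv (R^^(l*L)) x = 1" using sph_deriv_n_pos[OF V(5), of i] by (simp add: add.commute)
 hence "sph_deriv (R^^l) x^L = 1" using sph_deriv_iter[OF V(9)] by simp
 hence "sph_deriv (R^^l) x = 1" using L(1) sph_deriv_nonneg[OF rmap_Rn] power_eq_1_iff[of "sph_deriv (R^^l) x" L] by simp
 moreover have "inj_on (R^^j) V" for j
 proof (induction j)
  case (Suc j)
  have sub: "(R^^j) ` V <= cball ((R^^j) x) iz" using V(8)[of _ j] thetas(3) by (force simp: mem_cball)
  have "inj_on R ((R^^j) ` V)" by (rule inj_on_subset[OF iota(2) sub]) (use V(5) J_Rn in blast)
  from comp_inj_on[OF Suc this] show ?case by (simp only: funpow.simps)
 qed simp
 ultimately have "x : rationally_indifferent R"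
  using neutral_parabolic[OF V(2-4,7) _ V(5,9) _ V(6), of "%n. u (t' n)"] l1 V(1) by (simp add: a1)
 thus ?thesis by blast
qed

text \<open>By compactness finitely many exponents, all at most \<open>N\<close>, suffice, with a
  uniform gain. Orbits are cut into blocks of these lengths; with \<open>nv\<close> the
  \<open>N\<close>-th root of the gain, the derivative grows like \<open>nv^m\<close> up to a
  constant for the incomplete last block.\<close>

lemma expanding_if_pointwise:
 assumes "!!x. x : J ==> EX n>=1. sph_deriv (R^^n) x > 1"
 shows "expanding R"
proof -
 have "EX n U. n >= 1 & open U & x : U & (EX mm>1. ALL y:U. mm <= sph_deriv (R^^n) y)" if x: "x : J" for x
 proof -
  obtain n where n: "n >= 1" "sph_deriv (R^^n) x > 1" using assms[OF x] by blast
  define mm where "mm = (1 + sph_deriv (R^^n) x)/2"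
  have "open (sph_deriv (R^^n) -` {mm<..})"
   using continuous_on_open_vimage[of UNIV "sph_deriv (R^^n)"] continuous_sph_deriv[OF rmap_Rn] by auto
  moreover have "mm > 1" "x : sph_deriv (R^^n) -` {mm<..}" using n(2) by (auto simp: mm_def)
  ultimately show ?thesis using n(1) by (intro exI[of _ n] exI[of _ "sph_deriv (R^^n) -` {mm<..}"]) (auto intro!: exI[of _ mm])
 qed
 then obtain n U where nU: "!!x. x : J ==> n x >= (1::nat)" "!!x. x : J ==> open (U x)" "!!x. x : J ==> x : U x"
  "!!x. x : J ==> EX mm>1. ALL y:U x. mm <= sph_deriv (R^^n x) y" by metis
 have cov: "J <= (\<Union>x\<in>J. U x)" using nU(3) by blast
 obtain Y where Y: "Y <= J" "finite Y" "J <= (\<Union>x\<in>Y. U x)" by (rule compactE_image[OF compact_julia nU(2) cov])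
 have "EX e>0. ALL x:Y. ALL y:U x. 1 + e <= sph_deriv (R^^n x) y"
 proof (rule finite_uniform[OF Y(2)])
  fix x assume "x : Y"
  then obtain mm where "mm > 1" "ALL y:U x. mm <= sph_deriv (R^^n x) y" using nU(4) Y(1) by blast
  thus "EX e>0. ALL y:U x. 1 + e <= sph_deriv (R^^n x) y" by (intro exI[of _ "mm - 1"]) auto
 qed force
 then obtain e where e: "e > 0" "!!x y. x : Y ==> y : U x ==> 1 + e <= sph_deriv (R^^n x) y" by blast
 define N where "N = Suc (sum n Y)"
 have nN: "n x <= N" if "x : Y" for x using member_le_sum[OF that, of n] Y(2) by (simp add: N_def)
 define nv where "nv = (1 + e) powr (1/real N)"
 have nv: "nv > 1" using gr_one_powr[of "1 + e" "1/real N"] e(1) by (simp add: nv_def N_def del: of_nat_Suc)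
 have N0: "real N ~= 0" by (simp add: N_def del: of_nat_Suc)
 have "nv^N = (1 + e) powr (real N*(1/real N))" unfolding nv_def by (rule powr_power) (use e(1) in simp)
 hence nvN: "nv^N = 1 + e" using N0 e(1) by simp
 have "EX c>0. ALL i:{..N}. ALL x:J. c <= sph_deriv (R^^i) x"
 proof (rule finite_uniform)
  fix i
  have ps: "!!x. x : J ==> 0 < sph_deriv (R^^i) x" by (rule sph_deriv_n_pos)
  obtain b where "b >= 1" "!!x. x : J ==> 1/b <= sph_deriv (R^^i) x & sph_deriv (R^^i) x <= b"
   using positive_bounds[OF compact_julia continuous_sph_deriv[OF rmap_Rn] ps] by (metis (no_types))
  thus "EX c>0. ALL x:J. c <= sph_deriv (R^^i) x" by (intro exI[of _ "1/b"]) auto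
 qed force+
 then obtain c where c: "c > 0" "!!i x. i <= N ==> x : J ==> c <= sph_deriv (R^^i) x" by auto
 have grow: "c/nv^N*nv^m <= sph_deriv (R^^m) x" if "x : J" for m x
  using that
 proof (induction m arbitrary: x rule: less_induct)
  case (less m)
  show ?case
  proof (cases "m <= N")
   case True
   have "c/nv^N*nv^m <= c/nv^N*nv^N" using c(1) nv True by (intro mult_left_mono power_increasing) auto
   thus ?thesis using c(2)[OF True less.prems] nv by simp
  next
   case False
   obtain y where y: "y : Y" "x : U y" using less.prems Y(3) by blast
   define j where "j = n y"
   have j: "1 <= j" "j <= N" using nU(1) nN[OF y(1)] y(1) Y(1) by (auto simp: j_def)
   have RJ: "(R^^j) x : J" using less.prems J_Rn by blast
   have IH: "c/nv^N*nv^(m - j) <= sph_deriv (R^^(m - j)) ((R^^j) x)" by (rule less.IH[OF _ RJ]) (use j False in auto)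
   have "nv^j <= nv^N" using nv j by (intro power_increasing) auto
   hence "nv^j <= sph_deriv (R^^j) x" using e(2)[OF y] nvN by (simp add: j_def)
   hence "c/nv^N*nv^(m - j)*nv^j <= sph_deriv (R^^(m - j)) ((R^^j) x) * sph_deriv (R^^j) x"
    using IH c(1) nv sph_deriv_nonneg[OF rmap_Rn] by (intro mult_mono) auto
   also have "... = sph_deriv (R^^(m - j + j)) x" by (rule sph_deriv_add[symmetric])
   finally show ?thesis using j False by (simp add: mult.assoc power_add[symmetric])
  qed
 qed
 obtain m where m: "nv^N/c < nv^m" using real_arch_pow[OF nv] by blast
 have "sph_deriv (R^^Suc m) x > 1" if "x : J" for x
 proof -
  have "nv^N/c < nv^Suc m" using m nv by (simp add: less_le_trans)
  hence "1 < c/nv^N*nv^Suc m" using c(1) nv by (simp add: field_simps)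
  thus ?thesis using grow[OF that, of "Suc m"] by linarith
 qed
 thus ?thesis unfolding expanding_def by (intro exI[of _ "Suc m"]) auto
qed

text \<open>Otherwise every point of \<open>P0\<close> is repelling, which yields expansion along
  orbits that end in \<open>P0\<close>. The other orbits return infinitely often to a compact set
  away from \<open>P0\<close>, and near a limit point the branches leading back to \<open>x\<close>
  contract.\<close>

lemma omega_nonempty:
 assumes "~ expanding R"
 shows "rationally_indifferent R ~= {}"
proof (rule ccontr)
 assume empty: "~ ?thesis"
 obtain L where L: "L >= 1" "!!a. a : P0 ==> (R^^L) a = a" using P0_periodic by blast
 have big: "sph_deriv (R^^L) a > 1" if a: "a : P0" for a
  using not_attracting[OF P0_J[OF a] L(2)[OF a] L(1)] neutral_omega[OF a L(1) L(2)[OF a]] empty by fastforce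
 obtain et where et: "et > 0" "!!x N. x : J ==> (!!n. (R^^n) x ~: P0) ==> EX n>=N. ALL a:P0. et <= dist ((R^^n) x) a"
  by (rule away_from_P0) blast
 have "EX n>=1. sph_deriv (R^^n) x > 1" if x: "x : J" for x
 proof (cases "EX k. (R^^k) x : P0")
  case True
  then obtain k where k: "(R^^k) x : P0" by blast
  obtain j where j: "1/sph_deriv (R^^k) x < sph_deriv (R^^L) ((R^^k) x)^j" using real_arch_pow[OF big[OF k]] by blast
  have "sph_deriv (R^^L) ((R^^k) x)^j <= sph_deriv (R^^L) ((R^^k) x)^Suc j" using big[OF k] by simp
  hence "1/sph_deriv (R^^k) x < sph_deriv (R^^L) ((R^^k) x)^Suc j" using j by linarith
  hence "1 < sph_deriv (R^^L) ((R^^k) x)^Suc j * sph_deriv (R^^k) x" using sph_deriv_n_pos[OF x, of k] by (simp only: pos_divide_less_eq)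
  also have "... = sph_deriv (R^^(L*Suc j + k)) x" unfolding sph_deriv_add sph_deriv_iter[OF L(2)[OF k]] ..
  finally show ?thesis using L(1) by (intro exI[of _ "L*Suc j + k"]) auto
 next
  case False
  define X where "X = J Int (\<Inter>a\<in>P0. - ball a et)"
  have "EX n>=N. (R^^n) x : X" for N
   using et(2)[OF x, of N] False x J_Rn unfolding X_def by (auto simp: dist_commute not_less)
  then obtain f where f: "!!N. f N >= N" "!!N. (R^^f N) x : X" by metis
  obtain t l where t: "strict_mono (t :: nat => nat)" "((%N. (R^^f N) x) o t) ----> l" by (rule rsphere_convergent_subseq)
  have ll: "(%n. (R^^f (t n)) x) ----> l" using t(2) by (simp add: o_def)
  have "closed X" unfolding X_def by (intro closed_Int closed_julia closed_INT) auto
  hence "l : X" using closed_sequentially[OF _ _ ll] f(2) by blast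
  hence l: "l : J" "l ~: P0" using et(1) by (auto simp: X_def)
  then obtain r where r: "good (kap c0 l) r" by (rule good_disc)
  have rp: "r > 0" using r by (simp add: good_def)
  have c0J: "y ~= Fin c0" if "y : J" for y using that c0 crit_fatou by (auto simp: julia_def)
  have kl: "kinv c0 (kap c0 l) = l" by (rule kinv_kap[OF c0J[OF l(1)]])
  define q' where "q' = hw c0 (kap c0 l)/2/hw c0 (kap c0 x)"
  have q': "q' > 0" using hw_pos by (simp add: q'_def)
  obtain N where N: "!!n g w. n >= N ==> sect n (kap c0 l) r g ==> w : ball (kap c0 l) (r/10) ==> cmod (deriv (hat g) w) < q'"
   by (rule shrink_deriv[OF r _ q']) (use kl l(1) in auto)
  have kk: "(%n. kap c0 ((R^^f (t n)) x)) ----> kap c0 l" by (rule isCont_tendsto_compose[OF isCont_kap[OF c0J[OF l(1)]] ll])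
  have "isCont (hw c0) (kap c0 l)" using continuous_hw[of UNIV c0] by (simp add: continuous_on_eq_continuous_at)
  from order_tendstoD(1)[OF isCont_tendsto_compose[OF this kk]]
  have "EVS n. hw c0 (kap c0 l)/2 < hw c0 (kap c0 ((R^^f (t n)) x))"
   using hw_pos[of c0 "kap c0 l"] by (metis field_less_half_sum add_0 mult_2 field_sum_of_halves half_gt_zero less_add_same_cancel2)
  moreover have "EVS n. dist (kap c0 ((R^^f (t n)) x)) (kap c0 l) < r/10" using tendstoD[OF kk, of "r/10"] rp by simp
  moreover have "EVS n. max N 1 <= n" by (rule eventually_ge_at_top)
  ultimately have "EVS n. hw c0 (kap c0 l)/2 < hw c0 (kap c0 ((R^^f (t n)) x)) &
   dist (kap c0 ((R^^f (t n)) x)) (kap c0 l) < r/10 & max N 1 <= n" by eventually_elim simp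
  then obtain n where n: "hw c0 (kap c0 l)/2 < hw c0 (kap c0 ((R^^f (t n)) x))"
   "dist (kap c0 ((R^^f (t n)) x)) (kap c0 l) < r/10" "max N 1 <= n" using eventually_happens[of _ sequentially] by auto
  define j w where "j = f (t n)" and "w = kap c0 ((R^^f (t n)) x)"
  have jn: "j >= N" "j >= 1" using n(3) f(1)[of "t n"] seq_suble[OF t(1), of n] by (auto simp: j_def)
  have kw: "kinv c0 w = (R^^j) x" using kinv_kap[OF c0J] x J_Rn by (simp add: w_def j_def)
  have wb: "w : ball (kap c0 l) (r/10)" "w : ball (kap c0 l) r" using n(2) rp by (auto simp: w_def dist_commute)
  have "(R^^j) x : disc (kap c0 l) r" using wb(2) unfolding disc_def kw[symmetric] by blast
  then obtain g where g: "sect j (kap c0 l) r g" "g ((R^^j) x) = x" by (rule sect_exists[OF r _ refl])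
  have e: "sph_deriv (R^^j) x*(cmod (deriv (hat g) w)*hw c0 (kap c0 x)) = hw c0 w"
   by (rule sph_deriv_sect_point[OF r g(1) wb(2)]) (simp add: kw g(2))
  have "sph_deriv (R^^j) x > 1"
  proof (rule ccontr)
   assume "~ sph_deriv (R^^j) x > 1"
   hence "hw c0 w <= 1*(cmod (deriv (hat g) w)*hw c0 (kap c0 x))"
    unfolding e[symmetric] using hw_pos[of c0 "kap c0 x"] by (intro mult_right_mono) auto
   also have "... <= 1*(q'*hw c0 (kap c0 x))" using N[OF jn(1) g(1) wb(1)] hw_pos[of c0 "kap c0 x"] by simp
   also have "... = hw c0 (kap c0 l)/2" using hw_pos[of c0 "kap c0 x"] by (simp add: q'_def)
   finally show False using n(1) by (simp add: w_def)
  qed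
  thus ?thesis using jn(2) by blast
 qed
 thus False using expanding_if_pointwise assms by blast
qed

end

section \<open>Mixing with a neutral cycle\<close>

context based
begin

definition wt :: "real => nat \<times> (rsphere => rsphere) => real" where
 "wt s x = (aa (snd x)/kK) powr s"

text \<open>Families of arbitrarily large weight whose averages are within \<open>ta\<close> of
  \<open>bb\<close>, up to any \<open>ee\<close>. The goal is \<open>ta = 0\<close>; a positive
  \<open>ta\<close> is the starting point when only bounded averages are available.\<close>

definition HA :: "(rsphere => real) => real => real => real => bool" where
 "HA ph s bb ta \<longleftrightarrow> (ALL ee>0. ALL L. EX F. fam F & L <= sum (wt s) F &
  (ALL x:F. ALL y:D1 Int J. \<bar>bsum R ph (fst x) (snd x y) - real (fst x)*bb\<bar> <= (ta + ee)*real (fst x)))"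

definition cmp :: "nat \<times> (rsphere => rsphere) => nat \<times> (rsphere => rsphere) => nat \<times> (rsphere => rsphere)" where
 "cmp x y = (fst x + fst y, snd x o snd y)"

text \<open>The second letter may depend on the first, because the length of an appended stay is
  adjusted to the length of the word.\<close>

lemma fam_sigma:
 assumes F: "fam F" and G: "!!x. x : F ==> fam (G x)" and s: "s > 0"
 shows "fam (case_prod cmp ` Sigma F G)" (is "fam ?H")
  "(\<Sum>x\<in>F. wt s x * sum (wt s) (G x)) <= sum (wt s) (case_prod cmp ` Sigma F G)"
proof -
 have fin: "finite F" "!!x. x : F ==> finite (G x)" using F G by (auto simp: fam_def)
 have eq: "x = x' & y = y'" if *: "x : F" "y : G x" "x' : F" "y' : G x'" "a : D1" "b : D1"
  "snd (cmp x y) a = snd (cmp x' y') b" for x y x' y' a b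
 proof -
  have r: "snd y a : D1" "snd y' b : D1" using ret_D2(2)[OF fam_ret[OF G]]*by blast+
  have e: "snd x (snd y a) = snd x' (snd y' b)" using *(7) by (simp add: cmp_def)
  have x: "x = x'" by (rule fam_eqI[OF F *(1,3) r e])
  have "snd y a = snd y' b" using sect_R[OF ret_sect[OF fam_ret[OF F *(1)]]] r e x by metis
  hence "y = y'" using fam_eqI[OF G[OF *(1)] *(2) _ *(5,6)] *(4) x by blast
  thus ?thesis using x by simp
 qed
 show "fam ?H"
  unfolding fam_def
 proof (intro conjI ballI impI)
  show "finite ?H" using fin by auto
  fix z assume "z : ?H"
  then obtain x y where z: "x : F" "y : G x" "z = cmp x y" by auto
  show "1 <= fst z" using F z by (auto simp: fam_def cmp_def)
  show "ret (fst z) (snd z)" using ret_comp[OF fam_ret[OF F z(1)] fam_ret[OF G[OF z(1)] z(2)]] by (simp add: z(3) cmp_def)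
  fix z' assume "z' : ?H" "z ~= z'"
  then obtain x' y' where z': "x' : F" "y' : G x'" "z' = cmp x' y'" "z ~= z'" by auto
  show "snd z ` D1 Int snd z' ` D1 = {}"
  proof (rule ccontr)
   assume "snd z ` D1 Int snd z' ` D1 ~= {}"
   then obtain a b where "a : D1" "b : D1" "snd z a = snd z' b" by blast
   thus False using eq[OF z(1,2) z'(1,2)] z(3) z'(3,4) by blast
  qed
 qed
 have inj: "inj_on (case_prod cmp) (Sigma F G)"
 proof (rule inj_onI)
  fix v w assume vw: "v : Sigma F G" "w : Sigma F G" "case_prod cmp v = case_prod cmp w"
  show "v = w" using eq[of "fst v" "snd v" "fst w" "snd w" yy yy] vw yy by (auto simp: split_def mem_Sigma_iff prod_eq_iff)
 qed
 have "(\<Sum>x\<in>F. wt s x * sum (wt s) (G x)) = (\<Sum>x\<in>F. \<Sum>y\<in>G x. wt s x*wt s y)" by (simp only: sum_distrib_left)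
 also have "... <= (\<Sum>x\<in>F. \<Sum>y\<in>G x. wt s (cmp x y))"
 proof (intro sum_mono)
  fix x y assume xy: "x : F" "y : G x"
  have r: "sect (fst x) u0 r1 (snd x)" "ret (fst y) (snd y)" using ret_sect[OF fam_ret[OF F xy(1)]] fam_ret[OF G[OF xy(1)] xy(2)] by auto
  have ap: "aa (snd x) > 0" "aa (snd y) > 0" using aa_pos r(1) ret_sect[OF r(2)] by auto
  have "aa (snd x)/kK*(aa (snd y)/kK) <= aa (snd x o snd y)/kK"
   using divide_right_mono[OF aa_comp[OF r], of kK] kK by (simp add: mult_ac)
  hence "(aa (snd x)/kK*(aa (snd y)/kK)) powr s <= (aa (snd x o snd y)/kK) powr s"
   using ap kK s by (intro powr_mono2) auto
  moreover have "(aa (snd x)/kK*(aa (snd y)/kK)) powr s = (aa (snd x)/kK) powr s*(aa (snd y)/kK) powr s"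
   by (rule powr_mult)
  ultimately show "wt s x*wt s y <= wt s (cmp x y)" by (simp only: wt_def cmp_def snd_conv)
 qed
 also have "... = (\<Sum>z\<in>Sigma F G. wt s (case_prod cmp z))" using fin by (simp add: sum.Sigma split_def)
 also have "... = sum (wt s) ?H" by (simp add: sum.reindex[OF inj])
 finally show "(\<Sum>x\<in>F. wt s x * sum (wt s) (G x)) <= sum (wt s) ?H" .
qed

lemma bsum_cmp:
 assumes "ret (fst x) (snd x)" "ret (fst y) (snd y)" "z : D1"
 shows "bsum R ph (fst (cmp x y)) (snd (cmp x y) z) =
  bsum R ph (fst x) (snd x (snd y z)) + bsum R ph (fst y) (snd y z)"
 using sect_R[OF ret_sect[OF assms(1)] ret_D2(2)[OF assms(2,3)]] by (simp add: cmp_def bsum_add)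

definition wordfam where
 "wordfam ph s bb e T l W \<longleftrightarrow> fam W & 4^l <= sum (wt s) W & (ALL x:W. l <= fst x) & (ALL x:W. fst x <= l*T) &
  (ALL x:W. ALL y:D1 Int J. \<bar>bsum R ph (fst x) (snd x y) - real (fst x)*bb\<bar> <= e*real (fst x))"

lemma wordfamD:
 assumes "wordfam ph s bb e T l W"
 shows "fam W" "4^l <= sum (wt s) W" "!!x. x : W ==> l <= fst x" "!!x. x : W ==> fst x <= l*T"
  "!!x y. x : W ==> y : D1 Int J ==> \<bar>bsum R ph (fst x) (snd x y) - real (fst x)*bb\<bar> <= e*real (fst x)"
 using assms unfolding wordfam_def by blast+

lemma words:
 assumes F: "fam F" and s: "s > 0" and w: "sum (wt s) F >= 4" and T: "!!x. x : F ==> fst x <= T"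
  and av: "!!x y. x : F ==> y : D1 Int J ==> \<bar>bsum R ph (fst x) (snd x y) - real (fst x)*bb\<bar> <= e*real (fst x)"
 shows "EX W. wordfam ph s bb e T (Suc l) W"
proof (induction l)
 case 0
 have "1 <= fst x" if "x : F" for x using F that by (simp add: fam_def)
 thus ?case unfolding wordfam_def using F w T av by (intro exI[of _ F]) simp
next
 case (Suc l)
 then obtain W where "wordfam ph s bb e T (Suc l) W" by blast
 note W = wordfamD[OF this]
 note fs = fam_sigma[OF F W(1) s]
 have "(4::real)^Suc (Suc l) <= sum (wt s) F * sum (wt s) W" unfolding power_Suc[of 4 "Suc l"] using w W(2) by (intro mult_mono) auto
 also have "... <= sum (wt s) (case_prod cmp ` Sigma F (%_. W))" using fs(2) by (simp only: sum_distrib_right)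
 finally have big: "4^Suc (Suc l) <= sum (wt s) (case_prod cmp ` Sigma F (%_. W))" .
 have "Suc (Suc l) <= fst z & fst z <= Suc (Suc l)*T &
  (ALL y:D1 Int J. \<bar>bsum R ph (fst z) (snd z y) - real (fst z)*bb\<bar> <= e*real (fst z))"
  if "z : case_prod cmp ` Sigma F (%_. W)" for z
 proof -
  from that obtain v where v: "z = case_prod cmp v" "v : F \<times> W" by (rule imageE)
  obtain x y where "v = (x, y)" by (cases v)
  hence z: "x : F" "y : W" "z = cmp x y" using v by simp_all
  have l: "fst x >= 1" "fst x <= T" "fst y >= Suc l" "fst y <= Suc l*T" using F z(1) T W(3,4)[OF z(2)] by (auto simp: fam_def)
  have r: "ret (fst x) (snd x)" "ret (fst y) (snd y)" using fam_ret F W(1) z by auto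
  have "\<bar>bsum R ph (fst z) (snd z a) - real (fst z)*bb\<bar> <= e*real (fst z)" if a: "a : D1 Int J" for a
  proof -
   have "snd y a : D1 Int J" using a ret_D2(2)[OF r(2)] sect_J[OF ret_sect[OF r(2)]] by blast
   hence b1: "\<bar>bsum R ph (fst x) (snd x (snd y a)) - real (fst x)*bb\<bar> <= e*real (fst x)" by (rule av[OF z(1)])
   have b2: "\<bar>bsum R ph (fst y) (snd y a) - real (fst y)*bb\<bar> <= e*real (fst y)" by (rule W(5)[OF z(2) a])
   have f: "real (fst z)*c = real (fst x)*c + real (fst y)*c" for c by (simp add: z(3) cmp_def distrib_right)
   show ?thesis unfolding z(3)[symmetric] using b1 b2 bsum_cmp[OF r, of a ph] a f[of bb] f[of e] by (simp add: z(3)[symmetric] mult.commute[of e])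
  qed
  thus ?thesis using l by (simp add: z(3) cmp_def)
 qed
 thus ?case unfolding wordfam_def using fs(1) big by blast
qed

text \<open>Words of length \<open>l\<close> in a family of weight \<open>4\<close> have weight \<open>4 ^ l\<close> altogether, while an appended stay near the
 neutral cycle, of a duration proportional to that of the word, costs only a factor subexponential in \<open>l\<close>.\<close>

lemma mixing:
 assumes og: "og : J" "(R^^M) og = og" "M >= 1" "sph_deriv (R^^M) og = 1"
  and ph: "continuous_on J ph" and s: "s > 0" and ro: "0 <= ro" "ro < 1" and H: "HA ph s bb ta" and ta: "ta >= 0"
 shows "HA ph s ((1 - ro)*bb + ro*(bsum R ph M og/real M)) ((1 - ro)*ta)"
 unfolding HA_def
proof (intro allI impI)
 let ?b = "bsum R ph M og/real M" and ?ga = "(1 - ro)*bb + ro*(bsum R ph M og/real M)"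
 fix ee L :: real assume ee: "ee > 0"
 obtain F where F: "fam F" "4 <= sum (wt s) F"
  "!!x y. x : F ==> y : D1 Int J ==> \<bar>bsum R ph (fst x) (snd x y) - real (fst x)*bb\<bar> <= (ta + ee/4)*real (fst x)"
 proof -
  have "ee/4 > 0" using ee by simp
  thus ?thesis using H that unfolding HA_def by blast
 qed
 define T where "T = Suc (sum fst F)"
 have T: "fst x <= T" if "x : F" for x
  using member_le_sum[OF that, of fst] F(1) by (simp add: T_def fam_def)
 define Q where "Q = 1/(1 - ro)"
 have Q: "Q > 0" "ro/(1 - ro) <= Q" using ro by (auto simp: Q_def divide_right_mono)
 \<comment> \<open>A stay appended to a word of \<open>Suc l\<close> letters lasts at most about
   \<open>Q*T*Suc l\<close>. With this \<open>e\<close> it reduces the weight at most by the factor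
   \<open>2^Suc l\<close>, up to a constant, so of the total weight \<open>4^Suc l\<close> a
   constant times \<open>2^Suc l\<close> remains.\<close>
 define e where "e = min (ee/4) (ln 2/(s*Q*real T))"
 have sQT: "s*Q*real T > 0" using s Q by (simp add: T_def del: of_nat_Suc)
 have e: "e > 0" "e <= ee/4" "s*e*Q*real T <= ln 2"
 proof -
  show "e > 0" using ee sQT by (simp add: e_def)
  show "e <= ee/4" unfolding e_def by (rule min.cobounded1)
  have "(s*Q*real T)*e <= (s*Q*real T)*(ln 2/(s*Q*real T))" using sQT by (intro mult_left_mono) (auto simp: e_def)
  moreover have "c*(a/c) = a" if "c > 0" for a c :: real using that by simp
  ultimately have "(s*Q*real T)*e <= ln 2" using sQT by metis
  thus "s*e*Q*real T <= ln 2" by (simp only: mult_ac)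
 qed
 obtain C where C: "C >= 0" "!!N0. EX n h. N0 < n & real n <= real N0 + C & ret n h & exp (- (e*real n + C)) <= aa h &
  (ALL y:D1 Int J. \<bar>bsum R ph n (h y) - real n*?b\<bar> <= e*real n + C)"
  by (rule excursion[OF og ph e(1)]) blast
 \<comment> \<open>\<open>C3\<close> collects the bounded losses in the exponent of the weight and
   \<open>C4\<close> the bounded errors in the Birkhoff sums; \<open>l\<close> is chosen large
   enough to outweigh both.\<close>
 define C3 where "C3 = s*(e*(1 + C) + C + ln kK)"
 define C4 where "C4 = C + \<bar>bb - ?b\<bar>*(C + 1)"
 obtain l1 where l1: "L*exp C3 < 2^l1" using real_arch_pow[of 2] by auto
 obtain l2 where l2: "2*C4/ee < real l2" using reals_Archimedean2 by blast
 define l where "l = max l1 l2"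
 have l: "l1 <= Suc l" "l2 <= Suc l" by (simp_all add: l_def)
 have big: "L*exp C3 <= 2^Suc l" using l1 power_increasing[OF l(1), of "2::real"] by linarith
 have C4: "C4 <= ee/2*real (Suc l)"
 proof -
  have "real l2 <= real (Suc l)" using l(2) by (simp only: of_nat_le_iff)
  hence "2*C4/ee <= real (Suc l)" using l2 by linarith
  hence "2*C4 <= real (Suc l)*ee" using ee by (simp only: pos_divide_le_eq)
  thus ?thesis by (simp add: mult_ac)
 qed
 have "EX W. wordfam ph s bb (ta + ee/4) T (Suc l) W" by (rule words[OF F(1) s F(2) T F(3)])
 then obtain W where "wordfam ph s bb (ta + ee/4) T (Suc l) W" ..
 note W = wordfamD[OF this]
 \<comment> \<open>The duration for which the stay takes up the fraction \<open>ro\<close> of the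
   total time.\<close>
 define N0 where "N0 x = nat \<lceil>ro/(1 - ro)*real (fst x)\<rceil>" for x :: "nat \<times> (rsphere => rsphere)"
 obtain n h where nh: "!!x. N0 x < n x" "!!x. real (n x) <= real (N0 x) + C" "!!x. ret (n x) (h x)"
  "!!x. exp (- (e*real (n x) + C)) <= aa (h x)"
  "!!x y. y : D1 Int J ==> \<bar>bsum R ph (n x) (h x y) - real (n x)*?b\<bar> <= e*real (n x) + C"
 proof -
  have "ALL x. EX z. N0 x < fst z & real (fst z) <= real (N0 x) + C & ret (fst z) (snd z) & exp (- (e*real (fst z) + C)) <= aa (snd z) &
   (ALL y:D1 Int J. \<bar>bsum R ph (fst z) (snd z y) - real (fst z)*?b\<bar> <= e*real (fst z) + C)"
   using C(2) by simp
  from choice[OF this] obtain f where "ALL x. N0 x < fst (f x) & real (fst (f x)) <= real (N0 x) + C & ret (fst (f x)) (snd (f x)) &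
   exp (- (e*real (fst (f x)) + C)) <= aa (snd (f x)) &
   (ALL y:D1 Int J. \<bar>bsum R ph (fst (f x)) (snd (f x) y) - real (fst (f x))*?b\<bar> <= e*real (fst (f x)) + C)" by blast
  thus ?thesis using that[of "%x. fst (f x)" "%x. snd (f x)"] by blast
 qed
 have n: "ro/(1 - ro)*real (fst x) <= real (n x)" "real (n x) <= ro/(1 - ro)*real (fst x) + 1 + C" for x
 proof -
  have "ro/(1 - ro)*real (fst x) >= 0" using ro by simp
  hence "ro/(1 - ro)*real (fst x) <= real (N0 x)" "real (N0 x) <= ro/(1 - ro)*real (fst x) + 1"
   unfolding N0_def by linarith+
  thus "ro/(1 - ro)*real (fst x) <= real (n x)" "real (n x) <= ro/(1 - ro)*real (fst x) + 1 + C" using nh(1,2)[of x] by linarith+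
 qed
 define G where "G x = {(n x, h x)}" for x
 have G: "fam (G x)" if "x : W" for x unfolding fam_def G_def using nh(1,3)[of x] by simp
 note fs = fam_sigma[OF W(1) G s]
 have wt: "exp (- C3)/2^Suc l <= wt s (n x, h x)" if x: "x : W" for x
 proof -
  have "s*e*real (n x) <= s*e*(Q*real (fst x) + 1 + C)"
   using n(2)[of x] mult_right_mono[OF Q(2), of "real (fst x)"] s e(1) by (intro mult_left_mono) auto
  also have "... = s*e*Q*real (fst x) + s*e*(1 + C)" by (simp add: algebra_simps)
  also have "s*e*Q*real (fst x) <= s*e*Q*real (Suc l*T)"
   using s e(1) Q by (intro mult_left_mono iffD2[OF of_nat_le_iff] W(4)[OF x]) auto
  also have "... = (s*e*Q*real T)*real (Suc l)" by (simp only: of_nat_mult mult_ac)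
  also have "... <= ln 2*real (Suc l)" using e(3) by (intro mult_right_mono) auto
  finally have b: "s*e*real (n x) <= ln 2*real (Suc l) + s*e*(1 + C)" by simp
  have ap: "aa (h x) > 0" by (rule aa_pos[OF ret_sect[OF nh(3)]])
  have "exp (- C3)/2^Suc l = exp (- C3 - real (Suc l)*ln 2)" by (simp only: exp_diff exp_of_nat_mult exp_ln[OF zero_less_numeral])
  also have "... <= exp (s*(- (e*real (n x) + C) - ln kK))"
   using b by (simp only: exp_le_cancel_iff) (simp add: C3_def algebra_simps)
  also have "... <= exp (s*ln (aa (h x)/kK))"
  proof -
   have "- (e*real (n x) + C) <= ln (aa (h x))" using nh(4)[of x] ap by (subst ln_ge_iff)
   thus ?thesis using s ap kK by (simp only: exp_le_cancel_iff ln_div) (intro mult_left_mono, auto)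
  qed
  also have "... = wt s (n x, h x)" using ap kK by (simp add: wt_def powr_def mult.commute)
  finally show ?thesis .
 qed
 have "L <= 2^Suc l*exp (- C3)" using big by (simp add: exp_minus field_simps)
 also have "... = 4^Suc l*(exp (- C3)/2^Suc l)" using power_mult_distrib[of 2 "2::real" "Suc l"] by simp
 also have "... <= sum (wt s) W*(exp (- C3)/2^Suc l)" using W(2) by (intro mult_right_mono) auto
 also have "... = (\<Sum>x\<in>W. wt s x*(exp (- C3)/2^Suc l))" by (simp only: sum_distrib_right)
 also have "... <= (\<Sum>x\<in>W. wt s x * sum (wt s) (G x))"
  using wt by (intro sum_mono mult_left_mono) (auto simp: G_def wt_def)
 also have "... <= sum (wt s) (case_prod cmp ` Sigma W G)" by (rule fs(2))
 finally have L1: "L <= sum (wt s) (case_prod cmp ` Sigma W G)" .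
 have B1: "\<bar>bsum R ph (fst z) (snd z y) - real (fst z)*?ga\<bar> <= ((1 - ro)*ta + ee)*real (fst z)"
  if z: "z : case_prod cmp ` Sigma W G" and y: "y : D1 Int J" for z y
 proof -
  obtain x where x: "x : W" "z = cmp x (n x, h x)" using z by (auto simp: G_def)
  define t m where "t = real (fst x)" and "m = real (n x)"
  have hy: "h x y : D1 Int J" using y ret_D2(2)[OF nh(3)] sect_J[OF ret_sect[OF nh(3)]] by blast
  define A where "A = bsum R ph (fst x) (snd x (h x y))"
  define B where "B = bsum R ph (n x) (h x y)"
  have A: "\<bar>A - t*bb\<bar> <= (ta + ee/4)*t" unfolding A_def t_def by (rule W(5)[OF x(1) hy])
  have B: "\<bar>B - m*?b\<bar> <= e * m + C" unfolding B_def m_def by (rule nh(5)[OF y])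
  have sum: "bsum R ph (fst z) (snd z y) = A + B" "real (fst z) = t + m"
   using bsum_cmp[of x "(n x, h x)" y ph] fam_ret[OF W(1) x(1)] nh(3) y by (simp_all add: x(2) A_def B_def) (simp add: cmp_def t_def m_def)
  have tl: "real (Suc l) <= t" "m >= 0" using W(3)[OF x(1)] by (simp_all only: t_def m_def of_nat_le_iff of_nat_0_le_iff)
  have m: "ro*t <= (1 - ro) * m" "(1 - ro) * m <= ro*t + (C + 1)"
  proof -
   show "ro*t <= (1 - ro) * m" using n(1)[of x] ro by (simp add: t_def m_def field_simps)
   have "(1 - ro) * m <= (1 - ro)*(ro/(1 - ro)*t + 1 + C)" using n(2)[of x] ro unfolding t_def m_def by (intro mult_left_mono) auto
   also have "... = ro*t + (1 - ro)*(C + 1)" using ro by (simp add: field_simps)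
   also have "(1 - ro)*(C + 1) <= 1*(C + 1)" using ro C(1) by (intro mult_right_mono) auto
   finally show "(1 - ro) * m <= ro*t + (C + 1)" by simp
  qed
  have "t <= (1 - ro)*(t + m)" using m(1) by (simp add: algebra_simps)
  hence 1: "ta*t <= (1 - ro)*ta*(t + m)" using mult_left_mono[OF _ ta, of t "(1 - ro)*(t + m)"] by (simp add: mult_ac)
  have d1: "\<bar>(bb - ?b)*(ro*t - (1 - ro) * m)\<bar> <= \<bar>bb - ?b\<bar>*(C + 1)" unfolding abs_mult using m by (intro mult_left_mono) auto
  have d2: "A + B - (t + m)*?ga = (A - t*bb) + (B - m*?b) + (bb - ?b)*(ro*t - (1 - ro) * m)" by (simp add: algebra_simps)
  have "\<bar>x\<bar> <= a + b + (C + w)" if "x = x1 + x2 + x3" "\<bar>x1\<bar> <= a" "\<bar>x2\<bar> <= b + C" "\<bar>x3\<bar> <= w"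
   for x x1 x2 x3 a b w :: real using that by linarith
  from this[OF d2 A B d1] have 2: "\<bar>A + B - (t + m)*?ga\<bar> <= (ta + ee/4)*t + e * m + C4" unfolding C4_def .
  have 3: "e * m <= ee/4 * m" using e(2) tl(2) by (rule mult_right_mono)
  have 4: "C4 <= ee/2*t" using C4 mult_left_mono[OF tl(1), of "ee/2"] ee by linarith
  have pos: "0 <= ee*t" "0 <= ee * m" using ee tl by simp_all
  have "ee/4*t + ee/4 * m + ee/2*t <= ee*(t + m)" by (simp add: distrib_left) (use pos in linarith)
  hence 5: "ta*t + (ee/4*t + ee/4 * m + ee/2*t) <= (1 - ro)*ta*(t + m) + ee*(t + m)" using 1 by (rule add_mono[rotated])
  have "x <= y" if "x <= a + b + c" "b <= b'" "c <= c'" "a + (b' + c') <= y" for x y a b c b' c' :: real using that by linarith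
  from this[OF 2 3 4, of "((1 - ro)*ta + ee)*(t + m)"] 5 show ?thesis unfolding sum by (simp add: distrib_right)
 qed
 show "EX F. fam F & L <= sum (wt s) F & (ALL x:F. ALL y:D1 Int J.
  \<bar>bsum R ph (fst x) (snd x y) - real (fst x)*?ga\<bar> <= ((1 - ro)*ta + ee)*real (fst x))" by (intro exI[of _ "case_prod cmp ` Sigma W G"] conjI ballI fs(1) L1 B1)
qed

text \<open>Only the small fraction \<open>x\<close> of the time is left to the original word, so
  both its tolerance \<open>ta\<close> and the distance of its average from that of the cycle are
  multiplied by \<open>x\<close>.\<close>

lemma mixing_limit:
 assumes og: "og : J" "(R^^M) og = og" "M >= 1" "sph_deriv (R^^M) og = 1"
  and ph: "continuous_on J ph" and s: "s > 0" and H: "HA ph s bb ta" and ta: "ta >= 0"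
 shows "HA ph s (bsum R ph M og/real M) 0"
 unfolding HA_def
proof (intro allI impI)
 let ?b = "bsum R ph M og/real M"
 fix ee L :: real assume ee: "ee > 0"
 define D where "D = \<bar>bb - ?b\<bar> + ta + 1"
 have D: "D >= 1" using ta by (simp add: D_def)
 define x where "x = min 1 (ee/(2*D))"
 have x: "0 < x" "x <= 1" "x*D <= ee/2"
 proof -
  show "0 < x" "x <= 1" using ee D by (auto simp: x_def)
  have "x*D <= ee/(2*D)*D" using D by (intro mult_right_mono) (auto simp: x_def)
  thus "x*D <= ee/2" using D by simp
 qed
 have "HA ph s ((1 - (1 - x))*bb + (1 - x)*?b) ((1 - (1 - x))*ta)"
  by (rule mixing[OF og ph s _ _ H ta]) (use x in auto)
 hence "HA ph s (x*bb + (1 - x)*?b) (x*ta)" by simp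
 moreover have "ee/2 > 0" using ee by simp
 ultimately obtain F where F: "fam F" "L <= sum (wt s) F" "!!z y. z : F ==> y : D1 Int J ==>
  \<bar>bsum R ph (fst z) (snd z y) - real (fst z)*(x*bb + (1 - x)*?b)\<bar> <= (x*ta + ee/2)*real (fst z)"
  unfolding HA_def by blast
 have "\<bar>bsum R ph (fst z) (snd z y) - real (fst z)*?b\<bar> <= (0 + ee)*real (fst z)" if z: "z : F" "y : D1 Int J" for z y
 proof -
  define t B where "t = real (fst z)" and "B = bsum R ph (fst z) (snd z y)"
  have t: "t >= 0" by (simp add: t_def)
  have 1: "\<bar>B - t*(x*bb + (1 - x)*?b)\<bar> <= (x*ta + ee/2)*t" using F(3)[OF z] by (simp only: t_def B_def)
  have "B - t*b = (B - t*(x*bb + (1 - x)*b)) + t*x*(bb - b)" for b by (simp add: algebra_simps)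
  note 2 = this[of ?b]
  have 3: "\<bar>t*x*(bb - ?b)\<bar> = (x*\<bar>bb - ?b\<bar>)*t" using t x(1) by (simp add: abs_mult)
  have "(x*ta + ee/2)*t + (x*\<bar>bb - ?b\<bar>)*t = (x*ta + ee/2 + x*\<bar>bb - ?b\<bar>)*t" by (simp only: distrib_right)
  also have "... <= ee*t" using x t by (intro mult_right_mono) (auto simp: D_def algebra_simps)
  finally have 4: "(x*ta + ee/2)*t + (x*\<bar>bb - ?b\<bar>)*t <= ee*t" .
  have "\<bar>a + b\<bar> <= e" if "\<bar>a\<bar> <= c" "\<bar>b\<bar> = k" "c + k <= e" for a b c k e :: real using that by linarith
  from this[OF 1 3 4] have "\<bar>B - t*?b\<bar> <= ee*t" unfolding 2 .
  thus ?thesis by (simp add: t_def B_def)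
 qed
 thus "EX F. fam F & L <= sum (wt s) F & (ALL x:F. ALL y:D1 Int J. \<bar>bsum R ph (fst x) (snd x y) - real (fst x)*?b\<bar> <= (0 + ee)*real (fst x))"
  by (intro exI[of _ F] conjI ballI F(1,2))
qed

lemma mixing_between:
 assumes og: "og : J" "(R^^M) og = og" "M >= 1" "sph_deriv (R^^M) og = 1"
  and ph: "continuous_on J ph" and s: "s > 0" and H: "HA ph s bb 0"
  and al: "al : closed_segment bb (bsum R ph M og/real M)"
 shows "HA ph s al 0"
proof -
 obtain ro where ro: "0 <= ro" "ro <= 1" "al = (1 - ro)*bb + ro*(bsum R ph M og/real M)"
  using al unfolding closed_segment_def by auto
 show ?thesis
 proof (cases "ro = 1")
  case True
  thus ?thesis using mixing_limit[OF og ph s H] ro(3) by simp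
 next
  case False
  thus ?thesis using mixing[OF og ph s ro(1) _ H] ro by simp
 qed
qed

lemma HA_dimension:
 assumes ph: "continuous_on J ph" and s: "s > 0" and H: "HA ph s al 0"
 shows "hausdorff_outer s (birkhoff_level R ph al) > 0"
proof -
 have "EX F. fam F & 2 <= sum (wt s) F & (ALL x:F. ALL y:D1 Int J.
  \<bar>bsum R ph (fst x) (snd x y) - real (fst x)*al\<bar> <= (0 + 1/real (Suc j))*real (fst x))" for j
 proof -
  have "1/real (Suc j) > 0" by simp
  thus ?thesis using H unfolding HA_def by blast
 qed
 then obtain F where F: "!!j. fam (F j)" "!!j. 2 <= sum (wt s) (F j)" "!!j x y. x : F j ==> y : D1 Int J ==>
  \<bar>bsum R ph (fst x) (snd x y) - real (fst x)*al\<bar> <= (0 + 1/real (Suc j))*real (fst x)" by metis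
 obtain B where B: "!!x. x : J ==> \<bar>ph x\<bar> <= B" by (rule bounded_J[OF ph]) blast
 have "\<bar>ph y - al\<bar> <= B + \<bar>al\<bar>" if "y : J" for y using B[OF that] by linarith
 thus ?thesis by (rule dimension_from_families[OF s F(1) F(2)[unfolded wt_def]]) (use F(3) in auto)
qed

end

section \<open>The conformal measure\<close>

locale conformal = expansive_rational +
 fixes dl :: real and m :: "rsphere measure"
 assumes conf: "conformal_measure R dl m"
begin

lemma sets_m: "sets m = sets (restrict_space borel J)" and prob_m: "prob_space m"
 using conf by (auto simp: conformal_measure_def borel_measure_on_def)

lemma conformalD: "A : sets m ==> inj_on R A ==> emeasure m (R ` A) = (\<integral>\<^sup>+x\<in>A. ennreal (sph_deriv R x powr dl) \<partial>m)"
 using conf by (simp add: conformal_measure_def)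

lemma space_m: "space m = J" using sets_eq_imp_space_eq[OF sets_m] by (simp add: space_restrict_space)

lemma Int_J: "A : sets borel ==> A Int J : sets m" unfolding sets_m sets_restrict_space by blast

lemma continuous_measurable:
 fixes f :: "rsphere => real"
 shows "continuous_on J f ==> f : borel_measurable m"
 using borel_measurable_continuous_on_restrict measurable_cong_sets[OF sets_m refl] by blast

lemma R_measurable: "R : measurable m m"
proof -
 have "R : measurable (restrict_space borel J) borel" by (rule borel_measurable_continuous_on_restrict[OF cont_R])
 hence "R : measurable (restrict_space borel J) (restrict_space borel J)"
  by (intro measurable_restrict_space2) (auto simp: space_restrict_space J_R)
 thus ?thesis using measurable_cong_sets[OF sets_m sets_m] by blast
qed

lemma conformal_iterate:
 assumes "open U" "inj_on (R^^n) (U Int J)"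
 shows "emeasure m ((R^^n) ` (U Int J)) = (\<integral>\<^sup>+x\<in>U Int J. ennreal (sph_deriv (R^^n) x powr dl) \<partial>m)"
 using assms
proof (induction n arbitrary: U)
 case 0
 have "sph_deriv (%a. a) x = 1" for x using sph_deriv_0[of x] by (simp add: id_def)
 thus ?case using Int_J[of U] 0 by (simp add: id_def)
next
 case (Suc n)
 let ?A = "U Int J" and ?f = "%x. ennreal (sph_deriv (R^^n) x powr dl)" and ?g = "%x. ennreal (sph_deriv R x powr dl)"
 have A: "?A : sets m" using Int_J[of U] Suc.prems by simp
 have inj: "inj_on R ?A" "inj_on (R^^n) (R ` ?A)"
  using Suc.prems(2) by (auto simp: inj_on_def funpow_swap1)
 have im: "R ` ?A = R ` U Int J" using J_R by auto
 have RA: "R ` ?A : sets m" unfolding im using Int_J[of "R ` U"] open_R[OF Suc.prems(1)] by simp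
 have c: "continuous_on J (%x. sph_deriv (R^^n) x powr dl)" for n
  by (intro continuous_on_powr continuous_sph_deriv rmap_Rn continuous_on_const) (auto dest: sph_deriv_n_pos[of _ n])
 have meas: "?f : borel_measurable m" "?g : borel_measurable m"
  using continuous_measurable[OF c, of n] continuous_measurable[OF c, of 1] by simp_all
 let ?N = "distr (density m (%x. ?g x*indicator ?A x)) m R"
 have gA: "(%x. ?g x*indicator ?A x) : borel_measurable m" using meas A by simp
 have N: "?N = density m (indicator (R ` ?A))"
 proof (rule measure_eqI)
  fix B assume "B : sets ?N"
  hence B: "B : sets m" by simp
  have RB: "R -` B Int space m : sets m" using measurable_sets[OF R_measurable B] .
  have "emeasure ?N B = emeasure (density m (%x. ?g x*indicator ?A x)) (R -` B Int space m)"
   using R_measurable B by (subst emeasure_distr) auto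
  also have "... = (\<integral>\<^sup>+x. ?g x*indicator ?A x*indicator (R -` B Int space m) x \<partial>m)"
   by (rule emeasure_density[OF gA RB])
  also have "... = (\<integral>\<^sup>+x\<in>?A Int (R -` B Int space m). ?g x \<partial>m)"
   by (intro nn_integral_cong) (auto simp: indicator_def)
  also have "... = emeasure m (R ` (?A Int (R -` B Int space m)))"
   by (rule conformalD[symmetric, OF sets.Int[OF A RB] inj_on_subset[OF inj(1)]]) blast
  also have "R ` (?A Int (R -` B Int space m)) = R ` ?A Int B" using sets.sets_into_space[OF B] space_m by auto
  also have "emeasure m (R ` ?A Int B) = emeasure (density m (indicator (R ` ?A))) B"
   unfolding emeasure_density[OF borel_measurable_indicator[OF RA] B] indicator_inter_arith[symmetric]
   by (rule nn_integral_indicator[symmetric, OF sets.Int[OF RA B]])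
  finally show "emeasure ?N B = emeasure (density m (indicator (R ` ?A))) B" .
 qed simp
 have "(R^^Suc n) ` ?A = (R^^n) ` (R ` U Int J)" unfolding im[symmetric] by (simp add: image_comp funpow_Suc_right del: funpow.simps)
 hence "emeasure m ((R^^Suc n) ` ?A) = (\<integral>\<^sup>+x\<in>R ` ?A. ?f x \<partial>m)"
  using Suc.IH[OF open_R[OF Suc.prems(1)]] inj(2) unfolding im by simp
 also have "... = (\<integral>\<^sup>+x. ?f x \<partial>?N)" unfolding N using meas(1) RA by (subst nn_integral_density) (auto simp: mult.commute)
 also have "... = (\<integral>\<^sup>+x. ?f (R x) \<partial>density m (%x. ?g x*indicator ?A x))"
  by (rule nn_integral_distr) (use meas R_measurable in auto)
 also have "... = (\<integral>\<^sup>+x. ?g x*indicator ?A x*?f (R x) \<partial>m)"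
  by (rule nn_integral_density[OF gA]) (use measurable_compose[OF R_measurable meas(1)] in simp)
 also have "... = (\<integral>\<^sup>+x\<in>?A. ennreal (sph_deriv (R^^Suc n) x powr dl) \<partial>m)"
 proof (intro nn_integral_cong)
  fix x
  have "sph_deriv (R^^Suc n) x powr dl = sph_deriv (R^^n) (R x) powr dl * sph_deriv R x powr dl"
  proof -
   have "R^^1 = R" by (simp add: fun_eq_iff)
   hence "sph_deriv (R^^Suc n) x = sph_deriv (R^^n) (R x) * sph_deriv R x"
    using sph_deriv_add[of n 1 x] by (simp only: Suc_eq_plus1)
   thus ?thesis by (simp only: powr_mult)
  qed
  thus "?g x*indicator ?A x*?f (R x) = ennreal (sph_deriv (R^^Suc n) x powr dl)*indicator ?A x"
   by (simp add: ennreal_mult mult_ac)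
 qed
 finally show ?case .
qed

text \<open>\<open>R^^n\<close> maps the set injectively into \<open>J\<close> and multiplies its
  measure by at least \<open>k powr dl\<close>, while the total mass is one.\<close>

lemma sect_measure:
 assumes g: "good u r" and s: "sect n u r g" and t: "t <= r" and k: "k > 0" and dl: "dl >= 0"
  and lower: "!!y. y : disc u t ==> k <= sph_deriv (R^^n) (g y)"
 shows "open (g ` disc u t)" "emeasure m (g ` disc u t Int J) <= ennreal ((1/k) powr dl)"
proof -
 have sub: "ball u t <= ball u r" using t by auto
 have "g ` disc u t = kinv c0 ` hat g ` ball u t"
  unfolding disc_def image_image using sect_hat[OF g s] sub by (intro image_cong) auto
 moreover have "open (hat g ` ball u t)"
  by (intro open_mapping_thm3 holomorphic_on_subset[OF hat_holomorphic[OF g s] sub] inj_on_subset[OF hat_inj[OF g s] sub] open_ball)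
 ultimately show o: "open (g ` disc u t)" using open_kinv_image by simp
 let ?A = "g ` disc u t Int J"
 have A: "?A : sets m" using Int_J o by simp
 have gR: "g ((R^^n) x) = x" if "x : g ` disc u t" for x
  using s that disc_mono[OF t, of u] unfolding sect_def by auto
 hence inj: "inj_on (R^^n) ?A" by (intro inj_on_inverseI[of _ g]) auto
 interpret prob_space m by (rule prob_m)
 have "ennreal (k powr dl)*emeasure m ?A = (\<integral>\<^sup>+x\<in>?A. ennreal (k powr dl) \<partial>m)" using A by (simp add: nn_integral_cmult_indicator)
 also have "... <= (\<integral>\<^sup>+x\<in>?A. ennreal (sph_deriv (R^^n) x powr dl) \<partial>m)"
 proof (intro nn_integral_mono)
  fix x
  have "k powr dl <= sph_deriv (R^^n) x powr dl" if "x : ?A"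
   using that lower k dl by (intro powr_mono2) auto
  thus "ennreal (k powr dl)*indicator ?A x <= ennreal (sph_deriv (R^^n) x powr dl)*indicator ?A x"
   by (auto simp: indicator_def intro: ennreal_leI)
 qed
 also have "... = emeasure m ((R^^n) ` ?A)" by (rule conformal_iterate[OF o inj, symmetric])
 also have "... <= ennreal 1" using emeasure_le_1 by simp
 finally have le: "ennreal (k powr dl)*ennreal (measure m ?A) <= ennreal 1" by (simp only: emeasure_eq_measure)
 hence "k powr dl * measure m ?A <= 1" by (simp add: ennreal_mult[symmetric] del: ennreal_1)
 hence "measure m ?A <= 1/k powr dl" using k by (simp add: pos_le_divide_eq mult.commute)
 also have "... = (1/k) powr dl" using k by (simp add: powr_divide)
 finally show "emeasure m ?A <= ennreal ((1/k) powr dl)" unfolding emeasure_eq_measure by (rule ennreal_leI)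
qed

end

lemma nonatomic_singleton:
 assumes "nonatomic M" "{x} : sets M"
 shows "{x} : null_sets M"
proof -
 have "~ emeasure M {x} > 0"
 proof
  assume "emeasure M {x} > 0"
  then obtain B where "B <= {x}" "0 < emeasure M B" "emeasure M B < emeasure M {x}" using assms unfolding nonatomic_def by blast
  thus False by (auto simp: subset_singleton_iff)
 qed
 thus ?thesis using assms(2) by (simp add: null_sets_def)
qed

context conformal
begin

definition io :: "rsphere set => rsphere set" where "io V = {x : J. ALL N. EX n>=N. (R^^n) x : V}"

lemma vimage_Rn: "open V ==> {x : J. (R^^n) x : V} : sets m"
proof -
 assume "open V"
 hence "open ((R^^n) -` V)" using continuous_on_open_vimage[of UNIV "R^^n"] cont_Rn by auto
 hence "(R^^n) -` V Int J : sets m" by (intro Int_J) simp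
 moreover have "(R^^n) -` V Int J = {x : J. (R^^n) x : V}" by auto
 ultimately show ?thesis by simp
qed

lemma io_sets: "open V ==> io V : sets m"
proof -
 assume V: "open V"
 have "io V = (\<Inter>N. \<Union>n\<in>{N..}. {x : J. (R^^n) x : V})" unfolding io_def by auto
 also have "... : sets m" using vimage_Rn[OF V] by (intro sets.countable_INT sets.countable_UN') auto
 finally show ?thesis .
qed

lemma io_invariant: "R -` io V Int J = io V"
proof -
 have "(ALL N. EX n>=N. (R^^n) (R x) : V) \<longleftrightarrow> (ALL N. EX n>=N. (R^^n) x : V)" for x
 proof (intro iffI allI)
  fix N assume "ALL N. EX n>=N. (R^^n) (R x) : V"
  then obtain n where "n >= N" "(R^^n) (R x) : V" by blast
  thus "EX n>=N. (R^^n) x : V" by (intro exI[of _ "Suc n"]) (simp add: funpow_swap1)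
 next
  fix N assume "ALL N. EX n>=N. (R^^n) x : V"
  then obtain n where "n >= Suc N" "(R^^n) x : V" by blast
  thus "EX n>=N. (R^^n) (R x) : V" by (intro exI[of _ "n - 1"]) (cases n; simp add: funpow_swap1)
 qed
 thus ?thesis unfolding io_def by (auto simp: J_R)
qed

text \<open>The countably many points whose orbits meet \<open>P0\<close> form a null set, as
  \<open>m\<close> is nonatomic. All others visit infinitely often a compact set covered by finitely
  many discs, so one disc is visited infinitely often with positive measure, by ergodicity almost
  surely. If that disc were null, invariance would make all its preimages null.\<close>

lemma base_point:
 assumes na: "nonatomic m" and mm: "ergodic_conformal_class_measure R m mm" and K: "K >= 1"
 obtains u r where "good u r" "kinv c0 u : J" "emeasure m (disc u (r/K) Int J) > 0" "AE x in m. x : io (disc u (r/K))"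
proof -
 interpret prob_space m by (rule prob_m)
 have mms: "sets mm = sets m" using mm by (simp add: ergodic_conformal_class_measure_def borel_measure_on_def sets_m)
 have sp: "space mm = J" using sets_eq_imp_space_eq[OF mms] space_m by simp
 have inv: "!!A. A : sets m ==> emeasure mm (R -` A Int J) = emeasure mm A" and erg: "ergodic_measure R mm"
  using mm sp mms by (auto simp: ergodic_conformal_class_measure_def invariant_measure_def)
 have null: "A : null_sets mm \<longleftrightarrow> A : null_sets m" for A
  using mm unfolding ergodic_conformal_class_measure_def equivalent_measures_def absolutely_continuous_def by blast
 obtain et where et: "et > 0" "!!x N. x : J ==> (!!n. (R^^n) x ~: P0) ==> EX n>=N. ALL a:P0. et <= dist ((R^^n) x) a"
  by (rule away_from_P0) blast
 define X where "X = J Int (\<Inter>a\<in>P0. - ball a et)"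
 have X: "compact X" unfolding X_def by (intro compact_Int_closed compact_julia closed_INT) auto
 have "EX r. good (kap c0 y) r" if "y : X" for y
 proof -
  have "y : J" "y ~: P0" using that et(1) by (auto simp: X_def)
  thus ?thesis using good_disc by metis
 qed
 then obtain r where r: "!!y. y : X ==> good (kap c0 y) (r y)" by metis
 define V where "V y = disc (kap c0 y) (r y/K)" for y
 have V: "open (V y)" for y unfolding V_def by (rule disc_open)
 have yV: "y : V y" if "y : X" for y
 proof -
  have "y ~= Fin c0" using that c0 crit_fatou by (auto simp: X_def julia_def)
  moreover have "r y/K > 0" using r[OF that] K by (simp add: good_def)
  ultimately show ?thesis using disc_centre[of "r y/K" "kap c0 y"] by (simp add: V_def)
 qed
 hence "X <= (\<Union>y\<in>X. V y)" by blast
 then obtain Y where Y: "Y <= X" "finite Y" "X <= (\<Union>y\<in>Y. V y)" using compactE_image[OF X, of X V] V by metis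
 define Z where "Z = {x : J. EX n. (R^^n) x : P0}"
 have Znull: "Z : null_sets m"
 proof -
  have "Z <= (\<Union>n. \<Union>a\<in>P0. (R^^n) -` {a})" unfolding Z_def by blast
  moreover have "countable (\<Union>a\<in>P0. (R^^n) -` {a})" for n
   using finite_P0 finite_fiber_n by (intro countable_finite finite_UN_I) auto
  hence "countable (\<Union>n. \<Union>a\<in>P0. (R^^n) -` {a})" by (rule countable_UN[OF countableI_type])
  ultimately have "countable Z" by (rule countable_subset)
  moreover have "{x} : null_sets m" if "x : Z" for x
   using nonatomic_singleton[OF na, of x] Int_J[of "{x}"] that by (simp add: Z_def)
  ultimately have "(\<Union>x\<in>Z. {x}) : null_sets m" by (intro null_sets_UN')
  thus ?thesis by simp
 qed
 have cov: "J <= Z Un (\<Union>y\<in>Y. io (V y))"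
 proof
  fix x assume x: "x : J"
  show "x : Z Un (\<Union>y\<in>Y. io (V y))"
  proof (cases "x : Z")
   case False
   have "EX n>=N. EX y:Y. (R^^n) x : V y" for N
   proof -
    obtain n where n: "n >= N" "ALL a:P0. et <= dist ((R^^n) x) a" using et(2)[OF x] False x unfolding Z_def by blast
    hence "(R^^n) x : X" using x J_Rn by (auto simp: X_def dist_commute not_less)
    thus ?thesis using Y(3) n(1) by blast
   qed
   hence "infinite {n. EX y:Y. (R^^n) x : V y}" unfolding infinite_nat_iff_unbounded_le by blast
   moreover have "{n. EX y:Y. (R^^n) x : V y} = (\<Union>y\<in>Y. {n. (R^^n) x : V y})" by blast
   ultimately obtain y where y: "y : Y" "infinite {n. (R^^n) x : V y}" using Y(2) by auto
   hence "x : io (V y)" unfolding io_def infinite_nat_iff_unbounded_le using x by blast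
   thus ?thesis using y(1) by blast
  qed simp
 qed
 have "EX y:Y. io (V y) ~: null_sets m"
 proof (rule ccontr)
  assume "~ ?thesis"
  hence "Z Un (\<Union>y\<in>Y. io (V y)) : null_sets m"
   using Znull Y(2) by (intro null_sets.Un null_sets.finite_UN) auto
  from null_sets_subset[OF this _ cov] have "J : null_sets m" using sets.top[of m] by (simp add: space_m)
  thus False using emeasure_space_1 space_m by (simp add: null_sets_def)
 qed
 then obtain y where y: "y : Y" "io (V y) ~: null_sets m" by blast
 have F: "io (V y) : sets m" by (rule io_sets[OF V])
 have "emeasure mm (io (V y)) ~= 0" using y(2) F mms null[of "io (V y)"] by (auto simp: null_sets_def)
 hence "emeasure mm (J - io (V y)) = 0" using erg F mms sp io_invariant[of "V y"] unfolding ergodic_measure_def by auto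
 hence cn: "J - io (V y) : null_sets m" using null F mms sp sets.compl_sets[OF F] space_m by (auto simp: null_sets_def)
 have pos: "emeasure m (V y Int J) > 0"
 proof (rule ccontr)
  assume "~ emeasure m (V y Int J) > 0"
  hence "V y Int J : null_sets m" using Int_J V by (simp add: null_sets_def)
  hence 0: "emeasure mm (V y Int J) = 0" using null by (auto simp: null_sets_def)
  have e: "{x : J. (R^^Suc n) x : V y} = R -` {x : J. (R^^n) x : V y} Int J" for n by (auto simp: J_R funpow_swap1)
  have "emeasure mm {x : J. (R^^n) x : V y} = 0" for n
  proof (induction n)
   case 0
   have "{x : J. (R^^0) x : V y} = V y Int J" by auto
   thus ?case using `emeasure mm (V y Int J) = 0` by simp
  next
   case (Suc n)
   thus ?case unfolding e using inv[OF vimage_Rn[OF V]] by simp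
  qed
  hence U: "(\<Union>n. {x : J. (R^^n) x : V y}) : null_sets mm"
   using vimage_Rn[OF V] mms by (intro null_sets_UN) (auto simp: null_sets_def)
  have sub: "io (V y) <= (\<Union>n. {x : J. (R^^n) x : V y})" unfolding io_def by blast
  have "io (V y) : sets mm" using F mms by simp
  hence "io (V y) : null_sets mm" using null_sets_subset[OF U _ sub] by simp
  thus False using null y(2) by blast
 qed
 have yX: "y : X" using y(1) Y(1) by blast
 have yJ: "kinv c0 (kap c0 y) = y" "y : J"
 proof -
  have "y ~= Fin c0" using yX c0 crit_fatou by (auto simp: X_def julia_def)
  thus "kinv c0 (kap c0 y) = y" by simp
  show "y : J" using yX by (simp add: X_def)
 qed
 have "AE x in m. x : io (disc (kap c0 y) (r y/K))"
  by (rule AE_I'[OF cn]) (auto simp: space_m V_def)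
 thus ?thesis using that[OF r[OF yX]] pos yJ by (simp add: V_def)
qed

end

locale conformal_base = based + conformal
begin

text \<open>Vitali's covering lemma, applied to the images of the base disc under the inverse branches along a typical
 orbit, gives a finite disjoint family with \<open>(\<Sum>g. aa g powr dl)\<close> bounded below, while every \<open>aa g\<close> is as small as
 we please; a smaller exponent \<open>s\<close> makes the sum large.\<close>

lemma base_families:
 assumes rb: "good u0 rb" "r1 = rb/(8000 * kK^2)" and s: "0 < s" "s < dl" and ph: "continuous_on J ph"
  and pos: "emeasure m (disc u0 (r1/80) Int J) > 0" and vis: "AE x in m. x : io D1"
  and av: "AE x in m. ALL ee>0. EX N. ALL n>=N. \<bar>bsum R ph n x - real n*bb\<bar> <= (ta + ee)*real n"
 shows "HA ph s bb ta"
 unfolding HA_def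
proof (intro allI impI)
 interpret prob_space m by (rule prob_m)
 fix ee L :: real assume ee: "ee > 0"
 have e4: "ee/4 > 0" using ee by simp
 have rb0: "rb > 0" using rb(1) by (simp add: good_def)
 \<comment> \<open>The choice of \<open>r1\<close> makes \<open>50 * kK*r1\<close> exactly the
   largest radius allowed in \<open>koebe_cover\<close>. The image of \<open>D1\<close> lies in a
   ball of radius \<open>kK*r1\<close> times the derivative, Vitali's lemma enlarges it five times,
   and \<open>koebe_cover\<close> covers a tenth of its radius times the derivative.\<close>
 have t: "50 * kK*r1 = rb/(160 * kK)" using kK unfolding rb(2) by (simp add: power2_eq_square)
 have t10: "50 * kK*r1 <= rb/10" "50 * kK*r1 <= rb" "0 < 50 * kK*r1"
 proof -
  have "rb/(160 * kK) <= rb/160" using rb0 kK by (intro divide_left_mono) auto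
  thus "50 * kK*r1 <= rb/10" "50 * kK*r1 <= rb" using rb0 unfolding t by linarith+
  show "0 < 50 * kK*r1" using kK r1 by simp
 qed
 have r1t: "r1 <= 50 * kK*r1" using kK r1 by simp
 have r10: "10*r1 <= rb" using r1t t10 kK r1 by (simp add: t)
 obtain c where c: "c >= 1" "!!n g w. sect n u0 rb g ==> hat g u0 : ball u0 rb ==> cmod (deriv (hat g) u0) <= 1 ==> w : ball u0 (rb/10) ==>
  1/c <= sph_deriv (R^^n) (g (kinv c0 w))*cmod (deriv (hat g) u0)" by (rule sph_deriv_sect[OF rb(1)]) blast
 obtain N1 where N1: "!!n x. n >= N1 ==> x : J ==> x : disc u0 (r1/80) ==> (R^^n) x : D1 ==>
  EX g. ret n g & sect n u0 (10*r1) g & g ((R^^n) x) = x" by (rule ret_exists) blast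
 obtain C1 where C1: "C1 >= 0" "!!n g y z. sect n u0 (10*r1) g ==> y : D1 Int J ==> z : D1 Int J ==>
  \<bar>bsum R ph n (g y) - bsum R ph n (g z)\<bar> <= ee/4*real n + C1" by (rule bsum_sect[OF ph e4]) blast
 define A where "A k = {x : space m. ALL n. k <= n --> \<bar>bsum R ph n x - real n*bb\<bar> <= (ta + ee/2)*real n}" for k
 define E where "E k = (disc u0 (r1/80) Int J) Int A k Int io D1" for k
 have "continuous_on J (bsum R ph n)" for n
  unfolding bsum_def by (intro continuous_on_sum continuous_on_compose2[OF ph cont_Rn]) (auto simp: J_Rn)
 hence [measurable]: "bsum R ph n : borel_measurable m" for n by (rule continuous_measurable)
 have A: "A k : sets m" for k unfolding A_def by measurable
 have "disc u0 (r1/80) Int J : sets m" by (intro Int_J borel_open disc_open)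
 hence E: "E k : sets m" for k unfolding E_def by (rule sets.Int[OF sets.Int[OF _ A] io_sets[OF disc_open]])
 have "EX k. E k ~: null_sets m"
 proof (rule ccontr)
  assume "~ ?thesis"
  hence "AE x in m. ALL k. x ~: E k" using AE_not_in by (subst AE_all_countable) blast
  with vis av AE_space have "AE x in m. ~ x : disc u0 (r1/80) Int J"
  proof eventually_elim
   case (elim x)
   have "ee/2 > 0" using ee by simp
   then obtain N where "ALL n>=N. \<bar>bsum R ph n x - real n*bb\<bar> <= (ta + ee/2)*real n" using elim(2) by blast
   hence "x : A N" using elim(3) by (simp add: A_def)
   thus ?case using elim(1,4) unfolding E_def by blast
  qed
  hence "emeasure m {x : space m. x : disc u0 (r1/80) Int J} = 0" by (rule emeasure_eq_0_AE)
  moreover have "{x : space m. x : disc u0 (r1/80) Int J} = disc u0 (r1/80) Int J" by (auto simp: space_m)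
  ultimately show False using pos by simp
 qed
 then obtain k where k: "E k ~: null_sets m" by blast
 define mm0 where "mm0 = measure m (E k)"
 have mm0: "mm0 > 0" using k E[of k] by (simp add: mm0_def null_sets_def emeasure_eq_measure zero_less_measure_iff)
 \<comment> \<open>\<open>X\<close> is the gain needed to bring the weight up to \<open>L\<close>.
   As \<open>s - dl\<close> is negative, a derivative below \<open>ka\<close> satisfies
   \<open>aa powr s >= X*aa powr dl\<close>.\<close>
 define X where "X = max 1 (2*L * kK powr s*c powr dl/mm0)"
 define ka where "ka = X powr (1/(s - dl))"
 have X: "X >= 1" "2*L * kK powr s*c powr dl/mm0 <= X" by (simp_all add: X_def)
 have ka: "ka > 0" "ka powr (s - dl) = X" using X(1) s by (simp_all add: ka_def powr_powr)
 obtain N2 where N2: "!!n g. n >= N2 ==> sect n u0 rb g ==> cmod (deriv (hat g) u0) < ka"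
  by (rule shrink_deriv_centre[OF rb(1) u0J ka(1)]) blast
 obtain N3 where N3: "4*C1/ee < real N3" using reals_Archimedean2 by blast
 define N where "N = max (max N1 N2) (max (max N3 k) 1)"
 define G where "G = {i. N <= fst i & sect (fst i) u0 rb (snd i) & ret (fst i) (snd i) &
  (EX x:E k. (R^^fst i) x : D1 & snd i ((R^^fst i) x) = x)}"
 have sub10: "D1 <= disc u0 (10*r1)" "disc u0 (10*r1) <= disc u0 rb" using r1 r10 by (auto intro!: disc_mono)
 have ex: "EX i:G. EX y:D1. x = snd i y" if x: "x : E k" for x
 proof -
  obtain n where n: "n >= N" "(R^^n) x : D1" using x unfolding E_def io_def by blast
  have xx: "x : J" "x : disc u0 (r1/80)" using x by (auto simp: E_def)
  obtain g where g: "ret n g" "sect n u0 (10*r1) g" "g ((R^^n) x) = x" using N1[OF _ xx n(2)] n(1) by (auto simp: N_def)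
  have "(R^^n) x : disc u0 rb" using n(2) sub10 by blast
  then obtain h where h: "sect n u0 rb h" "h ((R^^n) x) = x" by (rule sect_exists[OF rb(1) _ refl])
  have "h y = g y" if "y : D1" for y
   by (rule sect_unique[OF good1 _ _ n(2) _ that]) (use sect_subset[OF h(1), of r1] ret_sect[OF g(1)] h(2) g(3) r10 r1 in auto)
  hence "ret n h" using g(1) sect_subset[OF h(1), of r1] r10 r1 by (auto simp: ret_def)
  hence "(n, h) : G" using n h x by (auto simp: G_def)
  thus ?thesis using n(2) h(2) by (intro bexI[of _ "(n, h)"] bexI[of _ "(R^^n) x"]) auto
 qed
 define a where "a i = hat (snd i) u0" for i :: "nat \<times> (rsphere => rsphere)"
 define ro where "ro i = kK*r1*aa (snd i)" for i :: "nat \<times> (rsphere => rsphere)"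
 have Gs: "sect (fst i) u0 rb (snd i)" "ret (fst i) (snd i)" "N <= fst i" if "i : G" for i using that by (auto simp: G_def)
 have ub: "u0 : ball u0 (rb/10)" using rb0 by simp
 have img: "kap c0 (snd i y) : ball (a i) (ro i)" if i: "i : G" and y: "y : D1" for i y
 proof -
  have ky: "kap c0 y : ball u0 r1" using disc_kap(1)[OF y] .
  have ap: "aa (snd i) > 0" using aa_pos[OF ret_sect[OF Gs(2)[OF i]]] .
  have "kap c0 y : ball u0 (rb/10)" using ky r10 r1 by auto
  hence "cmod (hat (snd i) (kap c0 y) - hat (snd i) u0) <= kK*cmod (deriv (hat (snd i)) u0)*cmod (kap c0 y - u0)"
   by (intro koebe_bilipschitz[OF hat_holomorphic[OF rb(1) Gs(1)[OF i]] hat_inj[OF rb(1) Gs(1)[OF i]] rb0 _ ub ub])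
  also have "... < kK*cmod (deriv (hat (snd i)) u0)*r1"
   using ky ap kK by (intro mult_strict_left_mono) (auto simp: dist_norm norm_minus_commute aa_def)
  finally show ?thesis using disc_kap(2)[OF y] by (simp add: a_def ro_def dist_norm norm_minus_commute hat_def aa_def mult_ac)
 qed
 have "kap c0 ` E k <= (\<Union>i\<in>G. ball (a i) (ro i))"
 proof (rule image_subsetI)
  fix x assume "x : E k"
  then obtain i y where "i : G" "y : D1" "x = snd i y" using ex by blast
  thus "kap c0 x : (\<Union>i\<in>G. ball (a i) (ro i))" using img by blast
 qed
 moreover have "0 < ro i & ro i <= kK*r1" if "i : G" for i
  using aa_pos[OF ret_sect[OF Gs(2)[OF that]]] aa_le[OF Gs(2)[OF that]] kK r1 by (auto simp: ro_def)
 ultimately obtain C where C: "countable C" "C <= G" "pairwise (%i j. disjnt (ball (a i) (ro i)) (ball (a j) (ro j))) C"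
  "kap c0 ` E k <= (\<Union>i\<in>C. ball (a i) (5*ro i))" by (rule Vitali_covering_lemma_balls) blast
 define U where "U i = snd i ` disc u0 (50 * kK*r1) Int J" for i :: "nat \<times> (rsphere => rsphere)"
 have U: "U i : sets m" "emeasure m (U i) <= ennreal ((c*aa (snd i)) powr dl)" if i: "i : G" for i
 proof -
  have ap: "aa (snd i) > 0" using aa_pos[OF ret_sect[OF Gs(2)[OF i]]] .
  have hu: "hat (snd i) u0 : ball u0 rb" using disc_kap(1)[OF ret_D2(2)[OF Gs(2)[OF i] yy(2)]] r10 r1 by (auto simp: hat_def)
  have low: "1/(c*aa (snd i)) <= sph_deriv (R^^fst i) (snd i y)" if "y : disc u0 (50 * kK*r1)" for y
  proof -
   have kb: "kap c0 y : ball u0 (rb/10)" using disc_kap(1)[OF that] t10(1) by auto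
   have "1/c <= sph_deriv (R^^fst i) (snd i y)*aa (snd i)"
    using c(2)[OF Gs(1)[OF i] hu aa_le[OF Gs(2)[OF i], unfolded aa_def] kb] unfolding disc_kap(2)[OF that] aa_def .
   hence "1/c/aa (snd i) <= sph_deriv (R^^fst i) (snd i y)" using ap by (simp only: pos_divide_le_eq)
   thus ?thesis by simp
  qed
  have p: "0 < 1/(c*aa (snd i))" "0 <= dl" using c(1) ap s by auto
  note sm = sect_measure[OF rb(1) Gs(1)[OF i] t10(2) p low]
  show "U i : sets m" unfolding U_def using sm(1) by (intro Int_J) simp
  show "emeasure m (U i) <= ennreal ((c*aa (snd i)) powr dl)" using sm(2) by (simp add: U_def)
 qed
 have cov: "E k <= (\<Union>i\<in>C. U i)"
 proof
  fix x assume x: "x : E k"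
  then obtain i where i: "i : C" "kap c0 x : ball (a i) (5*ro i)" using C(4) by blast
  hence iG: "i : G" using C(2) by blast
  have "kap c0 x : ball (hat (snd i) u0) ((50 * kK*r1)/10*cmod (deriv (hat (snd i)) u0))"
   using i(2) by (simp add: a_def ro_def aa_def mult_ac)
  moreover have "ball (hat (snd i) u0) ((50 * kK*r1)/10*cmod (deriv (hat (snd i)) u0)) <= hat (snd i) ` ball u0 (50 * kK*r1)"
   by (rule koebe_cover[OF hat_holomorphic[OF rb(1) Gs(1)[OF iG]] hat_inj[OF rb(1) Gs(1)[OF iG]] rb0]) (use t10 rb0 t in auto)
  ultimately obtain w where w: "w : ball u0 (50 * kK*r1)" "kap c0 x = hat (snd i) w" by blast
  have xJ: "x : J" using x by (simp add: E_def)
  hence xc: "x ~= Fin c0" using c0 crit_fatou by (auto simp: julia_def)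
  have "w : ball u0 rb" using w(1) t10(2) by auto
  hence "x = snd i (kinv c0 w)" using sect_hat[OF rb(1) Gs(1)[OF iG]] w(2) kinv_kap[OF xc] by metis
  hence "x : U i" unfolding U_def disc_def using w(1) xJ by blast
  thus "x : (\<Union>i\<in>C. U i)" using i(1) by blast
 qed
 have "EX F. finite F & F <= C & ennreal (mm0/2) < emeasure m (\<Union>i\<in>F. U i)"
 proof (cases "C = {}")
  case True
  thus ?thesis using cov k by simp
 next
  case False
  let ?U = "%n. \<Union>i\<in>from_nat_into C ` {..<n}. U i"
  have eC: "from_nat_into C n : C" for n by (rule from_nat_into[OF False])
  have "(SUP n. emeasure m (?U n)) = emeasure m (\<Union>n. ?U n)"
  proof (rule SUP_emeasure_incseq)
   have "U (from_nat_into C n) : sets m" for n using U(1) eC C(2) by blast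
   thus "range ?U <= sets m" by (auto intro!: sets.finite_UN)
   show "incseq ?U" by (intro incseq_SucI UN_mono image_mono) auto
  qed
  moreover have "(\<Union>n. ?U n) = (\<Union>i\<in>C. U i)"
  proof -
   have "(\<Union>n. ?U n) = (\<Union>i\<in>range (from_nat_into C). U i)" by (auto intro: lessI)
   thus ?thesis using range_from_nat_into[OF False C(1)] by simp
  qed
  moreover have "ennreal (mm0/2) < emeasure m (\<Union>i\<in>C. U i)"
  proof -
   have "ennreal (mm0/2) < ennreal mm0" using mm0 by (simp add: ennreal_less_iff)
   also have "... = emeasure m (E k)" by (simp add: mm0_def emeasure_eq_measure)
   also have "... <= emeasure m (\<Union>i\<in>C. U i)" using U(1) C by (intro emeasure_mono cov sets.countable_UN') auto
   finally show ?thesis .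
  qed
  ultimately have "ennreal (mm0/2) < (SUP n. emeasure m (?U n))" by (simp only:)
  then obtain n where "ennreal (mm0/2) < emeasure m (?U n)" unfolding less_SUP_iff by blast
  thus ?thesis using eC by (intro exI[of _ "from_nat_into C ` {..<n}"]) auto
 qed
 then obtain F where F: "finite F" "F <= C" "ennreal (mm0/2) < emeasure m (\<Union>i\<in>F. U i)" by blast
 have FG: "F <= G" using F(2) C(2) by blast
 have "emeasure m (\<Union>i\<in>F. U i) <= (\<Sum>i\<in>F. emeasure m (U i))"
  by (rule emeasure_subadditive_finite) (use F(1) U(1) FG in auto)
 also have "... <= (\<Sum>i\<in>F. ennreal ((c*aa (snd i)) powr dl))" by (rule sum_mono) (use U(2) FG in auto)
 also have "... = ennreal (\<Sum>i\<in>F. (c*aa (snd i)) powr dl)" by (rule sum_ennreal) simp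
 finally have "ennreal (mm0/2) <= ennreal (\<Sum>i\<in>F. (c*aa (snd i)) powr dl)" using F(3) by (simp only: less_le_trans less_imp_le)
 hence half: "mm0/2 <= (\<Sum>i\<in>F. (c*aa (snd i)) powr dl)" by (subst (asm) ennreal_le_iff) (auto intro: sum_nonneg)
 define H where "H = X/(kK powr s*c powr dl)"
 have Kc: "kK powr s*c powr dl > 0" using kK c(1) by simp
 have "L <= H*(mm0/2)"
 proof -
  have "2*L * kK powr s*c powr dl <= X * mm0" using X(2) mm0 by (simp add: pos_divide_le_eq)
  hence "L*(kK powr s*c powr dl) <= X * mm0/2" by simp
  hence "L <= X * mm0/2/(kK powr s*c powr dl)" using Kc by (simp only: pos_le_divide_eq)
  thus ?thesis by (simp add: H_def)
 qed
 also have "... <= H*(\<Sum>i\<in>F. (c*aa (snd i)) powr dl)" using half X(1) Kc by (intro mult_left_mono) (auto simp: H_def)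
 also have "... <= sum (wt s) F"
  unfolding sum_distrib_left
 proof (rule sum_mono)
  fix i assume "i : F"
  hence i: "i : G" using FG by blast
  have ap: "aa (snd i) > 0" using aa_pos[OF ret_sect[OF Gs(2)[OF i]]] .
  have "N2 <= fst i" using Gs(3)[OF i] by (simp add: N_def)
  hence "aa (snd i) < ka" unfolding aa_def by (rule N2) (rule Gs(1)[OF i])
  hence "X <= aa (snd i) powr (s - dl)" using ap s unfolding ka(2)[symmetric] by (intro powr_mono2') auto
  hence "X*aa (snd i) powr dl <= aa (snd i) powr (s - dl)*aa (snd i) powr dl" by (intro mult_right_mono) auto
  also have "... = aa (snd i) powr s" by (simp add: powr_add[symmetric])
  finally have "X*aa (snd i) powr dl/kK powr s <= aa (snd i) powr s/kK powr s" by (intro divide_right_mono) auto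
  moreover have "H*(c*aa (snd i)) powr dl = X*aa (snd i) powr dl/kK powr s"
   using c(1) by (simp add: H_def powr_mult)
  ultimately show "H*(c*aa (snd i)) powr dl <= wt s i" using ap kK by (simp add: wt_def powr_divide)
 qed
 finally have big: "L <= sum (wt s) F" .
 have fam: "fam F"
  unfolding fam_def
 proof (intro conjI ballI impI F(1))
  fix i assume i: "i : F"
  hence iG: "i : G" using FG by blast
  show "1 <= fst i" using Gs(3)[OF iG] by (simp add: N_def)
  show "ret (fst i) (snd i)" by (rule Gs(2)[OF iG])
  fix j assume j: "j : F" "i ~= j"
  hence jG: "j : G" using FG by blast
  have dj: "disjnt (ball (a i) (ro i)) (ball (a j) (ro j))" using C(3) i j F(2) unfolding pairwise_def by blast
  show "snd i ` D1 Int snd j ` D1 = {}"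
  proof (rule ccontr)
   assume "snd i ` D1 Int snd j ` D1 ~= {}"
   then obtain y z where "y : D1" "z : D1" "snd i y = snd j z" by blast
   thus False using img[OF iG, of y] img[OF jG, of z] dj by (auto simp: disjnt_iff)
  qed
 qed
 have avg: "\<bar>bsum R ph (fst i) (snd i y) - real (fst i)*bb\<bar> <= (ta + ee)*real (fst i)" if "i : F" "y : D1 Int J" for i y
 proof -
  have i: "i : G" using that(1) FG by blast
  define n where "n = fst i"
  obtain x where x: "x : E k" "(R^^n) x : D1" "snd i ((R^^n) x) = x" using i by (auto simp: G_def n_def)
  have xJ: "x : J" using x(1) by (simp add: E_def)
  have n: "k <= n" "N3 <= n" using Gs(3)[OF i] by (auto simp: N_def n_def)
  have 1: "\<bar>bsum R ph n x - real n*bb\<bar> <= (ta + ee/2)*real n" using x(1) n(1) by (simp add: E_def A_def)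
  have "sect n u0 (10*r1) (snd i)" unfolding n_def by (rule sect_subset[OF Gs(1)[OF i] r10])
  hence 2: "\<bar>bsum R ph n (snd i y) - bsum R ph n x\<bar> <= ee/4*real n + C1"
   using C1(2)[of n "snd i" y "(R^^n) x"] that(2) x J_Rn xJ by auto
  have "4*C1/ee <= real n" using N3 n(2) by linarith
  hence "4*C1 <= real n*ee" using ee by (simp only: pos_divide_le_eq)
  hence 3: "C1 <= ee/4*real n" by (simp add: mult.commute)
  have "(ta + ee)*real n = (ta + ee/2)*real n + ee/4*real n + ee/4*real n" by (simp add: algebra_simps)
  thus ?thesis using 1 2 3 unfolding n_def by linarith
 qed
 show "EX F. fam F & L <= sum (wt s) F & (ALL x:F. ALL y:D1 Int J.
  \<bar>bsum R ph (fst x) (snd x y) - real (fst x)*bb\<bar> <= (ta + ee)*real (fst x))"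
  by (intro exI[of _ F] conjI ballI fam big avg)
qed

end

text \<open>The maximal ergodic theorem in Garsia's form: \<open>F (Suc n) - F n \<circ> T\<close> decreases to \<open>f\<close> where \<open>F n\<close>, the maximum of
 the first partial sums, tends to infinity, while its integral is nonnegative by invariance.\<close>

lemma ergodic_sums_bounded_above:
 fixes T :: "rsphere => rsphere"
 assumes "prob_space M" and inv: "invariant_measure T M" and erg: "ergodic_measure T M"
  and f: "f : borel_measurable M" "!!x. x : space M ==> \<bar>f x\<bar> <= K" and neg: "(\<integral>x. f x \<partial>M) < 0"
 shows "AE x in M. EX B. ALL n. bsum T f n x <= B"
proof -
 interpret prob_space M by fact
 have T [measurable]: "T : measurable M M" using inv by (simp add: invariant_measure_def)
 note f(1) [measurable]
 \<comment> \<open>The recursion for the maximum of \<open>0\<close> and the first \<open>n\<close>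
   partial sums.\<close>
 define F where "F n = rec_nat (%x. 0) (%_ g x. max 0 (f x + g (T x))) n" for n
 have F0: "F 0 x = 0" and FS: "F (Suc n) x = max 0 (f x + F n (T x))" for n x by (simp_all add: F_def)
 have Tx: "x : space M ==> T x : space M" for x using measurable_space[OF T] by blast
 have Fm [measurable]: "F n : borel_measurable M" for n
 proof (induction n)
  case (Suc n)
  hence [measurable]: "F n : borel_measurable M" .
  have "(%x. max 0 (f x + F n (T x))) : borel_measurable M" by measurable
  thus ?case using FS by presburger
 qed (simp add: F_def)
 have F_nonneg: "0 <= F n x" for n x by (cases n) (simp_all add: F0 FS)
 have F_mono: "F n x <= F (Suc n) x" for n x
 proof (induction n arbitrary: x)
  case (Suc n)
  show ?case unfolding FS[of "Suc n"] FS[of n x] using Suc[of "T x"] by (intro max.mono order_refl add_left_mono)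
 qed (simp add: F0 F_nonneg)
 have F_le: "i <= j ==> F i x <= F j x" for i j x using lift_Suc_mono_le[of "%n. F n x"] F_mono by blast
 have F_bound: "x : space M ==> F n x <= real n*\<bar>K\<bar>" for n x
 proof (induction n arbitrary: x)
  case (Suc n)
  have "f x + F n (T x) <= \<bar>K\<bar> + real n*\<bar>K\<bar>" using Suc.IH[OF Tx[OF Suc.prems]] f(2)[OF Suc.prems] by linarith
  thus ?case by (simp add: FS algebra_simps)
 qed (simp add: F0)
 have S_F: "bsum T f n x <= F n x" for n x
 proof (induction n arbitrary: x)
  case (Suc n)
  have "bsum T f (1 + n) x = f x + bsum T f n (T x)" unfolding bsum_add by (simp add: bsum_def)
  thus ?case using Suc[of "T x"] by (simp add: FS le_max_iff_disj)
 qed (simp add: bsum_def F0)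
 have intF: "integrable M (F n)" for n
  by (rule integrable_const_bound[of _ "real n*\<bar>K\<bar>"]) (use F_bound F_nonneg in "auto intro!: AE_I2 simp: abs_of_nonneg")
 have MT: "distr M M T = M"
 proof (rule measure_eqI)
  fix B assume "B : sets (distr M M T)"
  hence B: "B : sets M" by simp
  thus "emeasure (distr M M T) B = emeasure M B" using inv by (simp add: emeasure_distr[OF T B] invariant_measure_def)
 qed simp
 have intT: "(\<integral>x. F n (T x) \<partial>M) = (\<integral>x. F n x \<partial>M)" "integrable M (%x. F n (T x))" for n
  using integral_distr[OF T Fm[of n]] integrable_distr[OF T, of "F n"] intF MT by simp_all
 \<comment> \<open>The set where the maxima are unbounded. Once they are large, passing from
   \<open>x\<close> to \<open>T x\<close> changes them by at most \<open>\<bar>K\<bar>\<close>, so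
   the set is invariant.\<close>
 define A where "A = {x : space M. ALL b::nat. EX n. F n x > real b}"
 have Am: "A : sets M" unfolding A_def by measurable
 have "T x : A \<longleftrightarrow> x : A" if x: "x : space M" for x
 proof
  assume a: "T x : A"
  have "EX n. F n x > real b" for b
  proof -
   obtain n where "F n (T x) > real (b + nat \<lceil>\<bar>K\<bar>\<rceil>)" using a unfolding A_def by blast
   hence "F (Suc n) x > real b" using f(2)[OF x] unfolding FS by simp linarith
   thus ?thesis by blast
  qed
  thus "x : A" using x by (simp add: A_def)
 next
  assume a: "x : A"
  have "EX n. F n (T x) > real b" for b
  proof -
   obtain n where n: "F n x > real (b + nat \<lceil>\<bar>K\<bar>\<rceil>)" using a unfolding A_def by blast
   have "F n x > 0" by (rule le_less_trans[OF of_nat_0_le_iff n])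
   then obtain n' where n': "n = Suc n'" using F0 by (cases n) auto
   have "F n' (T x) > real b" using n f(2)[OF x] unfolding n' FS by (simp add: less_max_iff_disj) linarith
   thus ?thesis by blast
  qed
  thus "T x : A" using Tx[OF x] by (simp add: A_def)
 qed
 hence "T -` A Int space M = A" using sets.sets_into_space[OF Am] by blast
 hence cases: "emeasure M A = 0 | emeasure M (space M - A) = 0" using erg Am unfolding ergodic_measure_def by blast
 have "emeasure M A = 0"
 proof (rule ccontr)
  assume "emeasure M A ~= 0"
  hence "emeasure M (space M - A) = 0" using cases by blast
  hence "AE x in M. x : A" by (intro AE_I[of _ _ "space M - A"]) (use Am in auto)
  hence lim: "AE x in M. (%n. F (Suc n) x - F n (T x)) ----> f x"
  proof eventually_elim
   case (elim x)
   hence x: "x : space M" by (simp add: A_def)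
   obtain N where N: "F N x > real (nat \<lceil>2*\<bar>K\<bar>\<rceil>)" using elim unfolding A_def by blast
   have "F (Suc n) x - F n (T x) = f x" if "n >= N" for n
   proof -
    have a: "F (Suc n) x > 2*\<bar>K\<bar>" using F_le[of N "Suc n" x] that N by linarith
    thus ?thesis unfolding FS by linarith
   qed
   thus ?case by (intro tendsto_eventually eventually_sequentiallyI[of N])
  qed
  have "(%n. \<integral>x. F (Suc n) x - F n (T x) \<partial>M) ----> (\<integral>x. f x \<partial>M)"
  proof (rule integral_dominated_convergence[OF f(1) _ _ lim])
   show "integrable M (%x. \<bar>K\<bar>)" by simp
   show "(%x. F (Suc n) x - F n (T x)) : borel_measurable M" for n by measurable
   show "AE x in M. norm (F (Suc n) x - F n (T x)) <= \<bar>K\<bar>" for n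
   proof (rule AE_I2)
    fix x assume "x : space M"
    thus "norm (F (Suc n) x - F n (T x)) <= \<bar>K\<bar>" using f(2)[of x] F_nonneg[of n "T x"] unfolding FS by (simp add: max_def abs_le_iff)
   qed
  qed
  moreover have "0 <= (\<integral>x. F (Suc n) x - F n (T x) \<partial>M)" for n
  proof -
   have "(\<integral>x. F n x \<partial>M) <= (\<integral>x. F (Suc n) x \<partial>M)" by (intro integral_mono intF F_mono)
   thus ?thesis using intF[of "Suc n"] intT[of n] by simp
  qed
  ultimately have "0 <= (\<integral>x. f x \<partial>M)" by (intro LIMSEQ_le_const) auto
  thus False using neg by simp
 qed
 hence "AE x in M. x ~: A" using Am by (intro AE_not_in) (simp add: null_sets_def)
 thus ?thesis using AE_space
 proof eventually_elim
  case (elim x)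
  then obtain b :: nat where "!!n. F n x <= real b" unfolding A_def by (auto simp: not_less)
  thus ?case using S_F order_trans by (intro exI[of _ "real b"]) blast
 qed
qed

text \<open>Subtracting the integral and a further \<open>1/real (Suc k)\<close> from
  \<open>ph\<close>, and likewise for its negative, gives functions of negative integral. Their sums
  are bounded above almost everywhere, which bounds the averages of \<open>ph\<close> from both
  sides.\<close>

lemma birkhoff_ergodic:
 fixes T :: "rsphere => rsphere"
 assumes "prob_space M" and inv: "invariant_measure T M" and erg: "ergodic_measure T M"
  and ph: "ph : borel_measurable M" "!!x. x : space M ==> \<bar>ph x\<bar> <= K"
 shows "AE x in M. ALL ee>0. EX N. ALL n>=N. \<bar>bsum T ph n x - real n*(\<integral>x. ph x \<partial>M)\<bar> <= ee*real n"
proof -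
 interpret prob_space M by fact
 let ?b = "\<integral>x. ph x \<partial>M"
 have int: "integrable M ph" by (rule integrable_const_bound[of _ K]) (use ph in "auto intro!: AE_I2")
 have one: "AE x in M. EX B. ALL n. bsum T (%x. c*ph x - (c*?b + 1/real (Suc k))) n x <= B" if "\<bar>c\<bar> = 1" for c k
 proof (rule ergodic_sums_bounded_above[OF assms(1) inv erg])
  show "(%x. c*ph x - (c*?b + 1/real (Suc k))) : borel_measurable M" using ph(1) by measurable
  show "\<bar>c*ph x - (c*?b + 1/real (Suc k))\<bar> <= K + \<bar>c*?b + 1/real (Suc k)\<bar>" if "x : space M" for x
   using ph(2)[OF that] `\<bar>c\<bar> = 1` abs_triangle_ineq4[of "c*ph x" "c*?b + 1/real (Suc k)"] abs_mult[of c "ph x"] by simp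
  show "(\<integral>x. c*ph x - (c*?b + 1/real (Suc k)) \<partial>M) < 0" using int prob_space by (simp del: of_nat_Suc)
 qed
 have all: "AE x in M. ALL k. EX B. ALL n. bsum T (%x. c*ph x - (c*?b + 1/real (Suc k))) n x <= B" if "\<bar>c\<bar> = 1" for c
  using one[OF that] by (subst AE_all_countable) blast
 have "\<bar>1::real\<bar> = 1" "\<bar>- 1::real\<bar> = 1" by simp_all
 from all[OF this(1)] all[OF this(2)] show ?thesis
 proof eventually_elim
  case (elim x)
  show ?case
  proof (intro allI impI)
   fix ee :: real assume ee: "ee > 0"
   obtain k where k: "1/real (Suc k) < ee/2" using nat_approx_posE[of "ee/2"] ee by auto
   have b: "bsum T (%x. c*ph x - e) n x = c*bsum T ph n x - real n*e" for c e n
    by (simp add: bsum_def sum_subtractf sum_distrib_left)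
   obtain B1 where B1: "!!n. 1*bsum T ph n x - real n*(1*?b + 1/real (Suc k)) <= B1" using elim(1) unfolding b by blast
   obtain B2 where B2: "!!n. (- 1)*bsum T ph n x - real n*((- 1)*?b + 1/real (Suc k)) <= B2" using elim(2) unfolding b by blast
   obtain N where N: "2*(\<bar>B1\<bar> + \<bar>B2\<bar>)/ee < real N" using reals_Archimedean2 by blast
   have "\<bar>bsum T ph n x - real n*?b\<bar> <= ee*real n" if "n >= N" for n
   proof -
    have "2*(\<bar>B1\<bar> + \<bar>B2\<bar>)/ee <= real n" using N that by linarith
    hence 1: "2*(\<bar>B1\<bar> + \<bar>B2\<bar>) <= real n*ee" using ee by (simp only: pos_divide_le_eq)
    have 2: "real n*(1/real (Suc k)) <= real n*(ee/2)" using k by (intro mult_left_mono) auto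
    define u v w where "u = real n*?b" and "v = real n*(1/real (Suc k))" and "w = real n*ee"
    have "bsum T ph n x - (u + v) <= B1" "- bsum T ph n x - (- u + v) <= B2" "v <= w/2" "2*(\<bar>B1\<bar> + \<bar>B2\<bar>) <= w"
     using B1[of n] B2[of n] 1 2 unfolding u_def v_def w_def by (simp_all only: mult_1 mult_minus1 distrib_left mult_minus_right times_divide_eq_right)
    moreover have "\<bar>x - u\<bar> <= w" if "x - (u + v) <= B1" "- x - (- u + v) <= B2" "v <= w/2" "2*(c1 + c2) <= w"
     "B1 <= c1" "B2 <= c2" "0 <= c1" "0 <= c2" for x u v w B1 B2 c1 c2 :: real
     unfolding abs_le_iff using that by (simp add: algebra_simps)
    ultimately have "\<bar>bsum T ph n x - u\<bar> <= w" using abs_ge_self abs_ge_zero by blast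
    thus ?thesis by (simp only: u_def w_def mult.commute)
   qed
   thus "EX N. ALL n>=N. \<bar>bsum T ph n x - real n*?b\<bar> <= ee*real n" by blast
  qed
 qed
qed

section \<open>Hausdorff dimension of the Julia set and of the level sets\<close>

lemma hausdorff_dim_mono:
 assumes "A <= B"
 shows "hausdorff_dim A <= hausdorff_dim B"
proof -
 have "hausdorff_pre s e A <= hausdorff_pre s e B" for s e
  unfolding hausdorff_pre_def by (rule INF_superset_mono) (use assms in auto)
 hence "hausdorff_outer s A <= hausdorff_outer s B" for s unfolding hausdorff_outer_def by (intro SUP_mono) blast
 hence "hausdorff_outer s B = 0 ==> hausdorff_outer s A = 0" for s by (metis le_zero_eq)
 thus ?thesis unfolding hausdorff_dim_def by (intro INF_superset_mono) auto
qed

lemma diameter_le_dist: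
 assumes "!!x y. x : S ==> y : S ==> dist x y <= d" "0 <= d"
 shows "bounded S" "diameter S <= d"
proof -
 show "bounded S" unfolding bounded_two_points using assms(1) by blast
 show "diameter S <= d" using assms unfolding diameter_def by (auto intro!: cSUP_least)
qed

context expansive_rational
begin

text \<open>Finiteness is needed because \<open>enn2real\<close> sends infinity to \<open>0\<close>.\<close>

lemma julia_dim_finite: "hausdorff_dim J <= 3"
proof -
 obtain b where b: "b > 0" "!!x. x : J ==> cmod (kap c0 x) < b"
 proof -
  have "J <= - {Fin c0}" using c0 crit_fatou by (auto simp: julia_def)
  hence "bounded (kap c0 ` J)" by (intro compact_imp_bounded compact_continuous_image compact_julia continuous_on_subset[OF continuous_on_kap])
  then obtain b where "b > 0" "ALL x:kap c0 ` J. cmod x <= b" unfolding bounded_pos by auto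
  thus ?thesis using that[of "b + 1"] by force
 qed
 define C where "C = cA*(8*b)"
 have C: "C > 0" using b cA(1) by (simp add: C_def)
 have est: "hausdorff_pre 3 e J <= ennreal (C^3/real n)" if n: "n >= 1" "C/real n <= e" for e n
 proof -
  \<comment> \<open>A grid of \<open>n*n\<close> squares in the coordinate, of spherical diameter at
    most \<open>C/real n\<close>. The exponent \<open>3\<close> exceeds the dimension
    \<open>2\<close> of the plane, so the sum is at most \<open>C^3/real n\<close> and tends to
    zero.\<close>
  define h where "h = 2*b/real n"
  have h: "h > 0" "8*b/real n = 4*h" "real n*h = 2*b" using b n by (simp_all add: h_def)
  define I where "I i x \<longleftrightarrow> \<bar>x - (h*real i - b)\<bar> <= h" for i x
  define Q where "Q k = (if k < n*n then kinv c0 ` {w. I (k div n) (Re w) & I (k mod n) (Im w)} else {})" for k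
  have Cn: "0 <= C/real n" using C by simp
  have dQ: "dist x y <= C/real n" if xy: "x : Q k" "y : Q k" for x y k
  proof -
   obtain w v where wv: "x = kinv c0 w" "y = kinv c0 v" "I (k div n) (Re w)" "I (k mod n) (Im w)" "I (k div n) (Re v)" "I (k mod n) (Im v)"
    using xy by (auto simp: Q_def split: if_splits)
   have "\<bar>Re (w - v)\<bar> <= 2*h" "\<bar>Im (w - v)\<bar> <= 2*h" using wv(3-6) unfolding I_def minus_complex.simps by linarith+
   hence "cmod (w - v) <= 4*h" using cmod_le[of "w - v"] by linarith
   hence "cA*cmod (w - v) <= cA*(4*h)" using cA(1) by (intro mult_left_mono) auto
   hence "dist x y <= cA*(8*b/real n)" using cA(2)[of w v] wv(1,2) h(2) by simp
   thus ?thesis by (simp add: C_def)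
  qed
  have dia: "bounded (Q k)" "diameter (Q k) <= C/real n" for k
   using diameter_le_dist[of "Q k", OF dQ[of _ k] Cn] by simp_all
  have idx: "EX i<n. I i x" if x: "\<bar>x\<bar> < b" for x
  proof (intro exI[of _ "nat \<lfloor>(x + b)/h\<rfloor>"] conjI)
   have 0: "0 <= (x + b)/h" "(x + b)/h < real n" using x h(1,3) by (auto simp: divide_less_eq)
   thus "nat \<lfloor>(x + b)/h\<rfloor> < n" by linarith
   have "real (nat \<lfloor>(x + b)/h\<rfloor>) <= (x + b)/h" "(x + b)/h <= real (nat \<lfloor>(x + b)/h\<rfloor>) + 1" using 0 by linarith+
   hence "real (nat \<lfloor>(x + b)/h\<rfloor>)*h <= x + b" "x + b <= (real (nat \<lfloor>(x + b)/h\<rfloor>) + 1)*h"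
    using h(1) by (simp_all only: pos_le_divide_eq pos_divide_le_eq)
   thus "I (nat \<lfloor>(x + b)/h\<rfloor>) x" unfolding I_def by (simp add: algebra_simps abs_le_iff)
  qed
  have "J <= (\<Union>k. Q k)"
  proof
   fix x assume x: "x : J"
   let ?w = "kap c0 x"
   obtain i j where ij: "i < n" "I i (Re ?w)" "j < n" "I j (Im ?w)"
    using idx[of "Re ?w"] idx[of "Im ?w"] b(2)[OF x] abs_Re_le_cmod[of ?w] abs_Im_le_cmod[of ?w] by fastforce
   have "i*n + j < Suc i*n" using ij(3) by simp
   also have "... <= n*n" using ij(1) by (intro mult_right_mono) auto
   finally have k: "i*n + j < n*n" "(i*n + j) div n = i" "(i*n + j) mod n = j" using ij(3) by auto
   have "x = kinv c0 ?w" using kinv_kap[of x c0] x c0 crit_fatou unfolding julia_def by (metis Compl_iff)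
   hence "x : Q (i*n + j)" unfolding Q_def using k ij(2,4) by auto
   thus "x : (\<Union>k. Q k)" by blast
  qed
  hence "hausdorff_pre 3 e J <= (\<Sum>k. ennreal (diameter (Q k) powr 3))"
   unfolding hausdorff_pre_def by (intro INF_lower) (simp add: dia(1) order_trans[OF dia(2) n(2)])
  also have "... = (\<Sum>k<n*n. ennreal (diameter (Q k) powr 3))"
   by (rule suminf_finite) (auto simp: Q_def diameter_def)
  also have "... <= (\<Sum>k<n*n. ennreal ((C/real n)^3))"
  proof (intro sum_mono ennreal_leI)
   fix k
   have "diameter (Q k) powr 3 <= (C/real n) powr 3" by (intro powr_mono2 diameter_ge_0 dia) simp
   thus "diameter (Q k) powr 3 <= (C/real n)^3" using C n(1) by simp
  qed
  also have "... = ennreal (real (n*n)*(C/real n)^3)" using C by (simp add: ennreal_mult ennreal_of_nat_eq_real_of_nat)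
  also have "real (n*n)*(C/real n)^3 = C^3/real n" using n(1) by (simp add: power3_eq_cube field_simps)
  finally show ?thesis .
 qed
 have "hausdorff_pre 3 e J = 0" if e: "e > 0" for e
 proof -
  have "hausdorff_pre 3 e J <= 0 + ennreal ee" if ee: "ee > 0" for ee
  proof -
   obtain n where n: "real n > max 1 (max (C/e) (C^3/ee))" using reals_Archimedean2 by blast
   hence "C/real n <= e" "C^3/real n <= ee" using e ee by (auto simp: field_simps)
   thus ?thesis using est[of n e] n order_trans[OF _ ennreal_leI] by force
  qed
  hence "hausdorff_pre 3 e J <= 0" by (rule ennreal_le_epsilon)
  thus ?thesis by simp
 qed
 hence "hausdorff_outer 3 J = 0" unfolding hausdorff_outer_def by (simp add: SUP_eq_const)
 hence "hausdorff_dim J <= ennreal 3" unfolding hausdorff_dim_def by (intro INF_lower) simp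
 thus ?thesis by simp
qed

end

context based
begin

lemma omega_average:
 assumes "og : rationally_indifferent R"
 obtains M where "og : J" "(R^^M) og = og" "M >= 1" "sph_deriv (R^^M) og = 1"
  "birkhoff_avg R ph (period R og) og = bsum R ph M og/real M"
proof -
 obtain M where M: "M >= 1" "(R^^M) og = og" "sph_deriv (R^^M) og = 1" by (rule omega_neutral[OF assms])
 note p = period[OF M(1,2)]
 obtain k where k: "M = k*period R og" using p(3) by (metis dvd_def mult.commute)
 have "bsum R ph M og = real k*bsum R ph (period R og) og" unfolding k by (rule bsum_periodic[OF p(2)])
 moreover have "k ~= 0" using k M(1) by (cases k) auto
 ultimately have "birkhoff_avg R ph (period R og) og = bsum R ph M og/real M" unfolding birkhoff_avg_def bsum_def[symmetric] by (simp add: k)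
 thus ?thesis using that[OF omega_julia[OF assms] M(2,1,3)] by blast
qed

end

context conformal
begin

lemma level_outer_pos:
 assumes "~ expanding R" and ph: "continuous_on J ph" and na: "nonatomic m" and mm: "ergodic_conformal_class_measure R m mm"
  and al: "al : frequency_interval R ph mm" and s: "0 < s" "s < dl"
 shows "hausdorff_outer s (birkhoff_level R ph al) > 0"
proof -
 \<comment> \<open>With \<open>r1 = r/(8000 * kK^2)\<close> as in \<open>base_families\<close>, this
   makes \<open>r/K = r1/80\<close>: the disc of positive measure from which the orbits of that
   lemma start.\<close>
 define K where "K = 8000 * kK^2*80"
 have kK2: "kK^2 >= 1" using kK by (simp add: one_le_power)
 have "K >= 1" using kK2 by (simp add: K_def)
 then obtain u r where u: "good u r" "kinv c0 u : J" "emeasure m (disc u (r/K) Int J) > 0" "AE x in m. x : io (disc u (r/K))"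
  by (rule base_point[OF na mm])
 define r1 where "r1 = r/(8000 * kK^2)"
 have r: "r > 0" using u(1) by (simp add: good_def)
 have rr: "r1 > 0" "r/K = r1/80" "10*r1 <= r"
 proof -
  show "r1 > 0" "r/K = r1/80" using r kK by (auto simp: r1_def K_def)
  have "r/(8000 * kK^2) <= r/8000" using r kK2 by (intro divide_left_mono) auto
  thus "10*r1 <= r" using r by (simp add: r1_def)
 qed
 interpret conformal_base p q d R u r1 dl m
  by unfold_locales (use good_subset[OF u(1), of "10*r1"] rr u(2) in auto)
 obtain B where B: "B >= 0" "!!x. x : J ==> \<bar>ph x\<bar> <= B" by (rule bounded_J[OF ph]) blast
 have pos: "emeasure m (disc u (r1/80) Int J) > 0" using u(3) rr(2) by simp
 have vis: "AE x in m. x : io D1"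
  using u(4)
 proof eventually_elim
  case (elim x)
  have "disc u (r/K) <= D1" using rr by (intro disc_mono) simp
  thus ?case using elim unfolding io_def by blast
 qed
 note base = base_families[OF u(1) r1_def s ph pos vis]
 define A where "A = (%x. birkhoff_avg R ph (period R x) x) ` rationally_indifferent R"
 have A: "finite A" "A ~= {}"
  unfolding A_def using finite_subset[OF omega_P0 finite_P0] omega_nonempty[OF assms(1)] by auto
 have le: "Min A <= Max A" using A by (meson Min_le Max_in)
 have lim: "HA ph s a 0" if "HA ph s bb ta" "ta >= 0" "a : A" for bb ta a
 proof -
  obtain og where og: "og : rationally_indifferent R" "a = birkhoff_avg R ph (period R og) og" using `a : A` by (auto simp: A_def)
  obtain M where M: "og : J" "(R^^M) og = og" "M >= 1" "sph_deriv (R^^M) og = 1"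
   "birkhoff_avg R ph (period R og) og = bsum R ph M og/real M" by (rule omega_average[OF og(1)])
  show ?thesis unfolding og(2) M(5) by (rule mixing_limit[OF M(1-4) ph s(1) that(1,2)])
 qed
 have between: "HA ph s x 0" if "HA ph s bb 0" "a : A" "x : closed_segment bb a" for bb a x
 proof -
  obtain og where og: "og : rationally_indifferent R" "a = birkhoff_avg R ph (period R og) og" using `a : A` by (auto simp: A_def)
  obtain M where M: "og : J" "(R^^M) og = og" "M >= 1" "sph_deriv (R^^M) og = 1"
   "birkhoff_avg R ph (period R og) og = bsum R ph M og/real M" by (rule omega_average[OF og(1)])
  show ?thesis by (rule mixing_between[OF M(1-4) ph s(1) that(1)]) (use that(3) og(2) M(5) in simp)
 qed
 have mM: "Min A : A" "Max A : A" using A by auto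
 \<comment> \<open>If \<open>\<mu>\<close> is finite, the start is
   \<open>\<integral>\<phi> d\<mu>\<close> with tolerance zero, and the interval consists of the two
   segments from there to \<open>Min A\<close> and \<open>Max A\<close>. If it is infinite, the
   start is \<open>0\<close> with tolerance \<open>B\<close>; mixing goes all the way to
   \<open>Min A\<close>, where the tolerance is zero, and from there towards
   \<open>Max A\<close>.\<close>
 have "HA ph s al 0"
 proof (cases "finite_measure mm")
  case True
  have mms: "sets mm = sets m" using mm by (simp add: ergodic_conformal_class_measure_def borel_measure_on_def sets_m)
  have sp: "space mm = J" using sets_eq_imp_space_eq[OF mms] space_m by simp
  have m: "prob_space mm" "invariant_measure R mm" "ergodic_measure R mm" "absolutely_continuous mm m"
   using mm True by (auto simp: ergodic_conformal_class_measure_def equivalent_measures_def)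
  define bb where "bb = (\<integral>x. ph x \<partial>mm)"
  have phm: "ph : borel_measurable mm" using continuous_measurable[OF ph] measurable_cong_sets[OF mms refl] by blast
  have "AE x in mm. ALL ee>0. EX N. ALL n>=N. \<bar>bsum R ph n x - real n*bb\<bar> <= ee*real n"
   unfolding bb_def by (rule birkhoff_ergodic[OF m(1-3) phm, of B]) (use B(2) sp in auto)
  hence "AE x in m. ALL ee>0. EX N. ALL n>=N. \<bar>bsum R ph n x - real n*bb\<bar> <= (0 + ee)*real n"
   using absolutely_continuous_AE[OF mms[symmetric] m(4)] by simp
  hence "HA ph s bb 0" by (rule base)
  moreover have "al : closed_segment bb (Min A) | al : closed_segment bb (Max A)"
   using al True le unfolding frequency_interval_def alpha_min_def alpha_max_def A_def[symmetric] bb_def[symmetric]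
   by (auto simp: closed_segment_eq_real_ivl min_def max_def split: if_splits)
  ultimately show ?thesis using between mM by blast
 next
  case False
  have "AE x in m. ALL ee>0. EX N. ALL n>=N. \<bar>bsum R ph n x - real n*0\<bar> <= (B + ee)*real n"
  proof (rule AE_I2, intro allI impI exI)
   fix x ee n assume x: "x : space m" and ee: "ee > (0::real)"
   have "\<bar>bsum R ph n x - real n*0\<bar> <= real n*B" by (rule bsum_bound) (use B(2) J_Rn x space_m in auto)
   also have "... <= (B + ee)*real n" using ee by (simp add: algebra_simps)
   finally show "\<bar>bsum R ph n x - real n*0\<bar> <= (B + ee)*real n" .
  qed
  hence "HA ph s 0 B" by (rule base)
  hence "HA ph s (Min A) 0" by (rule lim[OF _ B(1) mM(1)])
  moreover have "al : closed_segment (Min A) (Max A)"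
   using al False le unfolding frequency_interval_def alpha_min_def alpha_max_def A_def[symmetric] by (simp add: closed_segment_eq_real_ivl)
  ultimately show ?thesis using between mM(2) by blast
 qed
 thus ?thesis by (rule HA_dimension[OF ph s(1)])
qed

end

theorem theorem1p2:
  fixes R :: "rsphere \<Rightarrow> rsphere" and d :: nat and \<phi> :: "rsphere \<Rightarrow> real"
    and m \<mu> :: "rsphere measure" and \<alpha> :: real
  assumes "rational_map d R" and "d \<ge> 2" and "parabolic R"
    and "continuous_on (julia R) \<phi>"
    and "conformal_measure R (enn2real (hausdorff_dim (julia R))) m" and "nonatomic m"
    and "ergodic_conformal_class_measure R m \<mu>"
    and "\<alpha> \<in> frequency_interval R \<phi> \<mu>"
  shows "hausdorff_dim (birkhoff_level R \<phi> \<alpha>) = hausdorff_dim (julia R)"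
proof -
 obtain p q where pq: "q \<noteq> 0" "coprime p q" "d = max (degree p) (degree q)" "R = quotient_map p q"
  using assms(1) unfolding rational_map_def by blast
 define \<delta> where "\<delta> = enn2real (hausdorff_dim (julia R))"
 have m: "sets m = sets (restrict_space borel (julia R))" "prob_space m"
  using assms(5) by (auto simp: conformal_measure_def borel_measure_on_def)
 have sp: "space m = julia R" using sets_eq_imp_space_eq[OF m(1)] by (simp add: space_restrict_space)
 have "uncountable (julia R)"
 proof
  assume c: "countable (julia R)"
  have "{x} \<in> sets m" if "x \<in> julia R" for x
  proof -
   have "julia R \<inter> {x} \<in> sets m" unfolding m(1) sets_restrict_space by (intro imageI) simp
   thus ?thesis using that by simp
  qed
  hence "(\<Union>x\<in>julia R. {x}) \<in> null_sets m" by (intro null_sets_UN' c nonatomic_singleton[OF assms(6)])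
  thus False using prob_space.emeasure_space_1[OF m(2)] sp by (simp add: null_sets_def)
 qed
 then interpret conformal p q d R \<delta> m
  using pq assms(2,3,5) by unfold_locales (auto simp: parabolic_def \<delta>_def)
 have fin: "hausdorff_dim J = ennreal \<delta>"
  unfolding \<delta>_def using julia_dim_finite by (intro ennreal_enn2real[symmetric]) (auto simp: le_less_trans)
 show ?thesis
 proof (rule antisym)
  show "hausdorff_dim (birkhoff_level R \<phi> \<alpha>) \<le> hausdorff_dim J"
   by (rule hausdorff_dim_mono) (auto simp: birkhoff_level_def)
  show "hausdorff_dim J \<le> hausdorff_dim (birkhoff_level R \<phi> \<alpha>)"
   unfolding fin unfolding hausdorff_dim_def
  proof (rule INF_greatest)
   fix s assume "s \<in> {s. s > 0 \<and> hausdorff_outer s (birkhoff_level R \<phi> \<alpha>) = 0}"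
   hence s: "s > 0" "\<not> hausdorff_outer s (birkhoff_level R \<phi> \<alpha>) > 0" by auto
   have "\<not> expanding R" using assms(3) by (simp add: parabolic_def)
   hence "\<not> s < \<delta>" using level_outer_pos[OF _ assms(4,6,7,8) s(1)] s(2) by blast
   thus "ennreal \<delta> \<le> ennreal s" by (intro ennreal_leI) simp
  qed
 qed
qed

end
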